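(* Let $0<p,q<\infty$, $\omega\in\widehat{\mathcal D}$ and $\mu\in M^+([0,1))$. Then the following holds. (i) If $p\le q$, the following conditions are equivalent: (a) $C_{\mu,\omega}:H^p\to H^q$ is bounded; (b) $\|\mu^{(p,q)}_{\omega}\|_{L^\infty}:=\sup_{0\le r<1}\frac{\widehat\mu(r)}{\widehat\omega(r)(1-r)^{1+\frac1p-\frac1q}}<\infty$; (c) $\|\mu^{(p,q)}_{\omega}\|_{\ell^\infty}:=\sup_{n\in\mathbb N_0}\frac{\mu_n(n+1)^{1+\frac1p-\frac1q}}{\omega_n}<\infty$; (d) for every fixed $\beta>0$, $D^{\beta+\frac1p-\frac1q}F_{\mu,\omega}\in X_\beta$. Moreover, $\|C_{\mu,\omega}\|_{H^p\to H^q}\asymp\|\mu^{(p,q)}_\omega\|_{L^\infty}\asymp\|\mu^{(p,q)}_\omega\|_{\ell^\infty}\asymp\|D^{\beta+\frac1p-\frac1q}F_{\mu,\omega}\|_{X_\beta}$. (ii) If $q<p$, the following conditions are equivalent: (a) $C_{\mu,\omega}:H^p\to H^q$ is bounded; (b) $\|\mu_\omega\|_{L^{\frac{qp}{p-q}}}^{\frac{qp}{p-q}}:=\int_0^1\left(\frac{\widehat\mu(r)}{\widehat\omega(r)(1-r)}\right)^{\frac{qp}{p-q}}dr+\widehat\mu(0)^{\frac{qp}{p-q}}<\infty$; (c) $\|\mu_\omega\|_{\ell^{\frac{qp}{p-q}}}^{\frac{qp}{p-q}}:=\sum_{n=0}^\infty\left(\frac{\mu_n(n+1)}{\omega_n}\right)^{\frac{qp}{p-q}}\frac1{(n+1)^2}<\infty$;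 (d) $F_{\mu,\omega}\in H^{\frac{qp}{p-q}}$. Moreover, $\|C_{\mu,\omega}\|_{H^p\to H^q}\asymp\|\mu_\omega\|_{\ell^{\frac{qp}{p-q}}}\asymp\|\mu_\omega\|_{L^{\frac{qp}{p-q}}}\asymp\|F_{\mu,\omega}\|_{H^{\frac{qp}{p-q}}}$.
   Context: $\mathcal H(\mathbb D)$ is the space of analytic functions in the unit disc $\mathbb D$. A weight is an integrable function $\omega:\mathbb D\to[0,\infty)$; it is radial if $\omega(z)=\omega(|z|)$. For a radial weight, $\widehat\omega(r)=\int_r^1\omega(s)\,ds$ and $\omega_x=\int_0^1 r^x\omega(r)\,dr$. $\omega\in\widehat{\mathcal D}$ means: $\omega$ is a radial weight, not a.e. zero, and there is $C>1$ with $\widehat\omega(r)\le C\,\widehat\omega\left(\frac{1+r}2\right)$ for all $0\le r<1$. $M^+([0,1))$ is the set of finite positive Borel measures on $[0,1)$; $\widehat\mu(r)=\mu([r,1))$, $\mu_x=\int_{[0,1)}r^x\,d\mu(r)$ (with $0^0=1$). Kernel: $B^\omega_t(z)=\sum_{n=0}^\infty\frac{(tz)^n}{2\omega_{2n+1}}$, $0\le t<1$, $z\in\mathbb D$. Operator: $C_{\mu,\omega}(f)(z)=\int_0^1 f(tz)B^\omega_t(z)\,d\mu(t)$ for $f\in\mathcal H(\mathbb D)$. Fundamental function: $F_{\mu,\omega}(z)=C_{\mu,\omega}(1)(z)=\sum_{n=0}^\infty\frac{\mu_n}{2\omega_{2n+1}}z^n$. For a radial weight $\nu$ and $f(z)=\sum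 a_kz^k$, $D^\nu f(z)=\sum_k\frac{a_k}{\nu_{2k+1}}z^k$; for $\alpha>0$, $D^\alpha:=D^{\omega_{\alpha-1}}$ where $\omega_{\alpha-1}(z)=\alpha(1-|z|^2)^{\alpha-1}$ is the standard weight. $M_p^p(r,f)=\frac1{2\pi}\int_0^{2\pi}|f(re^{i\theta})|^p d\theta$, $M_\infty(r,f)=\max_{|z|=r}|f(z)|$; $\|f\|_{H^p}=\sup_{0\le r<1}M_p(r,f)$, $H^p=\{f\in\mathcal H(\mathbb D):\|f\|_{H^p}<\infty\}$. For $\beta>0$, $X_\beta$ is the space of $f\in\mathcal H(\mathbb D)$ with $\|f\|_{X_\beta}=\sup_{0\le r<1}(1-r)^\beta M_\infty(r,f)<\infty$. Bounded $X\to Y$ means $\|C_{\mu,\omega}f\|_Y\le C\|f\|_X$ for all $f\in X$; the operator norm is the least such $C$ (infinite if unbounded). $A\asymp B$ means $c^{-1}B\le A\le cB$ with a constant $c>0$ independent of $\mu$ (it may depend on $p,q,\omega,\beta$). *)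

theory Defs
  imports "HOL-Complex_Analysis.Complex_Analysis"
begin

text \<open>All norms below are \<^typ>\<open>ennreal\<close>-valued, so that a comparison of norms is meaningful also
  when they are infinite. The power is only used with exponents \<open>a > 0\<close>.\<close>

definition ennpowr :: "ennreal \<Rightarrow> real \<Rightarrow> ennreal" where
  "ennpowr x a = (if x = \<infinity> then \<infinity> else ennreal (enn2real x powr a))"

definition comparable :: "real \<Rightarrow> ennreal \<Rightarrow> ennreal \<Rightarrow> bool" where
  "comparable c A B \<longleftrightarrow> ennreal (1 / c) * B \<le> A \<and> A \<le> ennreal c * B"

text \<open>A weight is a function on the whole plane of which only the values in the disc matter.\<close>

definition radial_weight :: "(complex \<Rightarrow> real) \<Rightarrow> bool" where
  "radial_weight \<omega> \<longleftrightarrow>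
     (\<forall>z\<in>ball 0 1. 0 \<le> \<omega> z) \<and>
     set_integrable lebesgue (ball 0 1) \<omega> \<and>
     (\<forall>z\<in>ball 0 1. \<omega> z = \<omega> (of_real (norm z)))"

text \<open>The tail is an integral in \<open>[0, \<infinity>]\<close>. Integrability over the disc only controls
  \<open>s * \<omega> s\<close>, so the tail at \<open>0\<close> may be infinite; the doubling condition at \<open>r = 0\<close> excludes this.\<close>

definition weight_tail :: "(complex \<Rightarrow> real) \<Rightarrow> real \<Rightarrow> ennreal" where
  "weight_tail \<omega> r = (\<integral>\<^sup>+s\<in>{r..<1}. ennreal (\<omega> (of_real s)) \<partial>lebesgue)"

definition weight_moment :: "(complex \<Rightarrow> real) \<Rightarrow> nat \<Rightarrow> real" where
  "weight_moment \<omega> n = (LINT r:{0..<1}|lebesgue. r ^ n * \<omega> (of_real r))"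

definition D_hat :: "(complex \<Rightarrow> real) set" where
  "D_hat = {\<omega>. radial_weight \<omega> \<and>
     \<not> (AE z in lebesgue. z \<in> ball 0 1 \<longrightarrow> \<omega> z = 0) \<and>
     (\<exists>C>1. \<forall>r\<in>{0..<1}. weight_tail \<omega> r \<le> ennreal C * weight_tail \<omega> ((1 + r) / 2))}"

definition std_weight :: "real \<Rightarrow> complex \<Rightarrow> real" where
  "std_weight a z = (a + 1) * (1 - (norm z)\<^sup>2) powr a"

definition M_plus :: "real measure set" where
  "M_plus = {\<mu>. finite_measure \<mu> \<and> sets \<mu> = sets (restrict_space borel {0..<1})}"

definition measure_tail :: "real measure \<Rightarrow> real \<Rightarrow> ennreal" where
  "measure_tail \<mu> r = emeasure \<mu> {r..<1}"

definition measure_moment :: "real measure \<Rightarrow> nat \<Rightarrow> real" where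
  "measure_moment \<mu> n = (LINT r|\<mu>. r ^ n)"

definition B_kernel :: "(complex \<Rightarrow> real) \<Rightarrow> real \<Rightarrow> complex \<Rightarrow> complex" where
  "B_kernel \<omega> t z = (\<Sum>n. (of_real t * z) ^ n / of_real (2 * weight_moment \<omega> (2 * n + 1)))"

definition C_op ::
  "real measure \<Rightarrow> (complex \<Rightarrow> real) \<Rightarrow> (complex \<Rightarrow> complex) \<Rightarrow> complex \<Rightarrow> complex" where
  "C_op \<mu> \<omega> f z = (LINT t|\<mu>. f (of_real t * z) * B_kernel \<omega> t z)"

definition fundamental_fun :: "real measure \<Rightarrow> (complex \<Rightarrow> real) \<Rightarrow> complex \<Rightarrow> complex" where
  "fundamental_fun \<mu> \<omega> = C_op \<mu> \<omega> (\<lambda>_. 1)"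

definition weight_deriv ::
  "(complex \<Rightarrow> real) \<Rightarrow> (complex \<Rightarrow> complex) \<Rightarrow> complex \<Rightarrow> complex" where
  "weight_deriv \<nu> f z =
     (\<Sum>k. fps_nth (fps_expansion f 0) k / of_real (weight_moment \<nu> (2 * k + 1)) * z ^ k)"

definition frac_deriv :: "real \<Rightarrow> (complex \<Rightarrow> complex) \<Rightarrow> complex \<Rightarrow> complex" where
  "frac_deriv \<alpha> = weight_deriv (std_weight (\<alpha> - 1))"

definition mean_p :: "real \<Rightarrow> real \<Rightarrow> (complex \<Rightarrow> complex) \<Rightarrow> real" where
  "mean_p p r f =
     (1 / (2 * pi) * integral {0..2 * pi} (\<lambda>\<theta>. norm (f (of_real r * cis \<theta>)) powr p)) powr (1 / p)"

definition mean_infty :: "real \<Rightarrow> (complex \<Rightarrow> complex) \<Rightarrow> real" where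
  "mean_infty r f = (SUP z\<in>sphere 0 r. norm (f z))"

definition hardy_norm :: "real \<Rightarrow> (complex \<Rightarrow> complex) \<Rightarrow> ennreal" where
  "hardy_norm p f = (SUP r\<in>{0..<1}. ennreal (mean_p p r f))"

definition hardy_space :: "real \<Rightarrow> (complex \<Rightarrow> complex) set" where
  "hardy_space p = {f. f holomorphic_on ball 0 1 \<and> hardy_norm p f < \<infinity>}"

definition X_norm :: "real \<Rightarrow> (complex \<Rightarrow> complex) \<Rightarrow> ennreal" where
  "X_norm \<beta> f = (SUP r\<in>{0..<1}. ennreal ((1 - r) powr \<beta> * mean_infty r f))"

definition X_space :: "real \<Rightarrow> (complex \<Rightarrow> complex) set" where
  "X_space \<beta> = {f. f holomorphic_on ball 0 1 \<and> X_norm \<beta> f < \<infinity>}"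

definition hardy_bound ::
  "((complex \<Rightarrow> complex) \<Rightarrow> complex \<Rightarrow> complex) \<Rightarrow> real \<Rightarrow> real \<Rightarrow> real \<Rightarrow> bool" where
  "hardy_bound T p q K \<longleftrightarrow> 0 \<le> K \<and>
     (\<forall>f\<in>hardy_space p. T f \<in> hardy_space q \<and> hardy_norm q (T f) \<le> ennreal K * hardy_norm p f)"

definition hardy_bounded ::
  "((complex \<Rightarrow> complex) \<Rightarrow> complex \<Rightarrow> complex) \<Rightarrow> real \<Rightarrow> real \<Rightarrow> bool" where
  "hardy_bounded T p q \<longleftrightarrow> (\<exists>K. hardy_bound T p q K)"

text \<open>The infimum of the empty set is \<open>\<infinity>\<close>, the norm of an unbounded operator.\<close>

definition hardy_opnorm ::
  "((complex \<Rightarrow> complex) \<Rightarrow> complex \<Rightarrow> complex) \<Rightarrow> real \<Rightarrow> real \<Rightarrow> ennreal" where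
  "hardy_opnorm T p q = (INF K\<in>{K. hardy_bound T p q K}. ennreal K)"

definition muL_sup ::
  "real \<Rightarrow> real \<Rightarrow> (complex \<Rightarrow> real) \<Rightarrow> real measure \<Rightarrow> ennreal" where
  "muL_sup p q \<omega> \<mu> =
     (SUP r\<in>{0..<1}. measure_tail \<mu> r / (weight_tail \<omega> r * ennreal ((1 - r) powr (1 + 1/p - 1/q))))"

definition muell_sup ::
  "real \<Rightarrow> real \<Rightarrow> (complex \<Rightarrow> real) \<Rightarrow> real measure \<Rightarrow> ennreal" where
  "muell_sup p q \<omega> \<mu> =
     (SUP n. ennreal (measure_moment \<mu> n * (real n + 1) powr (1 + 1/p - 1/q) / weight_moment \<omega> n))"

text \<open>\<open>muL_pow\<close> and \<open>muell_pow\<close> are the \<open>s\<close>-th powers of the norms \<open>muL_norm\<close> and \<open>muell_norm\<close>.\<close>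

definition muL_pow :: "real \<Rightarrow> (complex \<Rightarrow> real) \<Rightarrow> real measure \<Rightarrow> ennreal" where
  "muL_pow s \<omega> \<mu> =
     (\<integral>\<^sup>+r\<in>{0..<1}. ennpowr (measure_tail \<mu> r / (weight_tail \<omega> r * ennreal (1 - r))) s \<partial>lebesgue)
     + ennpowr (measure_tail \<mu> 0) s"

definition muL_norm :: "real \<Rightarrow> (complex \<Rightarrow> real) \<Rightarrow> real measure \<Rightarrow> ennreal" where
  "muL_norm s \<omega> \<mu> = ennpowr (muL_pow s \<omega> \<mu>) (1 / s)"

definition muell_pow :: "real \<Rightarrow> (complex \<Rightarrow> real) \<Rightarrow> real measure \<Rightarrow> ennreal" where
  "muell_pow s \<omega> \<mu> =
     (\<Sum>n. ennreal ((measure_moment \<mu> n * (real n + 1) / weight_moment \<omega> n) powr s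
                     * (1 / (real n + 1)\<^sup>2)))"

definition muell_norm :: "real \<Rightarrow> (complex \<Rightarrow> real) \<Rightarrow> real measure \<Rightarrow> ennreal" where
  "muell_norm s \<omega> \<mu> = ennpowr (muell_pow s \<omega> \<mu>) (1 / s)"

end

theory Submission
  imports Defs
begin

text \<open>Put \<open>r k = 1 - 2\<^sup>-\<^sup>k\<close> and let \<open>h k\<close> be \<open>2\<^sup>k\<close> times the quotient of the tails of \<open>\<mu>\<close> and of
  \<open>\<omega>\<close> at \<open>r k\<close>. By the doubling condition, with \<open>s = qp / (p - q)\<close>, every quantity in the theorem is
  comparable to \<open>sup k. 2 powr (k (1/p - 1/q)) h k\<close> if \<open>p \<le> q\<close>, and to the \<open>s\<close>-th root of
  \<open>\<Sum>k. 2\<^sup>-\<^sup>k (h k) powr s\<close> if \<open>q < p\<close>.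

  Upper bounds: repeated summation by parts shows that the kernel \<open>\<Sum>n. b n z\<^sup>n\<close> with
  \<open>b n = 1 / (2 \<omega>\<^bsub>2n+1\<^esub>)\<close> is at most a constant times \<open>2\<^sup>k / W k\<close>, \<open>W k\<close> being the tail of \<open>\<omega>\<close> at
  \<open>r k\<close>, as soon as \<open>\<bar>1 - z\<bar> \<ge> 2\<^sup>-\<^sup>k\<^sup>-\<^sup>1\<close>. If \<open>G\<close> is a nontangential majorant of \<open>f\<close> and
  \<open>\<bar>1 - e\<^sup>i\<^sup>x\<bar> \<approx> 2\<^sup>-\<^sup>j\<close>, the image of \<open>f\<close> at \<open>e\<^sup>i\<^sup>x\<close> is therefore at most
  \<open>G x h j + (\<Sum>k<j. A k h k)\<close>, where \<open>A k\<close> is the minimum of \<open>G\<close> over the \<open>k\<close>-th dyadic arc. A discrete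
  Hardy inequality, Young's inequality if \<open>q < p\<close>, and the maximal theorem of Hardy and Littlewood
  then bound the integral means. The maximal theorem is reduced to a positive power of the
  modulus of a zero-free function by dividing out a finite Blaschke product; in \<open>L\<^sup>2\<close> it follows from
  the semigroup property of the Poisson kernel by a \<open>T T\<^sup>*\<close> argument.

  Lower bounds: the test functions are combinations of the peaks \<open>(2\<^sup>-\<^sup>k / (1 - r k z))\<^sup>M\<close>. Their
  images are large at the points \<open>r j\<close>, and the maximal theorem controls
  \<open>\<Sum>j. 2\<^sup>-\<^sup>j \<bar>g (r j)\<bar> powr q\<close> by the norm of \<open>g\<close>.\<close>

subsection \<open>Discrete inequalities\<close>

lemma sum_power_dist_le:
  fixes x :: real
  assumes "0 < x" "x < 1"
  shows "(\<Sum>k<n. x ^ nat \<bar>int j - int k\<bar>) \<le> 2 / (1 - x)"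
proof -
  have geo: "(\<Sum>k\<in>A. x ^ k) \<le> 1 / (1 - x)" if "finite A" for A :: "nat set"
    using assms sum_le_suminf[of "\<lambda>k. x ^ k" A] that by (simp add: suminf_geometric)
  have "(\<Sum>k<n. x ^ nat \<bar>int j - int k\<bar>)
      = (\<Sum>k\<in>{k\<in>{..<n}. k \<le> j}. x ^ nat \<bar>int j - int k\<bar>) + (\<Sum>k\<in>{k\<in>{..<n}. \<not> k \<le> j}. x ^ nat \<bar>int j - int k\<bar>)"
    by (subst sum.union_disjoint[symmetric]) (auto intro!: sum.cong)
  moreover have "(\<Sum>k\<in>{k\<in>{..<n}. k \<le> j}. x ^ nat \<bar>int j - int k\<bar>) = (\<Sum>m\<in>(\<lambda>k. j - k) ` {k\<in>{..<n}. k \<le> j}. x ^ m)"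
    by (subst sum.reindex) (auto simp: inj_on_def nat_diff_distrib of_nat_diff intro!: sum.cong)
  moreover have "(\<Sum>k\<in>{k\<in>{..<n}. \<not> k \<le> j}. x ^ nat \<bar>int j - int k\<bar>) = (\<Sum>m\<in>(\<lambda>k. k - j) ` {k\<in>{..<n}. \<not> k \<le> j}. x ^ m)"
    by (subst sum.reindex) (auto simp: inj_on_def abs_if nat_diff_distrib intro!: sum.cong)
  ultimately show ?thesis
    using geo[of "(\<lambda>k. j - k) ` {k\<in>{..<n}. k \<le> j}"] geo[of "(\<lambda>k. k - j) ` {k\<in>{..<n}. \<not> k \<le> j}"] by simp
qed

text \<open>For p < 1 the power of a sum cannot be treated by convexity or duality. Instead the
  terms are divided by \<open>y ^ d\<close>, where d is the distance of the indices: the sum is at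
  most the maximum of the quotients times a geometric series, and the p-th power of a maximum is at
  most the sum of the p-th powers. This works for all p > 0 at once.\<close>

lemma discrete_hardy:
  fixes p :: real
  assumes "p > 0" "2 \<le> real M * p"
  obtains C where "C > 0"
    "\<And>a N n. (\<And>k. 0 \<le> a k) \<Longrightarrow>
      (\<Sum>j<N. (1/2) ^ j * (\<Sum>k<n. a k * min 1 (2 ^ j / 2 ^ k) ^ M) powr p)
        \<le> C * (\<Sum>k<n. (1/2) ^ k * a k powr p)"
proof -
  \<comment> \<open>The choice makes \<open>y powr p\<close> equal to z, the square root of 1/2.
    Dividing by \<open>y ^ d\<close> then costs \<open>z ^ d\<close>, half of the available decay,
    and the other half still sums.\<close>
  define y where "y = (1/2) powr (1 / (2 * p))"
  define z :: real where "z = (1/2) powr (1 / 2)"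
  have y: "0 < y" "y < 1" unfolding y_def using assms powr_less_mono'[of "1/2" 0 "1 / (2 * p)"] by auto
  have z: "0 < z" "z < 1" unfolding z_def using powr_less_mono'[of "1/2" 0 "1 / 2"] by auto
  have yp: "y powr p = z" unfolding y_def z_def using assms by (simp add: powr_powr)
  define C where "C = (2 / (1 - y)) powr p * (2 / (1 - z))"
  have C: "C > 0" unfolding C_def using y z by simp
  have z2: "z * z = 1/2" unfolding z_def by (simp flip: powr_add)
  define d where "d j k = nat \<bar>int j - int k\<bar>" for j k
  define w :: "nat \<Rightarrow> nat \<Rightarrow> real" where "w j k = min 1 (2 ^ j / 2 ^ k) ^ M" for j k
  have w0: "0 \<le> w j k" for j k unfolding w_def by simp
  \<comment> \<open>For \<open>k \<le> j\<close> the decay comes from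
    \<open>(1/2) ^ j = (1/2) ^ k * z ^ (2 * d)\<close>. For k > j the weight supplies
    \<open>(1/2) ^ (2 * d)\<close> because \<open>2 \<le> M * p\<close>, of which one factor
    \<open>(1/2) ^ d\<close> converts \<open>(1/2) ^ j\<close> into
    \<open>(1/2) ^ k\<close>.\<close>
  have key: "(1/2) ^ j * (w j k powr p / z ^ d j k) \<le> (1/2) ^ k * z ^ d j k" for j k
  proof (cases "k \<le> j")
    case True
    then obtain m where m: "j = k + m" using le_Suc_ex by blast
    have "w j k = 1" unfolding w_def m by (simp add: power_add)
    moreover have "d j k = m" unfolding d_def m by simp
    moreover have "(1/2::real)^m = z^m * z^m" by (simp add: z2 flip: power_mult_distrib)
    ultimately show ?thesis using z by (simp add: m power_add field_simps)
  next
    case False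
    then obtain m where m: "k = j + m" using le_Suc_ex nat_le_linear by blast
    have "(2::real) ^ j / 2 ^ k = (1/2)^m" unfolding m by (simp add: power_add field_simps)
    moreover have "(1/2::real)^m \<le> 1" by (simp add: power_le_one)
    ultimately have "w j k = ((1/2)^m)^M" unfolding w_def by (simp add: min.absorb2)
    also have "\<dots> = (1/2) powr (real m * real M)"
      by (simp add: powr_realpow flip: power_mult of_nat_mult)
    finally have "w j k powr p = (1/2) powr (real m * (real M * p))" by (simp add: powr_powr mult.assoc)
    also have "\<dots> \<le> (1/2) powr (real m * 2)"
      using assms by (intro powr_mono') (auto intro: mult_left_mono)
    also have "\<dots> = (1/2)^m * (1/2)^m"
      by (simp only: mult_2_right powr_add) (simp add: powr_realpow)
    finally have "w j k powr p \<le> (1/2)^m * (z^m * z^m)" by (simp add: z2 flip: power_mult_distrib)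
    moreover have "d j k = m" unfolding d_def m by simp
    ultimately show ?thesis using z by (simp add: m power_add field_simps)
  qed
  have "(\<Sum>j<N. (1/2) ^ j * (\<Sum>k<n. a k * w j k) powr p) \<le> C * (\<Sum>k<n. (1/2) ^ k * a k powr p)"
    if a: "\<And>k. 0 \<le> a k" for a N n
  proof -
    have "(\<Sum>k<n. a k * w j k) powr p \<le> (2/(1-y)) powr p * (\<Sum>k<n. a k powr p * (w j k powr p / z ^ d j k))" for j
    proof (cases "n = 0")
      case False
      define m where "m = (MAX k\<in>{..<n}. a k * w j k / y ^ d j k)"
      have ne: "{..<n} \<noteq> {}" using False by auto
      have le: "a k * w j k / y ^ d j k \<le> m" if "k < n" for k
        unfolding m_def using that by (intro Max_ge) auto
      have "m \<in> (\<lambda>k. a k * w j k / y ^ d j k) ` {..<n}" unfolding m_def using ne by (intro Max_in) auto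
      then obtain i where i: "i < n" "m = a i * w j i / y ^ d j i" by blast
      have m0: "0 \<le> m" unfolding i using a w0 y by simp
      have "(\<Sum>k<n. a k * w j k) \<le> (\<Sum>k<n. m * y ^ d j k)"
        using le y by (intro sum_mono) (simp add: field_simps)
      also have "\<dots> \<le> m * (2/(1-y))"
        unfolding sum_distrib_left[symmetric] d_def by (intro mult_left_mono sum_power_dist_le y m0)
      finally have "(\<Sum>k<n. a k * w j k) powr p \<le> (m * (2/(1-y))) powr p"
        using assms a w0 by (intro powr_mono2) (auto intro!: sum_nonneg)
      also have "\<dots> = (2/(1-y)) powr p * m powr p" using m0 y by (subst powr_mult) auto
      also have "m powr p = a i powr p * (w j i powr p / z ^ d j i)"
      proof -
        have "(y ^ d j i) powr p = z ^ d j i"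
          using y yp by (metis powr_power powr_powr powr_realpow mult.commute powr_gt_zero)
        then show ?thesis unfolding i using a w0 y by (simp add: powr_divide powr_mult)
      qed
      also have "\<dots> \<le> (\<Sum>k<n. a k powr p * (w j k powr p / z ^ d j k))"
        using i z by (intro member_le_sum[where f="\<lambda>k. a k powr p * (w j k powr p / z ^ d j k)"]) auto
      finally show ?thesis using y by (simp add: mult_left_mono)
    qed auto
    then have "(\<Sum>j<N. (1/2) ^ j * (\<Sum>k<n. a k * w j k) powr p)
       \<le> (\<Sum>j<N. (1/2) ^ j * ((2/(1-y)) powr p * (\<Sum>k<n. a k powr p * (w j k powr p / z ^ d j k))))"
      by (intro sum_mono mult_left_mono) auto
    also have "\<dots> = (2/(1-y)) powr p * (\<Sum>k<n. a k powr p * (\<Sum>j<N. (1/2)^j * (w j k powr p / z ^ d j k)))"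
      unfolding sum_distrib_left
      by (subst sum.swap) (intro sum.cong refl, simp)
    also have "\<dots> \<le> (2/(1-y)) powr p * (\<Sum>k<n. a k powr p * (\<Sum>j<N. (1/2)^k * z ^ d j k))"
      by (intro mult_left_mono sum_mono key) auto
    also have "\<dots> \<le> (2/(1-y)) powr p * (\<Sum>k<n. a k powr p * ((1/2)^k * (2/(1-z))))"
      unfolding sum_distrib_left[symmetric]
      using sum_power_dist_le[OF z, of _ ] by (intro mult_left_mono sum_mono) (auto simp: d_def abs_minus_commute)
    also have "\<dots> = C * (\<Sum>k<n. (1/2) ^ k * a k powr p)"
      unfolding C_def sum_distrib_left by (intro sum.cong) auto
    finally show ?thesis .
  qed
  then show ?thesis using that[OF C] unfolding w_def by blast
qed

text \<open>The weights of \<open>discrete_hardy\<close> equal 1 for \<open>k \<le> j\<close>, so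
  partial sums are dominated by the weighted sums for any M that is large enough for p.\<close>

corollary discrete_hardy_partial_sums:
  fixes p :: real
  assumes "p > 0"
  obtains C where "C > 0"
    "\<And>a N. (\<And>k. 0 \<le> a k) \<Longrightarrow>
      (\<Sum>j<N. (1/2) ^ j * (\<Sum>k\<le>j. a k) powr p) \<le> C * (\<Sum>k<N. (1/2) ^ k * a k powr p)"
proof -
  obtain M :: nat where "2 / p \<le> real M" using real_arch_simple by blast
  then have "2 \<le> real M * p" using assms by (simp add: field_simps)
  then obtain C where C: "C > 0" "\<And>a N n. (\<And>k. 0 \<le> a k) \<Longrightarrow>
      (\<Sum>j<N. (1/2) ^ j * (\<Sum>k<n. a k * min 1 (2 ^ j / 2 ^ k) ^ M) powr p)
        \<le> C * (\<Sum>k<n. (1/2) ^ k * a k powr p)"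
    using discrete_hardy[OF assms] by blast
  have "(\<Sum>j<N. (1/2) ^ j * (\<Sum>k\<le>j. a k) powr p) \<le> C * (\<Sum>k<N. (1/2) ^ k * a k powr p)"
    if a: "\<And>k. 0 \<le> a k" for a N
  proof -
    have "(\<Sum>k\<le>j. a k) \<le> (\<Sum>k<N. a k * min 1 (2 ^ j / 2 ^ k) ^ M)" if "j < N" for j
    proof -
      have "(\<Sum>k\<le>j. a k) = (\<Sum>k\<le>j. a k * min 1 (2 ^ j / 2 ^ k) ^ M)" by (intro sum.cong) auto
      also have "\<dots> \<le> (\<Sum>k<N. a k * min 1 (2 ^ j / 2 ^ k) ^ M)"
        using that a by (intro sum_mono2) auto
      finally show ?thesis .
    qed
    then show ?thesis
      using a assms by (intro order_trans[OF _ C(2)[of a N N]] sum_mono mult_left_mono powr_mono2) (auto intro: sum_nonneg)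
  qed
  then show ?thesis using that C(1) by blast
qed

section \<open>Dyadic tails and moments of measures on [0,1)\<close>

definition dyadic_tail :: "real measure \<Rightarrow> nat \<Rightarrow> real" where
  "dyadic_tail \<mu> k = measure \<mu> {1 - (1/2) ^ k..<1}"

lemma space_M_plus: "\<mu> \<in> M_plus \<Longrightarrow> space \<mu> = {0..<1}"
  unfolding M_plus_def using sets_eq_imp_space_eq[of \<mu> "restrict_space borel {0..<1}"]
  by (simp add: space_restrict_space)

lemma finite_measure_M_plus: "\<mu> \<in> M_plus \<Longrightarrow> finite_measure \<mu>"
  unfolding M_plus_def by simp

lemma measurable_M_plus:
  assumes "\<mu> \<in> M_plus" "f \<in> borel_measurable borel"
  shows "f \<in> borel_measurable \<mu>"
proof -
  have "sets \<mu> = sets (restrict_space borel {0..<1})" using assms(1) by (simp add: M_plus_def)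
  then show ?thesis using measurable_restrict_space1[OF assms(2)] by (simp cong: measurable_cong_sets)
qed

lemma sets_M_plus_atLeastLessThan: "\<mu> \<in> M_plus \<Longrightarrow> 0 \<le> a \<Longrightarrow> {a..<1} \<in> sets \<mu>"
  unfolding M_plus_def by (auto simp: sets_restrict_space_iff)

lemma half_power_le_1: "(1/2::real) ^ k \<le> 1" "0 \<le> 1 - (1/2::real) ^ k"
  by (simp_all add: power_le_one)

lemma integrable_M_plus:
  fixes f :: "real \<Rightarrow> 'a::{banach, second_countable_topology}"
  assumes "\<mu> \<in> M_plus" "f \<in> borel_measurable borel" "\<And>t. 0 \<le> t \<Longrightarrow> t < 1 \<Longrightarrow> norm (f t) \<le> c"
  shows "integrable \<mu> f"
proof -
  interpret finite_measure \<mu> using assms(1) by (rule finite_measure_M_plus)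
  have "AE t in \<mu>. norm (f t) \<le> c"
    by (rule AE_I2) (use assms(3) space_M_plus[OF assms(1)] in auto)
  then show ?thesis by (rule integrable_const_bound) (rule measurable_M_plus[OF assms(1,2)])
qed

lemma dyadic_tail_nonneg: "0 \<le> dyadic_tail \<mu> k"
  unfolding dyadic_tail_def by simp

lemma dyadic_tail_Suc_le:
  assumes "\<mu> \<in> M_plus" shows "dyadic_tail \<mu> (Suc k) \<le> dyadic_tail \<mu> k"
proof -
  interpret finite_measure \<mu> using assms by (rule finite_measure_M_plus)
  have "{1 - (1/2) ^ k..<1} \<in> sets \<mu>"
    by (rule sets_M_plus_atLeastLessThan[OF assms half_power_le_1(2)])
  then show ?thesis unfolding dyadic_tail_def by (rule finite_measure_mono[rotated]) auto
qed

lemma ex_dyadic_block: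
  fixes t :: real
  assumes "0 \<le> t" "t < 1 - (1/2) ^ n"
  obtains k where "k < n" "1 - (1/2) ^ k \<le> t" "t < 1 - (1/2) ^ Suc k"
  using assms
proof (induction n arbitrary: thesis)
  case (Suc n)
  show ?case
  proof (cases "t < 1 - (1/2) ^ n")
    case True
    then show ?thesis using Suc.IH[of thesis] Suc.prems by (metis less_SucI)
  next
    case False
    then show ?thesis using Suc.prems(1)[of n] Suc.prems by simp
  qed
qed auto

text \<open>Each block is replaced by the whole tail that starts at its left end. The tails are
  nested, so this overcounts, but at every point the term of its own block already dominates \<phi>.
  Tails rather than measures of blocks are wanted because all conditions on \<mu> are conditions on
  tails.\<close>

lemma integral_le_sum_dyadic_tail:
  fixes \<phi> :: "real \<Rightarrow> real"
  assumes \<mu>: "\<mu> \<in> M_plus" and c: "\<And>k. 0 \<le> c k"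
    and bl: "\<And>k t. k < n \<Longrightarrow> 1 - (1/2) ^ k \<le> t \<Longrightarrow> t < 1 - (1/2) ^ Suc k \<Longrightarrow> \<phi> t \<le> c k"
    and bn: "\<And>t. 1 - (1/2) ^ n \<le> t \<Longrightarrow> t < 1 \<Longrightarrow> \<phi> t \<le> c n"
  shows "(LINT t|\<mu>. \<phi> t) \<le> (\<Sum>k\<le>n. c k * dyadic_tail \<mu> k)"
proof -
  interpret finite_measure \<mu> using \<mu> by (rule finite_measure_M_plus)
  define g where "g t = (\<Sum>k\<le>n. c k * indicator {1 - (1/2) ^ k..<1} t)" for t :: real
  have ind: "integrable \<mu> (\<lambda>t. c k * indicator {1 - (1/2) ^ k..<1} t)" for k
    using sets_M_plus_atLeastLessThan[OF \<mu>, of "1 - (1/2) ^ k"] by (simp add: half_power_le_1 emeasure_eq_measure)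
  have "\<phi> t \<le> g t \<and> 0 \<le> g t" if t: "t \<in> space \<mu>" for t
  proof -
    have t01: "0 \<le> t" "t < 1" using t space_M_plus[OF \<mu>] by auto
    have *: "\<phi> t \<le> g t" if "k \<le> n" "1 - (1/2) ^ k \<le> t" "\<phi> t \<le> c k" for k
    proof -
      have "c k = c k * indicator {1 - (1/2) ^ k..<1} t" using that t01 by simp
      also have "\<dots> \<le> g t" unfolding g_def using that c
        by (intro member_le_sum[where f="\<lambda>k. c k * indicator {1 - (1/2) ^ k..<1} t"]) auto
      finally show ?thesis using that by simp
    qed
    have "0 \<le> g t" unfolding g_def using c by (intro sum_nonneg) simp
    moreover have "\<phi> t \<le> g t"
    proof (cases "t < 1 - (1/2) ^ n")
      case True
      obtain k where "k < n" "1 - (1/2) ^ k \<le> t" "t < 1 - (1/2) ^ Suc k"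
        using ex_dyadic_block[OF t01(1) True] by blast
      then show ?thesis using *[of k] bl[of k t] by simp
    next
      case False
      then show ?thesis using *[of n] bn[of t] t01 by simp
    qed
    ultimately show ?thesis by simp
  qed
  then have "(LINT t|\<mu>. \<phi> t) \<le> (LINT t|\<mu>. g t)"
    using ind unfolding g_def by (intro integral_mono' Bochner_Integration.integrable_sum) auto
  also have "\<dots> = (\<Sum>k\<le>n. c k * dyadic_tail \<mu> k)"
  proof -
    have "{1 - (1/2) ^ k..<1} \<inter> space \<mu> = {1 - (1/2::real) ^ k..<1}" for k
      using space_M_plus[OF \<mu>] half_power_le_1(2)[of k] by force
    then show ?thesis unfolding g_def dyadic_tail_def using ind
      by (subst Bochner_Integration.integral_sum) auto
  qed
  finally show ?thesis .
qed

lemma integrable_power_M_plus: "\<mu> \<in> M_plus \<Longrightarrow> integrable \<mu> (\<lambda>t. t ^ n)"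
  by (rule integrable_M_plus[where c=1]) (auto simp: power_le_one)

lemma measure_moment_nonneg: "\<mu> \<in> M_plus \<Longrightarrow> 0 \<le> measure_moment \<mu> n"
  unfolding measure_moment_def by (intro integral_nonneg_AE AE_I2) (auto simp: space_M_plus)

lemma measure_moment_antimono:
  assumes "\<mu> \<in> M_plus" "m \<le> n" shows "measure_moment \<mu> n \<le> measure_moment \<mu> m"
  unfolding measure_moment_def
  by (rule integral_mono[OF integrable_power_M_plus integrable_power_M_plus])
    (use assms space_M_plus[OF assms(1)] in \<open>auto intro: power_decreasing\<close>)

lemma measure_moment_upper:
  assumes \<mu>: "\<mu> \<in> M_plus" and k: "2 ^ k \<le> Suc n"
  shows "measure_moment \<mu> n \<le> (\<Sum>i\<le>k. 2 * exp (- (2 ^ (k - i) / 2)) * dyadic_tail \<mu> i)"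
  unfolding measure_moment_def
proof (rule integral_le_sum_dyadic_tail[OF \<mu>])
  fix i t assume i: "i < k" and t: "1 - (1/2) ^ i \<le> t" "t < 1 - (1/2::real) ^ Suc i"
  define x where "x = (1/2::real) ^ Suc i"
  have x: "0 \<le> x" "x \<le> 1/2" unfolding x_def by (auto simp: half_power_le_1)
  have t0: "0 \<le> t" using t half_power_le_1(2)[of i] by linarith
  have "t ^ n \<le> (1 - x) ^ n" using t t0 unfolding x_def by (intro power_mono) auto
  \<comment> \<open>As \<open>x \<le> 1/2\<close>, one more factor \<open>1 - x\<close> costs at
    most 2. It raises the exponent to n + 1, which is the number that is compared with
    \<open>2 ^ k\<close>.\<close>
  also have "\<dots> \<le> 2 * (1 - x) ^ Suc n" using x by simp
  also have "\<dots> \<le> 2 * exp (- x) ^ Suc n"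
    using x exp_ge_add_one_self[of "-x"] by (intro mult_left_mono power_mono) auto
  also have "exp (- x) ^ Suc n = exp (- (x * real (Suc n)))"
    by (subst exp_of_nat_mult[symmetric]) (simp add: algebra_simps)
  also have "\<dots> \<le> exp (- (2 ^ (k - i) / 2))"
  proof -
    have "(2::real) ^ (k - i) / 2 = x * 2 ^ k"
      unfolding x_def using i by (simp add: power_diff field_simps)
    also have "(2::real) ^ k \<le> real (Suc n)" using k by (metis of_nat_le_iff of_nat_numeral of_nat_power)
    finally show ?thesis using x by (simp add: mult_left_mono)
  qed
  finally show "t ^ n \<le> 2 * exp (- (2 ^ (k - i) / 2))" by simp
next
  fix t :: real assume t: "1 - (1/2) ^ k \<le> t" "t < 1"
  have "0 \<le> t" using t half_power_le_1(2)[of k] by linarith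
  then have "t ^ n \<le> 1" using t by (simp add: power_le_one)
  also have "1 \<le> 2 * exp (- (1 / 2 :: real))" using exp_ge_add_one_self[of "-1/2 :: real"] by simp
  finally show "t ^ n \<le> 2 * exp (- (2 ^ (k - k) / 2))" by simp
qed auto

text \<open>The left side is at most 1/e since the power is the reciprocal of
  \<open>(1 + 1/l) ^ l\<close> with l = m - 1. The exponent m - 1 instead of m keeps the bound true
  for m = 1, which is the dyadic level 0.\<close>

lemma one_minus_inverse_power_ge:
  assumes "m \<ge> 1"
  shows "1/3 \<le> (1 - 1 / real m) ^ (m - 1)"
proof (cases "m = 1")
  case False
  define l where "l = m - 1"
  have l: "l \<ge> 1" "m = Suc l" using assms False by (auto simp: l_def)
  have "(1 + 1 / real l) ^ l \<le> exp (1 / real l) ^ l"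
    using exp_ge_add_one_self[of "1 / real l"] by (intro power_mono) auto
  also have "\<dots> = exp 1" using l by (simp flip: exp_of_nat_mult)
  also have "\<dots> \<le> 3" using exp_le by simp
  finally have "(1 + 1 / real l) ^ l \<le> 3" .
  moreover have "1 - 1 / real m = 1 / (1 + 1 / real l)" using l by (simp add: field_simps)
  moreover have "0 < (1 + 1 / real l) ^ l" by (simp add: add_pos_nonneg)
  ultimately show ?thesis using l by (simp add: power_divide field_simps)
qed simp

text \<open>Chebyshev's inequality: for \<open>n < 2 ^ k\<close> the power \<open>t ^ n\<close> is
  at least 1/3 on the tail at level k.\<close>

lemma measure_moment_lower:
  assumes \<mu>: "\<mu> \<in> M_plus" and k: "Suc n \<le> 2 ^ k"
  shows "dyadic_tail \<mu> k \<le> 3 * measure_moment \<mu> n"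
proof -
  interpret finite_measure \<mu> using \<mu> by (rule finite_measure_M_plus)
  define a where "a = 1 - (1/2::real) ^ k"
  have a: "0 \<le> a" "a < 1" unfolding a_def by (auto simp: half_power_le_1)
  have "1/3 \<le> a ^ (2 ^ k - 1)"
    using one_minus_inverse_power_ge[of "2 ^ k"] unfolding a_def by (simp add: power_divide)
  also have "\<dots> \<le> a ^ n" using a k by (intro power_decreasing) auto
  finally have an: "1/3 \<le> a ^ n" .
  have A: "{a..<1} \<in> sets \<mu>" "{a..<1} \<inter> space \<mu> = {a..<1}"
    using sets_M_plus_atLeastLessThan[OF \<mu> a(1)] sets.sets_into_space by blast+
  have "1/3 * dyadic_tail \<mu> k = (LINT t|\<mu>. 1/3 * indicator {a..<1} t)"
    using A by (simp add: dyadic_tail_def a_def)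
  also have "\<dots> \<le> measure_moment \<mu> n"
    unfolding measure_moment_def
  proof (rule integral_mono)
    show "integrable \<mu> (\<lambda>t. 1/3 * indicator {a..<1} t :: real)"
      using A by (simp add: emeasure_eq_measure)
    fix t assume "t \<in> space \<mu>"
    then have t: "0 \<le> t" "t < 1" using space_M_plus[OF \<mu>] by auto
    show "1/3 * indicator {a..<1} t \<le> t ^ n"
      using an a t power_mono[of a t n] by (auto simp: indicator_def)
  qed (rule integrable_power_M_plus[OF \<mu>])
  finally show ?thesis by simp
qed

section \<open>Radial weights as measures on [0,1)\<close>

lemma lborel_complex_eq_distr:
  "(lborel :: complex measure) = distr (lborel \<Otimes>\<^sub>M lborel) borel (\<lambda>(y, x). Complex x y)"
proof (rule lborel_eqI)
  fix l u :: complex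
  assume lu: "\<And>b. b \<in> Basis \<Longrightarrow> l \<bullet> b \<le> u \<bullet> b"
  have "Re l \<le> Re u" "Im l \<le> Im u" using lu[of 1] lu[of \<i>] by (auto simp: Basis_complex_def)
  have m: "(\<lambda>(y, x). Complex x y) \<in> borel_measurable (lborel \<Otimes>\<^sub>M lborel)"
    unfolding lborel_prod case_prod_beta
    by (intro borel_measurable_continuous_onI continuous_intros | simp)+
  have eq: "(\<lambda>(y, x). Complex x y) -` box l u \<inter> space (lborel \<Otimes>\<^sub>M lborel) = box (Im l, Re l) (Im u, Re u)"
    by (auto simp: box_def Basis_complex_def space_pair_measure Basis_prod_def inner_prod_def)
  show "emeasure (distr (lborel \<Otimes>\<^sub>M lborel) borel (\<lambda>(y, x). Complex x y)) (box l u) = ennreal (\<Prod>b\<in>Basis. (u - l) \<bullet> b)"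
    apply (subst emeasure_distr[OF m borel_open[OF open_box]])
    apply (subst eq)
    apply (subst lborel_prod)
    using \<open>Re l \<le> Re u\<close> \<open>Im l \<le> Im u\<close>
    by (subst emeasure_lborel_box) (auto simp: Basis_complex_def Basis_prod_def prod.union_disjoint prod.reindex inj_on_def inner_diff_left mult.commute)
qed simp

text \<open>The imaginary part is the first coordinate of the product, so the slices are horizontal
  lines and the exceptional set consists of heights.\<close>

lemma AE_lborel_complex_slices:
  assumes "AE z in lborel. P (z :: complex)"
  shows "AE y in lborel. AE x in lborel. P (Complex x y)"
proof -
  have m: "(\<lambda>(y, x). Complex x y) \<in> borel_measurable (lborel \<Otimes>\<^sub>M lborel)"
    unfolding lborel_prod case_prod_beta
    by (intro borel_measurable_continuous_onI continuous_intros | simp)+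
  have "AE p in lborel \<Otimes>\<^sub>M lborel. P (case p of (y, x) \<Rightarrow> Complex x y)"
    using assms unfolding lborel_complex_eq_distr by (rule AE_distrD[OF m])
  then have "AE y in lborel. AE x in lborel. P (case (y, x) of (y, x) \<Rightarrow> Complex x y)"
    by (rule lborel_pair.AE_pair)
  then show ?thesis by simp
qed

lemma integrable_lborel_complex_slices:
  fixes g :: "complex \<Rightarrow> real"
  assumes "integrable lborel g"
  shows "AE y in lborel. integrable lborel (\<lambda>x. g (Complex x y))"
proof -
  have m: "(\<lambda>(y, x). Complex x y) \<in> borel_measurable (lborel \<Otimes>\<^sub>M lborel)"
    unfolding lborel_prod case_prod_beta
    by (intro borel_measurable_continuous_onI continuous_intros | simp)+
  have "g \<in> borel_measurable borel" using assms borel_measurable_integrable by fastforce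
  then have "integrable (lborel \<Otimes>\<^sub>M lborel) (\<lambda>p. g (case p of (y, x) \<Rightarrow> Complex x y))"
    using assms integrable_distr_eq[OF m, of g] unfolding lborel_complex_eq_distr[symmetric] by simp
  then have "integrable (lborel \<Otimes>\<^sub>M lborel) (\<lambda>(y, x). g (Complex x y))"
    by (simp add: case_prod_beta')
  then show ?thesis by (rule lborel_pair.AE_integrable_fst)
qed

lemma ex_AE_lborel_greaterThanLessThan:
  fixes c :: real
  assumes "AE y in lborel. P y" "0 < c"
  obtains y where "0 < y" "y < c" "P y"
proof (rule ccontr)
  assume "\<not> thesis"
  then have nP: "\<not> P y" if "y \<in> {0<..<c}" for y using that \<open>\<And>y. \<lbrakk>0 < y; y < c; P y\<rbrakk> \<Longrightarrow> thesis\<close> by auto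
  have "AE y in lborel. y \<notin> {0<..<c}" using assms(1) by eventually_elim (use nP in blast)
  then have "{0<..<c} \<in> null_sets lborel" by (subst AE_iff_null_sets) auto
  then show False using assms(2) by (auto simp: null_sets_def)
qed

lemma radial_weight_nonneg:
  assumes "radial_weight \<omega>"
  shows "0 \<le> indicator {0..<1} r * \<omega> (of_real r)"
proof -
  have "\<forall>z\<in>ball 0 1. 0 \<le> \<omega> z" using assms unfolding radial_weight_def by blast
  then show ?thesis by (auto simp: indicator_def)
qed

text \<open>The hypothesis is integrability over the disc, so almost every horizontal line carries
  an integrable restriction. One such line at a height y in (0,a) is chosen. It meets the circle of
  radius r at the abscissa \<open>sqrt (r\<^sup>2 - y\<^sup>2)\<close>, and radial symmetry makes
  the restriction to the line, in the variable r, the restriction to the ray. The bound a > 0 leaves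
  room for y and keeps the substitution regular.\<close>

lemma radial_weight_integrable_ray:
  assumes \<omega>: "radial_weight \<omega>" and a: "0 < a"
  shows "(\<lambda>r. \<omega> (of_real r)) absolutely_integrable_on {a..<1}"
proof -
  define g where "g z = indicator (ball 0 1) z * \<omega> z" for z
  have g: "integrable lebesgue g"
    using \<omega> unfolding radial_weight_def set_integrable_def g_def by simp
  then obtain g' where g': "g' \<in> borel_measurable lborel" "AE z in lborel. g z = g' z"
    using completion_ex_borel_measurable_real[of g lborel] borel_measurable_integrable[OF g] by auto
  have "integrable lebesgue g'"
    using g g' by (subst integrable_cong_AE[symmetric, of g]) (auto intro: AE_completion measurable_completion)
  then have "integrable lborel g'" using g'(1) by (simp add: integrable_completion)
  from integrable_lborel_complex_slices[OF this] AE_lborel_complex_slices[OF g'(2)]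
  have "AE y in lborel. integrable lborel (\<lambda>x. g' (Complex x y)) \<and> (AE x in lborel. g (Complex x y) = g' (Complex x y))"
    by eventually_elim simp
  then obtain y where y: "0 < y" "y < a" and int: "integrable lborel (\<lambda>x. g' (Complex x y))"
    and ae: "AE x in lborel. g (Complex x y) = g' (Complex x y)"
    using ex_AE_lborel_greaterThanLessThan[OF _ a] by blast
  obtain N where N: "{x. g (Complex x y) \<noteq> g' (Complex x y)} \<subseteq> N" "N \<in> null_sets lebesgue"
    using AE_completion[OF ae] by (elim AE_E) (auto simp: null_sets_def)
  have "(\<lambda>x. g' (Complex x y)) absolutely_integrable_on UNIV"
    using int unfolding set_integrable_def
    by (subst integrable_completion) (auto dest: borel_measurable_integrable)
  then have k: "(\<lambda>x. g (Complex x y)) absolutely_integrable_on UNIV"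
    by (rule absolutely_integrable_spike[where S=N]) (use N negligible_iff_null_sets in auto)
  define G where "G r = sqrt (r\<^sup>2 - y\<^sup>2)" for r
  have pos: "0 < r\<^sup>2 - y\<^sup>2" if "r \<in> {a..<1}" for r using that y by (simp add: power_strict_mono)
  have img: "G ` {a..<1} = {G a..<G 1}"
  proof (intro equalityI subsetI)
    fix x assume "x \<in> {G a..<G 1}"
    then have x: "G a \<le> x" "x < G 1" by auto
    have "0 \<le> G a" unfolding G_def using y by (simp add: power_mono)
    then have x0: "0 \<le> x" using x by linarith
    have "(G a)\<^sup>2 \<le> x\<^sup>2" using x \<open>0 \<le> G a\<close> by (simp add: power_mono)
    then have "a\<^sup>2 \<le> x\<^sup>2 + y\<^sup>2" unfolding G_def using y by (simp add: power_mono)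
    then have "a \<le> sqrt (x\<^sup>2 + y\<^sup>2)" using real_le_rsqrt by blast
    moreover have "sqrt (x\<^sup>2 + y\<^sup>2) < 1"
    proof -
      have "x\<^sup>2 < (G 1)\<^sup>2" using x x0 by (simp add: power_strict_mono)
      moreover have "0 < sqrt (1 - y\<^sup>2)" using order_le_less_trans[OF x0 x(2)] unfolding G_def by simp
      then have "0 < 1 - y\<^sup>2" using real_sqrt_gt_0_iff by blast
      ultimately show ?thesis unfolding G_def by simp
    qed
    moreover have "x = G (sqrt (x\<^sup>2 + y\<^sup>2))" unfolding G_def using x0 by simp
    ultimately show "x \<in> G ` {a..<1}" by auto
  qed (use a in \<open>auto simp: G_def abs_square_less_1 intro!: power_mono\<close>)
  have der: "(G has_field_derivative r / sqrt (r\<^sup>2 - y\<^sup>2)) (at r within {a..<1})" if "r \<in> {a..<1}" for r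
    unfolding G_def using pos[OF that]
    by (auto intro!: derivative_eq_intros simp: field_simps)
  have inj: "inj_on G {a..<1}"
  proof (rule inj_onI)
    fix r s assume *: "r \<in> {a..<1}" "s \<in> {a..<1}" "G r = G s"
    then have "r\<^sup>2 = s\<^sup>2" using pos[of r] pos[of s] unfolding G_def by simp
    then show "r = s" using * a by (simp add: power2_eq_iff_nonneg)
  qed
  have "(\<lambda>x. g (Complex x y)) absolutely_integrable_on (G ` {a..<1})"
    unfolding img by (rule set_integrable_subset[OF k]) auto
  then have "(\<lambda>r. \<bar>r / sqrt (r\<^sup>2 - y\<^sup>2)\<bar> * g (Complex (G r) y)) absolutely_integrable_on {a..<1}"
    by (subst (asm) absolutely_integrable_change_of_variables_1'[OF _ der inj]) auto
  \<comment> \<open>The Jacobian is removed by multiplying with its reciprocal, which is continuous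
    and at most 1 on the interval.\<close>
  then have *: "(\<lambda>r. sqrt (r\<^sup>2 - y\<^sup>2) / r * (\<bar>r / sqrt (r\<^sup>2 - y\<^sup>2)\<bar> * g (Complex (G r) y))) absolutely_integrable_on {a..<1}"
  proof (rule absolutely_integrable_bounded_measurable_product_real[rotated 3])
    have "continuous_on {a..<1} (\<lambda>r. sqrt (r\<^sup>2 - y\<^sup>2) / r)"
      using a by (intro continuous_intros) auto
    then show "(\<lambda>r. sqrt (r\<^sup>2 - y\<^sup>2) / r) \<in> borel_measurable (lebesgue_on {a..<1})"
      by (rule continuous_imp_measurable_on_sets_lebesgue) auto
    have "\<bar>sqrt (r\<^sup>2 - y\<^sup>2) / r\<bar> \<le> 1" if "r \<in> {a..<1}" for r
    proof -
      have "sqrt (r\<^sup>2 - y\<^sup>2) \<le> sqrt (r\<^sup>2)" by (intro real_sqrt_le_mono) simp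
      then show ?thesis using that a pos[OF that] by simp
    qed
    then show "bounded ((\<lambda>r. sqrt (r\<^sup>2 - y\<^sup>2) / r) ` {a..<1})"
      unfolding bounded_iff by (intro exI[of _ 1]) auto
  qed auto
  have "sqrt (r\<^sup>2 - y\<^sup>2) / r * (\<bar>r / sqrt (r\<^sup>2 - y\<^sup>2)\<bar> * g (Complex (G r) y)) = \<omega> (of_real r)"
    if r: "r \<in> {a..<1}" for r
  proof -
    have "norm (Complex (G r) y) = r"
      using pos[OF r] r a unfolding G_def complex_norm by simp
    moreover from this have "g (Complex (G r) y) = \<omega> (of_real r)"
      using \<omega> r unfolding g_def radial_weight_def by (auto simp del: complex_norm)
    ultimately show ?thesis using pos[OF r] r a by simp
  qed
  then show ?thesis using * by (subst set_integrable_cong[OF refl refl, of _ _ _ , symmetric]) auto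
qed

text \<open>The density is only Lebesgue measurable, whereas \<open>M_plus\<close> asks for the
  Borel sets of [0,1); the push-forward performs this restriction. Points outside [0,1) are sent to
  0, but the density vanishes there and they carry no mass.\<close>

definition radial_measure :: "(complex \<Rightarrow> real) \<Rightarrow> real measure" where
  "radial_measure \<omega> = distr (density lebesgue (\<lambda>r. ennreal (indicator {0..<1} r * \<omega> (of_real r))))
     (restrict_space borel {0..<1}) (\<lambda>r. if r \<in> {0..<1} then r else 0)"

text \<open>Measurability is inherited from integrability on \<open>[1/(n+1), 1)\<close> by letting
  n tend to infinity. The value at 0 is not reached in this way and is added as a single
  point.\<close>

lemma radial_weight_measurable_ray:
  assumes \<omega>: "radial_weight \<omega>"
  shows "(\<lambda>r. indicator {0..<1} r * \<omega> (of_real r)) \<in> borel_measurable lebesgue"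
proof -
  have m: "(\<lambda>r. indicator {1 / real (Suc n)..<1} r * \<omega> (of_real r)) \<in> borel_measurable lebesgue" for n
    using radial_weight_integrable_ray[OF \<omega>, of "1 / real (Suc n)"]
    unfolding set_integrable_def by (auto dest: borel_measurable_integrable)
  have "(\<lambda>r. indicator {0<..<1} r * \<omega> (of_real r)) \<in> borel_measurable lebesgue"
  proof (rule borel_measurable_LIMSEQ_real[OF _ m])
    fix r :: real
    have "\<forall>\<^sub>F n in sequentially. indicator {1 / real (Suc n)..<1} r = (indicator {0<..<1} r :: real)"
    proof (cases "0 < r")
      case True
      then have "\<forall>\<^sub>F n in sequentially. 1 / real (Suc n) < r"
        using order_tendstoD(2)[OF LIMSEQ_inverse_real_of_nat, of r] by (simp add: inverse_eq_divide)
      then show ?thesis by (rule eventually_mono) (use True in \<open>auto simp: indicator_def\<close>)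
    next
      case False
      have "\<not> 1 / real (Suc n) \<le> r" for n using False by (smt (verit) divide_pos_pos of_nat_0_less_iff zero_less_Suc)
      then show ?thesis using False by (auto simp: indicator_def)
    qed
    then have "\<forall>\<^sub>F n in sequentially. indicator {0<..<1} r * \<omega> (of_real r) = indicator {1 / real (Suc n)..<1} r * \<omega> (of_real r)"
      by (rule eventually_mono) simp
    then show "(\<lambda>n. indicator {1 / real (Suc n)..<1} r * \<omega> (of_real r)) \<longlonglongrightarrow> indicator {0<..<1} r * \<omega> (of_real r)"
      by (rule Lim_transform_eventually[OF tendsto_const])
  qed
  moreover have "(\<lambda>r. indicator {0} r * \<omega> 0) \<in> borel_measurable lebesgue"
    by (intro measurable_completion) measurable
  ultimately have "(\<lambda>r. indicator {0<..<1} r * \<omega> (of_real r) + indicator {0} r * \<omega> 0) \<in> borel_measurable lebesgue"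
    by measurable
  moreover have "(\<lambda>r. indicator {0<..<1} r * \<omega> (of_real r) + indicator {0} r * \<omega> 0) = (\<lambda>r. indicator {0..<1} r * \<omega> (of_real r))"
    by (auto simp: indicator_def fun_eq_iff)
  ultimately show ?thesis by simp
qed

lemma
  assumes \<omega>: "radial_weight \<omega>"
  shows measure_tail_radial_measure: "0 \<le> r \<Longrightarrow> measure_tail (radial_measure \<omega>) r = weight_tail \<omega> r"
    and measure_moment_radial_measure: "measure_moment (radial_measure \<omega>) n = weight_moment \<omega> n"
    and sets_radial_measure: "sets (radial_measure \<omega>) = sets (restrict_space borel {0..<1})"
proof -
  define \<rho> where "\<rho> r = indicator {0..<1} r * \<omega> (of_real r)" for r
  define T where "T r = (if r \<in> {0..<1} then r else 0)" for r :: real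
  have \<rho>[measurable]: "\<rho> \<in> borel_measurable lebesgue" unfolding \<rho>_def using radial_weight_measurable_ray[OF \<omega>] .
  have \<rho>0: "0 \<le> \<rho> r" for r unfolding \<rho>_def by (rule radial_weight_nonneg[OF \<omega>])
  have rm: "radial_measure \<omega> = distr (density lebesgue (\<lambda>r. ennreal (\<rho> r))) (restrict_space borel {0..<1}) T"
    unfolding radial_measure_def \<rho>_def T_def ..
  have "T \<in> borel_measurable borel" unfolding T_def by measurable
  then have Tb: "T \<in> borel_measurable lebesgue" by (simp add: measurable_completion)
  then have T: "T \<in> measurable (density lebesgue (\<lambda>r. ennreal (\<rho> r))) (restrict_space borel {0..<1})"
    by (intro measurable_restrict_space2) (auto simp: T_def)
  show "sets (radial_measure \<omega>) = sets (restrict_space borel {0..<1})" unfolding rm by simp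
  show "measure_tail (radial_measure \<omega>) r = weight_tail \<omega> r" if r: "0 \<le> r"
  proof -
    have "{r..<1} \<in> sets (restrict_space borel {0..<1})" using r by (auto simp: sets_restrict_space_iff)
    then have "measure_tail (radial_measure \<omega>) r = emeasure (density lebesgue (\<lambda>r. ennreal (\<rho> r))) (T -` {r..<1})"
      unfolding measure_tail_def rm by (simp add: emeasure_distr[OF T])
    also have "\<dots> = (\<integral>\<^sup>+x. ennreal (\<rho> x) * indicator (T -` {r..<1}) x \<partial>lebesgue)"
      using measurable_sets[OF Tb, of "{r..<1}"] by (subst emeasure_density) auto
    also have "\<dots> = weight_tail \<omega> r"
      unfolding weight_tail_def using r by (intro nn_integral_cong) (auto simp: \<rho>_def T_def indicator_def)
    finally show ?thesis .
  qed
  show "measure_moment (radial_measure \<omega>) n = weight_moment \<omega> n"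
  proof -
    have "(\<lambda>r::real. r ^ n) \<in> borel_measurable (restrict_space borel {0..<1})"
      by (intro measurable_restrict_space1) simp
    then have "measure_moment (radial_measure \<omega>) n = (LINT r|density lebesgue (\<lambda>r. ennreal (\<rho> r)). T r ^ n)"
      unfolding measure_moment_def rm by (subst integral_distr[OF T]) auto
    also have "\<dots> = (LINT r|lebesgue. \<rho> r *\<^sub>R T r ^ n)"
      using \<rho>0 Tb by (subst integral_density) auto
    also have "\<dots> = weight_moment \<omega> n"
      unfolding weight_moment_def set_lebesgue_integral_def
      by (intro Bochner_Integration.integral_cong) (auto simp: \<rho>_def T_def indicator_def)
    finally show ?thesis .
  qed
qed

text \<open>A vanishing tail at 0 makes the radial profile zero off a null set E of radii. The
  points of the disc with nonzero weight lie in the image of \<open>E \<times> UNIV\<close> under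
  polar coordinates, and a differentiable map of the plane takes null sets to null sets. This links
  the assumption that a weight is not a.e. zero, which refers to area measure, with positivity of
  the tail.\<close>

lemma radial_weight_AE_zero:
  assumes \<omega>: "radial_weight \<omega>" and "weight_tail \<omega> 0 = 0"
  shows "AE z in lebesgue. z \<in> ball 0 1 \<longrightarrow> \<omega> z = 0"
proof -
  define \<rho> where "\<rho> r = indicator {0..<1} r * \<omega> (of_real r)" for r
  have \<rho>: "\<rho> \<in> borel_measurable lebesgue" unfolding \<rho>_def using radial_weight_measurable_ray[OF \<omega>] .
  have \<rho>0: "0 \<le> \<rho> r" for r unfolding \<rho>_def by (rule radial_weight_nonneg[OF \<omega>])
  have "weight_tail \<omega> 0 = (\<integral>\<^sup>+r. ennreal (\<rho> r) \<partial>lebesgue)"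
    unfolding weight_tail_def \<rho>_def by (intro nn_integral_cong) (auto simp: indicator_def)
  then have "AE r in lebesgue. ennreal (\<rho> r) = 0" using assms(2) \<rho> by (simp add: nn_integral_0_iff_AE)
  then have "AE r in lebesgue. \<rho> r = 0" using \<rho>0 by (simp add: order_antisym)
  then obtain N where N: "{r. \<rho> r \<noteq> 0} \<subseteq> N" "N \<in> null_sets lebesgue"
    by (elim AE_E) (auto simp: null_sets_def)
  define E where "E = {r. \<rho> r \<noteq> 0}"
  have "negligible E" unfolding E_def using N negligible_iff_null_sets negligible_subset by blast
  then have "negligible (E \<times> (UNIV :: real set))"
  proof -
    obtain N' where N': "E \<subseteq> N'" "N' \<in> null_sets lborel"
      using \<open>negligible E\<close> unfolding negligible_iff_null_sets null_sets_completion_iff2 by blast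
    have "N' \<times> (UNIV :: real set) \<in> null_sets (lborel \<Otimes>\<^sub>M lborel)"
      using N' by (auto simp: null_sets_def lborel.emeasure_pair_measure_Times)
    then have "N' \<times> (UNIV :: real set) \<in> null_sets lebesgue"
      unfolding lborel_prod by (rule null_sets_completionI)
    then show ?thesis using N' negligible_iff_null_sets negligible_subset[of "N' \<times> UNIV" "E \<times> UNIV"] by blast
  qed
  then have "negligible ((\<lambda>(r, t). of_real r * cis t) ` (E \<times> (UNIV :: real set)))"
  proof (rule negligible_differentiable_image_negligible[rotated])
    have "(\<lambda>p. of_real (fst p * cos (snd p)) + \<i> * of_real (fst p * sin (snd p))) differentiable_on E \<times> (UNIV :: real set)"
      unfolding differentiable_on_def differentiable_def
      by (auto intro!: exI derivative_eq_intros)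
    moreover have "(\<lambda>(r, t). of_real r * cis t) = (\<lambda>p. of_real (fst p * cos (snd p)) + \<i> * of_real (fst p * sin (snd p)))"
      by (auto simp: complex_eq_iff fun_eq_iff)
    ultimately show "(\<lambda>(r, t). of_real r * cis t) differentiable_on E \<times> UNIV" by simp
  qed simp
  then have "(\<lambda>(r, t). of_real r * cis t) ` (E \<times> (UNIV :: real set)) \<in> null_sets lebesgue"
    by (simp add: negligible_iff_null_sets)
  moreover have "{z \<in> space lebesgue. \<not> (z \<in> ball 0 1 \<longrightarrow> \<omega> z = 0)} \<subseteq> (\<lambda>(r, t). of_real r * cis t) ` (E \<times> (UNIV :: real set))"
  proof (rule subsetI)
    fix z :: complex assume "z \<in> {z \<in> space lebesgue. \<not> (z \<in> ball 0 1 \<longrightarrow> \<omega> z = 0)}"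
    then have z: "z \<in> ball 0 1" "\<omega> z \<noteq> 0" by auto
    then have "\<omega> (of_real (norm z)) \<noteq> 0" using \<omega> unfolding radial_weight_def by metis
    then have "norm z \<in> E" using z by (simp add: E_def \<rho>_def)
    moreover have "z = of_real (norm z) * cis (Arg z)" using rcis_cmod_Arg[of z] by (simp add: rcis_def)
    ultimately show "z \<in> (\<lambda>(r, t). of_real r * cis t) ` (E \<times> (UNIV :: real set))"
      by (intro image_eqI[of _ _ "(norm z, Arg z)"]) auto
  qed
  ultimately show ?thesis by (rule AE_I')
qed

section \<open>Measures with doubling tails\<close>

locale doubling_measure =
  fixes \<nu> :: "real measure" and D :: real
  assumes M_plus: "\<nu> \<in> M_plus"
    and tail_0_pos: "0 < dyadic_tail \<nu> 0"
    and tail_doubling: "\<And>k. dyadic_tail \<nu> k \<le> D * dyadic_tail \<nu> (Suc k)"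

text \<open>Finiteness is the point: integrability over the disc gives a finite tail at 1/2 only,
  and the doubling condition at r = 0 carries it over to 0. The doubling condition at
  \<open>1 - (1/2) ^ k\<close> is the one between consecutive dyadic tails, since the midpoint of
  this number and 1 is the next dyadic point.\<close>

lemma D_hat_doubling_measure:
  assumes "\<omega> \<in> D_hat"
  obtains D where "doubling_measure (radial_measure \<omega>) D"
proof -
  have \<omega>: "radial_weight \<omega>" and nz: "\<not> (AE z in lebesgue. z \<in> ball 0 1 \<longrightarrow> \<omega> z = 0)"
    using assms unfolding D_hat_def by auto
  obtain C where C: "C > 1" "\<And>r. 0 \<le> r \<Longrightarrow> r < 1 \<Longrightarrow> weight_tail \<omega> r \<le> ennreal C * weight_tail \<omega> ((1 + r) / 2)"
    using assms unfolding D_hat_def by auto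
  have "weight_tail \<omega> (1/2) < \<infinity>"
  proof -
    have "integrable lebesgue (\<lambda>r. indicator {1/2..<1} r *\<^sub>R \<omega> (of_real r))"
      using radial_weight_integrable_ray[OF \<omega>, of "1/2"] unfolding set_integrable_def by simp
    then have "(\<integral>\<^sup>+r. ennreal (norm (indicator {1/2..<1} r *\<^sub>R \<omega> (of_real r))) \<partial>lebesgue) < \<infinity>"
      by (simp add: integrable_iff_bounded)
    also have "(\<integral>\<^sup>+r. ennreal (norm (indicator {1/2..<1} r *\<^sub>R \<omega> (of_real r))) \<partial>lebesgue) = weight_tail \<omega> (1/2)"
      unfolding weight_tail_def
    proof (rule nn_integral_cong)
      fix r :: real
      show "ennreal (norm (indicator {1/2..<1} r *\<^sub>R \<omega> (of_real r))) = ennreal (\<omega> (of_real r)) * indicator {1/2..<1} r"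
        using radial_weight_nonneg[OF \<omega>, of r] by (auto simp: indicator_def split: if_splits)
    qed
    finally show ?thesis .
  qed
  then have "weight_tail \<omega> 0 < \<infinity>"
    using C(2)[of 0] by (auto simp: ennreal_mult_less_top intro: order_le_less_trans)
  then have fin: "emeasure (radial_measure \<omega>) {0..<1} < \<infinity>"
    using measure_tail_radial_measure[OF \<omega>, of 0] by (simp add: measure_tail_def)
  have "space (radial_measure \<omega>) = {0..<1}" unfolding radial_measure_def by (simp add: space_restrict_space)
  then have "finite_measure (radial_measure \<omega>)" using fin by (intro finite_measureI) auto
  then have M: "radial_measure \<omega> \<in> M_plus" unfolding M_plus_def using sets_radial_measure[OF \<omega>] by simp
  interpret finite_measure "radial_measure \<omega>" by fact
  have eq: "ennreal (dyadic_tail (radial_measure \<omega>) k) = weight_tail \<omega> (1 - (1/2) ^ k)" for k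
    using measure_tail_radial_measure[OF \<omega> half_power_le_1(2)[of k]]
    unfolding measure_tail_def dyadic_tail_def by (simp add: emeasure_eq_measure)
  have "dyadic_tail (radial_measure \<omega>) k \<le> C * dyadic_tail (radial_measure \<omega>) (Suc k)" for k
  proof -
    have half: "(1 + (1 - (1/2::real) ^ k)) / 2 = 1 - (1/2) ^ Suc k" by (simp add: field_simps)
    have "weight_tail \<omega> (1 - (1/2) ^ k) \<le> ennreal C * weight_tail \<omega> ((1 + (1 - (1/2) ^ k)) / 2)"
      by (rule C(2)) (simp_all add: half_power_le_1)
    then have "ennreal (dyadic_tail (radial_measure \<omega>) k) \<le> ennreal C * ennreal (dyadic_tail (radial_measure \<omega>) (Suc k))"
      unfolding eq half .
    then show ?thesis using C(1) by (simp add: dyadic_tail_nonneg flip: ennreal_mult)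
  qed
  moreover have "0 < dyadic_tail (radial_measure \<omega>) 0"
  proof (rule ccontr)
    assume "\<not> ?thesis"
    then have "dyadic_tail (radial_measure \<omega>) 0 = 0" using dyadic_tail_nonneg[of "radial_measure \<omega>" 0] by linarith
    then have "weight_tail \<omega> 0 = 0" using eq[of 0] by simp
    then show False using radial_weight_AE_zero[OF \<omega>] nz by blast
  qed
  ultimately show ?thesis using M that[of C] unfolding doubling_measure_def by blast
qed

subsection \<open>Moments of a doubling measure\<close>

lemma power_div_fact_le_exp:
  fixes y :: real
  assumes "0 \<le> y" shows "y ^ n / fact n \<le> exp y"
proof -
  have "(\<Sum>i\<in>{n}. inverse (fact i) * y ^ i) \<le> (\<Sum>i. inverse (fact i) * y ^ i)"
    using assms summable_exp[of y] by (intro sum_le_suminf) auto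
  then show ?thesis by (simp add: exp_def field_simps scaleR_conv_of_real)
qed

text \<open>The doubling constant D may be large, so geometric growth of any ratio has to be
  absorbed. The N-th term of the exponential series, with N chosen such that
  \<open>2 * D \<le> 2 ^ N\<close>, already gives decay \<open>(2 ^ N) ^ m\<close>.\<close>

lemma summable_geometric_exp_two_power:
  fixes D :: real
  assumes "0 < D"
  shows "summable (\<lambda>m. 2 * exp (- (2 ^ m / 2)) * D ^ m)"
proof -
  obtain N :: nat where "2 * D < 2 ^ N" using real_arch_pow[of 2 "2 * D"] by auto
  then have N: "2 * D \<le> 2 ^ N" by simp
  have "norm (2 * exp (- (2 ^ m / 2)) * D ^ m) \<le> (2 * fact N * 2 ^ N) * (1/2) ^ m" for m
  proof -
    have "(2 ^ m / 2) ^ N / fact N \<le> exp (2 ^ m / 2 :: real)" by (rule power_div_fact_le_exp) simp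
    then have "exp (- (2 ^ m / 2 :: real)) \<le> fact N * 2 ^ N / (2 ^ N) ^ m"
      by (simp add: exp_minus field_simps power_divide power_commutes flip: power_mult)
    then have "2 * exp (- (2 ^ m / 2)) * D ^ m \<le> 2 * (fact N * 2 ^ N / (2 ^ N) ^ m) * D ^ m"
      using assms by (intro mult_right_mono mult_left_mono) auto
    also have "\<dots> = 2 * fact N * 2 ^ N * (D / 2 ^ N) ^ m" by (simp add: power_divide)
    also have "\<dots> \<le> 2 * fact N * 2 ^ N * (1/2) ^ m"
      using N assms by (intro mult_left_mono power_mono) (auto simp: field_simps)
    finally show ?thesis using assms by simp
  qed
  then show ?thesis by (intro summable_comparison_test[OF _ summable_mult[OF summable_geometric]]) auto
qed

lemma ex_dyadic_index: obtains k where "2 ^ k \<le> Suc n" "Suc n < 2 ^ Suc k"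
  using ex_power_ivl1[of 2 "Suc n"] by auto

context doubling_measure
begin

abbreviation W where "W k \<equiv> dyadic_tail \<nu> k"
abbreviation e where "e n \<equiv> measure_moment \<nu> (2 * n + 1)"
definition b where "b n = 1 / (2 * e n)"

lemma W_pos: "0 < W k"
proof (induction k)
  case (Suc k)
  have "0 \<noteq> W (Suc k)" using tail_doubling[of k] Suc by auto
  then show ?case using dyadic_tail_nonneg[of \<nu> "Suc k"] by linarith
qed (rule tail_0_pos)

lemma D_ge_1: "1 \<le> D"
proof -
  have "W 1 \<le> D * W 1" using tail_doubling[of 0] dyadic_tail_Suc_le[OF M_plus, of 0] by simp
  then show ?thesis using W_pos[of 1] by simp
qed

lemma W_le_shift: "W k \<le> D ^ j * W (k + j)"
proof (induction j)
  case (Suc j)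
  have "D ^ j * W (k + j) \<le> D ^ j * (D * W (Suc (k + j)))"
    using tail_doubling D_ge_1 by (intro mult_left_mono) auto
  then show ?case using Suc by (simp add: mult_ac)
qed simp

text \<open>Going from level k back to level i multiplies the tail by at most
  \<open>D ^ (k - i)\<close>, while the moment gives level i the doubly exponentially small weight
  \<open>exp (- 2 ^ (k - i) / 2)\<close>. The series of the products is the constant.\<close>

lemma moment_le_W:
  obtains A where "0 < A" "\<And>k n. 2 ^ k \<le> Suc n \<Longrightarrow> measure_moment \<nu> n \<le> A * W k"
proof -
  define A where "A = (\<Sum>m. 2 * exp (- (2 ^ m / 2)) * D ^ m)"
  have D: "0 < D" using D_ge_1 by simp
  note s = summable_geometric_exp_two_power[OF D]
  have "measure_moment \<nu> n \<le> A * W k" if k: "2 ^ k \<le> Suc n" for k n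
  proof -
    have "measure_moment \<nu> n \<le> (\<Sum>i\<le>k. 2 * exp (- (2 ^ (k - i) / 2)) * W i)"
      by (rule measure_moment_upper[OF M_plus k])
    also have "\<dots> \<le> (\<Sum>i\<le>k. 2 * exp (- (2 ^ (k - i) / 2)) * D ^ (k - i) * W k)"
    proof (rule sum_mono)
      fix i assume "i \<in> {..k}"
      then have "W i \<le> D ^ (k - i) * W k" using W_le_shift[of i "k - i"] by simp
      then have "2 * exp (- (2 ^ (k - i) / 2)) * W i \<le> 2 * exp (- (2 ^ (k - i) / 2)) * (D ^ (k - i) * W k)"
        by (rule mult_left_mono) simp
      then show "2 * exp (- (2 ^ (k - i) / 2)) * W i \<le> 2 * exp (- (2 ^ (k - i) / 2)) * D ^ (k - i) * W k"
        by (simp add: mult.assoc)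
    qed
    also have "\<dots> = (\<Sum>m\<le>k. 2 * exp (- (2 ^ m / 2)) * D ^ m) * W k"
      unfolding sum_distrib_right[symmetric]
      by (subst sum.nat_diff_reindex[of "\<lambda>m. 2 * exp (- (2 ^ m / 2)) * D ^ m" "Suc k", symmetric, unfolded lessThan_Suc_atMost]) simp
    also have "\<dots> \<le> A * W k"
      unfolding A_def using W_pos[of k] D
      by (intro mult_right_mono sum_le_suminf s) (auto intro: order.strict_implies_order)
    finally show ?thesis .
  qed
  moreover have "0 < A"
    unfolding A_def using D by (intro suminf_pos s) auto
  ultimately show ?thesis using that by blast
qed

lemma W_le_moment:
  assumes "Suc n \<le> 2 ^ (k + j)"
  shows "W k \<le> 3 * D ^ j * measure_moment \<nu> n"
proof -
  have "D ^ j * W (k + j) \<le> D ^ j * (3 * measure_moment \<nu> n)"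
    using measure_moment_lower[OF M_plus assms] D_ge_1 by (intro mult_left_mono) auto
  then show ?thesis using W_le_shift[of k j] by simp
qed

lemma moment_pos: "0 < measure_moment \<nu> n"
proof -
  have "Suc n \<le> 2 ^ (0 + n)" by (simp add: Suc_leI)
  from W_le_moment[OF this] have "0 < 3 * D ^ n * measure_moment \<nu> n" using W_pos[of 0] by linarith
  then show ?thesis using D_ge_1 by (simp add: zero_less_mult_iff)
qed

lemma b_pos: "0 < b n"
  unfolding b_def using moment_pos by simp

lemma b_mono: "m \<le> n \<Longrightarrow> b m \<le> b n"
  unfolding b_def using moment_pos measure_moment_antimono[OF M_plus, of "2 * m + 1" "2 * n + 1"]
  by (intro divide_left_mono mult_left_mono mult_pos_pos) auto

text \<open>Moments decrease, so only this direction needs doubling: passing to an index larger by a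
  factor of at most \<open>2 ^ j\<close> lowers the moment by a bounded factor.\<close>

lemma moment_window:
  obtains A where "0 < A" "\<And>n m. Suc m \<le> 2 ^ j * Suc n \<Longrightarrow> measure_moment \<nu> n \<le> A * measure_moment \<nu> m"
proof -
  obtain A where A: "0 < A" "\<And>k n. 2 ^ k \<le> Suc n \<Longrightarrow> measure_moment \<nu> n \<le> A * W k"
    using moment_le_W by blast
  have "measure_moment \<nu> n \<le> A * (3 * D ^ Suc j) * measure_moment \<nu> m" if m: "Suc m \<le> 2 ^ j * Suc n" for n m
  proof -
    obtain k where k: "2 ^ k \<le> Suc n" "Suc n < 2 ^ Suc k" using ex_dyadic_index by blast
    have "2 ^ j * Suc n \<le> 2 ^ j * 2 ^ Suc k" using k(2) by (intro mult_left_mono) auto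
    then have "Suc m \<le> 2 ^ (k + Suc j)" using m by (simp add: power_add mult_ac)
    then have "W k \<le> 3 * D ^ Suc j * measure_moment \<nu> m" by (rule W_le_moment)
    then have "A * W k \<le> A * (3 * D ^ Suc j * measure_moment \<nu> m)" using A by simp
    then show ?thesis using A(2)[OF k(1)] by (simp add: mult.assoc)
  qed
  moreover have "0 < A * (3 * D ^ Suc j)" using A D_ge_1 by simp
  ultimately show ?thesis using that by blast
qed

text \<open>Here \<open>b n \<approx> 1 / W l\<close> when \<open>n \<approx> 2\<^sup>l\<close>, and \<open>W k \<le> D\<^sup>l\<^sup>-\<^sup>k W l\<close> is turned into a power of \<open>n / 2\<^sup>k\<close>.\<close>

lemma b_growth:
  obtains A \<eta> where "0 < A" "\<And>k n. 2 ^ k \<le> Suc n \<Longrightarrow> b n \<le> A * (real (Suc n) / 2 ^ k) ^ \<eta> / W k"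
proof -
  obtain \<eta> :: nat where "D < 2 ^ \<eta>" using real_arch_pow[of 2 D] by auto
  then have \<eta>: "D \<le> 2 ^ \<eta>" by simp
  have "b n \<le> (2 * D ^ 2) * (real (Suc n) / 2 ^ k) ^ \<eta> / W k" if k: "2 ^ k \<le> Suc n" for k n
  proof -
    obtain l where l: "2 ^ l \<le> Suc n" "Suc n < 2 ^ Suc l" using ex_dyadic_index by blast
    have "(2::nat) ^ k < 2 ^ Suc l" using k l by linarith
    then have "k < Suc l" by (rule power_less_imp_less_exp[rotated]) simp
    then have kl: "k \<le> l" by simp
    then obtain i where i: "l = k + i" using le_Suc_ex by blast
    have "W k \<le> D ^ i * W l" using W_le_shift[of k i] i by simp
    also have "W l \<le> 3 * D ^ 2 * e n" using l(2) by (intro W_le_moment) simp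
    finally have "W k \<le> D ^ i * (3 * D ^ 2 * e n)" using D_ge_1 by simp
    also have "D ^ i * (3 * D ^ 2 * e n) \<le> (real (Suc n) / 2 ^ k) ^ \<eta> * (3 * D ^ 2 * e n)"
    proof (rule mult_right_mono)
      have "real (2 ^ l) \<le> real (Suc n)" using l(1) by (rule of_nat_mono)
      then have "(2::real) ^ i \<le> real (Suc n) / 2 ^ k" by (simp add: i power_add field_simps)
      then have "(2 ^ i) ^ \<eta> \<le> (real (Suc n) / 2 ^ k) ^ \<eta>" by (intro power_mono) auto
      moreover have "D ^ i \<le> (2 ^ i) ^ \<eta>"
        using power_mono[OF \<eta>, of i] D_ge_1 by (simp add: mult.commute flip: power_mult)
      ultimately show "D ^ i \<le> (real (Suc n) / 2 ^ k) ^ \<eta>" by linarith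
    qed (use moment_pos[of "2 * n + 1"] in simp)
    also have "\<dots> \<le> (real (Suc n) / 2 ^ k) ^ \<eta> * (4 * D ^ 2 * e n)"
      using moment_pos[of "2 * n + 1"] D_ge_1 by (intro mult_left_mono mult_right_mono) auto
    finally show ?thesis unfolding b_def using W_pos[of k] moment_pos[of "2 * n + 1"] by (simp add: field_simps)
  qed
  moreover have "0 < 2 * D ^ 2" using D_ge_1 by simp
  ultimately show ?thesis using that by blast
qed

end

subsection \<open>Iterated differences\<close>

definition fdiff :: "(nat \<Rightarrow> real) \<Rightarrow> nat \<Rightarrow> real" where
  "fdiff f n = f (Suc n) - f n"

lemma fdiff_funpow_Suc: "(fdiff ^^ Suc j) f n = (fdiff ^^ j) f (Suc n) - (fdiff ^^ j) f n"
  by (simp add: fdiff_def)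

text \<open>Leibniz rule for differences. The shift by i in the second factor stems from the rule
  for one difference, where \<open>f n * fdiff g n\<close> and \<open>fdiff f n * g (n + 1)\<close>
  occur.\<close>

lemma fdiff_mult:
  "(fdiff ^^ j) (\<lambda>n. f n * g n) n = (\<Sum>i\<le>j. real (j choose i) * (fdiff ^^ i) f n * (fdiff ^^ (j - i)) g (n + i))"
proof (induction j arbitrary: n)
  case (Suc j)
  let ?f = "\<lambda>i. (fdiff ^^ i) f" and ?g = "\<lambda>i. (fdiff ^^ i) g"
  have "(fdiff ^^ Suc j) (\<lambda>n. f n * g n) n
      = (\<Sum>i\<le>j. real (j choose i) * (?f i (Suc n) * ?g (j - i) (Suc n + i) - ?f i n * ?g (j - i) (n + i)))"
    unfolding fdiff_funpow_Suc Suc.IH by (simp add: sum_subtractf algebra_simps)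
  also have "\<dots> = (\<Sum>i\<le>j. real (j choose i) * (?f (Suc i) n * ?g (j - i) (n + Suc i)))
      + (\<Sum>i\<le>j. real (j choose i) * (?f i n * ?g (Suc j - i) (n + i)))"
    unfolding sum.distrib[symmetric]
  proof (rule sum.cong[OF refl])
    fix i assume "i \<in> {..j}"
    then have eq: "?g (Suc j - i) (n + i) = ?g (j - i) (Suc (n + i)) - ?g (j - i) (n + i)"
      by (simp only: Suc_diff_le atMost_iff fdiff_funpow_Suc)
    show "real (j choose i) * (?f i (Suc n) * ?g (j - i) (Suc n + i) - ?f i n * ?g (j - i) (n + i))
      = real (j choose i) * (?f (Suc i) n * ?g (j - i) (n + Suc i)) + real (j choose i) * (?f i n * ?g (Suc j - i) (n + i))"
      unfolding fdiff_funpow_Suc eq by (simp add: algebra_simps)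
  qed
  also have "(\<Sum>i\<le>j. real (j choose i) * (?f i n * ?g (Suc j - i) (n + i)))
      = ?f 0 n * ?g (Suc j) n + (\<Sum>i\<le>j. real (j choose Suc i) * (?f (Suc i) n * ?g (j - i) (n + Suc i)))"
  proof -
    have "(\<Sum>i\<le>j. real (j choose i) * (?f i n * ?g (Suc j - i) (n + i)))
      = (\<Sum>i\<le>Suc j. real (j choose i) * (?f i n * ?g (Suc j - i) (n + i)))" by simp
    also have "\<dots> = ?f 0 n * ?g (Suc j) n + (\<Sum>i\<le>j. real (j choose Suc i) * (?f (Suc i) n * ?g (j - i) (n + Suc i)))"
      by (subst sum.atMost_Suc_shift) simp
    finally show ?thesis .
  qed
  also have "(\<Sum>i\<le>j. real (j choose i) * (?f (Suc i) n * ?g (j - i) (n + Suc i)))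
      + (?f 0 n * ?g (Suc j) n + (\<Sum>i\<le>j. real (j choose Suc i) * (?f (Suc i) n * ?g (j - i) (n + Suc i))))
      = ?f 0 n * ?g (Suc j) n + (\<Sum>i\<le>j. real (Suc j choose Suc i) * (?f (Suc i) n * ?g (j - i) (n + Suc i)))"
    by (simp add: sum.distrib algebra_simps)
  also have "\<dots> = (\<Sum>i\<le>Suc j. real (Suc j choose i) * ?f i n * ?g (Suc j - i) (n + i))"
    by (simp only: sum.atMost_Suc_shift) (simp add: mult.assoc)
  finally show ?case .
qed simp

lemma fdiff_const: "(fdiff ^^ Suc j) (\<lambda>_. c) n = 0"
  by (induction j arbitrary: n) (simp_all add: fdiff_def)

context doubling_measure
begin

text \<open>The sequence e uses odd indices only, so one step multiplies the integrand by
  \<open>t\<^sup>2\<close> and one difference by \<open>t\<^sup>2 - 1\<close>.\<close>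

lemma fdiff_moment: "(fdiff ^^ j) e n = (LINT t|\<nu>. t ^ (2 * n + 1) * (t\<^sup>2 - 1) ^ j)"
proof (induction j arbitrary: n)
  case (Suc j)
  have int: "integrable \<nu> (\<lambda>t. t ^ m * (t\<^sup>2 - 1) ^ j)" for m
  proof (rule integrable_M_plus[OF M_plus, where c=1])
    fix t :: real assume t: "0 \<le> t" "t < 1"
    have "t\<^sup>2 \<le> 1" using t by (simp add: power_le_one)
    then have "\<bar>t\<^sup>2 - 1\<bar> \<le> 1" using zero_le_power2[of t] by linarith
    then show "norm (t ^ m * (t\<^sup>2 - 1) ^ j) \<le> 1"
      using t by (auto simp: abs_mult power_abs intro!: mult_le_one power_le_one)
  qed simp
  have "(fdiff ^^ Suc j) e n = (LINT t|\<nu>. t ^ (2 * Suc n + 1) * (t\<^sup>2 - 1) ^ j - t ^ (2 * n + 1) * (t\<^sup>2 - 1) ^ j)"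
    unfolding fdiff_funpow_Suc Suc.IH by (intro Bochner_Integration.integral_diff[symmetric] int)
  also have "\<dots> = (LINT t|\<nu>. t ^ (2 * n + 1) * (t\<^sup>2 - 1) ^ Suc j)"
    by (intro Bochner_Integration.integral_cong) (simp_all add: algebra_simps power2_eq_square)
  finally show ?case .
qed (simp add: measure_moment_def)

lemma power_times_one_minus_power_le:
  fixes t :: real
  assumes "0 \<le> t" "t < 1"
  shows "t ^ Suc n * (1 - t\<^sup>2) ^ j \<le> 2 ^ j * fact j / real (Suc n) ^ j"
proof -
  define y where "y = 1 - t"
  have y: "0 \<le> y" unfolding y_def using assms by simp
  have "t ^ Suc n \<le> exp (- y) ^ Suc n"
    using exp_ge_add_one_self[of "- y"] assms unfolding y_def by (intro power_mono) auto
  also have "\<dots> = exp (- (real (Suc n) * y))" by (subst exp_of_nat_mult[symmetric]) simp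
  finally have 1: "t ^ Suc n \<le> exp (- (real (Suc n) * y))" .
  have "1 - t\<^sup>2 = (1 + t) * y" unfolding y_def by (simp add: power2_eq_square algebra_simps)
  also have "\<dots> \<le> 2 * y" using assms y by (intro mult_right_mono) auto
  finally have "(1 - t\<^sup>2) ^ j \<le> (2 * y) ^ j" using assms by (intro power_mono) (auto simp: power_le_one)
  with 1 have "t ^ Suc n * (1 - t\<^sup>2) ^ j \<le> exp (- (real (Suc n) * y)) * (2 * y) ^ j"
    using assms by (intro mult_mono) (auto simp: power_le_one)
  also have "\<dots> \<le> 2 ^ j * fact j / real (Suc n) ^ j"
    using power_div_fact_le_exp[of "real (Suc n) * y" j] y
    by (simp add: exp_minus power_mult_distrib field_simps del: of_nat_Suc)
  finally show ?thesis .
qed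

text \<open>The power is split as \<open>t ^ (2 * n + 1) = t ^ n * t ^ Suc n\<close>. The second
  factor pays for \<open>(1 - t\<^sup>2) ^ j\<close> and yields the gain
  \<open>1 / real (Suc n) ^ j\<close>. The first factor leaves the moment of order n, which by
  doubling is comparable to the one of order 2n + 1.\<close>

lemma fdiff_moment_bound:
  obtains C where "0 < C" "\<And>n. \<bar>(fdiff ^^ j) e n\<bar> \<le> C * e n / real (Suc n) ^ j"
proof -
  obtain A where A: "0 < A" "\<And>n m. Suc m \<le> 2 ^ 1 * Suc n \<Longrightarrow> measure_moment \<nu> n \<le> A * measure_moment \<nu> m"
    using moment_window by blast
  have "\<bar>(fdiff ^^ j) e n\<bar> \<le> (2 ^ j * fact j * A) * e n / real (Suc n) ^ j" for n
  proof -
    have "\<bar>(fdiff ^^ j) e n\<bar> \<le> (LINT t|\<nu>. \<bar>t ^ (2 * n + 1) * (t\<^sup>2 - 1) ^ j\<bar>)"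
      unfolding fdiff_moment by (rule integral_abs_bound)
    also have "\<dots> \<le> (LINT t|\<nu>. 2 ^ j * fact j / real (Suc n) ^ j * t ^ n)"
    proof (rule integral_mono')
      show "integrable \<nu> (\<lambda>t. 2 ^ j * fact j / real (Suc n) ^ j * t ^ n)"
        using integrable_power_M_plus[OF M_plus] by (intro integrable_mult_right) auto
      fix t assume "t \<in> space \<nu>"
      then have t: "0 \<le> t" "t < 1" using space_M_plus[OF M_plus] by auto
      have "t\<^sup>2 \<le> 1" using t by (simp add: power_le_one)
      then have "\<bar>t\<^sup>2 - 1\<bar> = 1 - t\<^sup>2" by simp
      then have "\<bar>t ^ (2 * n + 1) * (t\<^sup>2 - 1) ^ j\<bar> = t ^ n * (t ^ Suc n * (1 - t\<^sup>2) ^ j)"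
        using t by (simp add: abs_mult power_abs mult_2 power_add)
      also have "\<dots> \<le> t ^ n * (2 ^ j * fact j / real (Suc n) ^ j)"
        using t by (intro mult_left_mono power_times_one_minus_power_le) auto
      finally show "\<bar>t ^ (2 * n + 1) * (t\<^sup>2 - 1) ^ j\<bar> \<le> 2 ^ j * fact j / real (Suc n) ^ j * t ^ n"
        by (simp add: mult.commute)
      show "0 \<le> 2 ^ j * fact j / real (Suc n) ^ j * t ^ n" using t by simp
    qed
    also have "\<dots> = 2 ^ j * fact j / real (Suc n) ^ j * measure_moment \<nu> n"
      unfolding measure_moment_def by simp
    also have "\<dots> \<le> 2 ^ j * fact j / real (Suc n) ^ j * (A * e n)"
      by (intro mult_left_mono A) auto
    finally show ?thesis by (simp add: mult_ac)
  qed
  moreover have "0 < 2 ^ j * fact j * A" using A by simp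
  ultimately show ?thesis using that by blast
qed

text \<open>The product of b and e is the constant 1/2, so its j-th difference vanishes for j > 0.
  The Leibniz rule then expresses the j-th difference of b at n, times \<open>e (n + j)\<close>, by
  lower differences of b and differences of e, for which the gain is already known.\<close>

lemma fdiff_b_bound:
  obtains C where "0 < C" "\<And>n. \<bar>(fdiff ^^ j) b n\<bar> \<le> C * b n / real (Suc n) ^ j"
proof -
  have "\<exists>C>0. \<forall>n. \<bar>(fdiff ^^ j) b n\<bar> \<le> C * b n / real (Suc n) ^ j"
  proof (induction j rule: less_induct)
    case (less j)
    show ?case
    proof (cases j)
      case 0
      then show ?thesis using b_pos by (intro exI[of _ 1]) (auto simp: order.strict_implies_order)
    next
      case (Suc j')
      obtain A where A: "0 < A" "\<And>n m. Suc m \<le> 2 ^ Suc j * Suc n \<Longrightarrow> measure_moment \<nu> n \<le> A * measure_moment \<nu> m"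
        using moment_window by blast
      obtain C where C: "\<And>i. i < j \<Longrightarrow> 0 < C i" "\<And>i n. i < j \<Longrightarrow> \<bar>(fdiff ^^ i) b n\<bar> \<le> C i * b n / real (Suc n) ^ i"
        using less by metis
      have "\<exists>C. 0 < C \<and> (\<forall>n. \<bar>(fdiff ^^ i) e n\<bar> \<le> C * e n / real (Suc n) ^ i)" for i
        using fdiff_moment_bound[of i] by blast
      then obtain E where E': "\<And>i. 0 < E i \<and> (\<forall>n. \<bar>(fdiff ^^ i) e n\<bar> \<le> E i * e n / real (Suc n) ^ i)"
        by metis
      then have E: "\<And>i. 0 < E i" "\<And>i n. \<bar>(fdiff ^^ i) e n\<bar> \<le> E i * e n / real (Suc n) ^ i" by blast+
      define S where "S = (\<Sum>i<j. real (j choose i) * C i * E (j - i))"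
      have S0: "0 < S" unfolding S_def using C(1) E(1) Suc by (intro sum_pos) auto
      have "\<bar>(fdiff ^^ j) b n\<bar> \<le> (A * S) * b n / real (Suc n) ^ j" for n
      proof -
        have be: "(\<lambda>n. b n * e n) = (\<lambda>_. 1/2)"
          unfolding b_def using moment_pos by (auto simp: fun_eq_iff less_imp_neq[symmetric])
        have "0 = (fdiff ^^ j) (\<lambda>n. b n * e n) n" unfolding be Suc fdiff_const ..
        also have "\<dots> = (\<Sum>i\<le>j. real (j choose i) * (fdiff ^^ i) b n * (fdiff ^^ (j - i)) e (n + i))"
          by (rule fdiff_mult)
        also have "{..j} = insert j {..<j}" by auto
        finally have eq: "(fdiff ^^ j) b n * e (n + j) = - (\<Sum>i<j. real (j choose i) * (fdiff ^^ i) b n * (fdiff ^^ (j - i)) e (n + i))"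
          by simp
        have "\<bar>(fdiff ^^ j) b n\<bar> * e (n + j) = \<bar>(fdiff ^^ j) b n * e (n + j)\<bar>"
          using moment_pos[of "2 * (n + j) + 1"] by (simp add: abs_mult)
        also have "\<dots> = \<bar>\<Sum>i<j. real (j choose i) * (fdiff ^^ i) b n * (fdiff ^^ (j - i)) e (n + i)\<bar>"
          unfolding eq by (rule abs_minus_cancel)
        also have "\<dots> \<le> (\<Sum>i<j. real (j choose i) * \<bar>(fdiff ^^ i) b n\<bar> * \<bar>(fdiff ^^ (j - i)) e (n + i)\<bar>)"
          by (rule order_trans[OF sum_abs]) (simp add: abs_mult)
        also have "\<dots> \<le> (\<Sum>i<j. real (j choose i) * C i * E (j - i) * (b n * e n / real (Suc n) ^ j))"
        proof (rule sum_mono)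
          fix i assume "i \<in> {..<j}"
          then have i: "i < j" by simp
          have "\<bar>(fdiff ^^ (j - i)) e (n + i)\<bar> \<le> E (j - i) * e (n + i) / real (Suc (n + i)) ^ (j - i)" by (rule E)
          also have "\<dots> \<le> E (j - i) * e n / real (Suc n) ^ (j - i)"
            using E(1)[of "j - i"] moment_pos measure_moment_antimono[OF M_plus, of "2 * n + 1" "2 * (n + i) + 1"]
            by (intro frac_le mult_left_mono mult_nonneg_nonneg power_mono) (auto simp: order.strict_implies_order)
          finally have "\<bar>(fdiff ^^ i) b n\<bar> * \<bar>(fdiff ^^ (j - i)) e (n + i)\<bar>
              \<le> (C i * b n / real (Suc n) ^ i) * (E (j - i) * e n / real (Suc n) ^ (j - i))"
            using C[OF i] b_pos[of n] by (intro mult_mono) (auto simp: order.strict_implies_order)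
          also have "\<dots> = C i * E (j - i) * (b n * e n / (real (Suc n) ^ i * real (Suc n) ^ (j - i)))"
            by simp
          also have "real (Suc n) ^ i * real (Suc n) ^ (j - i) = real (Suc n) ^ j"
            using i by (subst power_add[symmetric]) simp
          finally have "real (j choose i) * (\<bar>(fdiff ^^ i) b n\<bar> * \<bar>(fdiff ^^ (j - i)) e (n + i)\<bar>)
            \<le> real (j choose i) * (C i * E (j - i) * (b n * e n / real (Suc n) ^ j))"
            by (rule mult_left_mono) simp
          then show "real (j choose i) * \<bar>(fdiff ^^ i) b n\<bar> * \<bar>(fdiff ^^ (j - i)) e (n + i)\<bar>
            \<le> real (j choose i) * C i * E (j - i) * (b n * e n / real (Suc n) ^ j)"
            by (simp only: mult.assoc)
        qed
        also have "\<dots> = S * (b n * e n / real (Suc n) ^ j)" unfolding S_def sum_distrib_right ..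
        \<comment> \<open>The top term of the Leibniz rule carries the shifted moment
          \<open>e (n + j)\<close>. It is reached from \<open>e n\<close> with a constant that
          depends on j only, because the index grows at most by a factor of order j + 1.\<close>
        also have "\<dots> \<le> S * (b n * (A * e (n + j)) / real (Suc n) ^ j)"
        proof -
          have "Suc j \<le> 2 ^ j" by (simp add: Suc_leI)
          have "Suc (2 * (n + j) + 1) \<le> 2 * Suc j * Suc n" by simp
          also have "\<dots> \<le> 2 * 2 ^ j * Suc n" using \<open>Suc j \<le> 2 ^ j\<close> by (intro mult_le_mono) auto
          also have "\<dots> \<le> 2 ^ Suc j * Suc (2 * n + 1)" by simp
          finally have "e n \<le> A * e (n + j)" by (rule A)
          then show ?thesis using S0 b_pos[of n] by (intro mult_left_mono divide_right_mono) auto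
        qed
        also have "\<dots> = (A * S) * b n / real (Suc n) ^ j * e (n + j)" by simp
        finally show ?thesis using moment_pos[of "2 * (n + j) + 1"] by (simp only: mult_le_cancel_right_pos)
      qed
      then show ?thesis using A(1) S0 by (intro exI[of _ "A * S"]) auto
    qed
  qed
  then show ?thesis using that by blast
qed

end

subsection \<open>The kernel\<close>

lemma summable_Suc_power_geometric:
  fixes x :: real
  assumes "\<bar>x\<bar> < 1"
  shows "summable (\<lambda>n. real (Suc n) ^ \<eta> * x ^ n)"
  using assms
proof (induction \<eta> arbitrary: x)
  case 0
  then show ?case by (simp add: summable_geometric)
next
  case (Suc \<eta>)
  have "summable (\<lambda>n. real n ^ \<eta> * y ^ n)" if "norm y < 1" for y :: real
  proof -
    have "summable (\<lambda>n. y * (real (Suc n) ^ \<eta> * y ^ n))" using that by (intro summable_mult Suc.IH) auto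
    then have "summable (\<lambda>n. real (Suc n) ^ \<eta> * y ^ Suc n)" by (simp add: mult_ac)
    then show ?thesis by (subst (asm) summable_Suc_iff)
  qed
  then have "summable (\<lambda>n. diffs (\<lambda>n. real n ^ \<eta>) n * x ^ n)"
    using Suc.prems by (intro termdiff_converges[of _ 1]) auto
  then show ?case by (simp add: diffs_def)
qed

lemma inverse_squares_tail_le:
  assumes "0 < N"
  shows "summable (\<lambda>n. 1 / real (Suc (n + N)) ^ 2)" "(\<Sum>n. 1 / real (Suc (n + N)) ^ 2) \<le> 1 / real N"
proof -
  have "(\<lambda>n. 1 / real (n + N)) \<longlonglongrightarrow> 0"
    using LIMSEQ_ignore_initial_segment[OF lim_inverse_n', of N] by simp
  from telescope_sums'[OF this] have s: "(\<lambda>n. 1 / real (n + N) - 1 / real (Suc (n + N))) sums (1 / real N)" by simp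
  have le: "1 / real (Suc (n + N)) ^ 2 \<le> 1 / real (n + N) - 1 / real (Suc (n + N))" for n
  proof -
    have "1 / real (n + N) - 1 / real (Suc (n + N)) = 1 / (real (n + N) * real (Suc (n + N)))"
      using assms by (simp add: field_simps)
    also have "\<dots> \<ge> 1 / (real (Suc (n + N)) * real (Suc (n + N)))"
      using assms by (intro divide_left_mono mult_right_mono mult_pos_pos) auto
    finally show ?thesis by (simp add: power2_eq_square)
  qed
  show "summable (\<lambda>n. 1 / real (Suc (n + N)) ^ 2)"
    by (rule summable_comparison_test[OF _ sums_summable[OF s]]) (use le in auto)
  then show "(\<Sum>n. 1 / real (Suc (n + N)) ^ 2) \<le> 1 / real N"
    using suminf_le[OF le _ sums_summable[OF s]] s by (simp add: sums_iff)
qed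

context doubling_measure
begin

text \<open>The kernel \<open>B_kernel\<close> depends on t and z only through their product. This
  is the same series as a function of that product, and \<open>kernr\<close> is its restriction to
  [0,1).\<close>

definition kern :: "complex \<Rightarrow> complex" where
  "kern z = (\<Sum>n. of_real (b n) * z ^ n)"

definition kernr :: "real \<Rightarrow> real" where
  "kernr x = (\<Sum>n. b n * x ^ n)"

lemma summable_b:
  fixes x :: real
  assumes "0 \<le> x" "x < 1"
  shows "summable (\<lambda>n. b n * x ^ n)"
proof -
  obtain A \<eta> where A: "0 < A" "\<And>k n. 2 ^ k \<le> Suc n \<Longrightarrow> b n \<le> A * (real (Suc n) / 2 ^ k) ^ \<eta> / W k"
    using b_growth by blast
  have bnd: "norm (b n * x ^ n) \<le> A / W 0 * (real (Suc n) ^ \<eta> * x ^ n)" for n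
  proof -
    have "b n * x ^ n \<le> (A * real (Suc n) ^ \<eta> / W 0) * x ^ n"
      using A(2)[of 0 n] assms by (intro mult_right_mono) auto
    then show ?thesis using assms b_pos[of n] by simp
  qed
  have "summable (\<lambda>n. A / W 0 * (real (Suc n) ^ \<eta> * x ^ n))"
    using assms by (intro summable_mult summable_Suc_power_geometric) auto
  then show ?thesis by (rule summable_comparison_test') (rule bnd)
qed

lemma summable_fdiff_b:
  fixes z :: complex
  assumes "norm z < 1"
  shows "summable (\<lambda>n. of_real ((fdiff ^^ j) b (n + N)) * z ^ (n + N))"
proof -
  obtain C where C: "0 < C" "\<And>n. \<bar>(fdiff ^^ j) b n\<bar> \<le> C * b n / real (Suc n) ^ j"
    using fdiff_b_bound by blast
  have bnd: "norm (of_real ((fdiff ^^ j) b n) * z ^ n) \<le> C * (b n * norm z ^ n)" for n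
  proof -
    have "C * b n / real (Suc n) ^ j \<le> C * b n / 1"
      using C(1) b_pos[of n] by (intro divide_left_mono) auto
    then have "\<bar>(fdiff ^^ j) b n\<bar> * norm z ^ n \<le> C * b n * norm z ^ n"
      using C(2)[of n] by (intro mult_right_mono) auto
    then show ?thesis by (simp add: norm_mult norm_power mult.assoc)
  qed
  have "summable (\<lambda>n. C * (b n * norm z ^ n))"
    using assms by (intro summable_mult summable_b) auto
  then have "summable (\<lambda>n. of_real ((fdiff ^^ j) b n) * z ^ n)"
    by (rule summable_comparison_test') (rule bnd)
  then show ?thesis by (rule summable_ignore_initial_segment)
qed

lemma kern_of_real: "0 \<le> x \<Longrightarrow> x < 1 \<Longrightarrow> kern (of_real x) = of_real (kernr x)"
  unfolding kern_def kernr_def using suminf_of_real[OF summable_b[of x], where 'a=complex] by simp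

lemma kernr_mono:
  assumes "0 \<le> x" "x \<le> y" "y < 1"
  shows "kernr x \<le> kernr y"
  unfolding kernr_def using assms b_pos
  by (intro suminf_le summable_b mult_left_mono power_mono) (auto intro: order.strict_implies_order)

text \<open>Only the tail from N = 2^k on is summed by parts. The first 2^k terms need no
  cancellation, and from N on the gain of one difference is at least the factor 2^-k.\<close>

definition ktail :: "nat \<Rightarrow> nat \<Rightarrow> complex \<Rightarrow> complex" where
  "ktail j N z = (\<Sum>n. of_real ((fdiff ^^ j) b (n + N)) * z ^ (n + N))"

lemma ktail_summation_by_parts:
  assumes "norm z < 1"
  shows "(1 - z) * ktail j N z = of_real ((fdiff ^^ j) b N) * z ^ N + z * ktail (Suc j) N z"
proof -
  define a where "a n = of_real ((fdiff ^^ j) b (n + N)) * z ^ (n + N)" for n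
  define d where "d n = of_real ((fdiff ^^ Suc j) b (n + N)) * z ^ (n + N)" for n
  have sa: "summable a" unfolding a_def by (rule summable_fdiff_b[OF assms])
  have sd: "summable d" unfolding d_def by (rule summable_fdiff_b[OF assms])
  have "a (Suc n) = z * a n + z * d n" for n
    unfolding a_def d_def fdiff_funpow_Suc by (simp add: algebra_simps)
  then have "(\<Sum>n. a (Suc n)) = z * (\<Sum>n. a n) + z * (\<Sum>n. d n)"
    using sa sd by (simp add: suminf_mult summable_mult suminf_add[symmetric])
  moreover have "(\<Sum>n. a (Suc n)) = (\<Sum>n. a n) - a 0" by (rule suminf_split_head[OF sa])
  ultimately show ?thesis unfolding ktail_def a_def[symmetric] d_def[symmetric]
    by (simp add: algebra_simps a_def)
qed

text \<open>After \<open>\<eta> + 2\<close> summations by parts the tail converges absolutely; each of them costs a factor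
  \<open>1 / \<bar>1 - z\<bar>\<close>, which is at most \<open>2\<^sup>k\<^sup>+\<^sup>1\<close>, and gains a factor \<open>2\<^sup>-\<^sup>k\<close>.\<close>

lemma kern_upper:
  obtains C where "0 < C"
    "\<And>k z. norm z < 1 \<Longrightarrow> (1/2) ^ k / 2 \<le> norm (1 - z) \<Longrightarrow> norm (kern z) \<le> C * 2 ^ k / W k"
proof -
  obtain A \<eta> where A: "0 < A" "\<And>k n. 2 ^ k \<le> Suc n \<Longrightarrow> b n \<le> A * (real (Suc n) / 2 ^ k) ^ \<eta> / W k"
    using b_growth by blast
  define A' where "A' = A * 2 ^ \<eta>"
  have A': "0 < A'" unfolding A'_def using A by simp
  have bN: "b (2 ^ k) \<le> A' / W k" for k
  proof -
    have "(2::real) ^ 0 \<le> 2 ^ k" by (intro power_increasing) auto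
    then have "real (Suc (2 ^ k)) / 2 ^ k \<le> 2" by (simp add: field_simps)
    then have "A * (real (Suc (2 ^ k)) / 2 ^ k) ^ \<eta> / W k \<le> A * 2 ^ \<eta> / W k"
      using A(1) W_pos[of k] by (intro divide_right_mono mult_left_mono power_mono) auto
    then show ?thesis using A(2)[of k "2 ^ k"] unfolding A'_def by simp
  qed
  \<comment> \<open>The bound is what \<open>|fdiff^j b|\<close>, of size
    \<open>1 / ((2^k)^j * W k)\<close> near n = 2^k, gives when it is multiplied by 2^k, the number
    of terms of comparable size. It is proved downwards, from the absolutely convergent case
    \<open>j = \<eta> + 2\<close> to j = 0.\<close>
  define P where "P j \<longleftrightarrow> (\<exists>E>0. \<forall>k z. norm z < 1 \<longrightarrow> (1/2) ^ k / 2 \<le> norm (1 - z) \<longrightarrow>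
      norm (ktail j (2 ^ k) z) \<le> E * 2 ^ k / ((2 ^ k) ^ j * W k))" for j
  have "P 0"
  proof (rule inc_induct[of 0 "\<eta> + 2"])
    show "P (\<eta> + 2)"
    proof -
      obtain C where C: "0 < C" "\<And>n. \<bar>(fdiff ^^ (\<eta> + 2)) b n\<bar> \<le> C * b n / real (Suc n) ^ (\<eta> + 2)"
        using fdiff_b_bound by blast
      have "norm (ktail (\<eta> + 2) (2 ^ k) z) \<le> (C * A) * 2 ^ k / ((2 ^ k) ^ (\<eta> + 2) * W k)"
        if z: "norm z < 1" for k z
      proof -
        define N where "N = (2::nat) ^ k"
        have N: "0 < N" "real N = 2 ^ k" unfolding N_def by auto
        have bd: "norm (of_real ((fdiff ^^ (\<eta> + 2)) b (n + N)) * z ^ (n + N))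
            \<le> C * A / (real N ^ \<eta> * W k) * (1 / real (Suc (n + N)) ^ 2)" for n
        proof -
          define s where "s = real (Suc (n + N))"
          have s: "0 < s" unfolding s_def by simp
          have "norm (of_real ((fdiff ^^ (\<eta> + 2)) b (n + N)) * z ^ (n + N)) \<le> \<bar>(fdiff ^^ (\<eta> + 2)) b (n + N)\<bar> * 1"
            unfolding norm_mult norm_power using z by (intro mult_mono power_le_one) auto
          also have "\<dots> \<le> C * b (n + N) / s ^ (\<eta> + 2)" using C(2)[of "n + N"] unfolding s_def by simp
          also have "\<dots> \<le> C * (A * (s / real N) ^ \<eta> / W k) / s ^ (\<eta> + 2)"
            using A(2)[of k "n + N"] C(1) s unfolding s_def N(2)
            by (intro divide_right_mono mult_left_mono) (auto simp: N_def)
          also have "\<dots> = C * A / (real N ^ \<eta> * W k) * (1 / s ^ 2)"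
            using s N W_pos[of k] by (simp add: power_divide power_add field_simps power2_eq_square)
          finally show ?thesis unfolding s_def .
        qed
        have "norm (ktail (\<eta> + 2) N z) \<le> (\<Sum>n. C * A / (real N ^ \<eta> * W k) * (1 / real (Suc (n + N)) ^ 2))"
          unfolding ktail_def by (rule norm_suminf_le[OF bd]) (intro summable_mult inverse_squares_tail_le N)
        also have "\<dots> = C * A / (real N ^ \<eta> * W k) * (\<Sum>n. 1 / real (Suc (n + N)) ^ 2)"
          by (intro suminf_mult inverse_squares_tail_le N)
        also have "\<dots> \<le> C * A / (real N ^ \<eta> * W k) * (1 / real N)"
          using A C W_pos[of k] by (intro mult_left_mono inverse_squares_tail_le N) auto
        also have "\<dots> = (C * A) * real N / (real N ^ (\<eta> + 2) * W k)"
          using N W_pos[of k] by (simp add: power_add field_simps power2_eq_square del: of_nat_power)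
        finally show ?thesis using N(2) unfolding N_def by simp
      qed
      then show ?thesis unfolding P_def using A C by (intro exI[of _ "C * A"]) auto
    qed
  next
    fix j assume "P (Suc j)"
    then obtain E where E: "0 < E" "\<And>k z. norm z < 1 \<Longrightarrow> (1/2) ^ k / 2 \<le> norm (1 - z) \<Longrightarrow>
      norm (ktail (Suc j) (2 ^ k) z) \<le> E * 2 ^ k / ((2 ^ k) ^ Suc j * W k)" unfolding P_def by blast
    obtain C where C: "0 < C" "\<And>n. \<bar>(fdiff ^^ j) b n\<bar> \<le> C * b n / real (Suc n) ^ j"
      using fdiff_b_bound by blast
    have "norm (ktail j (2 ^ k) z) \<le> (2 * (C * A' + E)) * 2 ^ k / ((2 ^ k) ^ j * W k)"
      if z: "norm z < 1" "(1/2) ^ k / 2 \<le> norm (1 - z)" for k z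
    proof -
      define N where "N = (2::nat) ^ k"
      have N: "0 < N" "real N = 2 ^ k" unfolding N_def by auto
      have "\<bar>(fdiff ^^ j) b N\<bar> \<le> C * b N / real (Suc N) ^ j" by (rule C)
      also have "\<dots> \<le> C * (A' / W k) / real N ^ j"
        using C(1) A' W_pos[of k] bN[of k] N b_pos[of N] unfolding N_def[symmetric]
        by (intro frac_le mult_left_mono power_mono) auto
      finally have 1: "\<bar>(fdiff ^^ j) b N\<bar> \<le> C * A' / (real N ^ j * W k)" by (simp add: mult_ac)
      have "norm (ktail (Suc j) N z) \<le> E * real N / (real N ^ Suc j * W k)"
        using E(2)[OF z] N unfolding N_def by simp
      also have "\<dots> = E / (real N ^ j * W k)" using N by simp
      finally have 2: "norm (ktail (Suc j) N z) \<le> E / (real N ^ j * W k)" .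
      have "norm (1 - z) * norm (ktail j N z) = norm (of_real ((fdiff ^^ j) b N) * z ^ N + z * ktail (Suc j) N z)"
        unfolding ktail_summation_by_parts[OF z(1), symmetric] norm_mult ..
      also have "\<dots> \<le> \<bar>(fdiff ^^ j) b N\<bar> * norm z ^ N + norm z * norm (ktail (Suc j) N z)"
        by (rule order_trans[OF norm_triangle_ineq]) (simp add: norm_mult norm_power)
      also have "\<dots> \<le> \<bar>(fdiff ^^ j) b N\<bar> * 1 + 1 * norm (ktail (Suc j) N z)"
        using z(1) by (intro add_mono mult_left_mono mult_right_mono power_le_one) auto
      also have "\<dots> \<le> C * A' / (real N ^ j * W k) + E / (real N ^ j * W k)" using 1 2 by simp
      also have "\<dots> = (C * A' + E) / (real N ^ j * W k)" by (simp add: add_divide_distrib)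
      finally have "norm (1 - z) * norm (ktail j N z) \<le> (C * A' + E) / (real N ^ j * W k)" .
      moreover have "1 / (2 * real N) * norm (ktail j N z) \<le> norm (1 - z) * norm (ktail j N z)"
        using z(2) N by (intro mult_right_mono) (auto simp: power_divide)
      ultimately have "1 / (2 * real N) * norm (ktail j N z) \<le> (C * A' + E) / (real N ^ j * W k)" by linarith
      then have "norm (ktail j N z) \<le> (2 * real N) * ((C * A' + E) / (real N ^ j * W k))"
        using N by (simp add: field_simps)
      then show ?thesis using N unfolding N_def by (simp add: algebra_simps)
    qed
    then show "P j" unfolding P_def using C E A' by (intro exI[of _ "2 * (C * A' + E)"]) (auto intro!: add_pos_pos)
  qed simp
  then obtain E where E: "0 < E" "\<And>k z. norm z < 1 \<Longrightarrow> (1/2) ^ k / 2 \<le> norm (1 - z) \<Longrightarrow>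
      norm (ktail 0 (2 ^ k) z) \<le> E * 2 ^ k / W k" unfolding P_def by auto
  have "norm (kern z) \<le> (E + A') * 2 ^ k / W k" if z: "norm z < 1" "(1/2) ^ k / 2 \<le> norm (1 - z)" for k z
  proof -
    have "summable (\<lambda>n. of_real (b n) * z ^ n)" using summable_fdiff_b[OF z(1), of 0 0] by simp
    from suminf_split_initial_segment[OF this, of "2 ^ k"]
    have "kern z = ktail 0 (2 ^ k) z + (\<Sum>n<2 ^ k. of_real (b n) * z ^ n)"
      unfolding kern_def ktail_def by simp
    \<comment> \<open>The initial segment is estimated term by term: b increases, so each of the 2^k
      terms is at most the value at 2^k.\<close>
    moreover have "norm (\<Sum>n<2 ^ k. of_real (b n) * z ^ n) \<le> (\<Sum>n<(2::nat) ^ k. A' / W k)"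
    proof (rule sum_norm_le)
      fix n :: nat assume "n \<in> {..<2 ^ k}"
      then have "b n \<le> A' / W k" using b_mono[of n "2 ^ k"] bN[of k] by simp
      moreover have "norm z ^ n \<le> 1" using z(1) by (intro power_le_one) auto
      ultimately have "b n * norm z ^ n \<le> (A' / W k) * 1"
        using b_pos[of n] A' W_pos[of k] by (intro mult_mono) auto
      then show "norm (of_real (b n) * z ^ n) \<le> A' / W k"
        using b_pos[of n] by (simp add: norm_mult norm_power)
    qed
    ultimately have "norm (kern z) \<le> E * 2 ^ k / W k + 2 ^ k * (A' / W k)"
      using E(2)[OF z] norm_triangle_ineq[of "ktail 0 (2 ^ k) z" "\<Sum>n<2 ^ k. of_real (b n) * z ^ n"] by simp
    then show ?thesis by (simp add: field_simps add_divide_distrib)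
  qed
  then show ?thesis using that[of "E + A'"] E(1) A' by simp
qed

text \<open>All coefficients are positive, so the terms with n between 2^k / 2 and 2^k suffice;
  there \<open>b n\<close> is at least a constant over \<open>W k\<close>. The square in the
  hypothesis is the form in which the lemma is used: the argument is a product of two numbers, each
  at least \<open>1 - (1/2) ^ k\<close>. It makes the lower bound for \<open>x ^ n\<close> the
  square of 1/3.\<close>

lemma kern_lower:
  obtains c where "0 < c" "\<And>k x. (1 - (1/2) ^ k)\<^sup>2 \<le> x \<Longrightarrow> x < 1 \<Longrightarrow> c * 2 ^ k / W k \<le> kernr x"
proof -
  obtain A where A: "0 < A" "\<And>k n. 2 ^ k \<le> Suc n \<Longrightarrow> measure_moment \<nu> n \<le> A * W k"
    using moment_le_W by blast
  have "1 / (36 * A) * 2 ^ k / W k \<le> kernr x" if x: "(1 - (1/2) ^ k)\<^sup>2 \<le> x" "x < 1" for k x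
  proof -
    define N where "N = (2::nat) ^ k"
    have N: "1 \<le> N" "real N = 2 ^ k" unfolding N_def by auto
    have x0: "0 \<le> x" using x(1) by (rule order_trans[rotated]) simp
    have "(1/3)\<^sup>2 \<le> ((1 - 1 / real N) ^ (N - 1))\<^sup>2"
      by (intro power_mono one_minus_inverse_power_ge N) auto
    also have "\<dots> = ((1 - (1/2) ^ k)\<^sup>2) ^ (N - 1)"
      by (simp add: N(2) power_divide mult.commute flip: power_mult)
    also have "\<dots> \<le> x ^ (N - 1)" using x by (intro power_mono) auto
    finally have xN: "1/9 \<le> x ^ (N - 1)" by (simp add: power2_eq_square)
    have "1 / (18 * (A * W k)) \<le> b n * x ^ n" if n: "n \<in> {N div 2..<N}" for n
    proof -
      have "2 ^ k \<le> Suc (2 * n + 1)" using n unfolding N_def by (cases k) auto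
      then have "e n \<le> A * W k" by (rule A)
      then have "1 / (2 * (A * W k)) \<le> b n"
        unfolding b_def using moment_pos[of "2 * n + 1"] A(1) W_pos[of k] by (intro divide_left_mono mult_pos_pos) auto
      moreover have "x ^ (N - 1) \<le> x ^ n" using n x x0 by (intro power_decreasing) auto
      then have "1/9 \<le> x ^ n" using xN by linarith
      ultimately have "1 / (2 * (A * W k)) * (1/9) \<le> b n * x ^ n"
        using b_pos[of n] by (intro mult_mono) auto
      then show ?thesis by simp
    qed
    then have "(\<Sum>n\<in>{N div 2..<N}. 1 / (18 * (A * W k))) \<le> (\<Sum>n\<in>{N div 2..<N}. b n * x ^ n)"
      by (rule sum_mono)
    also have "\<dots> \<le> kernr x"
      unfolding kernr_def using x x0 b_pos by (intro sum_le_suminf summable_b) (auto simp: order.strict_implies_order)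
    finally have "real (N - N div 2) * (1 / (18 * (A * W k))) \<le> kernr x" by simp
    moreover have "real N / 2 * (1 / (18 * (A * W k))) \<le> real (N - N div 2) * (1 / (18 * (A * W k)))"
      using A(1) W_pos[of k] by (intro mult_right_mono) auto
    ultimately have "real N / 2 * (1 / (18 * (A * W k))) \<le> kernr x" by linarith
    then show ?thesis using N(2) by (simp add: mult_ac)
  qed
  moreover have "0 < 1 / (36 * A)" using A(1) by simp
  ultimately show ?thesis using that by blast
qed

end

section \<open>A maximal inequality for families of symmetric kernels\<close>

lemma ennreal_sqrt_bound:
  fixes X Y Z :: ennreal
  assumes fin: "X < \<infinity>" "Y < \<infinity>" and 1: "Y\<^sup>2 \<le> X * Z" and 2: "X\<^sup>2 \<le> (ennreal c)\<^sup>2 * (X * Y)" and c: "0 \<le> c"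
  shows "Y \<le> (ennreal c)\<^sup>2 * Z"
proof (cases "Y = 0 \<or> Z = \<infinity>")
  case True
  then show ?thesis
  proof
    assume Z: "Z = \<infinity>"
    show ?thesis
    proof (cases "c = 0")
      case True
      then have "X = 0" using 2 by simp
      then show ?thesis using 1 by simp
    next
      case False
      then show ?thesis using Z c by (simp add: ennreal_mult_top ennreal_power)
    qed
  qed simp
next
  case False
  obtain x where x: "0 \<le> x" "X = ennreal x" using fin(1) by (cases X) auto
  obtain y where y: "0 < y" "Y = ennreal y" using fin(2) False by (cases Y) (auto simp: le_less)
  obtain z where z: "0 \<le> z" "Z = ennreal z" using False by (cases Z) auto
  have 1: "y\<^sup>2 \<le> x * z" using 1 x y z by (simp add: ennreal_power flip: ennreal_mult)
  have 2: "x\<^sup>2 \<le> c\<^sup>2 * (x * y)" using 2 x y c by (simp add: ennreal_power flip: ennreal_mult)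
  have "0 < x" using 1 y x by (metis mult_zero_left not_less_iff_gr_or_eq order_less_le zero_less_power linorder_not_le)
  then have "x \<le> c\<^sup>2 * y" using 2 by (simp add: power2_eq_square)
  then have "y\<^sup>2 \<le> c\<^sup>2 * y * z" using 1 mult_right_mono[OF _ z(1)] by fastforce
  then have "y \<le> c\<^sup>2 * z" using y by (simp add: power2_eq_square)
  then show ?thesis using y z c by (simp add: ennreal_power flip: ennreal_mult)
qed

text \<open>The maximal function is linearised by letting the index depend on x, and the adjoint of
  the linearised operator is bounded instead. Expanding the square of the adjoint gives compositions
  of two kernels, and the hypothesis says that composing with a later kernel costs no more than C.
  The square of the norm of the adjoint image of V is thereby at most 2C times its pairing with V
  itself, which bounds the operator norm by 2C. Nothing depends on the number n of kernels.\<close>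

lemma TT_star_maximal_inequality:
  fixes K :: "nat \<Rightarrow> 'a \<Rightarrow> 'a \<Rightarrow> ennreal" and v :: "'a \<Rightarrow> ennreal" and n :: nat
  assumes M: "finite_measure M"
    and K: "\<And>k. (\<lambda>(x, y). K k x y) \<in> borel_measurable (M \<Otimes>\<^sub>M M)"
    and v[measurable]: "v \<in> borel_measurable M"
    and sym: "\<And>k x y. K k x y = K k y x"
    and KB: "\<And>k x y. K k x y \<le> ennreal B" and vA: "\<And>y. v y \<le> ennreal A"
    and semi: "\<And>j k x y. j \<le> k \<Longrightarrow> x \<in> space M \<Longrightarrow> y \<in> space M \<Longrightarrow>
      (\<integral>\<^sup>+z. K j x z * K k z y \<partial>M) \<le> ennreal C * K j x y"
    and C: "0 \<le> C"
    and V_def: "V = (\<lambda>x. SUP k\<in>{..n}. \<integral>\<^sup>+y. K k x y * v y \<partial>M)"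
  shows "(\<integral>\<^sup>+x. V x ^ 2 \<partial>M) \<le> (ennreal (2 * C))\<^sup>2 * (\<integral>\<^sup>+y. v y ^ 2 \<partial>M)"
proof -
  interpret finite_measure M by fact
  interpret P: pair_sigma_finite M M ..
  have Kf[measurable]: "(\<lambda>x. K k (f x) (g x)) \<in> borel_measurable N"
    if "f \<in> measurable N M" "g \<in> measurable N M" for k f g and N :: "'b measure"
    using measurable_compose[OF measurable_Pair[OF that] K[of k]] by simp
  have Kf'[measurable]: "(\<lambda>x. K k (f x) (g x)) \<in> borel_measurable N"
    if "f \<in> measurable N M" "g \<in> measurable N M" for k f g and N :: "('a \<times> 'a) measure"
    using measurable_compose[OF measurable_Pair[OF that] K[of k]] by simp
  have Kf''[measurable]: "(\<lambda>x. K k (f x) (g x)) \<in> borel_measurable N"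
    if "f \<in> measurable N M" "g \<in> measurable N M" for k f g and N :: "'a measure"
    using measurable_compose[OF measurable_Pair[OF that] K[of k]] by simp
  define U where "U k x = (\<integral>\<^sup>+y. K k x y * v y \<partial>M)" for k x
  have U[measurable]: "U k \<in> borel_measurable M" for k
    unfolding U_def by measurable
  have V_alt: "V x = (SUP k\<in>{..n}. U k x)" for x unfolding V_def U_def ..
  have V[measurable]: "V \<in> borel_measurable M" unfolding V_alt by measurable
  have att: "\<exists>k\<le>n. U k x = V x" for x
  proof -
    have "V x = Max ((\<lambda>k. U k x) ` {..n})" unfolding V_alt by (intro cSup_eq_Max) auto
    moreover have "Max ((\<lambda>k. U k x) ` {..n}) \<in> (\<lambda>k. U k x) ` {..n}" by (intro Max_in) auto
    ultimately show ?thesis by (metis atMost_iff imageE)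
  qed
  \<comment> \<open>Taking the first index at which the maximum is attained makes the sets disjoint,
    so that V is the sum of the pieces \<open>g k\<close>.\<close>
  define E where "E k x \<longleftrightarrow> U k x = V x \<and> (\<forall>i<k. U i x \<noteq> V x)" for k x
  have E[measurable]: "Measurable.pred M (E k)" for k unfolding E_def by measurable
  have ex1: "\<exists>k\<le>n. E k x \<and> (\<forall>j. E j x \<longrightarrow> j = k)" for x
  proof -
    define k where "k = (LEAST k. U k x = V x)"
    obtain k0 where k0: "k0 \<le> n" "U k0 x = V x" using att by blast
    have "U k x = V x" unfolding k_def by (rule LeastI[of _ k0]) (rule k0)
    moreover have "k \<le> k0" unfolding k_def by (rule Least_le) (rule k0)
    moreover have "\<forall>i<k. U i x \<noteq> V x" unfolding k_def using not_less_Least by blast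
    ultimately show ?thesis using k0 unfolding E_def by (metis le_trans linorder_neqE_nat)
  qed
  obtain \<kappa> where \<kappa>: "\<And>x. \<kappa> x \<le> n" "\<And>x. E (\<kappa> x) x" "\<And>j x. E j x \<Longrightarrow> j = \<kappa> x"
    using ex1 by metis
  define g where "g k x = (if E k x then V x else 0)" for k x
  have g[measurable]: "g k \<in> borel_measurable M" for k unfolding g_def by measurable
  have sum_g: "(\<Sum>k\<le>n. g k x * h k) = V x * h (\<kappa> x)" for x and h :: "nat \<Rightarrow> ennreal"
  proof -
    have "g j x * h j = 0" if "j \<noteq> \<kappa> x" for j using \<kappa>(3)[of j x] that by (auto simp: g_def)
    then have "(\<Sum>j\<le>n. g j x * h j) = (\<Sum>j\<in>{\<kappa> x}. g j x * h j)"
      using \<kappa>(1)[of x] by (intro sum.mono_neutral_right) auto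
    then show ?thesis using \<kappa>(2)[of x] by (simp add: g_def)
  qed
  have gV: "(\<Sum>k\<le>n. g k x) = V x" for x using sum_g[of x "\<lambda>_. 1"] by simp
  have gU: "(\<Sum>k\<le>n. g k x * U k x) = V x ^ 2" for x
    using sum_g[of x "\<lambda>k. U k x"] \<kappa>(2)[of x] by (simp add: E_def power2_eq_square)
  define \<phi> where "\<phi> k y = (\<integral>\<^sup>+x. K k x y * g k x \<partial>M)" for k y
  have \<phi>[measurable]: "\<phi> k \<in> borel_measurable M" for k unfolding \<phi>_def by measurable
  define \<Phi> where "\<Phi> y = (\<Sum>k\<le>n. \<phi> k y)" for y
  have \<Phi>[measurable]: "\<Phi> \<in> borel_measurable M" unfolding \<Phi>_def by measurable
  \<comment> \<open>Duality: since \<open>U k\<close> equals V on the support of \<open>g k\<close>,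
    the square of V is the sum of \<open>g k * U k\<close>, and the kernels are moved from v to the
    pieces \<open>g k\<close>.\<close>
  have Vv: "(\<integral>\<^sup>+x. V x ^ 2 \<partial>M) = (\<integral>\<^sup>+y. \<Phi> y * v y \<partial>M)"
  proof -
    have "(\<integral>\<^sup>+x. V x ^ 2 \<partial>M) = (\<Sum>k\<le>n. \<integral>\<^sup>+x. g k x * U k x \<partial>M)"
      unfolding gU[symmetric] by (subst nn_integral_sum) auto
    also have "\<dots> = (\<Sum>k\<le>n. \<integral>\<^sup>+y. \<phi> k y * v y \<partial>M)"
    proof (rule sum.cong[OF refl])
      fix k
      have "(\<integral>\<^sup>+x. g k x * U k x \<partial>M) = (\<integral>\<^sup>+x. \<integral>\<^sup>+y. g k x * (K k x y * v y) \<partial>M \<partial>M)"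
        unfolding U_def by (intro nn_integral_cong nn_integral_cmult[symmetric]) measurable
      also have "\<dots> = (\<integral>\<^sup>+y. \<integral>\<^sup>+x. g k x * (K k x y * v y) \<partial>M \<partial>M)"
        by (rule P.Fubini') measurable
      also have "\<dots> = (\<integral>\<^sup>+y. \<phi> k y * v y \<partial>M)"
      proof (rule nn_integral_cong)
        fix y assume y: "y \<in> space M"
        have "\<phi> k y * v y = (\<integral>\<^sup>+x. K k x y * g k x * v y \<partial>M)"
          unfolding \<phi>_def using y by (intro nn_integral_multc[symmetric]) measurable
        then show "(\<integral>\<^sup>+x. g k x * (K k x y * v y) \<partial>M) = \<phi> k y * v y" by (simp add: mult_ac)
      qed
      finally show "(\<integral>\<^sup>+x. g k x * U k x \<partial>M) = (\<integral>\<^sup>+y. \<phi> k y * v y \<partial>M)" .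
    qed
    also have "\<dots> = (\<integral>\<^sup>+y. \<Phi> y * v y \<partial>M)"
      unfolding \<Phi>_def sum_distrib_right by (subst nn_integral_sum) auto
    finally show ?thesis .
  qed
  \<comment> \<open>Here \<open>\<phi> j\<close> is already smoothed by the kernel with index j, and
    smoothing it again by a later kernel enlarges it at most by the factor C.\<close>
  have conv: "(\<integral>\<^sup>+y. \<phi> j y * K k x y \<partial>M) \<le> ennreal C * \<phi> j x" if "j \<le> k" "x \<in> space M" for j k x
  proof -
    have "(\<integral>\<^sup>+y. \<phi> j y * K k x y \<partial>M) = (\<integral>\<^sup>+y. \<integral>\<^sup>+z. K j z y * g j z * K k x y \<partial>M \<partial>M)"
      unfolding \<phi>_def using that by (intro nn_integral_cong nn_integral_multc[symmetric]) measurable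
    also have "\<dots> = (\<integral>\<^sup>+z. \<integral>\<^sup>+y. K j z y * g j z * K k x y \<partial>M \<partial>M)"
      using that by (intro P.Fubini') measurable
    also have "\<dots> = (\<integral>\<^sup>+z. g j z * (\<integral>\<^sup>+y. K j z y * K k y x \<partial>M) \<partial>M)"
    proof (rule nn_integral_cong)
      fix z assume z: "z \<in> space M"
      have "g j z * (\<integral>\<^sup>+y. K j z y * K k y x \<partial>M) = (\<integral>\<^sup>+y. g j z * (K j z y * K k y x) \<partial>M)"
        using z that by (intro nn_integral_cmult[symmetric]) measurable
      then show "(\<integral>\<^sup>+y. K j z y * g j z * K k x y \<partial>M) = g j z * (\<integral>\<^sup>+y. K j z y * K k y x \<partial>M)"
        by (simp add: mult_ac sym[of k x])
    qed
    also have "\<dots> \<le> (\<integral>\<^sup>+z. g j z * (ennreal C * K j z x) \<partial>M)"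
      using that by (intro nn_integral_mono mult_left_mono semi) auto
    also have "\<dots> = ennreal C * \<phi> j x"
      unfolding \<phi>_def using that by (subst nn_integral_cmult[symmetric]) (measurable, simp add: mult_ac)
    finally show ?thesis .
  qed
  have prod: "(\<integral>\<^sup>+y. \<phi> j y * \<phi> k y \<partial>M) \<le> ennreal C * (\<integral>\<^sup>+y. \<phi> j y * g k y \<partial>M)" if "j \<le> k" for j k
  proof -
    have "(\<integral>\<^sup>+y. \<phi> j y * \<phi> k y \<partial>M) = (\<integral>\<^sup>+y. \<integral>\<^sup>+x. \<phi> j y * (K k x y * g k x) \<partial>M \<partial>M)"
      unfolding \<phi>_def[of k] by (intro nn_integral_cong nn_integral_cmult[symmetric]) measurable
    also have "\<dots> = (\<integral>\<^sup>+x. \<integral>\<^sup>+y. \<phi> j y * (K k x y * g k x) \<partial>M \<partial>M)"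
      by (rule P.Fubini') measurable
    also have "\<dots> = (\<integral>\<^sup>+x. (\<integral>\<^sup>+y. \<phi> j y * K k x y \<partial>M) * g k x \<partial>M)"
    proof (rule nn_integral_cong)
      fix x assume x: "x \<in> space M"
      have "(\<integral>\<^sup>+y. \<phi> j y * K k x y \<partial>M) * g k x = (\<integral>\<^sup>+y. \<phi> j y * K k x y * g k x \<partial>M)"
        using x by (intro nn_integral_multc[symmetric]) measurable
      then show "(\<integral>\<^sup>+y. \<phi> j y * (K k x y * g k x) \<partial>M) = (\<integral>\<^sup>+y. \<phi> j y * K k x y \<partial>M) * g k x"
        by (simp add: mult_ac)
    qed
    also have "\<dots> \<le> (\<integral>\<^sup>+x. (ennreal C * \<phi> j x) * g k x \<partial>M)"
      using that by (intro nn_integral_mono mult_right_mono conv) auto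
    also have "\<dots> = ennreal C * (\<integral>\<^sup>+y. \<phi> j y * g k y \<partial>M)"
      by (subst nn_integral_cmult[symmetric]) (measurable, simp add: mult_ac)
    finally show ?thesis .
  qed
  \<comment> \<open>Symmetric form: of the two mixed terms on the right one is the bound for the
    order at hand and the other is nonnegative. The double sum then becomes twice the pairing of
    \<Phi> and V.\<close>
  have prod': "(\<integral>\<^sup>+y. \<phi> j y * \<phi> k y \<partial>M) \<le> ennreal C * ((\<integral>\<^sup>+y. \<phi> j y * g k y \<partial>M) + (\<integral>\<^sup>+y. \<phi> k y * g j y \<partial>M))" for j k
  proof (cases "j \<le> k")
    case True
    show ?thesis by (rule order_trans[OF prod[OF True]]) (intro mult_left_mono; simp)
  next
    case False
    then have "(\<integral>\<^sup>+y. \<phi> j y * \<phi> k y \<partial>M) \<le> ennreal C * (\<integral>\<^sup>+y. \<phi> k y * g j y \<partial>M)"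
      using prod[of k j] by (simp add: mult.commute)
    also have "\<dots> \<le> ennreal C * ((\<integral>\<^sup>+y. \<phi> j y * g k y \<partial>M) + (\<integral>\<^sup>+y. \<phi> k y * g j y \<partial>M))"
      by (intro mult_left_mono; simp)
    finally show ?thesis .
  qed
  have X: "(\<integral>\<^sup>+y. \<Phi> y ^ 2 \<partial>M) \<le> ennreal (2 * C) * (\<integral>\<^sup>+y. \<Phi> y * V y \<partial>M)"
  proof -
    have "(\<integral>\<^sup>+y. \<Phi> y ^ 2 \<partial>M) = (\<Sum>j\<le>n. \<Sum>k\<le>n. \<integral>\<^sup>+y. \<phi> j y * \<phi> k y \<partial>M)"
      unfolding \<Phi>_def power2_eq_square sum_product by (subst nn_integral_sum, simp)+ simp
    also have "\<dots> \<le> (\<Sum>j\<le>n. \<Sum>k\<le>n. ennreal C * ((\<integral>\<^sup>+y. \<phi> j y * g k y \<partial>M) + (\<integral>\<^sup>+y. \<phi> k y * g j y \<partial>M)))"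
      by (intro sum_mono prod')
    also have "\<dots> = ennreal C * ((\<Sum>j\<le>n. \<Sum>k\<le>n. \<integral>\<^sup>+y. \<phi> j y * g k y \<partial>M) + (\<Sum>j\<le>n. \<Sum>k\<le>n. \<integral>\<^sup>+y. \<phi> k y * g j y \<partial>M))"
      by (simp only: sum.distrib sum_distrib_left distrib_left)
    also have "(\<Sum>j\<le>n. \<Sum>k\<le>n. \<integral>\<^sup>+y. \<phi> k y * g j y \<partial>M) = (\<Sum>j\<le>n. \<Sum>k\<le>n. \<integral>\<^sup>+y. \<phi> j y * g k y \<partial>M)"
      by (rule sum.swap)
    also have "(\<Sum>j\<le>n. \<Sum>k\<le>n. \<integral>\<^sup>+y. \<phi> j y * g k y \<partial>M) = (\<integral>\<^sup>+y. \<Phi> y * V y \<partial>M)"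
      unfolding \<Phi>_def gV[symmetric] sum_product by (subst nn_integral_sum, simp)+ simp
    also have "ennreal C * ((\<integral>\<^sup>+y. \<Phi> y * V y \<partial>M) + (\<integral>\<^sup>+y. \<Phi> y * V y \<partial>M)) = ennreal (2 * C) * (\<integral>\<^sup>+y. \<Phi> y * V y \<partial>M)"
      using C by (simp add: ennreal_mult flip: mult_2 mult.assoc) (simp add: mult_ac)
    finally show ?thesis .
  qed
  \<comment> \<open>The concluding argument cancels norms, so they have to be finite. This is why
    the kernels and v are assumed bounded and the measure finite; none of these bounds enters the
    final constant.\<close>
  define m where "m = measure M (space M)"
  have em: "emeasure M (space M) = ennreal m" unfolding m_def by (rule emeasure_eq_measure)
  have bd: "\<exists>b. \<forall>x. (\<integral>\<^sup>+y. K k x y * h y \<partial>M) \<le> ennreal b" if "\<And>y. h y \<le> ennreal a" for h a k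
  proof (intro exI allI)
    fix x
    have "(\<integral>\<^sup>+y. K k x y * h y \<partial>M) \<le> (\<integral>\<^sup>+y. ennreal (max B 0) * ennreal (max a 0) \<partial>M)"
      using KB that by (intro nn_integral_mono mult_mono order_trans[OF KB] order_trans[OF that] ennreal_leI) auto
    also have "\<dots> = ennreal (max B 0 * max a 0 * m)"
      using em by (simp add: ennreal_mult m_def)
    finally show "(\<integral>\<^sup>+y. K k x y * h y \<partial>M) \<le> ennreal (max B 0 * max a 0 * m)" .
  qed
  have "\<exists>b. \<forall>x. U k x \<le> ennreal b" for k
    using bd[OF vA, of k] unfolding U_def .
  then obtain u where u: "\<And>k x. U k x \<le> ennreal (u k)" by metis
  obtain a where a: "\<And>x. V x \<le> ennreal a"
  proof
    fix x
    obtain k where "k \<le> n" "V x = U k x" using att by metis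
    then have "V x \<le> ennreal (u k)" using u by simp
    also have "\<dots> \<le> ennreal (\<Sum>k\<le>n. max 0 (u k))"
      by (rule ennreal_leI, rule order_trans[OF _ member_le_sum[of k]]) (use \<open>k \<le> n\<close> in auto)
    finally show "V x \<le> ennreal (\<Sum>k\<le>n. max 0 (u k))" .
  qed
  have ga: "g k x \<le> ennreal a" for k x using a[of x] by (simp add: g_def)
  have "\<exists>b. \<forall>y. \<phi> k y \<le> ennreal b" for k
  proof -
    have "\<And>y. g k y \<le> ennreal a" by (rule ga)
    from bd[OF this, of k] show ?thesis unfolding \<phi>_def by (subst (asm) sym)
  qed
  then obtain b where b: "\<And>k y. \<phi> k y \<le> ennreal (b k)" by metis
  have \<Phi>b: "\<Phi> y \<le> ennreal (\<Sum>k\<le>n. max 0 (b k))" for y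
  proof -
    have "\<Phi> y \<le> (\<Sum>k\<le>n. ennreal (max 0 (b k)))"
      unfolding \<Phi>_def by (intro sum_mono order_trans[OF b] ennreal_leI) auto
    then show ?thesis by (subst (asm) sum_ennreal) auto
  qed
  have fin: "(\<integral>\<^sup>+y. h y ^ 2 \<partial>M) < \<infinity>" if "\<And>y. h y \<le> ennreal c" for h c
  proof -
    have "(\<integral>\<^sup>+y. h y ^ 2 \<partial>M) \<le> (\<integral>\<^sup>+y. ennreal c ^ 2 \<partial>M)"
      by (intro nn_integral_mono power_mono that) auto
    also have "\<dots> < \<infinity>" using em by (simp add: ennreal_mult_less_top power_less_top_ennreal)
    finally show ?thesis .
  qed
  show ?thesis
  proof (rule ennreal_sqrt_bound)
    show "(\<integral>\<^sup>+y. \<Phi> y ^ 2 \<partial>M) < \<infinity>" by (rule fin[OF \<Phi>b])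
    show "(\<integral>\<^sup>+x. V x ^ 2 \<partial>M) < \<infinity>" by (rule fin[OF a])
    show "(\<integral>\<^sup>+x. V x ^ 2 \<partial>M)\<^sup>2 \<le> (\<integral>\<^sup>+y. \<Phi> y ^ 2 \<partial>M) * (\<integral>\<^sup>+y. v y ^ 2 \<partial>M)"
      unfolding Vv by (rule Cauchy_Schwarz_nn_integral) measurable
    have "(\<integral>\<^sup>+y. \<Phi> y ^ 2 \<partial>M)\<^sup>2 \<le> (ennreal (2 * C) * (\<integral>\<^sup>+y. \<Phi> y * V y \<partial>M))\<^sup>2"
      by (intro power_mono X) simp
    also have "\<dots> = (ennreal (2 * C))\<^sup>2 * (\<integral>\<^sup>+y. \<Phi> y * V y \<partial>M)\<^sup>2" by (simp add: power_mult_distrib)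
    also have "\<dots> \<le> (ennreal (2 * C))\<^sup>2 * ((\<integral>\<^sup>+y. \<Phi> y ^ 2 \<partial>M) * (\<integral>\<^sup>+x. V x ^ 2 \<partial>M))"
      by (intro mult_left_mono Cauchy_Schwarz_nn_integral) auto
    finally show "(\<integral>\<^sup>+y. \<Phi> y ^ 2 \<partial>M)\<^sup>2 \<le> (ennreal (2 * C))\<^sup>2 * ((\<integral>\<^sup>+y. \<Phi> y ^ 2 \<partial>M) * (\<integral>\<^sup>+x. V x ^ 2 \<partial>M))" .
  qed (use C in auto)
qed

subsection \<open>The Poisson kernel\<close>

definition poisson :: "complex \<Rightarrow> complex \<Rightarrow> real" where
  "poisson a \<zeta> = (1 - (norm a)\<^sup>2) / (norm (\<zeta> - a))\<^sup>2"

text \<open>Cauchy's formula is applied to u times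
  \<open>(1 - |a|\<^sup>2) / (1 - cnj a * \<zeta>)\<close>. The factor is 1 at a, and on the circle
  \<open>1 - cnj a * \<zeta>\<close> equals \<zeta> times the conjugate of \<zeta> - a, which turns
  the Cauchy kernel into the Poisson kernel.\<close>

lemma Poisson_integral_formula:
  fixes u :: "complex \<Rightarrow> complex"
  assumes u: "continuous_on (cball 0 1) u" "u holomorphic_on ball 0 1" and a: "norm a < 1"
  shows "((\<lambda>t. of_real (poisson a (cis t)) * u (cis t)) has_integral 2 * pi * u a) {0..2 * pi}"
proof -
  define F where "F \<zeta> = u \<zeta> * of_real (1 - (norm a)\<^sup>2) / (1 - cnj a * \<zeta>)" for \<zeta>
  have ne: "1 - cnj a * \<zeta> \<noteq> 0" if "norm \<zeta> \<le> 1" for \<zeta>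
  proof
    assume "1 - cnj a * \<zeta> = 0"
    then have "norm (cnj a * \<zeta>) = 1" by (metis eq_iff_diff_eq_0 norm_one)
    then have "norm a * norm \<zeta> = 1" by (simp add: norm_mult)
    moreover have "norm a * norm \<zeta> \<le> norm a * 1" using that by (intro mult_left_mono) auto
    ultimately show False using a by simp
  qed
  have F: "continuous_on (cball 0 1) F" "F holomorphic_on ball 0 1"
    unfolding F_def using u ne by (auto intro!: continuous_intros holomorphic_intros)
  have "1 - cnj a * a = of_real (1 - (norm a)\<^sup>2)"
    by (simp add: complex_norm_square[symmetric] mult.commute[of _ a])
  then have Fa: "F a = u a" unfolding F_def using ne[of a] a by simp
  have "((\<lambda>w. F w / (w - a)) has_contour_integral 2 * of_real pi * \<i> * u a) (part_circlepath 0 1 0 (2 * pi))"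
    using Cauchy_integral_circlepath[OF F, of a] a unfolding circlepath_def Fa by simp
  then have "((\<lambda>t. F (0 + of_real 1 * cis t) / (0 + of_real 1 * cis t - a) * of_real 1 * \<i> * cis t)
      has_integral 2 * of_real pi * \<i> * u a) {0..2 * pi}"
    using has_contour_integral_part_circlepath_iff[of 0 "2 * pi" "\<lambda>w. F w / (w - a)" _ 0 1] by simp
  then have int: "((\<lambda>t. F (cis t) / (cis t - a) * \<i> * cis t / \<i>) has_integral 2 * of_real pi * \<i> * u a / \<i>) {0..2 * pi}"
    by (intro has_integral_divide) simp
  have eq: "F (cis t) / (cis t - a) * \<i> * cis t / \<i> = of_real (poisson a (cis t)) * u (cis t)" for t
  proof -
    have 1: "1 - cnj a * cis t = cis t * cnj (cis t - a)"
      by (simp add: algebra_simps cis_cnj cis_mult)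
    have 2: "cis t - a \<noteq> 0" using a norm_cis[of t] by (metis eq_iff_diff_eq_0 less_irrefl)
    have "F (cis t) / (cis t - a) * \<i> * cis t / \<i> = u (cis t) * of_real (1 - (norm a)\<^sup>2) / ((cis t - a) * cnj (cis t - a))"
    proof -
      have "A / (x * y) / w * \<i> * x / \<i> = A / (w * y)" if "x \<noteq> 0" for A x y w :: complex
      proof -
        have "A / (x * y) / w * \<i> * x / \<i> = A / (x * y) / w * x * (\<i> / \<i>)"
          by (simp only: times_divide_eq_left times_divide_eq_right divide_divide_eq_left mult_ac)
        then show ?thesis using that by simp
      qed
      from this[OF cis_neq_zero] show ?thesis unfolding F_def 1 .
    qed
    also have "(cis t - a) * cnj (cis t - a) = of_real ((norm (cis t - a))\<^sup>2)"
      by (simp only: complex_norm_square)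
    finally show ?thesis unfolding poisson_def by simp
  qed
  have c: "2 * of_real pi * \<i> * u a / \<i> = of_real (2 * pi) * u a" by simp
  show ?thesis using int unfolding eq c .
qed

lemma poisson_nonneg: "norm a < 1 \<Longrightarrow> 0 \<le> poisson a \<zeta>"
  unfolding poisson_def by (simp add: power_le_one)

lemma norm_minus_cis_pos: "norm a < 1 \<Longrightarrow> 0 < norm (cis t - a)"
  using norm_cis[of t] by (metis eq_iff_diff_eq_0 less_irrefl zero_less_norm_iff)

lemma poisson_commute:
  assumes "0 \<le> r"
  shows "poisson (of_real r * cis x) (cis y) = poisson (of_real r * cis y) (cis x)"
proof -
  have "cis y - of_real r * cis x = cis (x + y) * cnj (cis x - of_real r * cis y)"
    by (simp add: algebra_simps cis_cnj cis_mult)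
  then have "norm (cis y - of_real r * cis x) = norm (cis x - of_real r * cis y)"
    by (simp add: norm_mult del: complex_cnj_diff)
  then show ?thesis unfolding poisson_def using assms by (simp add: norm_mult)
qed

lemma Re_Cayley: 
  assumes "norm w < 1"
  shows "Re ((1 + w) / (1 - w)) = (1 - (norm w)\<^sup>2) / (norm (1 - w))\<^sup>2"
proof -
  have "(norm w)\<^sup>2 = (Re w)\<^sup>2 + (Im w)\<^sup>2" "(norm (1 - w))\<^sup>2 = (1 - Re w)\<^sup>2 + (Im w)\<^sup>2"
    by (simp_all add: cmod_power2)
  then show ?thesis by (simp add: Re_divide algebra_simps power2_eq_square)
qed

text \<open>The Poisson kernel in its second variable is the real part of a holomorphic function, so that
  the Poisson formula reproduces it.\<close>

lemma poisson_semigroup: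
  assumes r: "0 \<le> r" "r < 1" and s: "0 \<le> s" "s < 1"
  shows "((\<lambda>t. poisson (of_real r * cis x) (cis t) * poisson (of_real s * cis y) (cis t))
           has_integral 2 * pi * poisson (of_real (r * s) * cis x) (cis y)) {0..2 * pi}"
proof -
  define q where "q = of_real s * cis (- y)"
  have q: "norm q = s" unfolding q_def using s by (simp add: norm_mult)
  have ne: "1 - q * \<zeta> \<noteq> 0" if "norm \<zeta> \<le> 1" for \<zeta>
  proof
    assume "1 - q * \<zeta> = 0"
    then have "norm (q * \<zeta>) = 1" by (metis eq_iff_diff_eq_0 norm_one)
    then have "s * norm \<zeta> = 1" by (simp add: norm_mult q)
    moreover have "s * norm \<zeta> \<le> s * 1" using that s by (intro mult_left_mono) auto
    ultimately show False using s by simp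
  qed
  \<comment> \<open>This Cayley transform has as its real part on the circle the Poisson kernel with
    pole parameter s e^(iy). At r e^(ix) its real part is the kernel with radius r s, so the Poisson
    formula gives the semigroup property.\<close>
  define u where "u \<zeta> = (1 + q * \<zeta>) / (1 - q * \<zeta>)" for \<zeta>
  have u: "continuous_on (cball 0 1) u" "u holomorphic_on ball 0 1"
    unfolding u_def using ne by (auto intro!: continuous_intros holomorphic_intros)
  have Re_u: "Re (u (of_real \<rho> * cis t)) = poisson (of_real (\<rho> * s) * cis t) (cis y)" if "0 \<le> \<rho>" "\<rho> \<le> 1" for \<rho> t
  proof -
    have n: "norm (q * (of_real \<rho> * cis t)) = \<rho> * s" using that q by (simp add: norm_mult)
    also have "\<dots> \<le> 1 * s" using that s by (intro mult_right_mono) auto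
    also have "\<dots> < 1" using s by simp
    finally have 1: "norm (q * (of_real \<rho> * cis t)) < 1" .
    have "cis y * (1 - q * (of_real \<rho> * cis t)) = cis y - of_real (\<rho> * s) * cis t"
      unfolding q_def by (simp add: algebra_simps cis_mult)
    then have "norm (1 - q * (of_real \<rho> * cis t)) = norm (cis y - of_real (\<rho> * s) * cis t)"
      by (metis mult_1 norm_cis norm_mult)
    then show ?thesis unfolding u_def Re_Cayley[OF 1] poisson_def n using that s by (simp add: norm_mult)
  qed
  have a: "norm (of_real r * cis x) < 1" using r by (simp add: norm_mult)
  from has_integral_Re[OF Poisson_integral_formula[OF u a]]
  have "((\<lambda>t. poisson (of_real r * cis x) (cis t) * Re (u (cis t))) has_integral
      2 * pi * Re (u (of_real r * cis x))) {0..2 * pi}" by simp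
  moreover have "Re (u (cis t)) = poisson (of_real s * cis y) (cis t)" for t
    using Re_u[of 1 t] poisson_commute[OF s(1), of t y] by simp
  ultimately show ?thesis using Re_u[of r x] r by simp
qed

text \<open>The radius q = r s lies between r^2 and r. Hence 1 - q^2 is at most 1 - r^4, thus at
  most twice 1 - r^2, and moving from q to r at most doubles the distance to the boundary point. The
  constant is 8 = 2 * 4. Together with \<open>poisson_semigroup\<close> this is the composition
  hypothesis of the maximal inequality.\<close>

lemma poisson_le_of_le:
  assumes r: "0 \<le> r" "r \<le> s" "s < 1"
  shows "poisson (of_real (r * s) * cis x) (cis y) \<le> 8 * poisson (of_real r * cis x) (cis y)"
proof -
  define q where "q = r * s"
  have "r * s \<le> r * 1" using r by (intro mult_left_mono) auto
  then have q: "0 \<le> q" "q \<le> r" "r * r \<le> q" unfolding q_def using r by (auto intro: mult_left_mono)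
  have "q * q \<le> r * 1" using q r by (intro mult_mono) auto
  have n: "norm (of_real q * cis x) = q" "norm (of_real r * cis x) = r" using q r by (simp_all add: norm_mult)
  define X Y where "X = norm (cis y - of_real q * cis x)" and "Y = norm (cis y - of_real r * cis x)"
  have X: "0 < X" unfolding X_def using q r n by (intro norm_minus_cis_pos) simp
  have Y: "0 < Y" unfolding Y_def using r n by (intro norm_minus_cis_pos) simp
  have "1 - q \<le> X" unfolding X_def using norm_triangle_ineq2[of "cis y" "of_real q * cis x"] n by simp
  moreover have "Y \<le> X + (r - q)"
  proof -
    have "cis y - of_real r * cis x = (cis y - of_real q * cis x) - of_real (r - q) * cis x"
      by (simp add: algebra_simps)
    then have "Y \<le> X + norm (of_real (r - q) * cis x)" unfolding X_def Y_def by (metis norm_triangle_ineq4)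
    then show ?thesis using q by (simp add: norm_mult del: of_real_diff)
  qed
  ultimately have "Y \<le> 2 * X" using r by linarith
  then have "Y\<^sup>2 \<le> (2 * X)\<^sup>2" using Y by (intro power_mono) auto
  then have Y2: "Y\<^sup>2 \<le> 4 * X\<^sup>2" by (simp add: power_mult_distrib)
  have "(r\<^sup>2)\<^sup>2 \<le> q\<^sup>2" using q by (intro power_mono) (auto simp: power2_eq_square)
  then have "1 - q\<^sup>2 \<le> (1 - r\<^sup>2) * (1 + r\<^sup>2)" by (simp add: algebra_simps power2_eq_square)
  also have "\<dots> \<le> (1 - r\<^sup>2) * 2" using r by (intro mult_left_mono) (auto simp: power_le_one)
  finally have num: "1 - q\<^sup>2 \<le> 2 * (1 - r\<^sup>2)" by simp
  have "(1 - q\<^sup>2) / X\<^sup>2 \<le> 2 * (1 - r\<^sup>2) / X\<^sup>2" using num by (rule divide_right_mono) simp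
  also have "\<dots> \<le> 2 * (1 - r\<^sup>2) / (Y\<^sup>2 / 4)"
    using r X Y Y2 by (intro divide_left_mono) (auto simp: power_le_one)
  finally show ?thesis unfolding poisson_def q_def[symmetric] n X_def[symmetric] Y_def[symmetric] by simp
qed

text \<open>Moving from \<tau> e^(ix) to s e^(iy) displaces the point by at most 13 times 1 -
  \<tau>, hence the distance to any boundary point grows at most by the factor 14. The constant is
  392 = 2 * 14^2. It allows all points of a nontangential region to be replaced by dyadic points on
  one radius.\<close>

lemma poisson_nontangential:
  assumes \<tau>: "0 \<le> s" "s \<le> \<tau>" "\<tau> < 1" "1 - s \<le> 2 * (1 - \<tau>)" and d: "norm (cis x - cis y) \<le> 12 * (1 - \<tau>)"
  shows "poisson (of_real \<tau> * cis x) (cis t) \<le> 392 * poisson (of_real s * cis y) (cis t)"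
proof -
  have n: "norm (of_real \<tau> * cis x) = \<tau>" "norm (of_real s * cis y) = s" using \<tau> by (simp_all add: norm_mult)
  define X Y where "X = norm (cis t - of_real \<tau> * cis x)" and "Y = norm (cis t - of_real s * cis y)"
  have X: "0 < X" unfolding X_def using \<tau> n by (intro norm_minus_cis_pos) simp
  have Y: "0 < Y" unfolding Y_def using \<tau> n by (intro norm_minus_cis_pos) simp
  have "1 - \<tau> \<le> X" unfolding X_def using norm_triangle_ineq2[of "cis t" "of_real \<tau> * cis x"] n by simp
  moreover have "Y \<le> X + (12 * (1 - \<tau>) + (1 - \<tau>))"
  proof -
    have "cis t - of_real s * cis y = (cis t - of_real \<tau> * cis x) + (of_real \<tau> * (cis x - cis y) + of_real (\<tau> - s) * cis y)"
      by (simp add: algebra_simps)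
    then have "Y \<le> X + (norm (of_real \<tau> * (cis x - cis y)) + norm (of_real (\<tau> - s) * cis y))"
      unfolding X_def Y_def by (metis norm_triangle_mono norm_triangle_ineq order_refl)
    also have "norm (of_real \<tau> * (cis x - cis y)) \<le> 1 * (12 * (1 - \<tau>))"
      unfolding norm_mult using \<tau> d by (intro mult_mono) auto
    also have "norm (of_real (\<tau> - s) * cis y) \<le> 1 - \<tau>" unfolding norm_mult using \<tau> by (simp del: of_real_diff)
    finally show ?thesis by simp
  qed
  moreover have "12 * (1 - \<tau>) + (1 - \<tau>) = 13 * (1 - \<tau>)" by simp
  ultimately have "Y \<le> 14 * X" by linarith
  then have "Y\<^sup>2 \<le> (14 * X)\<^sup>2" using Y by (intro power_mono) auto
  then have Y2: "Y\<^sup>2 \<le> 196 * X\<^sup>2" by (simp add: power_mult_distrib)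
  have "s\<^sup>2 \<le> \<tau>\<^sup>2" "s\<^sup>2 \<le> 1" using \<tau> by (auto intro: power_mono simp: power_le_one)
  then have "(1 - \<tau>\<^sup>2) / X\<^sup>2 \<le> 2 * (1 - s\<^sup>2) / X\<^sup>2" by (intro divide_right_mono) auto
  also have "\<dots> \<le> 2 * (1 - s\<^sup>2) / (Y\<^sup>2 / 196)"
    using \<open>s\<^sup>2 \<le> 1\<close> X Y Y2 by (intro divide_left_mono) auto
  finally show ?thesis unfolding poisson_def n X_def[symmetric] Y_def[symmetric] by simp
qed

lemma norm_le_poisson_integral:
  fixes u :: "complex \<Rightarrow> complex"
  assumes u: "continuous_on (cball 0 1) u" "u holomorphic_on ball 0 1" and a: "norm a < 1"
  shows "2 * pi * norm (u a) \<le> integral {0..2 * pi} (\<lambda>t. poisson a (cis t) * norm (u (cis t)))"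
proof -
  note p = Poisson_integral_formula[OF u a]
  have cu: "continuous_on {0..2 * pi} (\<lambda>t. u (cis t))"
    by (intro continuous_on_compose2[OF u(1)] continuous_intros) auto
  have ne: "cmod (cis t - a) \<noteq> 0" for t using norm_minus_cis_pos[OF a, of t] by simp
  have "continuous_on {0..2 * pi} (\<lambda>t. poisson a (cis t))"
    unfolding poisson_def using ne by (intro continuous_intros) auto
  then have "(\<lambda>t. poisson a (cis t) * norm (u (cis t))) integrable_on {0..2 * pi}"
    by (intro integrable_continuous_real continuous_intros cu)
  moreover have "norm (integral {0..2 * pi} (\<lambda>t. of_real (poisson a (cis t)) * u (cis t))) = 2 * pi * norm (u a)"
    using integral_unique[OF p] by (simp add: norm_mult)
  ultimately show ?thesis
    using integral_norm_bound_integral[OF has_integral_integrable[OF p]] poisson_nonneg[OF a]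
    by (metis (no_types, lifting) abs_of_nonneg norm_mult norm_of_real order_refl)
qed

subsection \<open>Finite Blaschke products\<close>

lemma norm_minus_le_norm_one_minus_cnj:
  assumes "norm a \<le> 1" "norm z \<le> 1"
  shows "norm (z - a) \<le> norm (1 - cnj a * z)"
proof -
  have "(norm (1 - cnj a * z))\<^sup>2 - (norm (z - a))\<^sup>2 = (1 - (norm a)\<^sup>2) * (1 - (norm z)\<^sup>2)"
    unfolding cmod_power2 by (simp add: algebra_simps power2_eq_square)
  moreover have "0 \<le> (1 - (norm a)\<^sup>2) * (1 - (norm z)\<^sup>2)"
    using assms by (intro mult_nonneg_nonneg) (auto simp: power_le_one)
  ultimately have "(norm (z - a))\<^sup>2 \<le> (norm (1 - cnj a * z))\<^sup>2" by linarith
  then show ?thesis by (simp add: power2_le_iff_abs_le)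
qed

lemma norm_minus_eq_norm_one_minus_cnj:
  assumes "norm z = 1"
  shows "norm (z - a) = norm (1 - cnj a * z)"
proof -
  have "(norm (1 - cnj a * z))\<^sup>2 - (norm (z - a))\<^sup>2 = (1 - (norm a)\<^sup>2) * (1 - (norm z)\<^sup>2)"
    unfolding cmod_power2 by (simp add: algebra_simps power2_eq_square)
  then have "(norm (z - a))\<^sup>2 = (norm (1 - cnj a * z))\<^sup>2" using assms by simp
  then show ?thesis by (simp add: power2_eq_iff_nonneg)
qed

text \<open>A zero a of order m is removed by replacing \<open>(z - a) ^ m\<close> with
  \<open>(1 - cnj a * z) ^ m\<close>, that is, by dividing by a power of a Blaschke factor. The
  modulus is unchanged on the circle and does not decrease inside. The induction is on the number of
  distinct zeros, as each step removes a zero with its full order.\<close>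

lemma divide_out_zeros:
  assumes R: "1 < R" and g: "g holomorphic_on ball 0 R" and fin: "finite {z \<in> cball 0 1. g z = 0}"
    and sph: "\<And>z. norm z = 1 \<Longrightarrow> g z \<noteq> 0"
  obtains h where "h holomorphic_on ball 0 R" "\<And>z. norm z \<le> 1 \<Longrightarrow> h z \<noteq> 0"
    "\<And>z. norm z \<le> 1 \<Longrightarrow> norm (g z) \<le> norm (h z)" "\<And>z. norm z = 1 \<Longrightarrow> norm (h z) = norm (g z)"
proof -
  have "\<exists>h. h holomorphic_on ball 0 R \<and> (\<forall>z. norm z \<le> 1 \<longrightarrow> h z \<noteq> 0 \<and> norm (g z) \<le> norm (h z))
      \<and> (\<forall>z. norm z = 1 \<longrightarrow> norm (h z) = norm (g z))"
    using g fin sph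
  proof (induction "card {z \<in> cball 0 1. g z = 0}" arbitrary: g)
    case 0
    then have "{z \<in> cball 0 1. g z = 0} = {}" by simp
    then show ?case using 0 by (intro exI[of _ g]) auto
  next
    case (Suc n)
    have "{z \<in> cball 0 1. g z = 0} \<noteq> {}" using Suc.hyps(2) by (metis card.empty nat.distinct(1))
    then obtain a where a: "norm a \<le> 1" "g a = 0" by auto
    then have a1: "norm a < 1" using Suc.prems(3)[of a] by force
    have aR: "a \<in> ball 0 R" using a R by simp
    have "g 1 \<noteq> 0" using Suc.prems(3) by simp
    then have nc: "\<not> g constant_on ball 0 R"
      using a R unfolding constant_on_def by (metis dist_0_norm le_less_trans mem_ball norm_one)
    obtain k r m where k: "0 < m" "0 < r" "ball a r \<subseteq> ball 0 R" "k holomorphic_on ball a r"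
      "\<And>w. w \<in> ball a r \<Longrightarrow> g w = (w - a) ^ m * k w" "\<And>w. w \<in> ball a r \<Longrightarrow> k w \<noteq> 0"
      by (rule holomorphic_factor_zero_nonconstant[OF Suc.prems(1) open_ball connected_ball aR a(2) nc]) (rule that)
    \<comment> \<open>The quotient by \<open>(z - a) ^ m\<close> is patched at a with the value of
      the local cofactor; it is holomorphic away from a as a quotient and near a because it
      coincides with k.\<close>
    define l where "l z = (if z = a then k a else g z / (z - a) ^ m)" for z
    have "l holomorphic_on ball 0 R - {a}"
      by (rule holomorphic_transform[of "\<lambda>z. g z / (z - a) ^ m"])
        (auto intro!: holomorphic_intros holomorphic_on_subset[OF Suc.prems(1)] simp: l_def)
    moreover have "l holomorphic_on ball a r"
      by (rule holomorphic_transform[OF k(4)]) (use k in \<open>auto simp: l_def\<close>)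
    ultimately have "l holomorphic_on (ball 0 R - {a}) \<union> ball a r"
      by (intro holomorphic_on_Un) auto
    moreover have "(ball 0 R - {a}) \<union> ball a r = ball 0 R" using k(2,3) by auto
    ultimately have l: "l holomorphic_on ball 0 R" by simp
    have gl: "g z = (z - a) ^ m * l z" for z using a k(1) by (auto simp: l_def)
    have la: "l a \<noteq> 0" using k by (simp add: l_def)
    define g' where "g' z = (1 - cnj a * z) ^ m * l z" for z
    have g': "g' holomorphic_on ball 0 R" unfolding g'_def by (intro holomorphic_intros l)
    have ne: "1 - cnj a * z \<noteq> 0" if "norm z \<le> 1" for z
    proof
      assume "1 - cnj a * z = 0"
      then have "norm (cnj a * z) = 1" by (metis eq_iff_diff_eq_0 norm_one)
      then have "norm a * norm z = 1" by (simp add: norm_mult)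
      moreover have "norm a * norm z \<le> norm a * 1" using that by (intro mult_left_mono) auto
      ultimately show False using a1 by simp
    qed
    have eq: "{z \<in> cball 0 1. g' z = 0} = {z \<in> cball 0 1. g z = 0} - {a}"
      using ne la k(1) by (auto simp: g'_def gl)
    have "n = card {z \<in> cball 0 1. g' z = 0}"
      unfolding eq using Suc.hyps(2) Suc.prems(2) a by (subst card_Diff_singleton) auto
    moreover have "finite {z \<in> cball 0 1. g' z = 0}" unfolding eq using Suc.prems(2) by simp
    moreover have eqn: "norm (g' z) = norm (g z)" if "norm z = 1" for z
      unfolding g'_def gl norm_mult norm_power norm_minus_eq_norm_one_minus_cnj[OF that] ..
    moreover have "g' z \<noteq> 0" if "norm z = 1" for z using eqn[OF that] Suc.prems(3)[OF that] by auto
    ultimately obtain h where h: "h holomorphic_on ball 0 R"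
      "\<And>z. norm z \<le> 1 \<Longrightarrow> h z \<noteq> 0 \<and> norm (g' z) \<le> norm (h z)" "\<And>z. norm z = 1 \<Longrightarrow> norm (h z) = norm (g' z)"
      using Suc.hyps(1)[OF _ g'] by blast
    have "norm (g z) \<le> norm (g' z)" if "norm z \<le> 1" for z
      unfolding g'_def gl norm_mult norm_power
      using norm_minus_le_norm_one_minus_cnj[OF a(1) that] by (intro mult_right_mono power_mono) auto
    then show ?case using h eqn by (intro exI[of _ h]) (auto intro: order_trans)
  qed
  then show ?thesis using that by blast
qed

text \<open>Once the zeros are divided out, a holomorphic logarithm exists and every positive power
  of the modulus is the modulus of a holomorphic function. This replaces subharmonicity of
  \<open>|g| powr c\<close>: the Poisson formula for u majorises the power inside by its own
  boundary values, for arbitrarily small c.\<close>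

lemma holomorphic_majorant:
  assumes R: "1 < R" and g: "g holomorphic_on ball 0 R" and sph: "\<And>z. norm z = 1 \<Longrightarrow> g z \<noteq> 0"
    and c: "0 \<le> c"
  obtains u where "continuous_on (cball 0 1) u" "u holomorphic_on ball 0 1"
    "\<And>z. norm z \<le> 1 \<Longrightarrow> norm (g z) powr c \<le> norm (u z)" "\<And>z. norm z = 1 \<Longrightarrow> norm (u z) = norm (g z) powr c"
proof -
  have sub: "cball 0 1 \<subseteq> ball (0::complex) R" using R by auto
  have fin: "finite {z \<in> cball 0 1. g z = 0}"
  proof (cases "g constant_on ball 0 R")
    case True
    then have eq: "g z = g 1" if "z \<in> cball 0 1" for z
      using that R unfolding constant_on_def by (metis dist_0_norm le_less_trans mem_ball mem_cball norm_one)
    have "g 1 \<noteq> 0" using sph by simp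
    then have "{z \<in> cball 0 1. g z = 0} = {}" using eq by (metis (mono_tags, lifting) empty_Collect_eq)
    then show ?thesis by (simp only: finite.emptyI)
  next
    case False
    then show ?thesis
      using holomorphic_compact_finite_zeros[OF g open_ball connected_ball compact_cball sub] by simp
  qed
  obtain h where h: "h holomorphic_on ball 0 R" "\<And>z. norm z \<le> 1 \<Longrightarrow> h z \<noteq> 0"
    "\<And>z. norm z \<le> 1 \<Longrightarrow> norm (g z) \<le> norm (h z)" "\<And>z. norm z = 1 \<Longrightarrow> norm (h z) = norm (g z)"
    using divide_out_zeros[OF R g fin sph] by blast
  define U where "U = ball 0 R \<inter> h -` (- {0})"
  have "open U" unfolding U_def
    by (intro continuous_open_preimage holomorphic_on_imp_continuous_on[OF h(1)]) auto
  moreover have "cball 0 1 \<subseteq> U" unfolding U_def using h(2) R by auto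
  ultimately obtain \<epsilon> where \<epsilon>: "0 < \<epsilon>" "(\<Union>z\<in>cball 0 1. ball z \<epsilon>) \<subseteq> U"
    using compact_subset_open_imp_ball_epsilon_subset[OF compact_cball] by metis
  \<comment> \<open>A point outside the closed disc is compared with its projection
    \<open>sgn z\<close> to the circle. A zero-free disc of radius larger than 1 is wanted so that
    the logarithm, and with it u, is continuous up to the circle.\<close>
  have "ball 0 (1 + \<epsilon>) \<subseteq> (\<Union>z\<in>cball 0 1. ball z \<epsilon> :: complex set)"
  proof
    fix z :: complex assume z: "z \<in> ball 0 (1 + \<epsilon>)"
    show "z \<in> (\<Union>z\<in>cball 0 1. ball z \<epsilon>)"
    proof (cases "norm z \<le> 1")
      case True
      then show ?thesis using \<epsilon>(1) by (intro UN_I[of z]) auto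
    next
      case False
      have "z - sgn z = of_real (norm z - 1) * sgn z"
      proof -
        have "norm z \<noteq> 0" using False by auto
        then have "of_real (norm z) * sgn z = z" by (simp add: sgn_eq)
        then show ?thesis by (simp add: algebra_simps)
      qed
      then have "norm (z - sgn z) = norm z - 1" using False by (auto simp: norm_mult norm_sgn simp del: of_real_diff)
      then show ?thesis using z False by (intro UN_I[of "sgn z"]) (auto simp: dist_norm norm_minus_commute norm_sgn)
    qed
  qed
  then have b: "ball 0 (1 + \<epsilon>) \<subseteq> U" using \<epsilon>(2) by blast
  have "h holomorphic_on ball 0 (1 + \<epsilon>)" using b by (intro holomorphic_on_subset[OF h(1)]) (auto simp: U_def)
  moreover have "\<And>z. z \<in> ball 0 (1 + \<epsilon>) \<Longrightarrow> h z \<noteq> 0" using b by (auto simp: U_def)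
  moreover have "contractible (ball (0::complex) (1 + \<epsilon>))" by (intro convex_imp_contractible convex_ball)
  ultimately obtain l where l: "l holomorphic_on ball 0 (1 + \<epsilon>)" "\<And>z. z \<in> ball 0 (1 + \<epsilon>) \<Longrightarrow> h z = exp (l z)"
    using contractible_imp_holomorphic_log by blast
  define u where "u z = exp (of_real c * l z)" for z
  have u: "u holomorphic_on ball 0 (1 + \<epsilon>)" unfolding u_def by (intro holomorphic_intros l)
  have nu: "norm (u z) = norm (h z) powr c" if "norm z \<le> 1" for z
  proof -
    have "h z = exp (l z)" using that \<epsilon>(1) by (intro l) auto
    then show ?thesis unfolding u_def by (simp add: powr_def)
  qed
  have c1: "continuous_on (cball 0 1) u"
    using \<epsilon>(1) by (intro holomorphic_on_imp_continuous_on holomorphic_on_subset[OF u]) auto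
  have c2: "u holomorphic_on ball 0 1" using \<epsilon>(1) by (intro holomorphic_on_subset[OF u]) auto
  show ?thesis
  proof (rule that[OF c1 c2])
    fix z :: complex assume "norm z \<le> 1"
    then show "norm (g z) powr c \<le> norm (u z)" using nu h(3) c by (auto intro!: powr_mono2)
  next
    fix z :: complex assume "norm z = 1"
    then show "norm (u z) = norm (g z) powr c" using nu h(4) by simp
  qed
qed

subsection \<open>The nontangential maximal theorem\<close>

text \<open>Only the finitely many radii \<open>1 - (1/2) ^ k\<close> with \<open>k \<le> n\<close>
  occur, which keeps the kernels bounded, while the constant is free of n. The kernels are divided
  by 2 pi, so that the semigroup holds with constant 8, and 256 is the square of 2 * 8.\<close>

lemma poisson_maximal_inequality:
  fixes v :: "real \<Rightarrow> real" and n :: nat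
  assumes v: "v \<in> borel_measurable borel" "\<And>x. 0 \<le> v x" "\<And>x. v x \<le> A"
  obtains V :: "real \<Rightarrow> real" where "V \<in> borel_measurable borel" "\<And>x. 0 \<le> V x"
    "\<And>k x. k \<le> n \<Longrightarrow> (\<integral>\<^sup>+t\<in>{0..2*pi}. ennreal (poisson (of_real (1 - (1/2) ^ k) * cis x) (cis t) / (2 * pi) * v t) \<partial>lborel) \<le> ennreal (V x)"
    "(\<integral>\<^sup>+x\<in>{0..2*pi}. ennreal ((V x)\<^sup>2) \<partial>lborel) \<le> 256 * (\<integral>\<^sup>+t\<in>{0..2*pi}. ennreal ((v t)\<^sup>2) \<partial>lborel)"
proof -
  define M where "M = restrict_space lborel {0..2*pi}"
  define r where "r k = 1 - (1/2::real) ^ k" for k :: nat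
  have r: "0 \<le> r k" "r k < 1" for k unfolding r_def by (auto simp: half_power_le_1)
  have r_mono: "j \<le> k \<Longrightarrow> r j \<le> r k" for j k unfolding r_def by (simp add: power_decreasing)
  define K where "K k x t = ennreal (poisson (of_real (r k) * cis x) (cis t) / (2 * pi))" for k x t
  have p0: "0 \<le> poisson (of_real (r k) * cis x) (cis t)" for k x t
    using r by (intro poisson_nonneg) (simp add: norm_mult)
  have fin: "finite_measure M"
    unfolding M_def by (intro finite_measureI) (simp add: space_restrict_space emeasure_restrict_space)
  have sp: "space M = {0..2*pi}" unfolding M_def by (simp add: space_restrict_space)
  have id: "(\<lambda>x. x) \<in> borel_measurable M" unfolding M_def by (intro measurable_restrict_space1) simp
  have Kb: "(\<lambda>p. K k (fst p) (snd p)) \<in> borel_measurable (borel \<Otimes>\<^sub>M borel)" for k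
  proof -
    have ne: "cmod (cis t - of_real (r k) * cis x) \<noteq> 0" for x t
      using norm_minus_cis_pos[of "of_real (r k) * cis x" t] r by (simp add: norm_mult)
    have "continuous_on UNIV (\<lambda>p. poisson (of_real (r k) * cis (fst p)) (cis (snd p)) / (2 * pi))"
      unfolding poisson_def using ne by (intro continuous_intros) auto
    then have "(\<lambda>p. poisson (of_real (r k) * cis (fst p)) (cis (snd p)) / (2 * pi)) \<in> borel_measurable (borel \<Otimes>\<^sub>M borel)"
      unfolding borel_prod by (rule borel_measurable_continuous_onI)
    then show ?thesis unfolding K_def by measurable
  qed
  have KM: "(\<lambda>(x, y). K k x y) \<in> borel_measurable (M \<Otimes>\<^sub>M M)" for k
  proof -
    have "(\<lambda>p. (fst p, snd p)) \<in> measurable (M \<Otimes>\<^sub>M M) (borel \<Otimes>\<^sub>M borel)"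
      using measurable_compose[OF measurable_fst id] measurable_compose[OF measurable_snd id]
      by (intro measurable_Pair) auto
    from measurable_compose[OF this Kb[of k]] show ?thesis by (simp add: case_prod_beta')
  qed
  have vM: "(\<lambda>t. ennreal (v t)) \<in> borel_measurable M"
    using measurable_compose[OF id v(1)] by simp
  have sym: "K k x y = K k y x" for k x y unfolding K_def using poisson_commute[OF r(1)[of k], of x y] by simp
  have KB: "K k x y \<le> ennreal (\<Sum>k\<le>n. 1 / (1 - r k)\<^sup>2)" if kn: "k \<le> n" for k x y
  proof -
    have n: "norm (of_real (r k) * cis x) = r k" using r by (simp add: norm_mult)
    have "1 - r k \<le> norm (cis y - of_real (r k) * cis x)"
      using norm_triangle_ineq2[of "cis y" "of_real (r k) * cis x"] n by simp
    then have "(1 - r k)\<^sup>2 \<le> (norm (cis y - of_real (r k) * cis x))\<^sup>2" using r[of k] by (intro power_mono) auto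
    then have "poisson (of_real (r k) * cis x) (cis y) \<le> 1 / (1 - r k)\<^sup>2"
      unfolding poisson_def n using r[of k] by (intro frac_le) (auto simp: power_le_one)
    moreover have "poisson (of_real (r k) * cis x) (cis y) / (2 * pi) \<le> poisson (of_real (r k) * cis x) (cis y) / 1"
      using p0[of k x y] pi_gt3 by (intro divide_left_mono) auto
    moreover have "1 / (1 - r k)\<^sup>2 \<le> (\<Sum>k\<le>n. 1 / (1 - r k)\<^sup>2)"
      using kn by (intro member_le_sum[where f="\<lambda>k. 1 / (1 - r k)\<^sup>2"]) auto
    ultimately show ?thesis unfolding K_def by (intro ennreal_leI) linarith
  qed
  have semi: "(\<integral>\<^sup>+z. K j x z * K k z y \<partial>M) \<le> ennreal 8 * K j x y" if jk: "j \<le> k" for j k x y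
  proof -
    have "((\<lambda>t. poisson (of_real (r j) * cis x) (cis t) * poisson (of_real (r k) * cis y) (cis t))
           has_integral 2 * pi * poisson (of_real (r j * r k) * cis x) (cis y)) {0..2 * pi}"
      by (rule poisson_semigroup) (use r in auto)
    then have hi0: "((\<lambda>t. poisson (of_real (r j) * cis x) (cis t) * poisson (of_real (r k) * cis y) (cis t) / (2 * pi * (2 * pi)))
           has_integral 2 * pi * poisson (of_real (r j * r k) * cis x) (cis y) / (2 * pi * (2 * pi))) {0..2 * pi}"
      by (rule has_integral_divide)
    have hi: "((\<lambda>t. poisson (of_real (r j) * cis x) (cis t) / (2 * pi) * (poisson (of_real (r k) * cis t) (cis y) / (2 * pi)))
           has_integral poisson (of_real (r j * r k) * cis x) (cis y) / (2 * pi)) {0..2 * pi}"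
      unfolding poisson_commute[OF r(1)[of k], of _ y]
      by (rule has_integral_eq_rhs[OF has_integral_eq[OF _ hi0]]) simp_all
    have "(\<integral>\<^sup>+z. K j x z * K k z y \<partial>M) = (\<integral>\<^sup>+t\<in>{0..2*pi}. ennreal (poisson (of_real (r j) * cis x) (cis t) / (2 * pi) * (poisson (of_real (r k) * cis t) (cis y) / (2 * pi))) \<partial>lborel)"
      unfolding M_def K_def using p0
      by (subst nn_integral_restrict_space) (auto intro!: nn_integral_cong simp: ennreal_mult[symmetric])
    also have "\<dots> = ennreal (poisson (of_real (r j * r k) * cis x) (cis y) / (2 * pi))"
      by (rule nn_integral_has_integral_lebesgue'[OF _ hi]) (use p0 in auto)
    also have "\<dots> \<le> ennreal (8 * (poisson (of_real (r j) * cis x) (cis y) / (2 * pi)))"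
      using poisson_le_of_le[OF r(1) r_mono[OF jk] r(2), of x y] by (intro ennreal_leI) (simp add: field_simps)
    also have "\<dots> = ennreal 8 * K j x y" unfolding K_def using p0 by (subst ennreal_mult) auto
    finally show ?thesis .
  qed
  define B where "B = (\<Sum>k\<le>n. 1 / (1 - r k)\<^sup>2)"
  have B: "K k x y \<le> ennreal B" if "k \<le> n" for k x y
    unfolding B_def using KB[OF that] .
  \<comment> \<open>The general inequality asks for one bound and the composition property for all
    indices. Freezing the index at n provides both without changing the supremum over
    \<open>k \<le> n\<close>.\<close>
  define K' where "K' k = K (min n k)" for k
  define V0 where "V0 = (\<lambda>x. SUP k\<in>{..n}. \<integral>\<^sup>+y. K' k x y * ennreal (v y) \<partial>M)"
  have TT: "(\<integral>\<^sup>+x. V0 x ^ 2 \<partial>M) \<le> (ennreal (2 * 8))\<^sup>2 * (\<integral>\<^sup>+y. ennreal (v y) ^ 2 \<partial>M)"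
  proof (rule TT_star_maximal_inequality[where K=K' and n=n])
    show "finite_measure M" by fact
    show "(\<lambda>(x, y). K' k x y) \<in> borel_measurable (M \<Otimes>\<^sub>M M)" for k unfolding K'_def by (rule KM)
    show "K' k x y = K' k y x" for k x y unfolding K'_def by (rule sym)
    show "K' k x y \<le> ennreal B" for k x y unfolding K'_def by (rule B) simp
    show "ennreal (v y) \<le> ennreal A" for y by (intro ennreal_leI v)
    show "(\<integral>\<^sup>+z. K' j x z * K' k z y \<partial>M) \<le> ennreal 8 * K' j x y" if "j \<le> k" for j k x y
      unfolding K'_def using that by (intro semi) auto
  qed (use vM in \<open>auto simp: V0_def\<close>)
  have V0b: "V0 x \<le> ennreal (B * A * (2 * pi))" for x
    unfolding V0_def
  proof (rule SUP_least)
    fix k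
    have A0: "0 \<le> A" using v(2,3)[of 0] by linarith
    have "(\<integral>\<^sup>+y. K' k x y * ennreal (v y) \<partial>M) \<le> (\<integral>\<^sup>+y. ennreal B * ennreal A \<partial>M)"
      using v unfolding K'_def by (intro nn_integral_mono mult_mono B ennreal_leI) auto
    also have "\<dots> = ennreal B * ennreal A * ennreal (2 * pi)"
      unfolding M_def by (simp add: space_restrict_space emeasure_restrict_space)
    also have "\<dots> = ennreal (max 0 B * A * (2 * pi))"
      using A0 by (simp add: ennreal_mult max_def ennreal_neg)
    also have "max 0 B = B"
    proof -
      have "0 < K 0 0 0" unfolding K_def r_def poisson_def by simp
      then have "0 < ennreal B" using B[of 0 0 0] by (meson le0 order_less_le_trans)
      then show ?thesis by simp
    qed
    finally show "(\<integral>\<^sup>+y. K' k x y * ennreal (v y) \<partial>M) \<le> ennreal (B * A * (2 * pi))" .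
  qed
  have V0m: "V0 \<in> borel_measurable borel"
  proof -
    interpret finite_measure M by (rule fin)
    have "(\<lambda>(x, y). K' k x y * ennreal (v y)) \<in> borel_measurable (borel \<Otimes>\<^sub>M M)" for k
    proof -
      have "(\<lambda>p. (fst p, snd p)) \<in> measurable (borel \<Otimes>\<^sub>M M) (borel \<Otimes>\<^sub>M borel)"
        using measurable_compose[OF measurable_snd id] by (intro measurable_Pair) auto
      from measurable_compose[OF this Kb[of "min n k"]] measurable_compose[OF measurable_snd vM]
      show ?thesis unfolding K'_def case_prod_beta' by (intro borel_measurable_times_ennreal) auto
    qed
    then show ?thesis unfolding V0_def by (intro borel_measurable_SUP borel_measurable_nn_integral) auto
  qed
  define V where "V x = enn2real (V0 x)" for x
  have V0V: "V0 x = ennreal (V x)" for x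
  proof -
    have "V0 x < top" using order_le_less_trans[OF V0b[of x] ennreal_less_top] .
    then show ?thesis unfolding V_def by simp
  qed
  show ?thesis
  proof (rule that[of V])
    show "V \<in> borel_measurable borel" unfolding V_def using V0m by measurable
    show "0 \<le> V x" for x unfolding V_def by simp
    show "(\<integral>\<^sup>+t\<in>{0..2*pi}. ennreal (poisson (of_real (1 - (1/2) ^ k) * cis x) (cis t) / (2 * pi) * v t) \<partial>lborel) \<le> ennreal (V x)"
      if k: "k \<le> n" for k x
    proof -
      have "(\<integral>\<^sup>+t\<in>{0..2*pi}. ennreal (poisson (of_real (1 - (1/2) ^ k) * cis x) (cis t) / (2 * pi) * v t) \<partial>lborel)
        = (\<integral>\<^sup>+y. K' k x y * ennreal (v y) \<partial>M)"
        unfolding M_def K'_def K_def r_def[symmetric] using p0 v k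
        by (subst nn_integral_restrict_space) (auto intro!: nn_integral_cong simp: ennreal_mult[symmetric])
      also have "\<dots> \<le> V0 x" unfolding V0_def using k by (intro SUP_upper) auto
      finally show ?thesis using V0V by simp
    qed
    have "(\<integral>\<^sup>+x\<in>{0..2*pi}. ennreal ((V x)\<^sup>2) \<partial>lborel) = (\<integral>\<^sup>+x. V0 x ^ 2 \<partial>M)"
      unfolding M_def V0V by (subst nn_integral_restrict_space) (auto simp: V_def ennreal_power)
    also note TT
    also have "(\<integral>\<^sup>+y. ennreal (v y) ^ 2 \<partial>M) = (\<integral>\<^sup>+t\<in>{0..2*pi}. ennreal ((v t)\<^sup>2) \<partial>lborel)"
      unfolding M_def by (subst nn_integral_restrict_space) (auto simp: v ennreal_power)
    finally show "(\<integral>\<^sup>+x\<in>{0..2*pi}. ennreal ((V x)\<^sup>2) \<partial>lborel) \<le> 256 * (\<integral>\<^sup>+t\<in>{0..2*pi}. ennreal ((v t)\<^sup>2) \<partial>lborel)"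
      by (simp add: ennreal_power)
  qed
qed

lemma mean_p_nonneg: "0 \<le> mean_p p r f"
  unfolding mean_p_def by simp

lemma nn_integral_circle_eq_mean_p:
  assumes f: "f holomorphic_on ball 0 1" and r: "0 \<le> r" "r < 1" and p: "0 < p"
  shows "(\<integral>\<^sup>+\<theta>\<in>{0..2*pi}. ennreal (norm (f (of_real r * cis \<theta>)) powr p) \<partial>lborel) = ennreal (2 * pi * mean_p p r f powr p)"
proof -
  have c: "continuous_on UNIV (\<lambda>\<theta>. f (of_real r * cis \<theta>))"
    by (rule continuous_on_compose2[OF holomorphic_on_imp_continuous_on[OF f]])
      (use r in \<open>auto intro!: continuous_intros simp: norm_mult\<close>)
  then have c2: "continuous_on UNIV (\<lambda>\<theta>. norm (f (of_real r * cis \<theta>)) powr p)"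
    using p by (intro continuous_on_powr' continuous_intros) auto
  then have i: "(\<lambda>\<theta>. norm (f (of_real r * cis \<theta>)) powr p) integrable_on {0..2*pi}"
    by (intro integrable_continuous_real continuous_on_subset[OF c2]) auto
  have "(\<integral>\<^sup>+\<theta>\<in>{0..2*pi}. ennreal (norm (f (of_real r * cis \<theta>)) powr p) \<partial>lborel)
      = ennreal (integral {0..2*pi} (\<lambda>\<theta>. norm (f (of_real r * cis \<theta>)) powr p))"
    by (rule nn_integral_has_integral_lebesgue'[OF _ integrable_integral[OF i]])
      auto
  also have "integral {0..2*pi} (\<lambda>\<theta>. norm (f (of_real r * cis \<theta>)) powr p) = 2 * pi * mean_p p r f powr p"
    unfolding mean_p_def using p
    by (simp add: powr_powr Henstock_Kurzweil_Integration.integral_nonneg[OF i])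
  finally show ?thesis .
qed

text \<open>Any majorant will do, so the maximal function itself and its measurability need not be
  discussed. Regions are truncated at radius r, which leaves finitely many dyadic radii. The
  aperture 6 is wide enough for points e^(ix) and e^(iy) at distance at most 2^(1-k) when 1 - t
  exceeds 2^(-k-1).\<close>

definition nontangential_majorant :: "(complex \<Rightarrow> complex) \<Rightarrow> real \<Rightarrow> (real \<Rightarrow> real) \<Rightarrow> bool" where
  "nontangential_majorant f r G \<longleftrightarrow> (\<forall>x. 0 \<le> G x) \<and>
     (\<forall>t x y. 0 \<le> t \<longrightarrow> t \<le> r \<longrightarrow> norm (cis x - cis y) \<le> 6 * (1 - t) \<longrightarrow> norm (f (of_real t * cis x)) \<le> G y)"

lemma hardy_maximal:
  assumes p: "0 < p"
  obtains C where "0 < C" "\<And>f H r0. f holomorphic_on ball 0 1 \<Longrightarrow> (\<And>r. 0 \<le> r \<Longrightarrow> r < 1 \<Longrightarrow> mean_p p r f \<le> H) \<Longrightarrow>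
    0 \<le> r0 \<Longrightarrow> r0 < 1 \<Longrightarrow> \<exists>G\<in>borel_measurable borel. nontangential_majorant f r0 G \<and>
      (\<integral>\<^sup>+x\<in>{0..2*pi}. ennreal (G x powr p) \<partial>lborel) \<le> ennreal (C * H powr p)"
proof -
  define C where "C = 392\<^sup>2 * 256 * (2 * pi)"
  have "\<exists>G\<in>borel_measurable borel. nontangential_majorant f r0 G \<and>
      (\<integral>\<^sup>+x\<in>{0..2*pi}. ennreal (G x powr p) \<partial>lborel) \<le> ennreal (C * H powr p)"
    if f: "f holomorphic_on ball 0 1" and H: "\<And>r. 0 \<le> r \<Longrightarrow> r < 1 \<Longrightarrow> mean_p p r f \<le> H" and r0: "0 \<le> r0" "r0 < 1" for f H r0
  proof (cases "\<forall>z\<in>ball 0 1. f z = 0")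
    case True
    have "f (of_real t * cis x) = 0" if "0 \<le> t" "t \<le> r0" for t x
      using that True r0 by (auto simp: norm_mult)
    then show ?thesis using p unfolding C_def nontangential_majorant_def
      by (intro bexI[of _ "\<lambda>_. 0"]) auto
  next
    case False
    \<comment> \<open>For \<rho> > \<rho>0 and \<open>t \<le> r0\<close> one has
      \<open>t / \<rho> \<le> t * (3 - t) / 2 \<le> (1 + t) / 2\<close>. Hence the dilated point
      \<tau> = t / \<rho> satisfies \<open>1 - t \<le> 2 * (1 - \<tau>)\<close>, and the aperture 6
      becomes 12 after dilation.\<close>
    define \<rho>0 where "\<rho>0 = 2 / (3 - r0)"
    define \<rho>1 where "\<rho>1 = (1 + \<rho>0) / 2"
    have \<rho>0: "0 < \<rho>0" "\<rho>0 < 1" unfolding \<rho>0_def using r0 by auto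
    have \<rho>1: "\<rho>0 < \<rho>1" "\<rho>1 < 1" unfolding \<rho>1_def using \<rho>0 by auto
    have finz: "finite {z \<in> cball 0 \<rho>1. f z = 0}"
    proof (cases "f constant_on ball 0 1")
      case True
      then obtain c where c: "\<And>z. z \<in> ball 0 1 \<Longrightarrow> f z = c" unfolding constant_on_def by blast
      have "{z \<in> cball 0 \<rho>1. f z = 0} = {}"
      proof -
        have "c \<noteq> 0" using False c by auto
        moreover have "f z = c" if "z \<in> cball 0 \<rho>1" for z using that \<rho>1 by (intro c) auto
        ultimately show ?thesis by blast
      qed
      then show ?thesis by (simp only: finite.emptyI)
    next
      case False
      then show ?thesis using \<rho>1
        by (intro holomorphic_compact_finite_zeros[OF f open_ball connected_ball compact_cball]) auto
    qed
    \<comment> \<open>Only finitely many radii below \<rho>1 carry zeros, so a circle without zeros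
      can be chosen in the interval.\<close>
    have "infinite ({\<rho>0<..<\<rho>1} - norm ` {z \<in> cball 0 \<rho>1. f z = 0})"
      using finz \<rho>1 by (intro Diff_infinite_finite) auto
    then obtain \<rho> where \<rho>': "\<rho> \<in> {\<rho>0<..<\<rho>1} - norm ` {z \<in> cball 0 \<rho>1. f z = 0}"
      using infinite_imp_nonempty by blast
    then have \<rho>: "\<rho>0 < \<rho>" "\<rho> < \<rho>1" by auto
    have fz: "f z \<noteq> 0" if "norm z = \<rho>" for z
    proof
      assume "f z = 0"
      then have "z \<in> {z \<in> cball 0 \<rho>1. f z = 0}" using that \<rho> by simp
      then show False using \<rho>' that by blast
    qed
    have \<rho>01: "0 < \<rho>" "\<rho> < 1" using \<rho> \<rho>0 \<rho>1 by auto
    define g where "g z = f (of_real \<rho> * z)" for z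
    have R: "1 < 1 / \<rho>" using \<rho>01 by simp
    have g: "g holomorphic_on ball 0 (1 / \<rho>)"
      unfolding g_def
      by (rule holomorphic_on_compose_gen[OF _ f, unfolded o_def])
        (use \<rho>01 in \<open>auto intro!: holomorphic_intros simp: norm_mult field_simps\<close>)
    have gs: "g z \<noteq> 0" if "norm z = 1" for z
      unfolding g_def using \<rho>01 that by (intro fz) (simp add: norm_mult)
    obtain u where u: "continuous_on (cball 0 1) u" "u holomorphic_on ball 0 1"
      "\<And>z. norm z \<le> 1 \<Longrightarrow> norm (g z) powr (p / 2) \<le> norm (u z)"
      "\<And>z. norm z = 1 \<Longrightarrow> norm (u z) = norm (g z) powr (p / 2)"
      using holomorphic_majorant[OF R g gs, of "p / 2"] p by auto
    define v where "v t = norm (u (cis t))" for t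
    have vc: "continuous_on UNIV v"
      unfolding v_def by (intro continuous_intros continuous_on_compose2[OF u(1)]) auto
    have "compact (u ` cball 0 1)" by (intro compact_continuous_image u compact_cball)
    then have "bounded (u ` cball 0 1)" by (rule compact_imp_bounded)
    then obtain A where A': "\<forall>x\<in>u ` cball 0 1. norm x \<le> A" unfolding bounded_iff by (rule exE)
    have A: "norm (u z) \<le> A" if "z \<in> cball 0 1" for z by (rule bspec[OF A']) (rule imageI[OF that])
    have vA: "v t \<le> A" for t unfolding v_def by (rule A) simp
    have v0: "0 \<le> v t" for t unfolding v_def by simp
    have r0\<rho>: "r0 < \<rho>"
    proof -
      have "0 \<le> (1 - r0) * (2 - r0)" using r0 by (intro mult_nonneg_nonneg) auto
      then have "r0 * (3 - r0) \<le> 2" by (simp add: algebra_simps)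
      then have "r0 \<le> \<rho>0" unfolding \<rho>0_def using r0 by (simp add: field_simps)
      then show ?thesis using \<rho> by linarith
    qed
    \<comment> \<open>This n makes the dyadic radii up to level n exhaust all dilated radii t /
      \<rho> with \<open>t \<le> r0\<close>.\<close>
    obtain n where n: "(1/2) ^ n < 1 - r0 / \<rho>"
      using real_arch_pow_inv[of "1 - r0 / \<rho>" "1/2"] r0\<rho> \<rho>01 by auto
    obtain V where V: "V \<in> borel_measurable borel" "\<And>x. 0 \<le> V x"
      "\<And>k x. k \<le> n \<Longrightarrow> (\<integral>\<^sup>+t\<in>{0..2*pi}. ennreal (poisson (of_real (1 - (1/2) ^ k) * cis x) (cis t) / (2 * pi) * v t) \<partial>lborel) \<le> ennreal (V x)"
      "(\<integral>\<^sup>+x\<in>{0..2*pi}. ennreal ((V x)\<^sup>2) \<partial>lborel) \<le> 256 * (\<integral>\<^sup>+t\<in>{0..2*pi}. ennreal ((v t)\<^sup>2) \<partial>lborel)"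
      by (rule poisson_maximal_inequality[OF borel_measurable_continuous_onI[OF vc] v0 vA, of n]) (rule that)
    define G where "G x = (392 * V x) powr (2 / p)" for x
    have G2: "G x powr p = 392\<^sup>2 * (V x)\<^sup>2" for x
      unfolding G_def using p V(2)[of x] by (simp add: powr_powr powr_mult power2_eq_square)
    show ?thesis unfolding nontangential_majorant_def
    proof (intro bexI conjI allI impI)
      show "G \<in> borel_measurable borel" unfolding G_def using V(1) by measurable
      show "0 \<le> G x" for x unfolding G_def by simp
      have "(\<integral>\<^sup>+x\<in>{0..2*pi}. ennreal (G x powr p) \<partial>lborel) = (\<integral>\<^sup>+x. ennreal (392\<^sup>2) * (ennreal ((V x)\<^sup>2) * indicator {0..2*pi} x) \<partial>lborel)"
        unfolding G2 by (intro nn_integral_cong) (simp add: ennreal_mult mult.assoc)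
      also have "\<dots> = ennreal (392\<^sup>2) * (\<integral>\<^sup>+x\<in>{0..2*pi}. ennreal ((V x)\<^sup>2) \<partial>lborel)"
        using V(1) by (intro nn_integral_cmult borel_measurable_times_ennreal) auto
      also have "\<dots> \<le> ennreal (392\<^sup>2) * (256 * (\<integral>\<^sup>+t\<in>{0..2*pi}. ennreal ((v t)\<^sup>2) \<partial>lborel))"
        by (intro mult_left_mono V) auto
      also have "(\<integral>\<^sup>+t\<in>{0..2*pi}. ennreal ((v t)\<^sup>2) \<partial>lborel) = (\<integral>\<^sup>+t\<in>{0..2*pi}. ennreal (norm (f (of_real \<rho> * cis t)) powr p) \<partial>lborel)"
        unfolding v_def using p by (intro nn_integral_cong) (simp add: u(4) g_def powr_powr power2_eq_square flip: powr_add)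
      also have "\<dots> = ennreal (2 * pi * mean_p p \<rho> f powr p)"
        using \<rho>01 by (intro nn_integral_circle_eq_mean_p f p) auto
      also have "ennreal (392\<^sup>2) * (256 * ennreal (2 * pi * mean_p p \<rho> f powr p)) = ennreal (C * mean_p p \<rho> f powr p)"
        unfolding C_def by (simp add: ennreal_mult mult.assoc)
      also have "\<dots> \<le> ennreal (C * H powr p)"
        unfolding C_def using \<rho>01 p H[of \<rho>]
        by (intro ennreal_leI mult_left_mono powr_mono2) (auto simp: mean_p_nonneg)
      finally show "(\<integral>\<^sup>+x\<in>{0..2*pi}. ennreal (G x powr p) \<partial>lborel) \<le> ennreal (C * H powr p)" .
      fix t x y :: real assume t: "0 \<le> t" "t \<le> r0" and d: "norm (cis x - cis y) \<le> 6 * (1 - t)"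
      define \<tau> where "\<tau> = t / \<rho>"
      have \<tau>: "0 \<le> \<tau>" "\<tau> \<le> r0 / \<rho>" unfolding \<tau>_def using t \<rho>01 by (auto intro: divide_right_mono)
      have \<tau>1: "\<tau> < 1 - (1/2) ^ n" using \<tau> n by linarith
      then have \<tau>lt: "\<tau> < 1" using half_power_le_1(1)[of n] by (smt (verit) zero_le_power half_gt_zero_iff)
      have "1 - t \<le> 2 * (1 - \<tau>)"
      proof -
        have "1 / \<rho> \<le> 1 / \<rho>0" using \<rho>(1) \<rho>0(1) by (intro frac_le) auto
        also have "1 / \<rho>0 = (3 - r0) / 2" unfolding \<rho>0_def by simp
        finally have "1 / \<rho> \<le> (3 - r0) / 2" .
        then have "t * (1 / \<rho>) \<le> t * ((3 - r0) / 2)" using t by (intro mult_left_mono) auto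
        also have "\<dots> \<le> t * ((3 - t) / 2)" using t by (intro mult_left_mono) auto
        also have "\<dots> \<le> (1 + t) / 2"
          using zero_le_power2[of "1 - t"] by (simp add: power2_eq_square algebra_simps)
        finally show ?thesis unfolding \<tau>_def by simp
      qed
      then have "6 * (1 - t) \<le> 12 * (1 - \<tau>)" by simp
      with d have d': "norm (cis x - cis y) \<le> 12 * (1 - \<tau>)" by (rule order_trans)
      obtain k where k: "k < n" "1 - (1/2) ^ k \<le> \<tau>" "\<tau> < 1 - (1/2) ^ Suc k"
        using ex_dyadic_block[OF \<tau>(1) \<tau>1] by blast
      have a: "norm (of_real \<tau> * cis x) < 1" using \<tau> \<tau>lt by (simp add: norm_mult)
      have pm: "poisson (of_real \<tau> * cis x) (cis s) \<le> 392 * poisson (of_real (1 - (1/2) ^ k) * cis y) (cis s)" for s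
        by (rule poisson_nontangential) (use k \<tau>lt d' half_power_le_1(2)[of k] in auto)
      define b where "b = of_real (1 - (1/2) ^ k) * cis y"
      have b: "norm b < 1" unfolding b_def norm_mult norm_of_real norm_cis
        using half_power_le_1(2)[of k] by simp
      have pc: "continuous_on UNIV (\<lambda>s. poisson a (cis s))" if "norm a < 1" for a
      proof -
        have "cmod (cis s - a) \<noteq> 0" for s using norm_minus_cis_pos[OF that, of s] by simp
        then show ?thesis unfolding poisson_def by (intro continuous_intros) auto
      qed
      have ib: "(\<lambda>s. poisson b (cis s) / (2 * pi) * v s) integrable_on {0..2*pi}"
        by (intro integrable_continuous_real continuous_intros continuous_on_subset[OF pc[OF b]] continuous_on_subset[OF vc]) auto
      have ia: "(\<lambda>s. poisson (of_real \<tau> * cis x) (cis s) * v s) integrable_on {0..2*pi}"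
        by (intro integrable_continuous_real continuous_intros continuous_on_subset[OF pc[OF a]] continuous_on_subset[OF vc]) auto
      have "2 * pi * norm (u (of_real \<tau> * cis x)) \<le> integral {0..2*pi} (\<lambda>s. poisson (of_real \<tau> * cis x) (cis s) * v s)"
        unfolding v_def by (rule norm_le_poisson_integral[OF u(1,2) a])
      also have "\<dots> \<le> integral {0..2*pi} (\<lambda>s. (392 * (2 * pi)) * (poisson b (cis s) / (2 * pi) * v s))"
      proof (rule integral_le[OF ia])
        show "(\<lambda>s. (392 * (2 * pi)) * (poisson b (cis s) / (2 * pi) * v s)) integrable_on {0..2*pi}"
          using integrable_on_cmult_left[OF ib, of "392 * (2 * pi)"] by simp
        fix s
        show "poisson (of_real \<tau> * cis x) (cis s) * v s \<le> (392 * (2 * pi)) * (poisson b (cis s) / (2 * pi) * v s)"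
          using mult_right_mono[OF pm[of s], of "v s"] unfolding v_def b_def[symmetric] by (simp add: mult_ac)
      qed
      also have "\<dots> = 392 * (2 * pi) * integral {0..2*pi} (\<lambda>s. poisson b (cis s) / (2 * pi) * v s)"
        by (rule integral_mult_right)
      finally have 1: "norm (u (of_real \<tau> * cis x)) \<le> 392 * integral {0..2*pi} (\<lambda>s. poisson b (cis s) / (2 * pi) * v s)"
        by (simp add: field_simps)
      have "ennreal (integral {0..2*pi} (\<lambda>s. poisson b (cis s) / (2 * pi) * v s))
         = (\<integral>\<^sup>+s\<in>{0..2*pi}. ennreal (poisson b (cis s) / (2 * pi) * v s) \<partial>lborel)"
        by (rule nn_integral_has_integral_lebesgue'[OF _ integrable_integral[OF ib], symmetric])
          (use poisson_nonneg[OF b] in \<open>auto simp: v_def\<close>)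
      also have "\<dots> \<le> ennreal (V y)" unfolding b_def using k(1) by (intro V(3)) simp
      finally have "integral {0..2*pi} (\<lambda>s. poisson b (cis s) / (2 * pi) * v s) \<le> V y"
        using V(2)[of y] by simp
      with 1 have 2: "norm (u (of_real \<tau> * cis x)) \<le> 392 * V y" by linarith
      have "norm (f (of_real t * cis x)) = norm (g (of_real \<tau> * cis x))"
        unfolding g_def \<tau>_def using \<rho>01 by simp
      also have "\<dots> = (norm (g (of_real \<tau> * cis x)) powr (p / 2)) powr (2 / p)"
        using p by (simp add: powr_powr)
      also have "\<dots> \<le> (392 * V y) powr (2 / p)"
        using p a 2 u(3)[of "of_real \<tau> * cis x"] by (intro powr_mono2) auto
      finally show "norm (f (of_real t * cis x)) \<le> G y" unfolding G_def .
    qed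
  qed
  moreover have "0 < C" unfolding C_def by simp
  ultimately show ?thesis using that by blast
qed

subsection \<open>The operator as a coefficient multiplier\<close>

lemma norm_one_minus_cis: "norm (1 - cis t) = 2 * \<bar>sin (t / 2)\<bar>"
proof -
  have "(norm (1 - cis t))\<^sup>2 = (1 - cos t)\<^sup>2 + (sin t)\<^sup>2" by (simp add: cmod_power2)
  also have "\<dots> = 2 - 2 * cos t" by (simp add: power2_eq_square algebra_simps)
  also have "\<dots> = (2 * \<bar>sin (t / 2)\<bar>)\<^sup>2" using cos_double_sin[of "t / 2"] by (simp add: power_mult_distrib)
  finally show ?thesis by (rule power2_eq_imp_eq) simp_all
qed

lemma norm_cis_minus_cis_le: "norm (cis x - cis y) \<le> \<bar>x - y\<bar>"
proof -
  have "cis x - cis y = cis y * - (1 - cis (x - y))" by (simp add: algebra_simps cis_mult)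
  then have "norm (cis x - cis y) = 2 * \<bar>sin ((x - y) / 2)\<bar>"
    by (metis norm_mult norm_cis mult_1 norm_minus_cancel norm_one_minus_cis)
  then show ?thesis using abs_sin_x_le_abs_x[of "(x - y) / 2"] by simp
qed

text \<open>Below pi/3 the cosine is at least 1/2 and x is at most tan x; above pi/3 the sine is at
  least half the square root of 3. It converts a bound on |1 - e^(it)| into a bound on the
  angle.\<close>

lemma sin_ge_third:
  assumes "0 \<le> x" "x \<le> pi / 2"
  shows "x / 3 \<le> sin x"
proof (cases "x \<le> pi / 3")
  case True
  have "1 / 2 \<le> cos x" using cos_monotone_0_pi_le[of x "pi / 3"] assms True by (simp add: cos_60)
  moreover have "x \<le> tan x" using abs_tan_ge[of x] assms True pi_gt_zero tan_pos_pi2_le[of x] by simp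
  ultimately have "x * (1 / 2) \<le> tan x * cos x" using assms by (intro mult_mono) auto
  moreover have "tan x * cos x = sin x" using \<open>1 / 2 \<le> cos x\<close> by (simp add: tan_def)
  ultimately show ?thesis using assms by simp
next
  case False
  have "sin (pi / 3) \<le> sin x" using False assms by (intro sin_monotone_2pi_le) auto
  moreover have "3 / 2 \<le> sqrt 3" by (rule real_le_rsqrt) (simp add: power2_eq_square)
  ultimately show ?thesis using assms pi_less_4 by (simp add: sin_60)
qed

lemma emeasure_near_one_le:
  assumes "0 \<le> \<epsilon>"
  shows "emeasure lborel {t \<in> {0..2*pi}. norm (1 - cis t) \<le> \<epsilon>} \<le> ennreal (6 * \<epsilon>)"
proof -
  have "{t \<in> {0..2*pi}. norm (1 - cis t) \<le> \<epsilon>} \<subseteq> {0..3 * \<epsilon>} \<union> {2 * pi - 3 * \<epsilon>..2 * pi}"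
  proof safe
    fix t assume t: "t \<in> {0..2*pi}" "norm (1 - cis t) \<le> \<epsilon>" "t \<notin> {2 * pi - 3 * \<epsilon>..2 * pi}"
    show "t \<in> {0..3 * \<epsilon>}"
    proof (cases "t \<le> pi")
      case True
      then show ?thesis using t sin_ge_third[of "t / 2"] unfolding norm_one_minus_cis by auto
    next
      case False
      have "sin (t / 2) = sin ((2 * pi - t) / 2)" using sin_pi_minus[of "t / 2"] by (simp add: diff_divide_distrib)
      then show ?thesis using t False sin_ge_third[of "(2 * pi - t) / 2"] unfolding norm_one_minus_cis by auto
    qed
  qed
  then have "emeasure lborel {t \<in> {0..2*pi}. norm (1 - cis t) \<le> \<epsilon>} \<le> emeasure lborel ({0..3 * \<epsilon>} \<union> {2 * pi - 3 * \<epsilon>..2 * pi})"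
    by (intro emeasure_mono) auto
  also have "\<dots> \<le> emeasure lborel {0..3 * \<epsilon>} + emeasure lborel {2 * pi - 3 * \<epsilon>..2 * pi}"
    by (intro emeasure_subadditive) auto
  also have "\<dots> = ennreal (6 * \<epsilon>)" using assms by (simp flip: ennreal_plus)
  finally show ?thesis .
qed

text \<open>Averaging dilates over \<mu> multiplies the n-th Taylor coefficient by the n-th moment.
  Summation and integration may be exchanged because the Taylor series converges absolutely at |z|
  and dilation by t < 1 only decreases the terms.\<close>

lemma dilation_average_sums:
  assumes \<mu>: "\<mu> \<in> M_plus" and g: "g holomorphic_on ball 0 1" and z: "norm z < 1"
  shows "(\<lambda>n. (deriv ^^ n) g 0 / fact n * of_real (measure_moment \<mu> n) * z ^ n) sums (LINT t|\<mu>. g (of_real t * z))"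
proof -
  define c where "c n = (deriv ^^ n) g 0 / fact n" for n
  have ps: "(\<lambda>n. c n * w ^ n) sums g w" if "norm w < 1" for w
    using holomorphic_power_series[OF g, of w] that unfolding c_def by simp
  have abs: "summable (\<lambda>n. norm (c n) * norm z ^ n)"
  proof -
    define \<rho> where "\<rho> = (1 + norm z) / 2"
    have "0 \<le> \<rho>" "\<rho> < 1" "norm z < \<rho>" unfolding \<rho>_def using z by auto
    then have \<rho>: "norm (of_real \<rho> :: complex) < 1" "norm z < norm (of_real \<rho> :: complex)" by simp_all
    show ?thesis using powser_insidea[OF sums_summable[OF ps[OF \<rho>(1)]] \<rho>(2)] by (simp add: norm_mult norm_power)
  qed
  define F where "F n t = c n * (of_real t * z) ^ n" for n and t :: real
  have Fn: "norm (F n t) \<le> norm (c n) * norm z ^ n" if "0 \<le> t" "t < 1" for n t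
  proof -
    have "norm (F n t) = norm (c n) * (t * norm z) ^ n" unfolding F_def using that by (simp add: norm_mult norm_power)
    also have "\<dots> \<le> norm (c n) * (1 * norm z) ^ n" using that by (intro mult_left_mono power_mono mult_right_mono) auto
    finally show ?thesis by simp
  qed
  have Fm: "F n \<in> borel_measurable borel" for n
    unfolding F_def by (intro borel_measurable_continuous_onI continuous_intros)
  have Fi: "integrable \<mu> (F n)" for n by (rule integrable_M_plus[OF \<mu> Fm Fn])
  have sumn: "summable (\<lambda>n. norm (F n t))" if "0 \<le> t" "t < 1" for t
    by (rule summable_comparison_test'[OF abs, of 0]) (use Fn[OF that] in auto)
  have "(\<lambda>n. integral\<^sup>L \<mu> (F n)) sums (LINT t|\<mu>. (\<Sum>n. F n t))"
  proof (rule sums_integral[OF Fi])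
    show "AE t in \<mu>. summable (\<lambda>n. norm (F n t))"
      by (rule AE_I2) (use sumn space_M_plus[OF \<mu>] in auto)
    interpret finite_measure \<mu> using \<mu> by (rule finite_measure_M_plus)
    have "norm (LINT t|\<mu>. norm (F n t)) \<le> norm (c n) * norm z ^ n * measure \<mu> (space \<mu>)" for n
    proof -
      have "(LINT t|\<mu>. norm (F n t)) \<le> (LINT t|\<mu>. norm (c n) * norm z ^ n)"
        by (rule integral_mono[OF integrable_norm[OF Fi]]) (use Fn space_M_plus[OF \<mu>] in auto)
      then show ?thesis by (simp add: mult_ac)
    qed
    then show "summable (\<lambda>n. LINT t|\<mu>. norm (F n t))"
      by (intro summable_comparison_test'[OF summable_mult2[OF abs, of "measure \<mu> (space \<mu>)"], of 0]) auto
  qed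
  moreover have "integral\<^sup>L \<mu> (F n) = c n * of_real (measure_moment \<mu> n) * z ^ n" for n
    unfolding F_def measure_moment_def power_mult_distrib
    by (simp add: mult_ac flip: of_real_power)
  moreover have "(LINT t|\<mu>. (\<Sum>n. F n t)) = (LINT t|\<mu>. g (of_real t * z))"
  proof (rule Bochner_Integration.integral_cong[OF refl])
    fix t assume "t \<in> space \<mu>"
    then have t: "0 \<le> t" "t < 1" using space_M_plus[OF \<mu>] by auto
    have "norm (of_real t * z) \<le> 1 * norm z" unfolding norm_mult using t by (intro mult_right_mono) auto
    then have "norm (of_real t * z) < 1" using z by simp
    from ps[OF this] show "(\<Sum>n. F n t) = g (of_real t * z)" unfolding F_def by (simp add: sums_iff)
  qed
  ultimately show ?thesis unfolding c_def by simp
qed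

lemma dilation_average_holomorphic:
  assumes "\<mu> \<in> M_plus" "g holomorphic_on ball 0 1"
  shows "(\<lambda>z. LINT t|\<mu>. g (of_real t * z)) holomorphic_on ball 0 1"
  by (rule power_series_holomorphic[where a="\<lambda>n. (deriv ^^ n) g 0 / fact n * of_real (measure_moment \<mu> n)"])
    (use dilation_average_sums[OF assms] in simp)

context doubling_measure
begin

text \<open>Written with \<open>kern\<close>, the integrand is one holomorphic function, the product
  of f and \<open>kern\<close>, evaluated at t z. This makes the operator an average of
  dilates.\<close>

definition cesaro :: "real measure \<Rightarrow> (complex \<Rightarrow> complex) \<Rightarrow> complex \<Rightarrow> complex" where
  "cesaro \<mu> f z = (LINT t|\<mu>. f (of_real t * z) * kern (of_real t * z))"

text \<open>This is the number h k of the overview, with \<nu> the measure of the weight.\<close>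

definition ratio :: "real measure \<Rightarrow> nat \<Rightarrow> real" where
  "ratio \<mu> k = 2 ^ k * dyadic_tail \<mu> k / W k"

lemma ratio_nonneg: "0 \<le> ratio \<mu> k"
  unfolding ratio_def using W_pos[of k] dyadic_tail_nonneg by simp

lemma kern_sums: "norm z < 1 \<Longrightarrow> (\<lambda>n. of_real (b n) * z ^ n) sums kern z"
  using summable_fdiff_b[of z 0 0] unfolding kern_def by (simp add: summable_sums)

lemma kern_holomorphic: "kern holomorphic_on ball 0 1"
  by (rule power_series_holomorphic[where a="\<lambda>n. of_real (b n)"]) (use kern_sums in simp)

lemma cesaro_holomorphic:
  assumes "\<mu> \<in> M_plus" "f holomorphic_on ball 0 1"
  shows "cesaro \<mu> f holomorphic_on ball 0 1"
  unfolding cesaro_def using assms kern_holomorphic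
  by (intro dilation_average_holomorphic[where g="\<lambda>z. f z * kern z"] holomorphic_intros)

lemma kern_coeff: "(deriv ^^ n) kern 0 / fact n = of_real (b n)"
proof -
  have h: "kern has_fps_expansion Abs_fps (\<lambda>n. of_real (b n))"
  proof (rule has_fps_expansionI)
    have "eventually (\<lambda>z. z \<in> ball 0 1) (nhds (0::complex))" by (intro eventually_nhds_in_open) auto
    then show "\<forall>\<^sub>F u in nhds 0. (\<lambda>n. fps_nth (Abs_fps (\<lambda>n. of_real (b n))) n * u ^ n) sums kern u"
      by eventually_elim (use kern_sums in auto)
  qed
  show ?thesis using fps_nth_fps_expansion[OF h, of n] by simp
qed

lemma cesaro_one_sums:
  assumes "\<mu> \<in> M_plus" "norm z < 1"
  shows "(\<lambda>n. of_real (b n * measure_moment \<mu> n) * z ^ n) sums cesaro \<mu> (\<lambda>_. 1) z"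
  using dilation_average_sums[OF assms(1) kern_holomorphic assms(2)]
  unfolding kern_coeff cesaro_def by simp

lemma fps_expansion_cesaro_one:
  assumes "\<mu> \<in> M_plus"
  shows "fps_nth (fps_expansion (cesaro \<mu> (\<lambda>_. 1)) 0) n = of_real (b n * measure_moment \<mu> n)"
proof -
  let ?F = "Abs_fps (\<lambda>n. of_real (b n * measure_moment \<mu> n)) :: complex fps"
  have "cesaro \<mu> (\<lambda>_. 1) has_fps_expansion ?F"
  proof (rule has_fps_expansionI)
    have "eventually (\<lambda>z. z \<in> ball 0 1) (nhds (0::complex))" by (intro eventually_nhds_in_open) auto
    then show "\<forall>\<^sub>F u in nhds 0. (\<lambda>n. fps_nth ?F n * u ^ n) sums cesaro \<mu> (\<lambda>_. 1) u"
      by eventually_elim (use cesaro_one_sums[OF assms] in auto)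
  qed
  then have "fps_expansion (cesaro \<mu> (\<lambda>_. 1)) 0 = ?F" by (rule fps_expansion_eqI)
  then show ?thesis by simp
qed

lemma norm_cesaro_le:
  assumes \<mu>: "\<mu> \<in> M_plus" and c: "\<And>k. 0 \<le> c k"
    and "\<And>k t. k < n \<Longrightarrow> 1 - (1/2) ^ k \<le> t \<Longrightarrow> t < 1 - (1/2) ^ Suc k \<Longrightarrow>
      norm (f (of_real t * z)) * norm (kern (of_real t * z)) \<le> c k"
    and "\<And>t. 1 - (1/2) ^ n \<le> t \<Longrightarrow> t < 1 \<Longrightarrow> norm (f (of_real t * z)) * norm (kern (of_real t * z)) \<le> c n"
  shows "norm (cesaro \<mu> f z) \<le> (\<Sum>k\<le>n. c k * dyadic_tail \<mu> k)"
proof -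
  have "norm (cesaro \<mu> f z) \<le> (LINT t|\<mu>. norm (f (of_real t * z)) * norm (kern (of_real t * z)))"
    unfolding cesaro_def norm_mult[symmetric] by (rule integral_norm_bound)
  also have "\<dots> \<le> (\<Sum>k\<le>n. c k * dyadic_tail \<mu> k)"
    by (rule integral_le_sum_dyadic_tail[OF \<mu> c]) (fact assms(3), fact assms(4))
  finally show ?thesis .
qed

subsection \<open>Upper bounds\<close>

lemma norm_dilate_kernel_le:
  assumes C: "\<And>k z. norm z < 1 \<Longrightarrow> (1/2) ^ k / 2 \<le> norm (1 - z) \<Longrightarrow> norm (kern z) \<le> C * 2 ^ k / W k"
    and t: "0 \<le> t" "t < 1" and z: "norm z < 1" and l: "(1/2) ^ k / 2 \<le> norm (1 - of_real t * z)"
    and F: "norm (f (of_real t * z)) \<le> F" and C0: "0 < C"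
  shows "norm (f (of_real t * z)) * norm (kern (of_real t * z)) \<le> F * (C * 2 ^ k / W k)"
proof (rule mult_mono[OF F])
  have "norm (of_real t * z) \<le> 1 * norm z" unfolding norm_mult using t by (intro mult_right_mono) auto
  then show "norm (kern (of_real t * z)) \<le> C * 2 ^ k / W k" using z l by (intro C) auto
  show "0 \<le> F" using F norm_ge_zero order_trans by blast
qed simp

text \<open>For \<open>\<bar>1 - e\<^sup>i\<^sup>x\<bar> \<approx> 2\<^sup>-\<^sup>j\<close> the dilates \<open>t e\<^sup>i\<^sup>x\<close> with \<open>1 - t \<approx> 2\<^sup>-\<^sup>k\<close>, \<open>k < j\<close>, lie in the nontangential
  region of every boundary point at distance about \<open>2\<^sup>-\<^sup>k\<close> from \<open>1\<close>.\<close>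

lemma norm_cesaro_pointwise:
  obtains C where "0 < C" "\<And>\<mu> f G r x j. \<mu> \<in> M_plus \<Longrightarrow> 0 \<le> r \<Longrightarrow> r < 1 \<Longrightarrow> nontangential_majorant f r G \<Longrightarrow> (1/2) ^ j < norm (1 - cis x) \<Longrightarrow> norm (1 - cis x) \<le> 2 * (1/2) ^ j \<Longrightarrow>
    norm (cesaro \<mu> f (of_real r * cis x))
      \<le> C * ((\<Sum>k<j. (INF y\<in>{(1/2) ^ Suc k<..(1/2) ^ k}. G y) * ratio \<mu> k) + G x * ratio \<mu> j)"
proof -
  obtain C where C: "0 < C" "\<And>k z. norm z < 1 \<Longrightarrow> (1/2) ^ k / 2 \<le> norm (1 - z) \<Longrightarrow> norm (kern z) \<le> C * 2 ^ k / W k"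
    using kern_upper by blast
  have "norm (cesaro \<mu> f (of_real r * cis x))
      \<le> C * ((\<Sum>k<j. (INF y\<in>{(1/2) ^ Suc k<..(1/2) ^ k}. G y) * ratio \<mu> k) + G x * ratio \<mu> j)"
    if \<mu>: "\<mu> \<in> M_plus" and r: "0 \<le> r" "r < 1" and maj: "nontangential_majorant f r G"
      and x: "(1/2) ^ j < norm (1 - cis x)" "norm (1 - cis x) \<le> 2 * (1/2) ^ j" for \<mu> f G r x j
  proof -
    have G: "0 \<le> G y" for y using maj unfolding nontangential_majorant_def by blast
    have dom: "norm (f (of_real t * cis x)) \<le> G y" if "0 \<le> t" "t \<le> r" "norm (cis x - cis y) \<le> 6 * (1 - t)" for t x y
      using maj that unfolding nontangential_majorant_def by blast
    define z where "z = of_real r * cis x"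
    have z: "norm z < 1" unfolding z_def using r by (simp add: norm_mult)
    define A where "A k = (INF y\<in>{(1/2) ^ Suc k<..(1/2::real) ^ k}. G y)" for k
    have A0: "0 \<le> A k" for k unfolding A_def using G by (intro cINF_greatest) auto
    define c where "c k = (if k < j then A k else G x) * (C * 2 ^ k / W k)" for k
    have c0: "0 \<le> c k" for k unfolding c_def using A0 G C(1) W_pos[of k] by simp
    have tz: "of_real t * z = of_real (t * r) * cis x" for t unfolding z_def by simp
    have tr: "0 \<le> t * r" "t * r \<le> r" "t * r \<le> t" if "0 \<le> t" "t < 1" for t
      using that r by (auto simp: mult_left_le_one_le mult_left_le)
    have far: "1 - t \<le> norm (1 - of_real t * z)" if "0 \<le> t" "t < 1" for t
    proof -
      have "norm (of_real t * z) = t * r" unfolding tz norm_mult norm_of_real using tr[OF that] by simp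
      then show ?thesis using norm_triangle_ineq2[of 1 "of_real t * z"] tr[OF that] by simp
    qed
    \<comment> \<open>The point t z lies on the radius of e^(ix) at distance 1 - t r from it, and
      this is at most |1 - t z|. So |1 - t z| never drops below half of |1 - e^(ix)|, however close
      t is to 1, and the kernel stays at level j on the last tail.\<close>
    have far2: "norm (1 - cis x) \<le> 2 * norm (1 - of_real t * z)" if "0 \<le> t" "t < 1" for t
    proof -
      have nt: "norm (of_real t * z) = t * r" unfolding tz norm_mult norm_of_real using tr[OF that] by simp
      have "of_real t * z - cis x = of_real (t * r - 1) * cis x" unfolding tz by (simp add: algebra_simps)
      then have "norm (of_real t * z - cis x) = \<bar>t * r - 1\<bar>" by (simp only: norm_mult norm_of_real norm_cis mult_1_right)
      also have "\<dots> = 1 - t * r" using tr[OF that] r by simp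
      also have "\<dots> \<le> norm (1 - of_real t * z)" using norm_triangle_ineq2[of 1 "of_real t * z"] nt by simp
      finally have "norm (of_real t * z - cis x) \<le> norm (1 - of_real t * z)" .
      moreover have "norm (1 - cis x) \<le> norm (1 - of_real t * z) + norm (of_real t * z - cis x)"
        using norm_triangle_ineq[of "1 - of_real t * z" "of_real t * z - cis x"] by simp
      ultimately show ?thesis by simp
    qed
    have "norm (cesaro \<mu> f z) \<le> (\<Sum>k\<le>j. c k * dyadic_tail \<mu> k)"
    proof (rule norm_cesaro_le[OF \<mu> c0])
      fix k t assume k: "k < j" and t: "1 - (1/2) ^ k \<le> t" "t < 1 - (1/2::real) ^ Suc k"
      have t01: "0 \<le> t" "t < 1"
        using t half_power_le_1(2)[of k] zero_less_power[of "1/2::real" "Suc k"] by linarith+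
      have "norm (f (of_real t * z)) \<le> A k" unfolding A_def tz
      proof (rule cINF_greatest)
        fix y assume y: "y \<in> {(1/2) ^ Suc k<..(1/2::real) ^ k}"
        have "0 \<le> y" using y zero_le_power[of "1/2::real" "Suc k"] by simp
        have "(1/2::real) ^ j \<le> (1/2) ^ Suc k" using k by (intro power_decreasing) auto
        then have "norm (cis x - 1) \<le> (1/2) ^ k" using x(2) by (simp add: norm_minus_commute)
        moreover have "norm (1 - cis y) \<le> (1/2) ^ k" using norm_cis_minus_cis_le[of 0 y] y \<open>0 \<le> y\<close> by simp
        ultimately have "norm (cis x - cis y) \<le> 2 * (1/2) ^ k"
          using norm_triangle_ineq[of "cis x - 1" "1 - cis y"] by simp
        also have "\<dots> \<le> 6 * (1 - t)" using t by simp
        also have "\<dots> \<le> 6 * (1 - t * r)" using tr[OF t01] by simp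
        finally show "norm (f (of_real (t * r) * cis x)) \<le> G y" using tr[OF t01] by (intro dom) auto
      qed simp
      moreover have "(1/2) ^ k / 2 \<le> norm (1 - of_real t * z)" using far[OF t01] t by simp
      ultimately show "norm (f (of_real t * z)) * norm (kern (of_real t * z)) \<le> c k"
        unfolding c_def using k norm_dilate_kernel_le[OF C(2) t01 z _ _ C(1)] by simp
    next
      fix t assume t: "1 - (1/2::real) ^ j \<le> t" "t < 1"
      have t01: "0 \<le> t" "t < 1" using t half_power_le_1(2)[of j] by linarith+
      have "norm (f (of_real t * z)) \<le> G x" unfolding tz using tr[OF t01] r by (intro dom) auto
      moreover have "(1/2) ^ j / 2 \<le> norm (1 - of_real t * z)" using far2[OF t01] x(1) by simp
      ultimately show "norm (f (of_real t * z)) * norm (kern (of_real t * z)) \<le> c j"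
        unfolding c_def using norm_dilate_kernel_le[OF C(2) t01 z _ _ C(1)] by simp
    qed
    also have "\<dots> = (\<Sum>k<j. C * (A k * ratio \<mu> k)) + C * (G x * ratio \<mu> j)"
      unfolding lessThan_Suc_atMost[symmetric] sum.lessThan_Suc
      by (intro arg_cong2[of _ _ _ _ "(+)"] sum.cong) (simp_all add: c_def ratio_def)
    also have "\<dots> = C * ((\<Sum>k<j. A k * ratio \<mu> k) + G x * ratio \<mu> j)"
      by (simp add: sum_distrib_left distrib_left)
    finally show ?thesis unfolding z_def A_def .
  qed
  then show ?thesis using that[OF C(1)] by blast
qed

end

section \<open>Dyadic decomposition of the circle at the point 1\<close>

definition near_one :: "nat \<Rightarrow> real set" where
  "near_one j = {x \<in> {0..2*pi}. (1/2) ^ j < norm (1 - cis x) \<and> norm (1 - cis x) \<le> 2 * (1/2) ^ j}"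

text \<open>The sets \<open>near_one j\<close> exhaust [0, 2 pi] up to the end points and are where
  values are estimated. They have a piece at each end of the interval, hence are described by the
  distance to 1. The arcs here are intervals of angles of exact length 2^(-j-1) on one side of 1;
  they only serve to average a majorant.\<close>

definition dyadic_arc :: "nat \<Rightarrow> real set" where
  "dyadic_arc j = {(1/2) ^ Suc j<..(1/2) ^ j}"

lemma near_one_sets [measurable]: "near_one j \<in> sets borel"
proof -
  have [measurable]: "(\<lambda>x. norm (1 - cis x)) \<in> borel_measurable borel"
    by (intro borel_measurable_continuous_onI continuous_intros)
  show ?thesis unfolding near_one_def by measurable
qed

lemma dyadic_arc_sets [measurable]: "dyadic_arc j \<in> sets borel"
  unfolding dyadic_arc_def by simp

lemma half_power_double_le: "i < j \<Longrightarrow> 2 * (1/2::real) ^ j \<le> (1/2) ^ i"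
  using power_decreasing[of "Suc i" j "1/2::real"] by simp

lemma disjoint_near_one: "disjoint_family near_one"
  unfolding disjoint_family_on_def near_one_def
proof (safe, goal_cases)
  case (1 i j x)
  then show ?case
    using half_power_double_le[of i j] half_power_double_le[of j i] by (cases i j rule: linorder_cases) auto
qed

lemma disjoint_dyadic_arc: "disjoint_family dyadic_arc"
  unfolding disjoint_family_on_def dyadic_arc_def
proof (safe, goal_cases)
  case (1 i j x)
  then show ?case
    using half_power_double_le[of i j] half_power_double_le[of j i] by (cases i j rule: linorder_cases) auto
qed

lemma dyadic_arc_subset: "dyadic_arc j \<subseteq> {0..2*pi}"
proof
  fix x assume "x \<in> dyadic_arc j"
  then have "(1/2) ^ Suc j < x" "x \<le> (1/2) ^ j" unfolding dyadic_arc_def by auto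
  then have "0 \<le> x" "x \<le> 1" using half_power_le_1(1)[of j] zero_le_power[of "1/2::real" "Suc j"] by linarith+
  then show "x \<in> {0..2*pi}" using pi_gt3 by auto
qed

lemma AE_near_one: "AE x in lborel. x \<in> {0..2*pi} \<longrightarrow> (\<exists>j. x \<in> near_one j)"
  using AE_lborel_singleton[of 0] AE_lborel_singleton[of "2*pi"]
proof eventually_elim
  case (elim x)
  show ?case
  proof
    assume x: "x \<in> {0..2*pi}"
    then have "0 < sin (x / 2)" using elim by (intro sin_gt_zero) auto
    then have d: "0 < norm (1 - cis x)" unfolding norm_one_minus_cis by simp
    have d2: "norm (1 - cis x) \<le> 2" unfolding norm_one_minus_cis by simp
    define t where "t = 1 - norm (1 - cis x) / 2"
    obtain n where "(1/2) ^ n < norm (1 - cis x) / 2"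
      using real_arch_pow_inv[of "norm (1 - cis x) / 2" "1/2"] d by auto
    then have "0 \<le> t" "t < 1 - (1/2) ^ n" unfolding t_def using d2 by auto
    then obtain k where "1 - (1/2) ^ k \<le> t" "t < 1 - (1/2) ^ Suc k" using ex_dyadic_block by blast
    then have "x \<in> near_one k" unfolding near_one_def t_def using x by auto
    then show "\<exists>j. x \<in> near_one j" ..
  qed
qed

lemma emeasure_near_one: "emeasure lborel (near_one j) \<le> ennreal (12 * (1/2) ^ j)"
proof -
  have "emeasure lborel (near_one j) \<le> emeasure lborel {x \<in> {0..2*pi}. norm (1 - cis x) \<le> 2 * (1/2) ^ j}"
  proof (rule emeasure_mono)
    have [measurable]: "(\<lambda>x. norm (1 - cis x)) \<in> borel_measurable borel"
      by (intro borel_measurable_continuous_onI continuous_intros)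
    show "{x \<in> {0..2*pi}. norm (1 - cis x) \<le> 2 * (1/2) ^ j} \<in> sets lborel"
      unfolding sets_lborel by measurable
  qed (unfold near_one_def, blast)
  also have "\<dots> \<le> ennreal (6 * (2 * (1/2) ^ j))" by (rule emeasure_near_one_le) simp
  also have "6 * (2 * (1/2::real) ^ j) = 12 * (1/2) ^ j" by simp
  finally show ?thesis .
qed

lemma emeasure_dyadic_arc: "emeasure lborel (dyadic_arc j) = ennreal ((1/2) ^ Suc j)"
  unfolding dyadic_arc_def by (subst emeasure_lborel_Ioc) (auto simp: field_simps)

text \<open>One summand belongs to the term with G x at the point of evaluation, the other to the
  minima of G over arcs. Adding them gives both contributions the same form.\<close>

definition arc_integral :: "nat \<Rightarrow> (real \<Rightarrow> ennreal) \<Rightarrow> ennreal" where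
  "arc_integral j \<phi> = (\<integral>\<^sup>+x\<in>near_one j. \<phi> x \<partial>lborel) + (\<integral>\<^sup>+x\<in>dyadic_arc j. \<phi> x \<partial>lborel)"

lemma suminf_arc_integral_le:
  assumes [measurable]: "\<phi> \<in> borel_measurable borel"
  shows "(\<Sum>j. arc_integral j \<phi>) \<le> 2 * (\<integral>\<^sup>+x\<in>{0..2*pi}. \<phi> x \<partial>lborel)"
proof -
  have *: "(\<Sum>j. \<integral>\<^sup>+x\<in>A j. \<phi> x \<partial>lborel) \<le> (\<integral>\<^sup>+x\<in>{0..2*pi}. \<phi> x \<partial>lborel)"
    if A: "disjoint_family A" "\<And>j. A j \<subseteq> {0..2*pi}" and [measurable]: "\<And>j. A j \<in> sets borel" for A :: "nat \<Rightarrow> real set"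
  proof -
    have "(\<Sum>j. \<integral>\<^sup>+x\<in>A j. \<phi> x \<partial>lborel) = (\<integral>\<^sup>+x. (\<Sum>j. \<phi> x * indicator (A j) x) \<partial>lborel)"
      by (rule nn_integral_suminf[symmetric]) measurable
    also have "\<dots> = (\<integral>\<^sup>+x. \<phi> x * indicator (\<Union>j. A j) x \<partial>lborel)"
      by (simp add: ennreal_suminf_cmult suminf_indicator[OF A(1)])
    also have "\<dots> \<le> (\<integral>\<^sup>+x\<in>{0..2*pi}. \<phi> x \<partial>lborel)"
    proof (intro nn_integral_mono mult_left_mono)
      have "(\<Union>j. A j) \<subseteq> {0..2*pi}" using A(2) by blast
      then show "indicator (\<Union>j. A j) x \<le> (indicator {0..2*pi} x :: ennreal)" for x
        by (auto simp: indicator_def simp del: atLeastAtMost_iff)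
    qed auto
    finally show ?thesis .
  qed
  have "(\<Sum>j. arc_integral j \<phi>) = (\<Sum>j. \<integral>\<^sup>+x\<in>near_one j. \<phi> x \<partial>lborel) + (\<Sum>j. \<integral>\<^sup>+x\<in>dyadic_arc j. \<phi> x \<partial>lborel)"
    unfolding arc_integral_def by (rule suminf_add[symmetric]) auto
  also have "\<dots> \<le> (\<integral>\<^sup>+x\<in>{0..2*pi}. \<phi> x \<partial>lborel) + (\<integral>\<^sup>+x\<in>{0..2*pi}. \<phi> x \<partial>lborel)"
    by (intro add_mono * disjoint_near_one disjoint_dyadic_arc dyadic_arc_subset near_one_sets dyadic_arc_sets)
      (auto simp: near_one_def)
  finally show ?thesis unfolding mult_2 .
qed

lemma arc_integral_const_le:
  assumes "0 \<le> c"
  shows "arc_integral j (\<lambda>_. ennreal c) \<le> ennreal (13 * ((1/2) ^ j * c))"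
proof -
  have "arc_integral j (\<lambda>_. ennreal c) = ennreal c * emeasure lborel (near_one j) + ennreal c * emeasure lborel (dyadic_arc j)"
    unfolding arc_integral_def by (simp add: nn_integral_cmult_indicator)
  also have "\<dots> \<le> ennreal c * ennreal (12 * (1/2) ^ j) + ennreal c * ennreal ((1/2) ^ Suc j)"
    unfolding emeasure_dyadic_arc by (intro add_mono mult_left_mono emeasure_near_one) auto
  also have "\<dots> = ennreal (c * (12 * (1/2) ^ j) + c * (1/2) ^ Suc j)"
    using assms by (simp only: ennreal_mult[symmetric] ennreal_plus[symmetric] mult_nonneg_nonneg zero_le_power
        zero_le_numeral zero_le_divide_1_iff)
  also have "\<dots> \<le> ennreal (13 * ((1/2) ^ j * c))"
    using assms by (intro ennreal_leI) (simp add: algebra_simps)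
  finally show ?thesis .
qed

lemma powr_add_le:
  fixes u v q :: real
  assumes "0 \<le> u" "0 \<le> v" "0 < q"
  shows "(u + v) powr q \<le> 2 powr q * (u powr q + v powr q)"
proof -
  have "(u + v) powr q \<le> (2 * max u v) powr q" using assms by (intro powr_mono2) auto
  also have "\<dots> = 2 powr q * (max u v) powr q" using assms by (simp add: powr_mult)
  also have "\<dots> \<le> 2 powr q * (u powr q + v powr q)"
    by (intro mult_left_mono) (auto simp: max_def)
  finally show ?thesis .
qed

context doubling_measure
begin

text \<open>The pointwise bound at level j is raised to the power q and integrated over
  \<open>near_one j\<close>, whose measure is of order 2^-j. The partial sums are removed by the
  discrete Hardy inequality, after which the minimum of G over the k-th arc, weighted with the
  length of the arc, is at most the integral of G over it. The exponent p has not entered yet; the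
  relation between p and q decides how the right side is estimated.\<close>

lemma cesaro_circle_integral_le:
  assumes q: "0 < q"
  obtains C where "0 < C" "\<And>\<mu> f G r. \<mu> \<in> M_plus \<Longrightarrow> 0 \<le> r \<Longrightarrow> r < 1 \<Longrightarrow> G \<in> borel_measurable borel \<Longrightarrow> nontangential_majorant f r G \<Longrightarrow>
    (\<integral>\<^sup>+x\<in>{0..2*pi}. ennreal (norm (cesaro \<mu> f (of_real r * cis x)) powr q) \<partial>lborel)
      \<le> ennreal C * (\<Sum>j. ennreal (ratio \<mu> j powr q) * arc_integral j (\<lambda>x. ennreal (G x powr q)))"
proof -
  obtain C where C: "0 < C" "\<And>\<mu> f G r x j. \<mu> \<in> M_plus \<Longrightarrow> 0 \<le> r \<Longrightarrow> r < 1 \<Longrightarrow> nontangential_majorant f r G \<Longrightarrow>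
    (1/2) ^ j < norm (1 - cis x) \<Longrightarrow> norm (1 - cis x) \<le> 2 * (1/2) ^ j \<Longrightarrow>
    norm (cesaro \<mu> f (of_real r * cis x))
      \<le> C * ((\<Sum>k<j. (INF y\<in>{(1/2) ^ Suc k<..(1/2) ^ k}. G y) * ratio \<mu> k) + G x * ratio \<mu> j)"
    using norm_cesaro_pointwise by blast
  obtain CH where CH: "CH > 0" "\<And>a N. (\<And>k. 0 \<le> a k) \<Longrightarrow>
      (\<Sum>j<N. (1/2) ^ j * (\<Sum>k\<le>j. a k) powr q) \<le> CH * (\<Sum>k<N. (1/2) ^ k * a k powr q)"
    using discrete_hardy_partial_sums[OF q] by blast
  define E where "E = C powr q * 2 powr q"
  define C' where "C' = E * (24 * CH + 1)"
  have E: "0 < E" unfolding E_def using C by simp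
  have "(\<integral>\<^sup>+x\<in>{0..2*pi}. ennreal (norm (cesaro \<mu> f (of_real r * cis x)) powr q) \<partial>lborel)
      \<le> ennreal C' * (\<Sum>j. ennreal (ratio \<mu> j powr q) * arc_integral j (\<lambda>x. ennreal (G x powr q)))"
    if \<mu>: "\<mu> \<in> M_plus" and r: "0 \<le> r" "r < 1" and G[measurable]: "G \<in> borel_measurable borel" and maj: "nontangential_majorant f r G" for \<mu> f G r
  proof -
    have G0: "0 \<le> G y" for y using maj unfolding nontangential_majorant_def by blast
    define A where "A k = (INF y\<in>{(1/2) ^ Suc k<..(1/2::real) ^ k}. G y)" for k
    have A0: "0 \<le> A k" for k unfolding A_def using G0 by (intro cINF_greatest) auto
    have AG: "A k \<le> G y" if "y \<in> dyadic_arc k" for k y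
      unfolding A_def using that G0 by (intro cINF_lower bdd_belowI2[of _ 0]) (auto simp: dyadic_arc_def)
    define h where "h = ratio \<mu>"
    have h0: "0 \<le> h k" for k unfolding h_def by (rule ratio_nonneg)
    define S where "S j = (\<Sum>k<j. A k * h k)" for j
    have S0: "0 \<le> S j" for j unfolding S_def using A0 h0 by (intro sum_nonneg) auto
    define g where "g j x = ennreal E * (ennreal (S j powr q) + ennreal (h j powr q) * ennreal (G x powr q))" for j x
    have [measurable]: "g j \<in> borel_measurable borel" for j unfolding g_def by measurable
    have pt: "ennreal (norm (cesaro \<mu> f (of_real r * cis x)) powr q) \<le> g j x" if x: "x \<in> near_one j" for j x
    proof -
      have "norm (cesaro \<mu> f (of_real r * cis x)) \<le> C * (S j + G x * h j)"
        unfolding S_def A_def h_def using x by (intro C(2)[OF \<mu> r maj]) (auto simp: near_one_def)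
      then have "norm (cesaro \<mu> f (of_real r * cis x)) powr q \<le> (C * (S j + G x * h j)) powr q"
        using q by (intro powr_mono2) auto
      also have "\<dots> = C powr q * (S j + G x * h j) powr q"
        by (rule powr_mult)
      also have "\<dots> \<le> C powr q * (2 powr q * (S j powr q + (G x * h j) powr q))"
        using S0 G0 h0 q by (intro mult_left_mono powr_add_le) auto
      also have "\<dots> = E * (S j powr q + h j powr q * G x powr q)"
        unfolding E_def using G0 h0 by (simp add: powr_mult mult_ac)
      finally have "ennreal (norm (cesaro \<mu> f (of_real r * cis x)) powr q) \<le> ennreal (E * (S j powr q + h j powr q * G x powr q))"
        by (rule ennreal_leI)
      also have "\<dots> = g j x" unfolding g_def using E by (simp add: ennreal_mult ennreal_plus)
      finally show ?thesis .
    qed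
    have "(\<integral>\<^sup>+x\<in>{0..2*pi}. ennreal (norm (cesaro \<mu> f (of_real r * cis x)) powr q) \<partial>lborel)
        \<le> (\<integral>\<^sup>+x. (\<Sum>j. g j x * indicator (near_one j) x) \<partial>lborel)"
    proof (rule nn_integral_mono_AE)
      show "AE x in lborel. ennreal (norm (cesaro \<mu> f (of_real r * cis x)) powr q) * indicator {0..2*pi} x
          \<le> (\<Sum>j. g j x * indicator (near_one j) x)"
        using AE_near_one
      proof eventually_elim
        case (elim x)
        show ?case
        proof (cases "x \<in> {0..2*pi}")
          case True
          then obtain j where j: "x \<in> near_one j" using elim by blast
          define F where "F i = g i x * indicator (near_one i) x" for i
          have "ennreal (norm (cesaro \<mu> f (of_real r * cis x)) powr q) \<le> F j"
            unfolding F_def using pt[OF j] j by simp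
          also have "\<dots> = (\<Sum>i\<in>{j}. F i)" by simp
          also have "\<dots> \<le> (\<Sum>j. F j)" by (intro sum_le_suminf) auto
          also have "\<dots> = (\<Sum>j. g j x * indicator (near_one j) x)" unfolding F_def ..
          finally show ?thesis using True by simp
        qed simp
      qed
    qed
    also have "\<dots> = (\<Sum>j. \<integral>\<^sup>+x\<in>near_one j. g j x \<partial>lborel)"
      by (rule nn_integral_suminf) measurable
    also have "\<dots> \<le> (\<Sum>j. ennreal E * (12 * ennreal ((1/2) ^ j * S j powr q)
        + ennreal (h j powr q) * (\<integral>\<^sup>+x\<in>near_one j. ennreal (G x powr q) \<partial>lborel)))"
    proof (intro suminf_le summableI)
      fix j
      have "(\<integral>\<^sup>+x\<in>near_one j. g j x \<partial>lborel) = (\<integral>\<^sup>+x. ennreal E * (ennreal (S j powr q) * indicator (near_one j) x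
          + ennreal (h j powr q) * (ennreal (G x powr q) * indicator (near_one j) x)) \<partial>lborel)"
        unfolding g_def by (intro nn_integral_cong) (simp add: algebra_simps)
      also have "\<dots> = ennreal E * (ennreal (S j powr q) * emeasure lborel (near_one j)
          + ennreal (h j powr q) * (\<integral>\<^sup>+x\<in>near_one j. ennreal (G x powr q) \<partial>lborel))"
        by (simp add: nn_integral_cmult nn_integral_add nn_integral_cmult_indicator)
      also have "\<dots> \<le> ennreal E * (ennreal (S j powr q) * ennreal (12 * (1/2) ^ j)
          + ennreal (h j powr q) * (\<integral>\<^sup>+x\<in>near_one j. ennreal (G x powr q) \<partial>lborel))"
        by (intro mult_left_mono add_right_mono emeasure_near_one) auto
      also have "ennreal (S j powr q) * ennreal (12 * (1/2) ^ j) = 12 * ennreal ((1/2) ^ j * S j powr q)"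
        by (simp add: ennreal_mult mult_ac)
      finally show "(\<integral>\<^sup>+x\<in>near_one j. g j x \<partial>lborel) \<le> ennreal E * (12 * ennreal ((1/2) ^ j * S j powr q)
        + ennreal (h j powr q) * (\<integral>\<^sup>+x\<in>near_one j. ennreal (G x powr q) \<partial>lborel))" .
    qed
    also have "\<dots> = ennreal E * (12 * (\<Sum>j. ennreal ((1/2) ^ j * S j powr q))
        + (\<Sum>j. ennreal (h j powr q) * (\<integral>\<^sup>+x\<in>near_one j. ennreal (G x powr q) \<partial>lborel)))"
      by (simp add: ennreal_suminf_cmult suminf_add[symmetric])
    finally have total: "(\<integral>\<^sup>+x\<in>{0..2*pi}. ennreal (norm (cesaro \<mu> f (of_real r * cis x)) powr q) \<partial>lborel)
      \<le> ennreal E * (12 * (\<Sum>j. ennreal ((1/2) ^ j * S j powr q))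
        + (\<Sum>j. ennreal (h j powr q) * (\<integral>\<^sup>+x\<in>near_one j. ennreal (G x powr q) \<partial>lborel)))" .
    have bound: "(\<Sum>j. ennreal ((1/2) ^ j * S j powr q)) \<le> ennreal (2 * CH) * (\<Sum>j. ennreal (h j powr q) * (\<integral>\<^sup>+x\<in>dyadic_arc j. ennreal (G x powr q) \<partial>lborel))"
    proof (rule suminf_le_const[OF summableI])
      fix N
      \<comment> \<open>The sum in \<open>S j\<close> runs over k < j. It is enlarged to
        \<open>k \<le> j\<close>, the form of the discrete Hardy inequality.\<close>
      have "(\<Sum>j<N. (1/2) ^ j * S j powr q) \<le> (\<Sum>j<N. (1/2) ^ j * (\<Sum>k\<le>j. A k * h k) powr q)"
        unfolding S_def using A0 h0 q
        by (intro sum_mono mult_left_mono powr_mono2 sum_mono2) (auto intro!: sum_nonneg)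
      also have "\<dots> \<le> CH * (\<Sum>k<N. (1/2) ^ k * (A k * h k) powr q)"
        using A0 h0 by (intro CH) auto
      finally have "ennreal (\<Sum>j<N. (1/2) ^ j * S j powr q) \<le> ennreal (CH * (\<Sum>k<N. (1/2) ^ k * (A k * h k) powr q))"
        by (rule ennreal_leI)
      also have "\<dots> = ennreal CH * (\<Sum>k<N. ennreal ((1/2) ^ k * (A k * h k) powr q))"
        using CH(1) by (subst sum_ennreal) (auto simp: ennreal_mult sum_nonneg)
      also have "\<dots> \<le> ennreal CH * (\<Sum>k<N. 2 * (ennreal (h k powr q) * (\<integral>\<^sup>+x\<in>dyadic_arc k. ennreal (G x powr q) \<partial>lborel)))"
      proof (intro mult_left_mono sum_mono)
        fix k
        \<comment> \<open>The weight 2^-k is twice the length of the k-th arc, on all of which G is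
          at least \<open>A k\<close>.\<close>
        have "ennreal ((1/2) ^ k * (A k * h k) powr q) = ennreal (2 * (h k powr q * (A k powr q * (1/2) ^ Suc k)))"
          using A0 h0 by (simp add: powr_mult mult_ac)
        also have "\<dots> = 2 * (ennreal (h k powr q) * (ennreal (A k powr q) * emeasure lborel (dyadic_arc k)))"
          unfolding emeasure_dyadic_arc by (simp add: ennreal_mult del: power_Suc)
        finally have eq: "ennreal ((1/2) ^ k * (A k * h k) powr q) = 2 * (ennreal (h k powr q) * (ennreal (A k powr q) * emeasure lborel (dyadic_arc k)))" .
        have "ennreal (A k powr q) * emeasure lborel (dyadic_arc k) = (\<integral>\<^sup>+x. ennreal (A k powr q) * indicator (dyadic_arc k) x \<partial>lborel)"
          by (rule nn_integral_cmult_indicator[symmetric]) simp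
        also have "\<dots> \<le> (\<integral>\<^sup>+x\<in>dyadic_arc k. ennreal (G x powr q) \<partial>lborel)"
          using AG A0 q by (intro nn_integral_mono) (auto simp: indicator_def intro!: ennreal_leI powr_mono2)
        finally show "ennreal ((1/2) ^ k * (A k * h k) powr q) \<le> 2 * (ennreal (h k powr q) * (\<integral>\<^sup>+x\<in>dyadic_arc k. ennreal (G x powr q) \<partial>lborel))"
          unfolding eq by (intro mult_left_mono) auto
      qed auto
      also have "\<dots> = ennreal (2 * CH) * (\<Sum>k<N. ennreal (h k powr q) * (\<integral>\<^sup>+x\<in>dyadic_arc k. ennreal (G x powr q) \<partial>lborel))"
        using CH(1) by (simp add: ennreal_mult sum_distrib_left mult_ac)
      also have "\<dots> \<le> ennreal (2 * CH) * (\<Sum>k. ennreal (h k powr q) * (\<integral>\<^sup>+x\<in>dyadic_arc k. ennreal (G x powr q) \<partial>lborel))"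
        by (intro mult_left_mono sum_le_suminf) auto
      finally show "(\<Sum>j<N. ennreal ((1/2) ^ j * S j powr q)) \<le> ennreal (2 * CH) * (\<Sum>j. ennreal (h j powr q) * (\<integral>\<^sup>+x\<in>dyadic_arc j. ennreal (G x powr q) \<partial>lborel))"
        by (subst sum_ennreal) auto
    qed
    define Y1 where "Y1 = (\<Sum>j. ennreal (h j powr q) * (\<integral>\<^sup>+x\<in>dyadic_arc j. ennreal (G x powr q) \<partial>lborel))"
    define Y2 where "Y2 = (\<Sum>j. ennreal (h j powr q) * (\<integral>\<^sup>+x\<in>near_one j. ennreal (G x powr q) \<partial>lborel))"
    have "12 * (\<Sum>j. ennreal ((1/2) ^ j * S j powr q)) \<le> 12 * (ennreal (2 * CH) * Y1)"
      unfolding Y1_def by (intro mult_left_mono bound) auto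
    also have "\<dots> = ennreal (24 * CH) * Y1"
      using CH(1) by (simp add: ennreal_mult mult.assoc[symmetric])
    also have "\<dots> \<le> ennreal (24 * CH + 1) * Y1" by (intro mult_right_mono ennreal_leI) auto
    finally have "12 * (\<Sum>j. ennreal ((1/2) ^ j * S j powr q)) + Y2 \<le> ennreal (24 * CH + 1) * Y1 + ennreal (24 * CH + 1) * Y2"
    proof (rule add_mono)
      have "1 * Y2 \<le> ennreal (24 * CH + 1) * Y2"
        using CH(1) by (intro mult_right_mono) (auto simp flip: ennreal_1 intro!: ennreal_leI)
      then show "Y2 \<le> ennreal (24 * CH + 1) * Y2" by simp
    qed
    then have "ennreal E * (12 * (\<Sum>j. ennreal ((1/2) ^ j * S j powr q)) + Y2) \<le> ennreal E * (ennreal (24 * CH + 1) * (Y1 + Y2))"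
      by (intro mult_left_mono) (auto simp: distrib_left)
    also have "\<dots> = ennreal C' * (Y1 + Y2)"
      unfolding C'_def using E CH(1) by (simp add: ennreal_mult mult.assoc)
    also have "Y1 + Y2 = (\<Sum>j. ennreal (h j powr q) * arc_integral j (\<lambda>x. ennreal (G x powr q)))"
      unfolding Y1_def Y2_def arc_integral_def distrib_left
      by (subst suminf_add) (auto simp: add.commute)
    finally show ?thesis using total unfolding Y2_def h_def by (rule order_trans[rotated])
  qed
  moreover have "0 < C'" unfolding C'_def using E CH(1) by (auto intro!: mult_pos_pos add_pos_pos)
  ultimately show ?thesis using that by blast
qed

end

section \<open>Growth of Hardy functions and elementary inequalities\<close>

lemma mean_p_le_of_circle_integral_le:
  assumes f: "f holomorphic_on ball 0 1" and r: "0 \<le> r" "r < 1" and p: "0 < p" and X: "0 \<le> X"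
    and le: "(\<integral>\<^sup>+x\<in>{0..2*pi}. ennreal (norm (f (of_real r * cis x)) powr p) \<partial>lborel) \<le> ennreal X"
  shows "mean_p p r f \<le> X powr (1 / p)"
proof -
  have "2 * pi * mean_p p r f powr p \<le> X"
    using le X unfolding nn_integral_circle_eq_mean_p[OF f r p] by simp
  moreover have "1 * mean_p p r f powr p \<le> 2 * pi * mean_p p r f powr p"
    using pi_gt3 by (intro mult_right_mono) auto
  ultimately have "(mean_p p r f powr p) powr (1 / p) \<le> X powr (1 / p)"
    using p by (intro powr_mono2) auto
  then show ?thesis using p by (simp add: powr_powr mean_p_nonneg)
qed

text \<open>The majorant dominates |f(t e^(ix))| on a whole arc of length 1 - t, so its p-th power
  times 1 - t is at most the integral of the p-th power of the majorant.\<close>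

lemma hardy_growth:
  assumes p: "0 < p"
  obtains C where "0 < C" "\<And>f H t x. f holomorphic_on ball 0 1 \<Longrightarrow> (\<And>r. 0 \<le> r \<Longrightarrow> r < 1 \<Longrightarrow> mean_p p r f \<le> H) \<Longrightarrow>
    0 \<le> t \<Longrightarrow> t < 1 \<Longrightarrow> x \<in> {0..2*pi} \<Longrightarrow> norm (f (of_real t * cis x)) \<le> C * H * (1 - t) powr (- 1 / p)"
proof -
  obtain C where C: "0 < C" "\<And>f H r0. f holomorphic_on ball 0 1 \<Longrightarrow> (\<And>r. 0 \<le> r \<Longrightarrow> r < 1 \<Longrightarrow> mean_p p r f \<le> H) \<Longrightarrow>
    0 \<le> r0 \<Longrightarrow> r0 < 1 \<Longrightarrow> \<exists>G\<in>borel_measurable borel. nontangential_majorant f r0 G \<and>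
      (\<integral>\<^sup>+x\<in>{0..2*pi}. ennreal (G x powr p) \<partial>lborel) \<le> ennreal (C * H powr p)"
    using hardy_maximal[OF p] by blast
  have "norm (f (of_real t * cis x)) \<le> C powr (1 / p) * H * (1 - t) powr (- 1 / p)"
    if f: "f holomorphic_on ball 0 1" and H: "\<And>r. 0 \<le> r \<Longrightarrow> r < 1 \<Longrightarrow> mean_p p r f \<le> H"
      and t: "0 \<le> t" "t < 1" and x: "x \<in> {0..2*pi}" for f H t x
  proof -
    obtain G where G: "G \<in> borel_measurable borel" "nontangential_majorant f t G"
      "(\<integral>\<^sup>+x\<in>{0..2*pi}. ennreal (G x powr p) \<partial>lborel) \<le> ennreal (C * H powr p)"
      using C(2)[OF f H t] by blast
    define m where "m = norm (f (of_real t * cis x))"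
    \<comment> \<open>The arc starts at x, or ends there if it would otherwise leave
      [0, 2 pi].\<close>
    define a where "a = (if x + (1 - t) \<le> 2 * pi then x else x - (1 - t))"
    have H0: "0 \<le> H" using H[of 0] mean_p_nonneg[of p 0 f] by simp
    have a: "{a..a + (1 - t)} \<subseteq> {0..2*pi}" unfolding a_def using x t pi_gt3 by auto
    have mG: "m \<le> G y" if y: "y \<in> {a..a + (1 - t)}" for y
    proof -
      have "\<bar>x - y\<bar> \<le> 1 - t" using y unfolding a_def by (auto split: if_splits)
      also have "1 - t \<le> 6 * (1 - t)" using t by simp
      finally have "norm (cis x - cis y) \<le> 6 * (1 - t)" using norm_cis_minus_cis_le[of x y] by (rule order_trans[rotated])
      then show ?thesis unfolding m_def using G(2) t unfolding nontangential_majorant_def by blast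
    qed
    have "ennreal ((1 - t) * m powr p) = (\<integral>\<^sup>+y. ennreal (m powr p) * indicator {a..a + (1 - t)} y \<partial>lborel)"
      using t by (simp add: nn_integral_cmult_indicator ennreal_mult mult.commute)
    also have "\<dots> \<le> (\<integral>\<^sup>+x\<in>{0..2*pi}. ennreal (G x powr p) \<partial>lborel)"
      using a mG p by (intro nn_integral_mono) (auto simp: indicator_def m_def subset_iff intro!: ennreal_leI powr_mono2)
    also note G(3)
    finally have "(1 - t) * m powr p \<le> C * H powr p" using C(1) H0 by simp
    then have "m powr p \<le> C * H powr p / (1 - t)" using t by (simp add: field_simps)
    then have "(m powr p) powr (1 / p) \<le> (C * H powr p / (1 - t)) powr (1 / p)"
      using p by (intro powr_mono2) auto
    then have "m \<le> C powr (1 / p) * H / (1 - t) powr (1 / p)"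
      using p H0 by (simp add: powr_powr powr_mult powr_divide m_def)
    then show ?thesis unfolding m_def by (simp add: powr_minus divide_inverse)
  qed
  moreover have "0 < C powr (1 / p)" using C(1) by simp
  ultimately show ?thesis using that by blast
qed

text \<open>Since 1/s = 1/q - 1/p, the two summands balance where h equals
  \<open>(l * x) powr (p / s)\<close>; on either side of this threshold one of them alone dominates.
  The parameter l restores homogeneity and is chosen by the caller.\<close>

lemma young_conjugate_le:
  fixes h x l p q s :: real
  assumes pq: "0 < q" "q < p" and s: "s = q * p / (p - q)" and l: "0 < l" and hx: "0 \<le> h" "0 \<le> x"
  shows "(h * x) powr q \<le> l powr (p - q) * x powr p + l powr (- q) * h powr s"
proof (cases "h \<le> (l * x) powr (p / s)")
  case True
  have ps: "p / s * q = p - q" unfolding s using pq by simp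
  have "(h * x) powr q = h powr q * x powr q" by (rule powr_mult)
  also have "\<dots> \<le> ((l * x) powr (p / s)) powr q * x powr q"
    using True hx pq by (intro mult_right_mono powr_mono2) auto
  also have "\<dots> = l powr (p - q) * (x powr (p - q) * x powr q)"
    unfolding powr_powr ps powr_mult by simp
  also have "x powr (p - q) * x powr q = x powr p" by (simp flip: powr_add)
  finally show ?thesis by (simp add: add_increasing2)
next
  case False
  have s0: "0 < s" unfolding s using pq by simp
  have sq: "s / p * q + q = s" unfolding s using pq by (simp add: field_simps)
  have "((l * x) powr (p / s)) powr (s / p) \<le> h powr (s / p)"
    using False s0 pq by (intro powr_mono2) auto
  then have "l * x \<le> h powr (s / p)" using s0 pq l hx by (simp add: powr_powr)
  then have "x \<le> h powr (s / p) / l" using l by (simp add: field_simps)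
  then have "(h * x) powr q \<le> (h * (h powr (s / p) / l)) powr q"
    using hx pq by (intro powr_mono2 mult_left_mono) auto
  also have "\<dots> = l powr (- q) * (h powr (s / p * q) * h powr q)"
    unfolding powr_mult powr_divide powr_powr by (simp add: powr_minus divide_inverse)
  also have "h powr (s / p * q) * h powr q = h powr s" unfolding powr_add[symmetric] sq ..
  finally show ?thesis using hx by (simp add: add_increasing)
qed

text \<open>It permits division by Q and H in an estimate that must also cover the value 0 of
  either.\<close>

lemma le_mult_of_forall_pos_add:
  fixes x C Q H :: real
  assumes "\<And>\<epsilon>. 0 < \<epsilon> \<Longrightarrow> x \<le> C * (Q + \<epsilon>) * (H + \<epsilon>)"
  shows "x \<le> C * Q * H"
proof -
  have "((\<lambda>\<epsilon>. C * (Q + \<epsilon>) * (H + \<epsilon>)) \<longlongrightarrow> C * (Q + 0) * (H + 0)) (at_right 0)"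
    by (intro tendsto_intros)
  moreover have "\<forall>\<^sub>F \<epsilon> in at_right 0. x \<le> C * (Q + \<epsilon>) * (H + \<epsilon>)"
    using assms by (auto simp: eventually_at_right_field intro: exI[of _ 1])
  ultimately have "x \<le> C * (Q + 0) * (H + 0)" by (rule tendsto_lowerbound) simp
  then show ?thesis by simp
qed

text \<open>The minimum changes sides where \<open>2 powr (k / p)\<close> equals G / L. Before that
  index the terms grow like \<open>2 powr (k / q)\<close>, after it they decay like
  \<open>2 powr (- k * (1/p - 1/q))\<close>. The sum is therefore of the order of the term at the
  crossover, which is the product on the right.\<close>

lemma sum_min_geometric_le:
  fixes p q :: real
  assumes pq: "0 < p" "p < q"
  obtains C where "0 < C" "\<And>n G L. 0 \<le> G \<Longrightarrow> 0 < L \<Longrightarrow>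
    (\<Sum>k\<le>n. min G (L * 2 powr (real k / p)) * 2 powr (- real k * (1/p - 1/q))) \<le> C * G powr (p/q) * L powr (1 - p/q)"
proof -
  define \<delta> where "\<delta> = 1/p - 1/q"
  have d: "0 < \<delta>" unfolding \<delta>_def using pq by (simp add: field_simps)
  define \<sigma> where "\<sigma> = min \<delta> (1/q)"
  have \<sigma>: "0 < \<sigma>" unfolding \<sigma>_def using d pq by simp
  define x where "x = (2::real) powr (- \<sigma>)"
  have x: "0 < x" "x < 1" unfolding x_def using \<sigma> by (auto simp: powr_less_one)
  define C where "C = 2 powr \<sigma> * (2 / (1 - x))"
  have "(\<Sum>k\<le>n. min G (L * 2 powr (real k / p)) * 2 powr (- real k * \<delta>)) \<le> C * G powr (p/q) * L powr (1 - p/q)"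
    if G: "0 \<le> G" and L: "0 < L" for n G L
  proof (cases "G = 0")
    case True
    have "min G (L * 2 powr (real k / p)) = 0" for k using True L by (simp add: min_def)
    then show ?thesis using True by simp
  next
    case False
    define y where "y = G / L"
    have y: "0 < y" unfolding y_def using False G L by simp
    define \<kappa> where "\<kappa> = p * log 2 y"
    \<comment> \<open>The crossover \<kappa> is rounded to a natural number, with 0 for negative
      \<kappa>. Distances to k change by at most 1, which the factor \<open>2 powr \<sigma>\<close>
      absorbs; \<sigma> is the smaller of the two rates.\<close>
    define j where "j = nat \<lfloor>\<kappa>\<rfloor>"
    have yk: "y = 2 powr (\<kappa> / p)" unfolding \<kappa>_def using y pq by simp
    have bnd: "min G (L * 2 powr (real k / p)) * 2 powr (- real k * \<delta>) \<le> L * y powr (p/q) * (2 powr \<sigma> * x ^ nat \<bar>int j - int k\<bar>)" for k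
    proof -
      have "\<bar>real j - real k\<bar> \<le> \<bar>\<kappa> - real k\<bar> + 1" unfolding j_def by (cases "0 \<le> \<kappa>") linarith+
      then have dist: "\<sigma> * \<bar>real j - real k\<bar> \<le> \<sigma> * (\<bar>\<kappa> - real k\<bar> + 1)" using \<sigma> by (intro mult_left_mono) auto
      have ypq: "y powr (p/q) = 2 powr (\<kappa> / q)" unfolding yk using pq by (simp add: powr_powr)
      have \<kappa>\<delta>: "\<kappa> / p = \<kappa> / q + \<kappa> * \<delta>" unfolding \<delta>_def by (simp add: field_simps)
      have 1: "y * 2 powr (- real k * \<delta>) = 2 powr (\<kappa> / q) * 2 powr ((\<kappa> - real k) * \<delta>)"
        unfolding yk powr_add[symmetric] \<kappa>\<delta> by (simp add: algebra_simps)
      have 2: "2 powr (real k / p) * 2 powr (- real k * \<delta>) = 2 powr (\<kappa> / q) * 2 powr ((real k - \<kappa>) / q)"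
        unfolding powr_add[symmetric] \<delta>_def by (simp add: algebra_simps diff_divide_distrib)
      have "min y (2 powr (real k / p)) * 2 powr (- real k * \<delta>) \<le> 2 powr (\<kappa> / q) * 2 powr (- \<sigma> * \<bar>\<kappa> - real k\<bar>)"
      proof (cases "\<kappa> \<le> real k")
        case True
        have "min y (2 powr (real k / p)) * 2 powr (- real k * \<delta>) \<le> y * 2 powr (- real k * \<delta>)"
          by (intro mult_right_mono) auto
        also have "\<dots> \<le> 2 powr (\<kappa> / q) * 2 powr (- \<sigma> * \<bar>\<kappa> - real k\<bar>)"
          unfolding 1
        proof (intro mult_left_mono powr_mono)
          have "\<sigma> * (real k - \<kappa>) \<le> \<delta> * (real k - \<kappa>)" using True unfolding \<sigma>_def by (intro mult_right_mono) auto
          then show "(\<kappa> - real k) * \<delta> \<le> - \<sigma> * \<bar>\<kappa> - real k\<bar>" using True by (simp add: algebra_simps)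
        qed auto
        finally show ?thesis .
      next
        case False
        have "min y (2 powr (real k / p)) * 2 powr (- real k * \<delta>) \<le> 2 powr (real k / p) * 2 powr (- real k * \<delta>)"
          by (intro mult_right_mono) auto
        also have "\<dots> \<le> 2 powr (\<kappa> / q) * 2 powr (- \<sigma> * \<bar>\<kappa> - real k\<bar>)"
          unfolding 2
        proof (intro mult_left_mono powr_mono)
          have "\<sigma> * (\<kappa> - real k) \<le> 1/q * (\<kappa> - real k)" using False unfolding \<sigma>_def by (intro mult_right_mono) auto
          then show "(real k - \<kappa>) / q \<le> - \<sigma> * \<bar>\<kappa> - real k\<bar>" using False by (simp add: algebra_simps diff_divide_distrib)
        qed auto
        finally show ?thesis .
      qed
      also have "\<dots> \<le> 2 powr (\<kappa> / q) * (2 powr \<sigma> * x ^ nat \<bar>int j - int k\<bar>)"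
      proof (rule mult_left_mono)
        have "x ^ nat \<bar>int j - int k\<bar> = 2 powr (- \<sigma> * \<bar>real j - real k\<bar>)"
          unfolding x_def by (simp add: powr_powr flip: powr_realpow)
        then have "2 powr \<sigma> * x ^ nat \<bar>int j - int k\<bar> = 2 powr (\<sigma> - \<sigma> * \<bar>real j - real k\<bar>)"
          by (simp flip: powr_add)
        moreover have "- \<sigma> * \<bar>\<kappa> - real k\<bar> \<le> \<sigma> - \<sigma> * \<bar>real j - real k\<bar>" using dist by (simp add: algebra_simps)
        ultimately show "2 powr (- \<sigma> * \<bar>\<kappa> - real k\<bar>) \<le> 2 powr \<sigma> * x ^ nat \<bar>int j - int k\<bar>" by (simp add: powr_mono)
      qed simp
      finally have "min y (2 powr (real k / p)) * 2 powr (- real k * \<delta>) \<le> y powr (p/q) * (2 powr \<sigma> * x ^ nat \<bar>int j - int k\<bar>)"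
        unfolding ypq .
      then have "L * (min y (2 powr (real k / p)) * 2 powr (- real k * \<delta>)) \<le> L * (y powr (p/q) * (2 powr \<sigma> * x ^ nat \<bar>int j - int k\<bar>))"
        using L by (intro mult_left_mono) auto
      moreover have "L * min y (2 powr (real k / p)) = min G (L * 2 powr (real k / p))"
        unfolding y_def using L by (simp add: min_mult_distrib_left)
      ultimately show ?thesis by (simp add: mult.assoc[symmetric])
    qed
    have "(\<Sum>k\<le>n. min G (L * 2 powr (real k / p)) * 2 powr (- real k * \<delta>))
        \<le> (\<Sum>k\<le>n. L * y powr (p/q) * (2 powr \<sigma> * x ^ nat \<bar>int j - int k\<bar>))" by (intro sum_mono bnd)
    also have "\<dots> = L * y powr (p/q) * 2 powr \<sigma> * (\<Sum>k<Suc n. x ^ nat \<bar>int j - int k\<bar>)"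
      unfolding lessThan_Suc_atMost sum_distrib_left by (simp add: mult_ac)
    also have "\<dots> \<le> L * y powr (p/q) * 2 powr \<sigma> * (2 / (1 - x))"
      using L by (intro mult_left_mono sum_power_dist_le x) auto
    also have "L * y powr (p/q) = G powr (p/q) * L powr (1 - p/q)"
      unfolding y_def powr_divide powr_diff using L by simp
    finally show ?thesis unfolding C_def by (simp add: mult_ac)
  qed
  moreover have "0 < C" unfolding C_def using x by simp
  ultimately show ?thesis using that unfolding \<delta>_def by blast
qed

section \<open>Upper bounds in the three ranges of exponents\<close>

context doubling_measure
begin

text \<open>Common part of the cases q < p and q = p: an inequality of Young type for each level is
  integrated over the arcs of that level. The term with \<open>x powr p\<close> is summed by the
  maximal theorem, the constant term by the measure 2^-j of the arcs.\<close>

lemma cesaro_mean_le_of_young: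
  assumes p: "0 < p" and q: "0 < q"
  obtains C where "0 < C" "\<And>\<mu> f H a g r B. \<mu> \<in> M_plus \<Longrightarrow> f holomorphic_on ball 0 1 \<Longrightarrow>
    (\<And>r. 0 \<le> r \<Longrightarrow> r < 1 \<Longrightarrow> mean_p p r f \<le> H) \<Longrightarrow> 0 \<le> a \<Longrightarrow> (\<And>j. 0 \<le> g j) \<Longrightarrow>
    (\<And>j x. 0 \<le> x \<Longrightarrow> (ratio \<mu> j * x) powr q \<le> a * x powr p + g j) \<Longrightarrow>
    0 \<le> B \<Longrightarrow> (\<Sum>j. ennreal ((1/2) ^ j * g j)) \<le> ennreal B \<Longrightarrow>
    0 \<le> r \<Longrightarrow> r < 1 \<Longrightarrow> mean_p q r (cesaro \<mu> f) \<le> C * (a * H powr p + B) powr (1 / q)"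
proof -
  obtain C1 where C1: "0 < C1" "\<And>f H r0. f holomorphic_on ball 0 1 \<Longrightarrow> (\<And>r. 0 \<le> r \<Longrightarrow> r < 1 \<Longrightarrow> mean_p p r f \<le> H) \<Longrightarrow>
    0 \<le> r0 \<Longrightarrow> r0 < 1 \<Longrightarrow> \<exists>G\<in>borel_measurable borel. nontangential_majorant f r0 G \<and>
      (\<integral>\<^sup>+x\<in>{0..2*pi}. ennreal (G x powr p) \<partial>lborel) \<le> ennreal (C1 * H powr p)"
    using hardy_maximal[OF p] by blast
  obtain C2 where C2: "0 < C2" "\<And>\<mu> f G r. \<mu> \<in> M_plus \<Longrightarrow> 0 \<le> r \<Longrightarrow> r < 1 \<Longrightarrow> G \<in> borel_measurable borel \<Longrightarrow> nontangential_majorant f r G \<Longrightarrow>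
    (\<integral>\<^sup>+x\<in>{0..2*pi}. ennreal (norm (cesaro \<mu> f (of_real r * cis x)) powr q) \<partial>lborel)
      \<le> ennreal C2 * (\<Sum>j. ennreal (ratio \<mu> j powr q) * arc_integral j (\<lambda>x. ennreal (G x powr q)))"
    using cesaro_circle_integral_le[OF q] by blast
  \<comment> \<open>The numbers come from summing arc integrals, where the two families of arcs give
    2, and from the total measure of the arcs of one level, at most 13 * 2^-j.\<close>
  define C where "C = C2 * (2 * C1 + 13)"
  have C0: "0 < C" unfolding C_def using C1(1) C2(1) by simp
  have "mean_p q r (cesaro \<mu> f) \<le> C powr (1 / q) * (a * H powr p + B) powr (1 / q)"
    if \<mu>: "\<mu> \<in> M_plus" and f: "f holomorphic_on ball 0 1" and H: "\<And>r. 0 \<le> r \<Longrightarrow> r < 1 \<Longrightarrow> mean_p p r f \<le> H"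
      and a: "0 \<le> a" and g: "\<And>j. 0 \<le> g j"
      and young: "\<And>j x. 0 \<le> x \<Longrightarrow> (ratio \<mu> j * x) powr q \<le> a * x powr p + g j"
      and B: "0 \<le> B" "(\<Sum>j. ennreal ((1/2) ^ j * g j)) \<le> ennreal B"
      and r: "0 \<le> r" "r < 1" for \<mu> f H a g r B
  proof -
    obtain G where G[measurable]: "G \<in> borel_measurable borel" and maj: "nontangential_majorant f r G"
      and GH: "(\<integral>\<^sup>+x\<in>{0..2*pi}. ennreal (G x powr p) \<partial>lborel) \<le> ennreal (C1 * H powr p)"
      using C1(2)[OF f H r] by blast
    have G0: "0 \<le> G x" for x using maj unfolding nontangential_majorant_def by blast
    have one: "ennreal (ratio \<mu> j powr q) * arc_integral j (\<lambda>x. ennreal (G x powr q))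
        \<le> ennreal a * arc_integral j (\<lambda>x. ennreal (G x powr p)) + ennreal (13 * ((1/2) ^ j * g j))" for j
    proof -
      have *: "ennreal (ratio \<mu> j powr q) * (\<integral>\<^sup>+x\<in>A. ennreal (G x powr q) \<partial>lborel)
          \<le> ennreal a * (\<integral>\<^sup>+x\<in>A. ennreal (G x powr p) \<partial>lborel) + (\<integral>\<^sup>+x\<in>A. ennreal (g j) \<partial>lborel)"
        if [measurable]: "A \<in> sets borel" for A
      proof -
        have "ennreal (ratio \<mu> j powr q) * (\<integral>\<^sup>+x\<in>A. ennreal (G x powr q) \<partial>lborel)
            = (\<integral>\<^sup>+x. ennreal (ratio \<mu> j powr q) * (ennreal (G x powr q) * indicator A x) \<partial>lborel)"
          by (rule nn_integral_cmult[symmetric]) measurable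
        also have "\<dots> \<le> (\<integral>\<^sup>+x. ennreal a * (ennreal (G x powr p) * indicator A x) + ennreal (g j) * indicator A x \<partial>lborel)"
        proof (rule nn_integral_mono)
          fix x
          have "ennreal (ratio \<mu> j powr q) * ennreal (G x powr q) = ennreal ((ratio \<mu> j * G x) powr q)"
            by (simp add: powr_mult ennreal_mult)
          also have "\<dots> \<le> ennreal (a * G x powr p + g j)" using young[OF G0] by (rule ennreal_leI)
          also have "\<dots> = ennreal a * ennreal (G x powr p) + ennreal (g j)"
            using a g by (simp add: ennreal_mult ennreal_plus)
          finally show "ennreal (ratio \<mu> j powr q) * (ennreal (G x powr q) * indicator A x)
            \<le> ennreal a * (ennreal (G x powr p) * indicator A x) + ennreal (g j) * indicator A x"
            by (cases "x \<in> A") auto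
        qed
        also have "\<dots> = ennreal a * (\<integral>\<^sup>+x\<in>A. ennreal (G x powr p) \<partial>lborel) + (\<integral>\<^sup>+x\<in>A. ennreal (g j) \<partial>lborel)"
          by (simp add: nn_integral_add nn_integral_cmult)
        finally show ?thesis .
      qed
      have "ennreal (ratio \<mu> j powr q) * arc_integral j (\<lambda>x. ennreal (G x powr q))
        \<le> ennreal a * arc_integral j (\<lambda>x. ennreal (G x powr p)) + arc_integral j (\<lambda>x. ennreal (g j))"
        using add_mono[OF *[OF near_one_sets[of j]] *[OF dyadic_arc_sets[of j]]]
        unfolding arc_integral_def distrib_left by (simp only: ac_simps)
      also have "\<dots> \<le> ennreal a * arc_integral j (\<lambda>x. ennreal (G x powr p)) + ennreal (13 * ((1/2) ^ j * g j))"
        by (intro add_left_mono arc_integral_const_le g)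
      finally show ?thesis .
    qed
    have "(\<integral>\<^sup>+x\<in>{0..2*pi}. ennreal (norm (cesaro \<mu> f (of_real r * cis x)) powr q) \<partial>lborel)
      \<le> ennreal C2 * (\<Sum>j. ennreal a * arc_integral j (\<lambda>x. ennreal (G x powr p)) + ennreal (13 * ((1/2) ^ j * g j)))"
      by (rule order_trans[OF C2(2)[OF \<mu> r G maj]]) (intro mult_left_mono suminf_le summableI one; simp)
    also have "\<dots> = ennreal C2 * (ennreal a * (\<Sum>j. arc_integral j (\<lambda>x. ennreal (G x powr p))) + 13 * (\<Sum>j. ennreal ((1/2) ^ j * g j)))"
      using g by (simp add: suminf_add[symmetric] ennreal_suminf_cmult ennreal_mult)
    also have "\<dots> \<le> ennreal C2 * (ennreal a * (2 * ennreal (C1 * H powr p)) + 13 * ennreal B)"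
    proof (intro mult_left_mono add_mono B)
      show "(\<Sum>j. arc_integral j (\<lambda>x. ennreal (G x powr p))) \<le> 2 * ennreal (C1 * H powr p)"
        by (rule order_trans[OF suminf_arc_integral_le]) (measurable, intro mult_left_mono GH, simp)
    qed auto
    also have "\<dots> = ennreal (C2 * (a * (2 * (C1 * H powr p)) + 13 * B))"
      using C1(1) C2(1) a B(1) by (simp add: ennreal_mult ennreal_plus)
    also have "\<dots> \<le> ennreal (C * (a * H powr p + B))"
    proof (rule ennreal_leI)
      have "0 \<le> C2 * (2 * C1 * B + 13 * (a * H powr p))" using C1(1) C2(1) a B(1) by simp
      then show "C2 * (a * (2 * (C1 * H powr p)) + 13 * B) \<le> C * (a * H powr p + B)"
        unfolding C_def by (simp add: algebra_simps)
    qed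
    finally have "mean_p q r (cesaro \<mu> f) \<le> (C * (a * H powr p + B)) powr (1 / q)"
      using C0 a B(1) by (intro mean_p_le_of_circle_integral_le[OF cesaro_holomorphic[OF \<mu> f] r q]) auto
    then show ?thesis by (simp add: powr_mult)
  qed
  moreover have "0 < C powr (1 / q)" using C0 by simp
  ultimately show ?thesis using that by blast
qed

text \<open>The free parameter in Young's inequality is chosen as \<open>l = Q powr (s / p) / H\<close>.\<close>

lemma cesaro_mean_le_of_less:
  assumes q: "0 < q" "q < p" and s: "s = q * p / (p - q)"
  obtains C where "0 < C" "\<And>\<mu> f H Q r. \<mu> \<in> M_plus \<Longrightarrow> f holomorphic_on ball 0 1 \<Longrightarrow>
    (\<And>r. 0 \<le> r \<Longrightarrow> r < 1 \<Longrightarrow> mean_p p r f \<le> H) \<Longrightarrow> 0 \<le> Q \<Longrightarrow>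
    (\<Sum>j. ennreal ((1/2) ^ j * ratio \<mu> j powr s)) \<le> ennreal (Q powr s) \<Longrightarrow>
    0 \<le> r \<Longrightarrow> r < 1 \<Longrightarrow> mean_p q r (cesaro \<mu> f) \<le> C * Q * H"
proof -
  have p: "0 < p" using q by simp
  have s0: "0 < s" unfolding s using q by simp
  obtain C where C: "0 < C" "\<And>\<mu> f H a g r B. \<mu> \<in> M_plus \<Longrightarrow> f holomorphic_on ball 0 1 \<Longrightarrow>
    (\<And>r. 0 \<le> r \<Longrightarrow> r < 1 \<Longrightarrow> mean_p p r f \<le> H) \<Longrightarrow> 0 \<le> a \<Longrightarrow> (\<And>j. 0 \<le> g j) \<Longrightarrow>
    (\<And>j x. 0 \<le> x \<Longrightarrow> (ratio \<mu> j * x) powr q \<le> a * x powr p + g j) \<Longrightarrow>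
    0 \<le> B \<Longrightarrow> (\<Sum>j. ennreal ((1/2) ^ j * g j)) \<le> ennreal B \<Longrightarrow>
    0 \<le> r \<Longrightarrow> r < 1 \<Longrightarrow> mean_p q r (cesaro \<mu> f) \<le> C * (a * H powr p + B) powr (1 / q)"
    using cesaro_mean_le_of_young[OF p q(1)] by blast
  have "mean_p q r (cesaro \<mu> f) \<le> (C * 2 powr (1 / q)) * Q * H"
    if \<mu>: "\<mu> \<in> M_plus" and f: "f holomorphic_on ball 0 1" and H: "\<And>r. 0 \<le> r \<Longrightarrow> r < 1 \<Longrightarrow> mean_p p r f \<le> H"
      and Q: "0 \<le> Q" "(\<Sum>j. ennreal ((1/2) ^ j * ratio \<mu> j powr s)) \<le> ennreal (Q powr s)"
      and r: "0 \<le> r" "r < 1" for \<mu> f H Q r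
  proof (rule le_mult_of_forall_pos_add)
    fix \<epsilon> :: real assume \<epsilon>: "0 < \<epsilon>"
    define Q' H' where "Q' = Q + \<epsilon>" and "H' = H + \<epsilon>"
    have H0: "0 \<le> H" using H[of 0] mean_p_nonneg[of p 0 f] by simp
    have Q': "0 < Q'" "0 < H'" unfolding Q'_def H'_def using Q(1) H0 \<epsilon> by auto
    define l where "l = Q' powr (s / p) / H'"
    have l: "0 < l" unfolding l_def using Q' by simp
    have sp: "s / p = q / (p - q)" unfolding s using q by simp
    \<comment> \<open>The two exponent identities show that with this l both terms of Young's
      inequality equal the q-th power of Q' H'.\<close>
    have e1: "s / p * (p - q) = q" unfolding sp using q by simp
    have "s - s / p * q = q * (p - q) / (p - q)" unfolding sp unfolding s by (simp add: diff_divide_distrib right_diff_distrib)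
    then have e2: "s - s / p * q = q" using q by simp
    have lH: "l powr (p - q) * H' powr p = (Q' * H') powr q"
    proof -
      have "l powr (p - q) * H' powr p = (Q' powr (s / p)) powr (p - q) * (H' powr p / H' powr (p - q))"
        unfolding l_def powr_divide by simp
      also have "H' powr p / H' powr (p - q) = H' powr q" by (simp flip: powr_diff)
      finally show ?thesis by (simp only: powr_powr powr_mult e1)
    qed
    have lQ: "l powr (- q) * Q' powr s = (Q' * H') powr q"
    proof -
      have "l powr (- q) * Q' powr s = Q' powr s / (Q' powr (s / p)) powr q * H' powr q"
        unfolding l_def powr_minus powr_divide by simp
      also have "Q' powr s / (Q' powr (s / p)) powr q = Q' powr q"
        unfolding powr_powr powr_diff[symmetric] e2 ..
      finally show ?thesis by (simp add: powr_mult)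
    qed
    have "mean_p q r (cesaro \<mu> f) \<le> C * (l powr (p - q) * H' powr p + l powr (- q) * Q' powr s) powr (1 / q)"
    proof (rule C(2)[OF \<mu> f _ _ _ _ _ _ r, where g="\<lambda>j. l powr (- q) * ratio \<mu> j powr s"])
      show "mean_p p r f \<le> H'" if "0 \<le> r" "r < 1" for r using H[OF that] \<epsilon> unfolding H'_def by simp
      show "(ratio \<mu> j * x) powr q \<le> l powr (p - q) * x powr p + l powr (- q) * ratio \<mu> j powr s" if "0 \<le> x" for j x
        by (rule young_conjugate_le[OF q s l ratio_nonneg that])
      have "(\<Sum>j. ennreal ((1/2) ^ j * (l powr (- q) * ratio \<mu> j powr s))) = ennreal (l powr (- q)) * (\<Sum>j. ennreal ((1/2) ^ j * ratio \<mu> j powr s))"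
        unfolding ennreal_suminf_cmult[symmetric] by (intro suminf_cong) (simp add: ennreal_mult[symmetric] mult_ac)
      also have "\<dots> \<le> ennreal (l powr (- q)) * ennreal (Q powr s)" by (intro mult_left_mono Q) auto
      also have "\<dots> = ennreal (l powr (- q) * Q powr s)" by (simp add: ennreal_mult)
      also have "\<dots> \<le> ennreal (l powr (- q) * Q' powr s)"
        unfolding Q'_def using \<epsilon> Q(1) s0 by (intro ennreal_leI mult_left_mono powr_mono2) auto
      finally show "(\<Sum>j. ennreal ((1/2) ^ j * (l powr (- q) * ratio \<mu> j powr s))) \<le> ennreal (l powr (- q) * Q' powr s)" .
    qed auto
    also have "\<dots> = C * (2 * (Q' * H') powr q) powr (1 / q)" unfolding lH lQ by simp
    also have "\<dots> = C * 2 powr (1 / q) * Q' * H'"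
      using q Q' by (simp add: powr_mult powr_powr)
    finally show "mean_p q r (cesaro \<mu> f) \<le> C * 2 powr (1 / q) * (Q + \<epsilon>) * (H + \<epsilon>)" unfolding Q'_def H'_def .
  qed
  moreover have "0 < C * 2 powr (1 / q)" using C(1) by simp
  ultimately show ?thesis using that by blast
qed

text \<open>Equal exponents need no additive term: the level inequality holds with a = Q^p and g =
  0.\<close>

lemma cesaro_mean_le_of_eq:
  assumes p: "0 < p"
  obtains C where "0 < C" "\<And>\<mu> f H Q r. \<mu> \<in> M_plus \<Longrightarrow> f holomorphic_on ball 0 1 \<Longrightarrow>
    (\<And>r. 0 \<le> r \<Longrightarrow> r < 1 \<Longrightarrow> mean_p p r f \<le> H) \<Longrightarrow> (\<And>j. ratio \<mu> j \<le> Q) \<Longrightarrow>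
    0 \<le> r \<Longrightarrow> r < 1 \<Longrightarrow> mean_p p r (cesaro \<mu> f) \<le> C * Q * H"
proof -
  obtain C where C: "0 < C" "\<And>\<mu> f H a g r B. \<mu> \<in> M_plus \<Longrightarrow> f holomorphic_on ball 0 1 \<Longrightarrow>
    (\<And>r. 0 \<le> r \<Longrightarrow> r < 1 \<Longrightarrow> mean_p p r f \<le> H) \<Longrightarrow> 0 \<le> a \<Longrightarrow> (\<And>j. 0 \<le> g j) \<Longrightarrow>
    (\<And>j x. 0 \<le> x \<Longrightarrow> (ratio \<mu> j * x) powr p \<le> a * x powr p + g j) \<Longrightarrow>
    0 \<le> B \<Longrightarrow> (\<Sum>j. ennreal ((1/2) ^ j * g j)) \<le> ennreal B \<Longrightarrow>
    0 \<le> r \<Longrightarrow> r < 1 \<Longrightarrow> mean_p p r (cesaro \<mu> f) \<le> C * (a * H powr p + B) powr (1 / p)"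
    using cesaro_mean_le_of_young[OF p p] by blast
  have "mean_p p r (cesaro \<mu> f) \<le> C * Q * H"
    if \<mu>: "\<mu> \<in> M_plus" and f: "f holomorphic_on ball 0 1" and H: "\<And>r. 0 \<le> r \<Longrightarrow> r < 1 \<Longrightarrow> mean_p p r f \<le> H"
      and Q: "\<And>j. ratio \<mu> j \<le> Q" and r: "0 \<le> r" "r < 1" for \<mu> f H Q r
  proof -
    have H0: "0 \<le> H" using H[of 0] mean_p_nonneg[of p 0 f] by simp
    have Q0: "0 \<le> Q" using Q[of 0] ratio_nonneg[of \<mu> 0] by simp
    have "mean_p p r (cesaro \<mu> f) \<le> C * (Q powr p * H powr p + 0) powr (1 / p)"
    proof (rule C(2)[OF \<mu> f H _ _ _ _ _ r, where g="\<lambda>_. 0"])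
      fix j and x :: real assume "0 \<le> x"
      then show "(ratio \<mu> j * x) powr p \<le> Q powr p * x powr p + 0"
        using p Q[of j] ratio_nonneg[of \<mu> j] by (simp add: powr_mult mult_right_mono powr_mono2)
    qed auto
    then show ?thesis using p Q0 H0 by (simp add: powr_mult powr_powr)
  qed
  then show ?thesis using that C(1) by blast
qed

text \<open>For p < q the q-th power of a majorant of f need not be integrable. At level k the
  dilate is bounded both by G x and by the growth bound of order \<open>2 powr (k / p)\<close>, and
  the smaller of the two is used against the decay of \<open>ratio \<mu> k\<close>. Summation yields
  G to the power p/q, whose q-th power is integrable again. Each boundary point is treated on its
  own, with no comparison between arcs.\<close>

lemma cesaro_mean_le_of_greater:
  assumes p: "0 < p" "p < q"
  obtains C where "0 < C" "\<And>\<mu> f H Q r. \<mu> \<in> M_plus \<Longrightarrow> f holomorphic_on ball 0 1 \<Longrightarrow>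
    (\<And>r. 0 \<le> r \<Longrightarrow> r < 1 \<Longrightarrow> mean_p p r f \<le> H) \<Longrightarrow> (\<And>j. ratio \<mu> j \<le> Q * 2 powr (- real j * (1/p - 1/q))) \<Longrightarrow>
    0 \<le> r \<Longrightarrow> r < 1 \<Longrightarrow> mean_p q r (cesaro \<mu> f) \<le> C * Q * H"
proof -
  have q: "0 < q" using p by simp
  obtain C1 where C1: "0 < C1" "\<And>f H r0. f holomorphic_on ball 0 1 \<Longrightarrow> (\<And>r. 0 \<le> r \<Longrightarrow> r < 1 \<Longrightarrow> mean_p p r f \<le> H) \<Longrightarrow>
    0 \<le> r0 \<Longrightarrow> r0 < 1 \<Longrightarrow> \<exists>G\<in>borel_measurable borel. nontangential_majorant f r0 G \<and>
      (\<integral>\<^sup>+x\<in>{0..2*pi}. ennreal (G x powr p) \<partial>lborel) \<le> ennreal (C1 * H powr p)"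
    using hardy_maximal[OF p(1)] by blast
  obtain C2 where C2: "0 < C2" "\<And>f H t x. f holomorphic_on ball 0 1 \<Longrightarrow> (\<And>r. 0 \<le> r \<Longrightarrow> r < 1 \<Longrightarrow> mean_p p r f \<le> H) \<Longrightarrow>
    0 \<le> t \<Longrightarrow> t < 1 \<Longrightarrow> x \<in> {0..2*pi} \<Longrightarrow> norm (f (of_real t * cis x)) \<le> C2 * H * (1 - t) powr (- 1 / p)"
    using hardy_growth[OF p(1)] by blast
  obtain C3 where C3: "0 < C3" "\<And>k z. norm z < 1 \<Longrightarrow> (1/2) ^ k / 2 \<le> norm (1 - z) \<Longrightarrow> norm (kern z) \<le> C3 * 2 ^ k / W k"
    using kern_upper by blast
  obtain C4 where C4: "0 < C4" "\<And>n G L. 0 \<le> G \<Longrightarrow> 0 < L \<Longrightarrow>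
    (\<Sum>k\<le>n. min G (L * 2 powr (real k / p)) * 2 powr (- real k * (1/p - 1/q))) \<le> C4 * G powr (p/q) * L powr (1 - p/q)"
    using sum_min_geometric_le[OF p] by blast
  define C5 where "C5 = C2 * 2 powr (1/p)"
  \<comment> \<open>This is the product left after the powers of H are collected: one factor
    \<open>H powr (1 - p/q)\<close> comes from L and one \<open>H powr (p/q)\<close> from the
    maximal theorem.\<close>
  define C where "C = C3 * C4 * C5 powr (1 - p/q) * C1 powr (1/q)"
  have C50: "0 < C5" unfolding C5_def using C2(1) by simp
  have C0: "0 < C" unfolding C_def using C1(1) C3(1) C4(1) C50 by simp
  have "mean_p q r (cesaro \<mu> f) \<le> C * Q * H"
    if \<mu>: "\<mu> \<in> M_plus" and f: "f holomorphic_on ball 0 1" and H: "\<And>r. 0 \<le> r \<Longrightarrow> r < 1 \<Longrightarrow> mean_p p r f \<le> H"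
      and Q: "\<And>j. ratio \<mu> j \<le> Q * 2 powr (- real j * (1/p - 1/q))" and r: "0 \<le> r" "r < 1" for \<mu> f H Q r
  proof (rule le_mult_of_forall_pos_add)
    fix \<epsilon> :: real assume \<epsilon>: "0 < \<epsilon>"
    have H0: "0 \<le> H" using H[of 0] mean_p_nonneg[of p 0 f] by simp
    have Q0: "0 \<le> Q" using Q[of 0] ratio_nonneg[of \<mu> 0] by simp
    define H' where "H' = H + \<epsilon>"
    have H': "0 < H'" "H \<le> H'" unfolding H'_def using H0 \<epsilon> by auto
    define L where "L = C5 * H'"
    have L: "0 < L" unfolding L_def using C50 H' by simp
    obtain G where G[measurable]: "G \<in> borel_measurable borel" and maj: "nontangential_majorant f r G"
      and GH: "(\<integral>\<^sup>+x\<in>{0..2*pi}. ennreal (G x powr p) \<partial>lborel) \<le> ennreal (C1 * H powr p)"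
      using C1(2)[OF f H r] by blast
    have G0: "0 \<le> G x" for x using maj unfolding nontangential_majorant_def by blast
    \<comment> \<open>Beyond level n the factor r alone keeps t r away from 1, so the whole
      remaining tail of \<mu> is handled at level n.\<close>
    obtain n where n: "(1/2) ^ n < 1 - r" using real_arch_pow_inv[of "1 - r" "1/2"] r by auto
    have pt: "norm (cesaro \<mu> f (of_real r * cis x)) \<le> C3 * Q * C4 * L powr (1 - p/q) * G x powr (p/q)"
      if x: "x \<in> {0..2*pi}" for x
    proof -
      define z where "z = of_real r * cis x"
      have z: "norm z < 1" unfolding z_def using r by (simp add: norm_mult)
      define c where "c k = min (G x) (L * 2 powr (real k / p)) * (C3 * 2 ^ k / W k)" for k
      have c0: "0 \<le> c k" for k unfolding c_def using G0 L C3(1) W_pos[of k] by simp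
      have key: "norm (f (of_real t * z)) * norm (kern (of_real t * z)) \<le> c k"
        if t: "0 \<le> t" "t < 1" and far: "(1/2) ^ k / 2 \<le> 1 - t * r" for k t
      proof -
        have tz: "of_real t * z = of_real (t * r) * cis x" unfolding z_def by simp
        have tr: "0 \<le> t * r" "t * r \<le> r" using t r by (auto simp: mult_left_le_one_le)
        have "norm (of_real t * z) = t * r" unfolding tz norm_mult norm_of_real using tr by simp
        then have "(1/2) ^ k / 2 \<le> norm (1 - of_real t * z)"
          using norm_triangle_ineq2[of 1 "of_real t * z"] far by simp
        moreover have "norm (f (of_real t * z)) \<le> min (G x) (L * 2 powr (real k / p))"
        proof (rule min.boundedI)
          have "norm (cis x - cis x) \<le> 6 * (1 - t * r)" using tr r by simp
          then show "norm (f (of_real t * z)) \<le> G x"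
            unfolding tz using maj tr unfolding nontangential_majorant_def by blast
          have "norm (f (of_real t * z)) \<le> C2 * H * (1 - t * r) powr (- 1 / p)"
            unfolding tz using tr r by (intro C2(2)[OF f H _ _ x]) auto
          also have "\<dots> \<le> C2 * H' * ((1/2) ^ k / 2) powr (- 1 / p)"
            using far C2(1) H0 H' p by (intro mult_mono powr_mono2') auto
          also have "((1/2::real) ^ k / 2) powr (- 1 / p) = 2 powr (1/p) * 2 powr (real k / p)"
          proof -
            have "(1/2::real) ^ k / 2 = inverse (2 ^ Suc k)" by (simp add: power_one_over inverse_eq_divide)
            also have "\<dots> = 2 powr (- (real k + 1))" by (subst powr_minus) (simp add: powr_add powr_realpow)
            finally have half: "(1/2::real) ^ k / 2 = 2 powr (- (real k + 1))" .
            have "- (real k + 1) * (- 1 / p) = (real k + 1) / p" using p by (simp add: field_simps)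
            then have "((1/2::real) ^ k / 2) powr (- 1 / p) = 2 powr ((real k + 1) / p)" unfolding half powr_powr by (rule arg_cong)
            then show ?thesis by (simp add: add_divide_distrib add.commute flip: powr_add)
          qed
          finally show "norm (f (of_real t * z)) \<le> L * 2 powr (real k / p)" unfolding L_def C5_def by (simp add: mult_ac)
        qed
        ultimately show ?thesis unfolding c_def by (intro norm_dilate_kernel_le[OF C3(2) t z _ _ C3(1)])
      qed
      have "norm (cesaro \<mu> f z) \<le> (\<Sum>k\<le>n. c k * dyadic_tail \<mu> k)"
      proof (rule norm_cesaro_le[OF \<mu> c0])
        fix k t assume t: "1 - (1/2) ^ k \<le> t" "t < 1 - (1/2::real) ^ Suc k"
        have t01: "0 \<le> t" "t < 1"
          using t half_power_le_1(2)[of k] zero_less_power[of "1/2::real" "Suc k"] by linarith+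
        have "t * r \<le> t * 1" using t01 r by (intro mult_left_mono) auto
        then show "norm (f (of_real t * z)) * norm (kern (of_real t * z)) \<le> c k" using t by (intro key t01) auto
      next
        fix t assume t: "1 - (1/2::real) ^ n \<le> t" "t < 1"
        have t01: "0 \<le> t" "t < 1" using t half_power_le_1(2)[of n] by linarith+
        have "t * r \<le> 1 * r" using t01 r by (intro mult_right_mono) auto
        then have "(1/2) ^ n / 2 \<le> 1 - t * r" using n zero_le_power[of "1/2::real" n] by linarith
        then show "norm (f (of_real t * z)) * norm (kern (of_real t * z)) \<le> c n" by (intro key t01)
      qed
      also have "\<dots> = (\<Sum>k\<le>n. C3 * (min (G x) (L * 2 powr (real k / p)) * ratio \<mu> k))"
        by (intro sum.cong) (simp_all add: c_def ratio_def)
      also have "\<dots> \<le> (\<Sum>k\<le>n. C3 * (min (G x) (L * 2 powr (real k / p)) * (Q * 2 powr (- real k * (1/p - 1/q)))))"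
        using Q C3(1) G0 L by (intro sum_mono mult_left_mono) auto
      also have "\<dots> = C3 * Q * (\<Sum>k\<le>n. min (G x) (L * 2 powr (real k / p)) * 2 powr (- real k * (1/p - 1/q)))"
        unfolding sum_distrib_left by (simp only: mult_ac)
      also have "\<dots> \<le> C3 * Q * (C4 * G x powr (p/q) * L powr (1 - p/q))"
        using C3(1) Q0 G0 L by (intro mult_left_mono C4) auto
      finally show ?thesis unfolding z_def by (simp add: mult_ac)
    qed
    define E where "E = (C3 * Q * C4 * L powr (1 - p/q)) powr q"
    have "(\<integral>\<^sup>+x\<in>{0..2*pi}. ennreal (norm (cesaro \<mu> f (of_real r * cis x)) powr q) \<partial>lborel)
       \<le> (\<integral>\<^sup>+x. ennreal E * (ennreal (G x powr p) * indicator {0..2*pi} x) \<partial>lborel)"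
    proof (rule nn_integral_mono)
      fix x :: real
      show "ennreal (norm (cesaro \<mu> f (of_real r * cis x)) powr q) * indicator {0..2*pi} x
        \<le> ennreal E * (ennreal (G x powr p) * indicator {0..2*pi} x)"
      proof (cases "x \<in> {0..2*pi}")
        case True
        have "norm (cesaro \<mu> f (of_real r * cis x)) powr q \<le> (C3 * Q * C4 * L powr (1 - p/q) * G x powr (p/q)) powr q"
          using q by (intro powr_mono2 pt True) auto
        also have "\<dots> = E * G x powr p" unfolding E_def powr_mult[of _ "G x powr (p/q)"] using q by (simp add: powr_powr)
        finally have "ennreal (norm (cesaro \<mu> f (of_real r * cis x)) powr q) \<le> ennreal E * ennreal (G x powr p)"
          by (simp add: E_def ennreal_leI flip: ennreal_mult)
        then show ?thesis using True by simp
      qed simp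
    qed
    also have "\<dots> = ennreal E * (\<integral>\<^sup>+x\<in>{0..2*pi}. ennreal (G x powr p) \<partial>lborel)"
      by (rule nn_integral_cmult) simp
    also have "\<dots> \<le> ennreal E * ennreal (C1 * H powr p)" by (intro mult_left_mono GH) auto
    also have "\<dots> = ennreal (E * (C1 * H powr p))" unfolding E_def using C1(1) by (simp add: ennreal_mult)
    finally have "mean_p q r (cesaro \<mu> f) \<le> (E * (C1 * H powr p)) powr (1 / q)"
      using C1(1) by (intro mean_p_le_of_circle_integral_le[OF cesaro_holomorphic[OF \<mu> f] r q]) (auto simp: E_def)
    also have "\<dots> \<le> (E * (C1 * H' powr p)) powr (1 / q)"
      using C1(1) H0 H' p q by (intro powr_mono2 mult_left_mono mult_nonneg_nonneg) (auto simp: E_def)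
    also have "\<dots> = (C3 * Q * C4 * L powr (1 - p/q)) * (C1 powr (1/q) * H' powr (p/q))"
      unfolding E_def powr_mult[of "_ powr q"] powr_mult[of C1] powr_powr using q C3(1) C4(1) Q0 by simp
    also have "\<dots> = C * Q * (H' powr (1 - p/q) * H' powr (p/q))"
      unfolding L_def C_def powr_mult by (simp add: mult_ac)
    also have "H' powr (1 - p/q) * H' powr (p/q) = H'" using H' by (simp flip: powr_add)
    also have "C * Q * H' \<le> C * (Q + \<epsilon>) * H'" using C0 H' \<epsilon> by (intro mult_right_mono mult_left_mono) auto
    finally show "mean_p q r (cesaro \<mu> f) \<le> C * (Q + \<epsilon>) * (H + \<epsilon>)" unfolding H'_def .
  qed
  then show ?thesis using that C0 by blast
qed

text \<open>The constant 1 is a nontangential majorant of itself, so the arc integrals reduce to the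
  measures of the arcs.\<close>

lemma cesaro_one_mean_le:
  assumes s: "0 < s"
  obtains C where "0 < C" "\<And>\<mu> Q r. \<mu> \<in> M_plus \<Longrightarrow> 0 \<le> Q \<Longrightarrow>
    (\<Sum>j. ennreal ((1/2) ^ j * ratio \<mu> j powr s)) \<le> ennreal (Q powr s) \<Longrightarrow>
    0 \<le> r \<Longrightarrow> r < 1 \<Longrightarrow> mean_p s r (cesaro \<mu> (\<lambda>_. 1)) \<le> C * Q"
proof -
  obtain C2 where C2: "0 < C2" "\<And>\<mu> f G r. \<mu> \<in> M_plus \<Longrightarrow> 0 \<le> r \<Longrightarrow> r < 1 \<Longrightarrow> G \<in> borel_measurable borel \<Longrightarrow> nontangential_majorant f r G \<Longrightarrow>
    (\<integral>\<^sup>+x\<in>{0..2*pi}. ennreal (norm (cesaro \<mu> f (of_real r * cis x)) powr s) \<partial>lborel)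
      \<le> ennreal C2 * (\<Sum>j. ennreal (ratio \<mu> j powr s) * arc_integral j (\<lambda>x. ennreal (G x powr s)))"
    using cesaro_circle_integral_le[OF s] by blast
  have "mean_p s r (cesaro \<mu> (\<lambda>_. 1)) \<le> (13 * C2) powr (1 / s) * Q"
    if \<mu>: "\<mu> \<in> M_plus" and Q: "0 \<le> Q" "(\<Sum>j. ennreal ((1/2) ^ j * ratio \<mu> j powr s)) \<le> ennreal (Q powr s)"
      and r: "0 \<le> r" "r < 1" for \<mu> Q r
  proof -
    have "nontangential_majorant (\<lambda>_. 1) r (\<lambda>_. 1)" unfolding nontangential_majorant_def by simp
    from C2(2)[OF \<mu> r _ this]
    have "(\<integral>\<^sup>+x\<in>{0..2*pi}. ennreal (norm (cesaro \<mu> (\<lambda>_. 1) (of_real r * cis x)) powr s) \<partial>lborel)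
      \<le> ennreal C2 * (\<Sum>j. ennreal (ratio \<mu> j powr s) * arc_integral j (\<lambda>x. ennreal 1))" by simp
    also have "\<dots> \<le> ennreal C2 * (\<Sum>j. 13 * ennreal ((1/2) ^ j * ratio \<mu> j powr s))"
    proof (intro mult_left_mono suminf_le summableI)
      fix j
      have "ennreal (ratio \<mu> j powr s) * arc_integral j (\<lambda>x. ennreal 1) \<le> ennreal (ratio \<mu> j powr s) * ennreal (13 * ((1/2) ^ j * 1))"
        by (intro mult_left_mono arc_integral_const_le) auto
      also have "\<dots> = 13 * ennreal ((1/2) ^ j * ratio \<mu> j powr s)" by (simp add: ennreal_mult mult_ac)
      finally show "ennreal (ratio \<mu> j powr s) * arc_integral j (\<lambda>x. ennreal 1) \<le> 13 * ennreal ((1/2) ^ j * ratio \<mu> j powr s)" .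
    qed auto
    also have "\<dots> \<le> ennreal C2 * (13 * ennreal (Q powr s))"
      unfolding ennreal_suminf_cmult by (intro mult_left_mono Q) auto
    also have "\<dots> = ennreal (13 * C2 * Q powr s)" using C2(1) by (simp add: ennreal_mult mult_ac)
    finally have "mean_p s r (cesaro \<mu> (\<lambda>_. 1)) \<le> (13 * C2 * Q powr s) powr (1 / s)"
      using C2(1) by (intro mean_p_le_of_circle_integral_le[OF cesaro_holomorphic[OF \<mu>] r s]) auto
    also have "\<dots> = (13 * C2) powr (1 / s) * Q"
      unfolding powr_mult[of "13 * C2"] using s Q(1) by (simp add: powr_powr)
    finally show ?thesis .
  qed
  moreover have "0 < (13 * C2) powr (1 / s)" using C2(1) by simp
  ultimately show ?thesis using that by blast
qed

end

subsection \<open>Lower bounds\<close>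

text \<open>The point \<open>1 - (1/2) ^ j\<close> lies in the nontangential region of every angle
  of the j-th arc, because these angles are at most 2^-j. So |g| there is bounded by the majorant on
  that arc, and the arcs are disjoint.\<close>

lemma hardy_radial_sum_le:
  assumes q: "0 < q"
  obtains C where "0 < C" "\<And>g H n. g holomorphic_on ball 0 1 \<Longrightarrow> (\<And>r. 0 \<le> r \<Longrightarrow> r < 1 \<Longrightarrow> mean_p q r g \<le> H) \<Longrightarrow>
    (\<Sum>j<n. (1/2) ^ j * norm (g (of_real (1 - (1/2) ^ j))) powr q) \<le> C * H powr q"
proof -
  obtain C1 where C1: "0 < C1" "\<And>f H r0. f holomorphic_on ball 0 1 \<Longrightarrow> (\<And>r. 0 \<le> r \<Longrightarrow> r < 1 \<Longrightarrow> mean_p q r f \<le> H) \<Longrightarrow>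
    0 \<le> r0 \<Longrightarrow> r0 < 1 \<Longrightarrow> \<exists>G\<in>borel_measurable borel. nontangential_majorant f r0 G \<and>
      (\<integral>\<^sup>+x\<in>{0..2*pi}. ennreal (G x powr q) \<partial>lborel) \<le> ennreal (C1 * H powr q)"
    using hardy_maximal[OF q] by blast
  have "(\<Sum>j<n. (1/2) ^ j * norm (g (of_real (1 - (1/2) ^ j))) powr q) \<le> 4 * C1 * H powr q"
    if g: "g holomorphic_on ball 0 1" and H: "\<And>r. 0 \<le> r \<Longrightarrow> r < 1 \<Longrightarrow> mean_p q r g \<le> H" for g H n
  proof -
    have r0: "0 \<le> 1 - (1/2::real) ^ n" "1 - (1/2::real) ^ n < 1" by (auto simp: half_power_le_1)
    obtain G where G[measurable]: "G \<in> borel_measurable borel" and maj: "nontangential_majorant g (1 - (1/2) ^ n) G"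
      and GH: "(\<integral>\<^sup>+x\<in>{0..2*pi}. ennreal (G x powr q) \<partial>lborel) \<le> ennreal (C1 * H powr q)"
      using C1(2)[OF g H r0] by blast
    define m where "m j = norm (g (of_real (1 - (1/2) ^ j)))" for j
    have mG: "m j \<le> G y" if j: "j < n" and y: "y \<in> dyadic_arc j" for j y
    proof -
      have y2: "(1/2) ^ Suc j < y" "y \<le> (1/2) ^ j" using y unfolding dyadic_arc_def by auto
      then have "0 \<le> y" using zero_le_power[of "1/2::real" "Suc j"] by linarith
      have "norm (cis 0 - cis y) \<le> \<bar>0 - y\<bar>" by (rule norm_cis_minus_cis_le)
      also have "\<dots> \<le> 6 * (1 - (1 - (1/2) ^ j))" using y2 \<open>0 \<le> y\<close> by simp
      finally have "norm (cis 0 - cis y) \<le> 6 * (1 - (1 - (1/2) ^ j))" .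
      moreover have "1 - (1/2::real) ^ j \<le> 1 - (1/2) ^ n" using j by (simp add: power_decreasing)
      ultimately have "norm (g (of_real (1 - (1/2) ^ j) * cis 0)) \<le> G y"
        using maj half_power_le_1(2)[of j] unfolding nontangential_majorant_def by blast
      then show ?thesis unfolding m_def by simp
    qed
    have "ennreal (\<Sum>j<n. (1/2) ^ j * m j powr q) = (\<Sum>j<n. ennreal ((1/2) ^ j * m j powr q))"
      by (rule sum_ennreal[symmetric]) simp
    also have "\<dots> \<le> (\<Sum>j<n. 2 * arc_integral j (\<lambda>x. ennreal (G x powr q)))"
    proof (rule sum_mono)
      fix j assume j: "j \<in> {..<n}"
      have "ennreal ((1/2) ^ j * m j powr q) = ennreal (2 * (m j powr q * (1/2) ^ Suc j))" by simp
      also have "\<dots> = 2 * (ennreal (m j powr q) * emeasure lborel (dyadic_arc j))"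
        unfolding emeasure_dyadic_arc by (simp add: ennreal_mult del: power_Suc)
      finally have eq: "ennreal ((1/2) ^ j * m j powr q) = 2 * (ennreal (m j powr q) * emeasure lborel (dyadic_arc j))" .
      have "ennreal (m j powr q) * emeasure lborel (dyadic_arc j) = (\<integral>\<^sup>+x. ennreal (m j powr q) * indicator (dyadic_arc j) x \<partial>lborel)"
        by (rule nn_integral_cmult_indicator[symmetric]) simp
      also have "\<dots> \<le> (\<integral>\<^sup>+x\<in>dyadic_arc j. ennreal (G x powr q) \<partial>lborel)"
        using mG j q by (intro nn_integral_mono) (auto simp: indicator_def m_def intro!: ennreal_leI powr_mono2)
      also have "\<dots> \<le> arc_integral j (\<lambda>x. ennreal (G x powr q))" unfolding arc_integral_def by simp
      finally show "ennreal ((1/2) ^ j * m j powr q) \<le> 2 * arc_integral j (\<lambda>x. ennreal (G x powr q))"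
        unfolding eq by (intro mult_left_mono) auto
    qed
    also have "\<dots> = 2 * (\<Sum>j<n. arc_integral j (\<lambda>x. ennreal (G x powr q)))" by (simp add: sum_distrib_left)
    also have "\<dots> \<le> 2 * (\<Sum>j. arc_integral j (\<lambda>x. ennreal (G x powr q)))"
      by (intro mult_left_mono sum_le_suminf) auto
    also have "\<dots> \<le> 2 * (2 * ennreal (C1 * H powr q))"
      by (intro mult_left_mono order_trans[OF suminf_arc_integral_le] GH) (auto intro: mult_left_mono GH)
    also have "\<dots> = ennreal (4 * C1 * H powr q)" using C1(1) by (simp add: ennreal_mult mult.assoc[symmetric])
    finally show ?thesis using C1(1) unfolding m_def by simp
  qed
  moreover have "0 < 4 * C1" using C1(1) by simp
  ultimately show ?thesis using that by blast
qed

text \<open>Normalised so that the modulus is at most 1 in the disc. It is of order 1 on the part of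
  the circle at distance about 2^-k from 1 and decays with power M away from it.\<close>

definition peak :: "nat \<Rightarrow> nat \<Rightarrow> complex \<Rightarrow> complex" where
  "peak M k z = (of_real ((1/2) ^ k) / (1 - of_real (1 - (1/2) ^ k) * z)) ^ M"

lemma peak_denominator_ge:
  fixes z :: complex
  assumes "norm z < 1"
  shows "(1/2) ^ k \<le> norm (1 - of_real (1 - (1/2) ^ k) * z)"
proof -
  have "norm (of_real (1 - (1/2) ^ k) * z) = (1 - (1/2) ^ k) * norm z"
    unfolding norm_mult norm_of_real using half_power_le_1(2)[of k] by simp
  also have "\<dots> \<le> (1 - (1/2) ^ k) * 1" using assms half_power_le_1(2)[of k] by (intro mult_left_mono) auto
  finally show ?thesis using norm_triangle_ineq2[of 1 "of_real (1 - (1/2) ^ k) * z"] by simp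
qed

lemma peak_holomorphic: "peak M k holomorphic_on ball 0 1"
proof -
  have "1 - of_real (1 - (1/2) ^ k) * z \<noteq> 0" if "z \<in> ball 0 1" for z :: complex
  proof -
    have "norm (1 - of_real (1 - (1/2) ^ k) * z) > 0"
      using that by (intro less_le_trans[OF _ peak_denominator_ge]) auto
    then show ?thesis using zero_less_norm_iff by blast
  qed
  then show ?thesis unfolding peak_def by (intro holomorphic_intros) auto
qed

text \<open>The denominator is at least 2^-k and, by the triangle inequality along the radius, at
  least half the distance of e^(ix) to 1. The resulting decay is exactly the weight of
  \<open>discrete_hardy\<close>.\<close>

lemma norm_peak_le:
  assumes r: "0 \<le> r" "r < 1" and x: "(1/2) ^ j < norm (1 - cis x)"
  shows "norm (peak M k (of_real r * cis x)) \<le> 2 ^ M * min 1 (2 ^ j / 2 ^ k) ^ M"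
proof -
  define \<rho> where "\<rho> = 1 - (1/2::real) ^ k"
  have \<rho>: "0 \<le> \<rho>" "\<rho> < 1" unfolding \<rho>_def by (auto simp: half_power_le_1)
  define N where "N = norm (1 - of_real \<rho> * (of_real r * cis x))"
  have \<rho>r: "0 \<le> \<rho> * r" "\<rho> * r \<le> 1" using \<rho> r by (auto simp: mult_le_one)
  have N1: "(1/2) ^ k \<le> N" unfolding N_def \<rho>_def using r by (intro peak_denominator_ge) (simp add: norm_mult)
  have N0: "0 < N" using N1 zero_less_power[of "1/2::real" k] by linarith
  have "norm (of_real \<rho> * (of_real r * cis x)) = \<rho> * r" using \<rho> r by (simp add: norm_mult)
  then have "1 - \<rho> * r \<le> N" unfolding N_def using norm_triangle_ineq2[of 1 "of_real \<rho> * (of_real r * cis x)"] by simp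
  moreover have "norm (of_real \<rho> * (of_real r * cis x) - cis x) = 1 - \<rho> * r"
  proof -
    have "of_real \<rho> * (of_real r * cis x) - cis x = of_real (\<rho> * r - 1) * cis x" by (simp add: algebra_simps)
    then show ?thesis using \<rho>r by (simp only: norm_mult norm_of_real norm_cis) simp
  qed
  moreover have "norm (1 - cis x) \<le> N + norm (of_real \<rho> * (of_real r * cis x) - cis x)"
    unfolding N_def using norm_triangle_ineq[of "1 - of_real \<rho> * (of_real r * cis x)" "of_real \<rho> * (of_real r * cis x) - cis x"] by simp
  ultimately have N2: "(1/2) ^ j / 2 \<le> N" using x by simp
  have "(1/2) ^ k / N \<le> 2 * min 1 (2 ^ j / 2 ^ k)"
  proof (cases "1 \<le> (2::real) ^ j / 2 ^ k")
    case True
    have "(1/2) ^ k / N \<le> 1" using N1 N0 by simp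
    then show ?thesis using True by simp
  next
    case False
    have "(1/2) ^ k / N \<le> (1/2) ^ k / ((1/2) ^ j / 2)" using N2 N0 by (intro divide_left_mono) auto
    also have "\<dots> = 2 * (2 ^ j / 2 ^ k)" by (simp add: power_divide)
    finally show ?thesis using False by simp
  qed
  then have "((1/2) ^ k / N) ^ M \<le> (2 * min 1 (2 ^ j / 2 ^ k)) ^ M" using N0 by (intro power_mono) auto
  then show ?thesis unfolding peak_def norm_power norm_divide \<rho>_def[symmetric] N_def[symmetric] power_mult_distrib
    by (simp add: norm_power norm_divide)
qed

text \<open>With \<open>2 \<le> M * p\<close> the interaction of peaks at different levels is
  summable, so the norm of a combination is controlled as if the peaks had disjoint supports of
  length 2^-k.\<close>

lemma peak_sum_mean_le:
  assumes p: "0 < p" and M: "2 \<le> real M * p"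
  obtains C where "0 < C" "\<And>l n r. (\<And>k. 0 \<le> l k) \<Longrightarrow> 0 \<le> r \<Longrightarrow> r < 1 \<Longrightarrow>
    mean_p p r (\<lambda>z. \<Sum>k<n. of_real (l k) * peak M k z) \<le> C * (\<Sum>k<n. (1/2) ^ k * l k powr p) powr (1 / p)"
proof -
  obtain C1 where C1: "C1 > 0" "\<And>a N n. (\<And>k. 0 \<le> a k) \<Longrightarrow>
      (\<Sum>j<N. (1/2) ^ j * (\<Sum>k<n. a k * min 1 (2 ^ j / 2 ^ k) ^ M) powr p)
        \<le> C1 * (\<Sum>k<n. (1/2) ^ k * a k powr p)"
    using discrete_hardy[OF p M] by blast
  define C where "C = 12 * (2 ^ M) powr p * C1"
  have C0: "0 < C" unfolding C_def using C1 by simp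
  have "mean_p p r (\<lambda>z. \<Sum>k<n. of_real (l k) * peak M k z) \<le> C powr (1 / p) * (\<Sum>k<n. (1/2) ^ k * l k powr p) powr (1 / p)"
    if l: "\<And>k. 0 \<le> l k" and r: "0 \<le> r" "r < 1" for l n r
  proof -
    define f where "f z = (\<Sum>k<n. of_real (l k) * peak M k z)" for z
    have f: "f holomorphic_on ball 0 1" unfolding f_def by (intro holomorphic_intros peak_holomorphic)
    define T where "T j = (\<Sum>k<n. l k * min 1 (2 ^ j / 2 ^ k) ^ M)" for j :: nat
    define \<Sigma> where "\<Sigma> = (\<Sum>k<n. (1/2) ^ k * l k powr p)"
    have pt: "norm (f (of_real r * cis x)) powr p \<le> (2 ^ M) powr p * T j powr p" if x: "x \<in> near_one j" for x j
    proof -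
      have "norm (f (of_real r * cis x)) \<le> (\<Sum>k<n. l k * (2 ^ M * min 1 (2 ^ j / 2 ^ k) ^ M))"
        unfolding f_def
      proof (rule sum_norm_le)
        fix k
        show "norm (of_real (l k) * peak M k (of_real r * cis x)) \<le> l k * (2 ^ M * min 1 (2 ^ j / 2 ^ k) ^ M)"
          unfolding norm_mult using l[of k] x by (auto intro!: mult_left_mono norm_peak_le r simp: near_one_def)
      qed
      also have "\<dots> = 2 ^ M * T j" unfolding T_def sum_distrib_left by (intro sum.cong) auto
      finally have "norm (f (of_real r * cis x)) powr p \<le> (2 ^ M * T j) powr p" using p by (intro powr_mono2) auto
      then show ?thesis by (simp only: powr_mult)
    qed
    have "(\<integral>\<^sup>+x\<in>{0..2*pi}. ennreal (norm (f (of_real r * cis x)) powr p) \<partial>lborel)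
        \<le> (\<integral>\<^sup>+x. (\<Sum>j. ennreal ((2 ^ M) powr p * T j powr p) * indicator (near_one j) x) \<partial>lborel)"
    proof (rule nn_integral_mono_AE)
      show "AE x in lborel. ennreal (norm (f (of_real r * cis x)) powr p) * indicator {0..2*pi} x
          \<le> (\<Sum>j. ennreal ((2 ^ M) powr p * T j powr p) * indicator (near_one j) x)"
        using AE_near_one
      proof eventually_elim
        case (elim x)
        show ?case
        proof (cases "x \<in> {0..2*pi}")
          case True
          then obtain j where j: "x \<in> near_one j" using elim by blast
          define F where "F i = ennreal ((2 ^ M) powr p * T i powr p) * indicator (near_one i) x" for i
          have "ennreal (norm (f (of_real r * cis x)) powr p) \<le> F j"
            unfolding F_def using ennreal_leI[OF pt[OF j]] j by simp
          also have "\<dots> = (\<Sum>i\<in>{j}. F i)" by simp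
          also have "\<dots> \<le> (\<Sum>j. F j)" by (intro sum_le_suminf) auto
          finally show ?thesis using True unfolding F_def by simp
        qed simp
      qed
    qed
    also have "\<dots> = (\<Sum>j. \<integral>\<^sup>+x. ennreal ((2 ^ M) powr p * T j powr p) * indicator (near_one j) x \<partial>lborel)"
      by (rule nn_integral_suminf) simp
    also have "\<dots> \<le> (\<Sum>j. ennreal (12 * (2 ^ M) powr p) * ennreal ((1/2) ^ j * T j powr p))"
    proof (intro suminf_le summableI)
      fix j
      have "(\<integral>\<^sup>+x. ennreal ((2 ^ M) powr p * T j powr p) * indicator (near_one j) x \<partial>lborel)
          = ennreal ((2 ^ M) powr p * T j powr p) * emeasure lborel (near_one j)"
        by (rule nn_integral_cmult_indicator) simp
      also have "\<dots> \<le> ennreal ((2 ^ M) powr p * T j powr p) * ennreal (12 * (1/2) ^ j)"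
        by (intro mult_left_mono emeasure_near_one) auto
      also have "\<dots> = ennreal (12 * (2 ^ M) powr p * ((1/2) ^ j * T j powr p))"
        by (subst ennreal_mult[symmetric]) (simp_all add: mult_ac)
      also have "\<dots> = ennreal (12 * (2 ^ M) powr p) * ennreal ((1/2) ^ j * T j powr p)"
        by (rule ennreal_mult) auto
      finally show "(\<integral>\<^sup>+x. ennreal ((2 ^ M) powr p * T j powr p) * indicator (near_one j) x \<partial>lborel)
        \<le> ennreal (12 * (2 ^ M) powr p) * ennreal ((1/2) ^ j * T j powr p)" .
    qed
    also have "\<dots> = ennreal (12 * (2 ^ M) powr p) * (\<Sum>j. ennreal ((1/2) ^ j * T j powr p))"
      by (rule ennreal_suminf_cmult)
    also have "(\<Sum>j. ennreal ((1/2) ^ j * T j powr p)) \<le> ennreal (C1 * \<Sigma>)"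
    proof (rule suminf_le_const[OF summableI])
      fix N
      have "(\<Sum>j<N. ennreal ((1/2) ^ j * T j powr p)) = ennreal (\<Sum>j<N. (1/2) ^ j * T j powr p)"
        by (rule sum_ennreal) simp
      also have "\<dots> \<le> ennreal (C1 * \<Sigma>)" unfolding T_def \<Sigma>_def by (intro ennreal_leI C1 l)
      finally show "(\<Sum>j<N. ennreal ((1/2) ^ j * T j powr p)) \<le> ennreal (C1 * \<Sigma>)" .
    qed
    then have "ennreal (12 * (2 ^ M) powr p) * (\<Sum>j. ennreal ((1/2) ^ j * T j powr p)) \<le> ennreal (12 * (2 ^ M) powr p) * ennreal (C1 * \<Sigma>)"
      by (intro mult_left_mono) auto
    also have "\<dots> = ennreal (C * \<Sigma>)" unfolding C_def by (subst ennreal_mult[symmetric]) (use C1(1) in \<open>auto simp: \<Sigma>_def mult_ac intro!: mult_nonneg_nonneg sum_nonneg\<close>)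
    finally have "mean_p p r f \<le> (C * \<Sigma>) powr (1 / p)"
      using C0 by (intro mean_p_le_of_circle_integral_le f r p) (auto simp: \<Sigma>_def intro!: sum_nonneg mult_nonneg_nonneg)
    then show ?thesis unfolding f_def \<Sigma>_def powr_mult .
  qed
  moreover have "0 < C powr (1 / p)" using C0 by simp
  ultimately show ?thesis using that by blast
qed

section \<open>Lower bounds for images of test functions\<close>

context doubling_measure
begin

text \<open>On the radius the integrand is real and nonnegative, so the integral may be restricted
  to \<open>t \<ge> 1 - (1/2) ^ j\<close>. There the argument of f and of the kernel is a product of
  two such numbers, at least their square, and both factors increase.\<close>

lemma norm_cesaro_real_ge:
  obtains c where "0 < c" "\<And>\<mu> f u j. \<mu> \<in> M_plus \<Longrightarrow> f holomorphic_on ball 0 1 \<Longrightarrow>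
    (\<And>x. 0 \<le> x \<Longrightarrow> x < 1 \<Longrightarrow> f (of_real x) = of_real (u x)) \<Longrightarrow> (\<And>x. 0 \<le> x \<Longrightarrow> x < 1 \<Longrightarrow> 0 \<le> u x) \<Longrightarrow>
    (\<And>x y. 0 \<le> x \<Longrightarrow> x \<le> y \<Longrightarrow> y < 1 \<Longrightarrow> u x \<le> u y) \<Longrightarrow>
    c * u ((1 - (1/2) ^ j)\<^sup>2) * ratio \<mu> j \<le> norm (cesaro \<mu> f (of_real (1 - (1/2) ^ j)))"
proof -
  obtain c where c: "0 < c" "\<And>k x. (1 - (1/2) ^ k)\<^sup>2 \<le> x \<Longrightarrow> x < 1 \<Longrightarrow> c * 2 ^ k / W k \<le> kernr x"
    using kern_lower by blast
  have "c * u ((1 - (1/2) ^ j)\<^sup>2) * ratio \<mu> j \<le> norm (cesaro \<mu> f (of_real (1 - (1/2) ^ j)))"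
    if \<mu>: "\<mu> \<in> M_plus" and f: "f holomorphic_on ball 0 1" and fu: "\<And>x. 0 \<le> x \<Longrightarrow> x < 1 \<Longrightarrow> f (of_real x) = of_real (u x)"
      and u0: "\<And>x. 0 \<le> x \<Longrightarrow> x < 1 \<Longrightarrow> 0 \<le> u x" and um: "\<And>x y. 0 \<le> x \<Longrightarrow> x \<le> y \<Longrightarrow> y < 1 \<Longrightarrow> u x \<le> u y" for \<mu> f u j
  proof -
    interpret fm: finite_measure \<mu> using \<mu> by (rule finite_measure_M_plus)
    define a where "a = 1 - (1/2::real) ^ j"
    have a: "0 \<le> a" "a < 1" unfolding a_def by (auto simp: half_power_le_1)
    have ta: "0 \<le> t * a" "t * a \<le> a" "t * a < 1" if "0 \<le> t" "t < 1" for t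
    proof -
      show "0 \<le> t * a" "t * a \<le> a" using that a by (auto simp: mult_left_le_one_le)
      then show "t * a < 1" using a by linarith
    qed
    have kr0: "0 \<le> kernr x" if "0 \<le> x" "x < 1" for x
      unfolding kernr_def using that by (intro suminf_nonneg summable_b) (auto intro!: mult_nonneg_nonneg less_imp_le[OF b_pos])
    \<comment> \<open>The indicator makes the integrand a Borel function on the whole line, and the
      real part gives it real values; on the interval nothing changes.\<close>
    define g where "g t = indicator {0..<1} t *\<^sub>R Re (f (of_real t * of_real a) * kern (of_real t * of_real a))" for t :: real
    have g_eq: "g t = u (t * a) * kernr (t * a)" and g_c: "f (of_real t * of_real a) * kern (of_real t * of_real a) = of_real (g t)"
      if t: "0 \<le> t" "t < 1" for t
    proof -
      have "f (of_real t * of_real a) * kern (of_real t * of_real a) = of_real (u (t * a) * kernr (t * a))"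
        by (simp only: of_real_mult[symmetric] fu[OF ta(1,3)[OF t]] kern_of_real[OF ta(1,3)[OF t]])
      then show "g t = u (t * a) * kernr (t * a)" "f (of_real t * of_real a) * kern (of_real t * of_real a) = of_real (g t)"
        unfolding g_def using t by simp_all
    qed
    have gm: "g \<in> borel_measurable borel"
      unfolding g_def
    proof (rule borel_measurable_continuous_on_indicator)
      have cf: "continuous_on (ball 0 1) f" "continuous_on (ball 0 1) kern"
        using f kern_holomorphic by (auto intro: holomorphic_on_imp_continuous_on)
      have "of_real t * of_real a \<in> ball (0::complex) 1" if "t \<in> {0..<1}" for t
        using ta[of t] that by (simp add: norm_mult flip: of_real_mult)
      then show "continuous_on {0..<1} (\<lambda>t. Re (f (of_real t * of_real a) * kern (of_real t * of_real a)))"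
        by (intro continuous_intros continuous_on_compose2[OF cf(1)] continuous_on_compose2[OF cf(2)]) auto
    qed simp
    have gb: "norm (g t) \<le> u a * kernr a" if t: "0 \<le> t" "t < 1" for t
    proof -
      have "u (t * a) * kernr (t * a) \<le> u a * kernr a"
        by (rule mult_mono[OF um kernr_mono u0 kr0]) (use ta[OF t] a in auto)
      moreover have "0 \<le> u (t * a) * kernr (t * a)" using ta[OF t] by (intro mult_nonneg_nonneg[OF u0 kr0]) auto
      ultimately show ?thesis unfolding g_eq[OF t] by simp
    qed
    have gi: "integrable \<mu> g" by (rule integrable_M_plus[OF \<mu> gm gb])
    have "cesaro \<mu> f (of_real a) = (LINT t|\<mu>. of_real (g t))"
      unfolding cesaro_def by (intro Bochner_Integration.integral_cong g_c refl) (use space_M_plus[OF \<mu>] in auto)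
    then have ce: "cesaro \<mu> f (of_real a) = of_real (LINT t|\<mu>. g t)" by simp
    define m where "m = u (a\<^sup>2) * (c * 2 ^ j / W j)"
    have aa: "0 \<le> a\<^sup>2" "a\<^sup>2 < 1" using a by (auto simp: power_less_one_iff abs_square_less_1)
    have A: "{a..<1} \<in> sets \<mu>" "{a..<1} \<inter> space \<mu> = {a..<1}"
      using sets_M_plus_atLeastLessThan[OF \<mu> a(1)] sets.sets_into_space by blast+
    have "m * dyadic_tail \<mu> j = (LINT t|\<mu>. m * indicator {a..<1} t)"
      using A by (simp add: dyadic_tail_def a_def)
    also have "\<dots> \<le> (LINT t|\<mu>. g t)"
    proof (rule integral_mono[OF _ gi])
      show "integrable \<mu> (\<lambda>t. m * indicator {a..<1} t)" using A by (simp add: fm.emeasure_eq_measure)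
      fix t assume "t \<in> space \<mu>"
      then have t: "0 \<le> t" "t < 1" using space_M_plus[OF \<mu>] by auto
      show "m * indicator {a..<1} t \<le> g t"
      proof (cases "a \<le> t")
        case True
        have "a\<^sup>2 \<le> t * a" unfolding power2_eq_square using True a by (intro mult_right_mono) auto
        then have "m \<le> u (t * a) * kernr (t * a)"
          unfolding m_def using ta[OF t] aa c(1) W_pos[of j]
          by (intro mult_mono um c(2) u0) (auto simp: a_def)
        then show ?thesis using True t g_eq[OF t] by simp
      next
        case False
        have "0 \<le> u (t * a) * kernr (t * a)" using ta[OF t] t a by (intro mult_nonneg_nonneg u0 kr0) auto
        then show ?thesis using False g_eq[OF t] by simp
      qed
    qed
    also have "\<dots> \<le> norm (cesaro \<mu> f (of_real a))" unfolding ce by simp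
    finally show ?thesis unfolding m_def ratio_def a_def by (simp add: mult_ac)
  qed
  then show ?thesis using that c(1) by blast
qed

text \<open>The test function is a sum of peaks with arbitrary nonnegative coefficients. On the
  radius all peaks are positive, so at the j-th dyadic point the image is at least a multiple of
  \<open>l j * ratio \<mu> j\<close>. The later choice of l extracts the sharp conditions.\<close>

lemma cesaro_bounded_imp_ratio_sum_le:
  assumes p: "0 < p" and q: "0 < q"
  obtains C where "0 < C" "\<And>\<mu> K l n. \<mu> \<in> M_plus \<Longrightarrow> 0 \<le> K \<Longrightarrow>
    (\<And>f H r. f holomorphic_on ball 0 1 \<Longrightarrow> (\<And>r. 0 \<le> r \<Longrightarrow> r < 1 \<Longrightarrow> mean_p p r f \<le> H) \<Longrightarrow> 0 \<le> r \<Longrightarrow> r < 1 \<Longrightarrow>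
      mean_p q r (cesaro \<mu> f) \<le> K * H) \<Longrightarrow> (\<And>k. 0 \<le> l k) \<Longrightarrow>
    (\<Sum>j<n. (1/2) ^ j * (l j * ratio \<mu> j) powr q) \<le> C * K powr q * (\<Sum>k<n. (1/2) ^ k * l k powr p) powr (q / p)"
proof -
  obtain M :: nat where "2 / p \<le> real M" using real_arch_simple by blast
  then have M: "2 \<le> real M * p" using p by (simp add: field_simps)
  obtain C1 where C1: "0 < C1" "\<And>l n r. (\<And>k. 0 \<le> l k) \<Longrightarrow> 0 \<le> r \<Longrightarrow> r < 1 \<Longrightarrow>
    mean_p p r (\<lambda>z. \<Sum>k<n. of_real (l k) * peak M k z) \<le> C1 * (\<Sum>k<n. (1/2) ^ k * l k powr p) powr (1 / p)"
    using peak_sum_mean_le[OF p M] by blast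
  obtain C2 where C2: "0 < C2" "\<And>g H n. g holomorphic_on ball 0 1 \<Longrightarrow> (\<And>r. 0 \<le> r \<Longrightarrow> r < 1 \<Longrightarrow> mean_p q r g \<le> H) \<Longrightarrow>
    (\<Sum>j<n. (1/2) ^ j * norm (g (of_real (1 - (1/2) ^ j))) powr q) \<le> C2 * H powr q"
    using hardy_radial_sum_le[OF q] by blast
  obtain c where c: "0 < c" "\<And>\<mu> f u j. \<mu> \<in> M_plus \<Longrightarrow> f holomorphic_on ball 0 1 \<Longrightarrow>
    (\<And>x. 0 \<le> x \<Longrightarrow> x < 1 \<Longrightarrow> f (of_real x) = of_real (u x)) \<Longrightarrow> (\<And>x. 0 \<le> x \<Longrightarrow> x < 1 \<Longrightarrow> 0 \<le> u x) \<Longrightarrow>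
    (\<And>x y. 0 \<le> x \<Longrightarrow> x \<le> y \<Longrightarrow> y < 1 \<Longrightarrow> u x \<le> u y) \<Longrightarrow>
    c * u ((1 - (1/2) ^ j)\<^sup>2) * ratio \<mu> j \<le> norm (cesaro \<mu> f (of_real (1 - (1/2) ^ j)))"
    using norm_cesaro_real_ge by blast
  define c' where "c' = c / 3 ^ M"
  have c': "0 < c'" unfolding c'_def using c(1) by simp
  define C where "C = C2 * C1 powr q / c' powr q"
  have "(\<Sum>j<n. (1/2) ^ j * (l j * ratio \<mu> j) powr q) \<le> C * K powr q * (\<Sum>k<n. (1/2) ^ k * l k powr p) powr (q / p)"
    if \<mu>: "\<mu> \<in> M_plus" and K: "0 \<le> K" and bd: "\<And>f H r. f holomorphic_on ball 0 1 \<Longrightarrow> (\<And>r. 0 \<le> r \<Longrightarrow> r < 1 \<Longrightarrow> mean_p p r f \<le> H) \<Longrightarrow> 0 \<le> r \<Longrightarrow> r < 1 \<Longrightarrow>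
      mean_p q r (cesaro \<mu> f) \<le> K * H" and l: "\<And>k. 0 \<le> l k" for \<mu> K l n
  proof -
    define f where "f z = (\<Sum>k<n. of_real (l k) * peak M k z)" for z
    define \<Sigma> where "\<Sigma> = (\<Sum>k<n. (1/2) ^ k * l k powr p)"
    define H where "H = C1 * \<Sigma> powr (1 / p)"
    have f: "f holomorphic_on ball 0 1" unfolding f_def by (intro holomorphic_intros peak_holomorphic)
    have fH: "mean_p p r f \<le> H" if "0 \<le> r" "r < 1" for r
      unfolding f_def H_def \<Sigma>_def using l that by (intro C1) auto
    define \<rho> where "\<rho> k = 1 - (1/2::real) ^ k" for k :: nat
    have \<rho>: "0 \<le> \<rho> k" "\<rho> k < 1" for k unfolding \<rho>_def by (auto simp: half_power_le_1)
    define u where "u x = (\<Sum>k<n. l k * ((1/2) ^ k / (1 - \<rho> k * x)) ^ M)" for x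
    have den: "0 < 1 - \<rho> k * x" if "0 \<le> x" "x < 1" for k x
    proof -
      have "\<rho> k * x \<le> 1 * x" using \<rho>[of k] that by (intro mult_right_mono) auto
      then show ?thesis using that by simp
    qed
    have fu: "f (of_real x) = of_real (u x)" if "0 \<le> x" "x < 1" for x
      unfolding f_def u_def peak_def \<rho>_def[symmetric] by simp
    have u0: "0 \<le> u x" if "0 \<le> x" "x < 1" for x
      unfolding u_def using l den[OF that] by (intro sum_nonneg mult_nonneg_nonneg zero_le_power divide_nonneg_nonneg) (auto simp: order.strict_implies_order)
    have um: "u x \<le> u y" if "0 \<le> x" "x \<le> y" "y < 1" for x y
      unfolding u_def using l den[of y] den[of x] \<rho> that
      by (intro sum_mono mult_left_mono power_mono divide_left_mono diff_left_mono mult_pos_pos den divide_nonneg_nonneg)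
        (auto simp: order.strict_implies_order)
    \<comment> \<open>Only the j-th peak is kept. With \<epsilon> = 2^-j its denominator at the
      squared dyadic point is 1 - (1 - \<epsilon>)^3, at most 3 \<epsilon>.\<close>
    have ul: "l j / 3 ^ M \<le> u ((\<rho> j)\<^sup>2)" if j: "j < n" for j
    proof -
      have sq: "0 \<le> (\<rho> j)\<^sup>2" "(\<rho> j)\<^sup>2 < 1" using \<rho>[of j] by (auto simp: power_less_one_iff abs_square_less_1)
      define \<epsilon> where "\<epsilon> = (1/2::real) ^ j"
      have \<epsilon>: "0 < \<epsilon>" "\<epsilon> \<le> 1" "\<rho> j = 1 - \<epsilon>" unfolding \<epsilon>_def \<rho>_def by (auto simp: power_le_one)
      have "1 - \<rho> j * (\<rho> j)\<^sup>2 = 3 * \<epsilon> - \<epsilon>\<^sup>2 * (3 - \<epsilon>)" unfolding \<epsilon>(3) by (simp add: power2_eq_square algebra_simps)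
      moreover have "0 \<le> \<epsilon>\<^sup>2 * (3 - \<epsilon>)" using \<epsilon> by simp
      ultimately have "1 - \<rho> j * (\<rho> j)\<^sup>2 \<le> 3 * \<epsilon>" by linarith
      then have "\<epsilon> / (3 * \<epsilon>) \<le> \<epsilon> / (1 - \<rho> j * (\<rho> j)\<^sup>2)"
        using \<epsilon> den[OF sq, of j] by (intro divide_left_mono mult_pos_pos) auto
      then have "(1/3) ^ M \<le> (\<epsilon> / (1 - \<rho> j * (\<rho> j)\<^sup>2)) ^ M" using \<epsilon> by (intro power_mono) auto
      then have "l j * (1/3) ^ M \<le> l j * (\<epsilon> / (1 - \<rho> j * (\<rho> j)\<^sup>2)) ^ M" using l by (intro mult_left_mono) auto
      also have "\<dots> \<le> u ((\<rho> j)\<^sup>2)" unfolding u_def \<epsilon>_def using j l den[OF sq]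
        by (intro member_le_sum[where f="\<lambda>k. l k * ((1/2) ^ k / (1 - \<rho> k * (\<rho> j)\<^sup>2)) ^ M"])
          (auto intro!: mult_nonneg_nonneg zero_le_power divide_nonneg_nonneg simp: order.strict_implies_order)
      finally show ?thesis by (simp add: power_divide)
    qed
    have low: "c' * (l j * ratio \<mu> j) \<le> norm (cesaro \<mu> f (of_real (1 - (1/2) ^ j)))" if j: "j < n" for j
    proof -
      have "c' * (l j * ratio \<mu> j) = c * (l j / 3 ^ M) * ratio \<mu> j" unfolding c'_def by simp
      also have "\<dots> \<le> c * u ((\<rho> j)\<^sup>2) * ratio \<mu> j"
        using c(1) ul[OF j] ratio_nonneg[of \<mu> j] by (intro mult_right_mono mult_left_mono) auto
      also have "\<dots> \<le> norm (cesaro \<mu> f (of_real (1 - (1/2) ^ j)))"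
        unfolding \<rho>_def by (rule c(2)[OF \<mu> f fu u0 um])
      finally show ?thesis .
    qed
    have "c' powr q * (\<Sum>j<n. (1/2) ^ j * (l j * ratio \<mu> j) powr q) = (\<Sum>j<n. (1/2) ^ j * (c' * (l j * ratio \<mu> j)) powr q)"
      unfolding sum_distrib_left powr_mult[of c'] by (simp only: mult_ac)
    also have "\<dots> \<le> (\<Sum>j<n. (1/2) ^ j * norm (cesaro \<mu> f (of_real (1 - (1/2) ^ j))) powr q)"
      using low c' l ratio_nonneg q by (intro sum_mono mult_left_mono powr_mono2) (auto intro!: mult_nonneg_nonneg simp: order.strict_implies_order)
    also have "\<dots> \<le> C2 * (K * H) powr q"
      by (rule C2(2)[OF cesaro_holomorphic[OF \<mu> f]]) (rule bd[OF f fH])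
    also have "\<dots> = c' powr q * (C * K powr q * \<Sigma> powr (q / p))"
      unfolding H_def C_def powr_mult powr_powr using c' by simp
    finally show ?thesis unfolding \<Sigma>_def using c' by simp
  qed
  moreover have "0 < C" unfolding C_def using C1(1) C2(1) c' by simp
  ultimately show ?thesis using that by blast
qed

text \<open>A single peak is tested: its norm is of order \<open>2 powr (- j / p)\<close>, and the
  radial sum contributes the factor \<open>2 powr (- j / q)\<close>.\<close>

lemma cesaro_bounded_imp_ratio_le:
  assumes p: "0 < p" and q: "0 < q"
  obtains C where "0 < C" "\<And>\<mu> K j. \<mu> \<in> M_plus \<Longrightarrow> 0 \<le> K \<Longrightarrow>
    (\<And>f H r. f holomorphic_on ball 0 1 \<Longrightarrow> (\<And>r. 0 \<le> r \<Longrightarrow> r < 1 \<Longrightarrow> mean_p p r f \<le> H) \<Longrightarrow> 0 \<le> r \<Longrightarrow> r < 1 \<Longrightarrow>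
      mean_p q r (cesaro \<mu> f) \<le> K * H) \<Longrightarrow> ratio \<mu> j \<le> C * K * 2 powr (- real j * (1/p - 1/q))"
proof -
  obtain C where C: "0 < C" "\<And>\<mu> K l n. \<mu> \<in> M_plus \<Longrightarrow> 0 \<le> K \<Longrightarrow>
    (\<And>f H r. f holomorphic_on ball 0 1 \<Longrightarrow> (\<And>r. 0 \<le> r \<Longrightarrow> r < 1 \<Longrightarrow> mean_p p r f \<le> H) \<Longrightarrow> 0 \<le> r \<Longrightarrow> r < 1 \<Longrightarrow>
      mean_p q r (cesaro \<mu> f) \<le> K * H) \<Longrightarrow> (\<And>k. 0 \<le> l k) \<Longrightarrow>
    (\<Sum>j<n. (1/2) ^ j * (l j * ratio \<mu> j) powr q) \<le> C * K powr q * (\<Sum>k<n. (1/2) ^ k * l k powr p) powr (q / p)"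
    using cesaro_bounded_imp_ratio_sum_le[OF p q] by blast
  have "ratio \<mu> j \<le> C powr (1/q) * K * 2 powr (- real j * (1/p - 1/q))"
    if \<mu>: "\<mu> \<in> M_plus" and K: "0 \<le> K" and bd: "\<And>f H r. f holomorphic_on ball 0 1 \<Longrightarrow> (\<And>r. 0 \<le> r \<Longrightarrow> r < 1 \<Longrightarrow> mean_p p r f \<le> H) \<Longrightarrow> 0 \<le> r \<Longrightarrow> r < 1 \<Longrightarrow>
      mean_p q r (cesaro \<mu> f) \<le> K * H" for \<mu> K j
  proof -
    define l where "l k = (if k = j then 1 else 0 :: real)" for k
    have S1: "(\<Sum>i<Suc j. (1/2) ^ i * (l i * ratio \<mu> i) powr q) = (1/2) ^ j * ratio \<mu> j powr q"
      unfolding l_def using q by (simp add: if_distrib[of "\<lambda>x. x powr q"] if_distrib[of "\<lambda>x. x * _"] sum.delta cong: if_cong)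
    have S2: "(\<Sum>i<Suc j. (1/2) ^ i * l i powr p) = (1/2) ^ j"
      unfolding l_def using p by (simp add: if_distrib[of "\<lambda>x. x powr p"] sum.delta cong: if_cong)
    have "(1/2) ^ j * ratio \<mu> j powr q \<le> C * K powr q * ((1/2) ^ j) powr (q / p)"
      using C(2)[OF \<mu> K bd, of l "Suc j"] unfolding S1 S2 by (simp add: l_def)
    moreover have half: "(1/2::real) ^ j = 2 powr (- real j)" by (simp add: powr_minus powr_realpow power_one_over inverse_eq_divide)
    ultimately have "2 powr real j * (2 powr (- real j) * ratio \<mu> j powr q) \<le> 2 powr real j * (C * K powr q * 2 powr (- real j * (q / p)))"
      unfolding half powr_powr by (intro mult_left_mono) auto
    moreover have "2 powr real j * (2 powr (- real j) * ratio \<mu> j powr q) = ratio \<mu> j powr q"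
      by (simp add: powr_minus)
    ultimately have "ratio \<mu> j powr q \<le> C * K powr q * (2 powr real j * 2 powr (- real j * (q / p)))"
      by (simp only: mult_ac)
    also have "2 powr real j * 2 powr (- real j * (q / p)) = (2 powr (- real j * (1/p - 1/q))) powr q"
    proof -
      have "real j + - real j * (q / p) = - real j * (1/p - 1/q) * q" using p q by (simp add: field_simps)
      then show ?thesis unfolding powr_add[symmetric] powr_powr by (rule arg_cong)
    qed
    finally have "(ratio \<mu> j powr q) powr (1/q) \<le> (C * K powr q * (2 powr (- real j * (1/p - 1/q))) powr q) powr (1/q)"
      using q by (intro powr_mono2) auto
    then show ?thesis unfolding powr_mult powr_powr using q K ratio_nonneg[of \<mu> j] by simp
  qed
  moreover have "0 < C powr (1/q)" using C(1) by simp
  ultimately show ?thesis using that by blast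
qed

text \<open>The coefficients \<open>ratio \<mu> j powr (s / p)\<close> make both
  \<open>(l j * ratio \<mu> j) powr q\<close> and \<open>l j powr p\<close> equal to
  \<open>ratio \<mu> j powr s\<close>. The same sum then stands on both sides, on the right with
  exponent q/p < 1, and being a finite sum it can be divided out.\<close>

lemma cesaro_bounded_imp_ratio_power_sum_le:
  assumes q: "0 < q" "q < p" and s: "s = q * p / (p - q)"
  obtains C where "0 < C" "\<And>\<mu> K n. \<mu> \<in> M_plus \<Longrightarrow> 0 \<le> K \<Longrightarrow>
    (\<And>f H r. f holomorphic_on ball 0 1 \<Longrightarrow> (\<And>r. 0 \<le> r \<Longrightarrow> r < 1 \<Longrightarrow> mean_p p r f \<le> H) \<Longrightarrow> 0 \<le> r \<Longrightarrow> r < 1 \<Longrightarrow>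
      mean_p q r (cesaro \<mu> f) \<le> K * H) \<Longrightarrow> (\<Sum>j<n. (1/2) ^ j * ratio \<mu> j powr s) \<le> (C * K) powr s"
proof -
  have p: "0 < p" using q by simp
  have s0: "0 < s" unfolding s using q by simp
  obtain C where C: "0 < C" "\<And>\<mu> K l n. \<mu> \<in> M_plus \<Longrightarrow> 0 \<le> K \<Longrightarrow>
    (\<And>f H r. f holomorphic_on ball 0 1 \<Longrightarrow> (\<And>r. 0 \<le> r \<Longrightarrow> r < 1 \<Longrightarrow> mean_p p r f \<le> H) \<Longrightarrow> 0 \<le> r \<Longrightarrow> r < 1 \<Longrightarrow>
      mean_p q r (cesaro \<mu> f) \<le> K * H) \<Longrightarrow> (\<And>k. 0 \<le> l k) \<Longrightarrow>
    (\<Sum>j<n. (1/2) ^ j * (l j * ratio \<mu> j) powr q) \<le> C * K powr q * (\<Sum>k<n. (1/2) ^ k * l k powr p) powr (q / p)"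
    using cesaro_bounded_imp_ratio_sum_le[OF p q(1)] by blast
  have "(\<Sum>j<n. (1/2) ^ j * ratio \<mu> j powr s) \<le> (C powr (1/q) * K) powr s"
    if \<mu>: "\<mu> \<in> M_plus" and K: "0 \<le> K" and bd: "\<And>f H r. f holomorphic_on ball 0 1 \<Longrightarrow> (\<And>r. 0 \<le> r \<Longrightarrow> r < 1 \<Longrightarrow> mean_p p r f \<le> H) \<Longrightarrow> 0 \<le> r \<Longrightarrow> r < 1 \<Longrightarrow>
      mean_p q r (cesaro \<mu> f) \<le> K * H" for \<mu> K n
  proof -
    define \<Sigma> where "\<Sigma> = (\<Sum>j<n. (1/2) ^ j * ratio \<mu> j powr s)"
    have sp: "s / p = q / (p - q)" unfolding s using q by simp
    have "s / p * q + q = (q * q + q * (p - q)) / (p - q)" unfolding sp using q by (simp add: add_divide_distrib)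
    also have "\<dots> = s" unfolding s by (simp add: algebra_simps)
    finally have e1: "s / p * q + q = s" .
    have e2: "(1 - q / p) * (s / q) = 1" unfolding s using q p by (simp add: field_simps)
    have "(ratio \<mu> j powr (s / p) * ratio \<mu> j) powr q = ratio \<mu> j powr s" for j
    proof -
      have "(ratio \<mu> j powr (s / p) * ratio \<mu> j) powr q = ratio \<mu> j powr (s / p * q + q)"
        unfolding powr_mult powr_powr powr_add ..
      then show ?thesis unfolding e1 .
    qed
    moreover have "(ratio \<mu> j powr (s / p)) powr p = ratio \<mu> j powr s" for j using p by (simp add: powr_powr)
    ultimately have "\<Sigma> \<le> C * K powr q * \<Sigma> powr (q / p)"
      using C(2)[OF \<mu> K bd, of "\<lambda>j. ratio \<mu> j powr (s / p)" n] unfolding \<Sigma>_def by simp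
    moreover have "0 \<le> \<Sigma>" unfolding \<Sigma>_def by (intro sum_nonneg) simp
    ultimately show ?thesis
    proof (cases "\<Sigma> = 0")
      case False
      then have S: "0 < \<Sigma>" using \<open>0 \<le> \<Sigma>\<close> by simp
      have "\<Sigma> powr (1 - q / p) = \<Sigma> / \<Sigma> powr (q / p)" using S by (simp add: powr_diff)
      also have "\<dots> \<le> C * K powr q" using \<open>\<Sigma> \<le> _\<close> S by (simp add: divide_le_eq)
      finally have "(\<Sigma> powr (1 - q / p)) powr (s / q) \<le> (C * K powr q) powr (s / q)"
        using s0 q by (intro powr_mono2) auto
      then have "\<Sigma> \<le> C powr (s / q) * K powr (q * (s / q))" unfolding powr_powr powr_mult e2 using S by simp
      then show ?thesis unfolding \<Sigma>_def powr_mult powr_powr using q by simp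
    qed (simp add: \<Sigma>_def)
  qed
  moreover have "0 < C powr (1/q)" using C(1) by simp
  ultimately show ?thesis using that by blast
qed

lemma cesaro_one_imp_ratio_power_sum_le:
  assumes s: "0 < s"
  obtains C where "0 < C" "\<And>\<mu> H n. \<mu> \<in> M_plus \<Longrightarrow>
    (\<And>r. 0 \<le> r \<Longrightarrow> r < 1 \<Longrightarrow> mean_p s r (cesaro \<mu> (\<lambda>_. 1)) \<le> H) \<Longrightarrow> (\<Sum>j<n. (1/2) ^ j * ratio \<mu> j powr s) \<le> (C * H) powr s"
proof -
  obtain C2 where C2: "0 < C2" "\<And>g H n. g holomorphic_on ball 0 1 \<Longrightarrow> (\<And>r. 0 \<le> r \<Longrightarrow> r < 1 \<Longrightarrow> mean_p s r g \<le> H) \<Longrightarrow>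
    (\<Sum>j<n. (1/2) ^ j * norm (g (of_real (1 - (1/2) ^ j))) powr s) \<le> C2 * H powr s"
    using hardy_radial_sum_le[OF s] by blast
  obtain c where c: "0 < c" "\<And>\<mu> f u j. \<mu> \<in> M_plus \<Longrightarrow> f holomorphic_on ball 0 1 \<Longrightarrow>
    (\<And>x. 0 \<le> x \<Longrightarrow> x < 1 \<Longrightarrow> f (of_real x) = of_real (u x)) \<Longrightarrow> (\<And>x. 0 \<le> x \<Longrightarrow> x < 1 \<Longrightarrow> 0 \<le> u x) \<Longrightarrow>
    (\<And>x y. 0 \<le> x \<Longrightarrow> x \<le> y \<Longrightarrow> y < 1 \<Longrightarrow> u x \<le> u y) \<Longrightarrow>
    c * u ((1 - (1/2) ^ j)\<^sup>2) * ratio \<mu> j \<le> norm (cesaro \<mu> f (of_real (1 - (1/2) ^ j)))"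
    using norm_cesaro_real_ge by blast
  have "(\<Sum>j<n. (1/2) ^ j * ratio \<mu> j powr s) \<le> (C2 powr (1/s) / c * H) powr s"
    if \<mu>: "\<mu> \<in> M_plus" and H: "\<And>r. 0 \<le> r \<Longrightarrow> r < 1 \<Longrightarrow> mean_p s r (cesaro \<mu> (\<lambda>_. 1)) \<le> H" for \<mu> H n
  proof -
    have low: "c * ratio \<mu> j \<le> norm (cesaro \<mu> (\<lambda>_. 1) (of_real (1 - (1/2) ^ j)))" for j
      using c(2)[OF \<mu>, of "\<lambda>_. 1" "\<lambda>_. 1" j] by simp
    have "c powr s * (\<Sum>j<n. (1/2) ^ j * ratio \<mu> j powr s) = (\<Sum>j<n. (1/2) ^ j * (c * ratio \<mu> j) powr s)"
      unfolding sum_distrib_left powr_mult[of c] by (simp only: mult_ac)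
    also have "\<dots> \<le> (\<Sum>j<n. (1/2) ^ j * norm (cesaro \<mu> (\<lambda>_. 1) (of_real (1 - (1/2) ^ j))) powr s)"
      using low c(1) ratio_nonneg s by (intro sum_mono mult_left_mono powr_mono2) (auto simp: order.strict_implies_order)
    also have "\<dots> \<le> C2 * H powr s" by (rule C2(2)[OF cesaro_holomorphic[OF \<mu>] H]) auto
    finally have "(\<Sum>j<n. (1/2) ^ j * ratio \<mu> j powr s) \<le> C2 * H powr s / c powr s"
      using c(1) by (simp add: field_simps)
    also have "\<dots> = (C2 powr (1/s) / c * H) powr s"
      unfolding powr_mult powr_divide powr_powr using s C2(1) by simp
    finally show ?thesis .
  qed
  moreover have "0 < C2 powr (1/s) / c" using C2(1) c(1) by simp
  ultimately show ?thesis using that by blast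
qed

end

subsection \<open>The tail and moment conditions in dyadic form\<close>

text \<open>Reduces a comparison of suprema in [0, \<infinity>] to real bounds Q. An infinite right
  side is harmless because c is positive.\<close>

lemma SUP_ennreal_le_cmult_SUP:
  fixes f :: "'a \<Rightarrow> real" and g :: "'b \<Rightarrow> real"
  assumes c: "0 \<le> c" and le: "\<And>Q i. 0 \<le> Q \<Longrightarrow> i \<in> I \<Longrightarrow> (\<And>j. j \<in> J \<Longrightarrow> g j \<le> Q) \<Longrightarrow> f i \<le> c * Q"
    and pos: "0 < c"
  shows "(SUP i\<in>I. ennreal (f i)) \<le> ennreal c * (SUP j\<in>J. ennreal (g j))"
proof (cases "(SUP j\<in>J. ennreal (g j)) = \<infinity>")
  case True
  show ?thesis unfolding True using pos by (simp add: ennreal_mult_top)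
next
  case False
  then obtain Q where Q: "0 \<le> Q" "(SUP j\<in>J. ennreal (g j)) = ennreal Q"
    by (cases "SUP j\<in>J. ennreal (g j)") auto
  have "g j \<le> Q" if "j \<in> J" for j
  proof -
    have "ennreal (g j) \<le> ennreal Q" unfolding Q(2)[symmetric] using that by (rule SUP_upper)
    then show ?thesis using Q(1) by (simp add: ennreal_le_iff)
  qed
  then have "f i \<le> c * Q" if "i \<in> I" for i using le[OF Q(1) that] by blast
  then show ?thesis unfolding Q(2) ennreal_mult[OF c Q(1), symmetric] by (intro SUP_least ennreal_leI)
qed

text \<open>The blocks are dyadic in n + 1 instead of n: the first block is n = 0, and the factor n
  + 1 in the moment conditions is at least 2^k and at most 2^(k+1) on the k-th block.\<close>

lemma sum_dyadic_blocks:
  fixes f :: "nat \<Rightarrow> 'a::comm_monoid_add"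
  shows "(\<Sum>n<2 ^ K - 1. f n) = (\<Sum>k<K. \<Sum>n\<in>{2 ^ k - 1..<2 ^ Suc k - 1}. f n)"
proof (induction K)
  case (Suc K)
  have "(2::nat) ^ K - 1 \<le> 2 ^ Suc K - 1" by simp
  then have "(\<Sum>n<2 ^ Suc K - 1. f n) = (\<Sum>n<2 ^ K - 1. f n) + (\<Sum>n\<in>{2 ^ K - 1..<2 ^ Suc K - 1}. f n)"
    unfolding lessThan_atLeast0 by (intro sum.atLeastLessThan_concat[symmetric]) auto
  then show ?case using Suc by simp
qed simp

lemma suminf_le_of_dyadic_blocks:
  fixes f :: "nat \<Rightarrow> ennreal"
  assumes "\<And>K. (\<Sum>k<K. \<Sum>n\<in>{2 ^ k - 1..<2 ^ Suc k - 1}. f n) \<le> X"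
  shows "(\<Sum>n. f n) \<le> X"
proof (rule suminf_le_const[OF summableI])
  fix N :: nat
  have "N \<le> 2 ^ N - 1" using less_exp[of N] by linarith
  then have "(\<Sum>n<N. f n) \<le> (\<Sum>n<2 ^ N - 1. f n)" by (intro sum_mono2) auto
  also have "\<dots> \<le> X" unfolding sum_dyadic_blocks by (rule assms)
  finally show "(\<Sum>n<N. f n) \<le> X" .
qed

lemma ennpowr_ennreal: "0 \<le> x \<Longrightarrow> ennpowr (ennreal x) a = ennreal (x powr a)"
  by (simp add: ennpowr_def)

lemma half_power_powr: "(1/2::real) ^ k = 2 powr (- real k)"
  by (simp add: powr_minus powr_realpow power_one_over inverse_eq_divide)

lemma emeasure_dyadic_block: "emeasure lebesgue {1 - (1/2::real) ^ k..<1 - (1/2) ^ Suc k} = ennreal ((1/2) ^ Suc k)"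
  by (subst emeasure_completion) (auto simp: field_simps)

lemma disjoint_dyadic_block: "disjoint_family (\<lambda>k. {1 - (1/2::real) ^ k..<1 - (1/2) ^ Suc k})"
  unfolding disjoint_family_on_def
proof (safe, goal_cases)
  case (1 i j x)
  then show ?case
    using half_power_double_le[of i j] half_power_double_le[of j i] by (cases i j rule: linorder_cases) auto
qed

lemma UN_dyadic_block: "(\<Union>k. {1 - (1/2::real) ^ k..<1 - (1/2) ^ Suc k}) = {0..<1}"
proof (intro equalityI subsetI)
  fix x :: real assume x: "x \<in> {0..<1}"
  obtain n where "(1/2) ^ n < 1 - x" using real_arch_pow_inv[of "1 - x" "1/2"] x by auto
  then have "x < 1 - (1/2) ^ n" by simp
  then obtain k where "1 - (1/2) ^ k \<le> x" "x < 1 - (1/2) ^ Suc k" using ex_dyadic_block x by (metis atLeastLessThan_iff)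
  then show "x \<in> (\<Union>k. {1 - (1/2) ^ k..<1 - (1/2) ^ Suc k})" by auto
next
  fix x :: real assume "x \<in> (\<Union>k. {1 - (1/2) ^ k..<1 - (1/2) ^ Suc k})"
  then obtain k where k: "1 - (1/2) ^ k \<le> x" "x < 1 - (1/2) ^ Suc k" by auto
  have "0 < (1/2::real) ^ Suc k" by simp
  then have "0 \<le> x" "x < 1" using k half_power_le_1(2)[of k] by linarith+
  then show "x \<in> {0..<1}" by simp
qed

context doubling_measure
begin

definition ratio_sup :: "real \<Rightarrow> real measure \<Rightarrow> ennreal" where
  "ratio_sup \<delta> \<mu> = (SUP k. ennreal (ratio \<mu> k * 2 powr (real k * \<delta>)))"

definition ratio_sum :: "real \<Rightarrow> real measure \<Rightarrow> ennreal" where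
  "ratio_sum s \<mu> = (\<Sum>k. ennreal ((1/2) ^ k * ratio \<mu> k powr s))"

definition tail_ratio :: "real \<Rightarrow> real measure \<Rightarrow> real \<Rightarrow> real" where
  "tail_ratio a \<mu> r = measure \<mu> {r..<1} / (measure \<nu> {r..<1} * (1 - r) powr a)"

lemma measure_tail_bounds:
  assumes \<mu>: "\<mu> \<in> M_plus" and r: "1 - (1/2) ^ k \<le> r" "r < 1 - (1/2) ^ Suc k"
  shows "measure \<mu> {r..<1} \<le> dyadic_tail \<mu> k" "dyadic_tail \<mu> (Suc k) \<le> measure \<mu> {r..<1}"
proof -
  interpret finite_measure \<mu> using \<mu> by (rule finite_measure_M_plus)
  have "0 \<le> r" using r(1) half_power_le_1(2)[of k] by linarith
  then show "measure \<mu> {r..<1} \<le> dyadic_tail \<mu> k" "dyadic_tail \<mu> (Suc k) \<le> measure \<mu> {r..<1}"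
    unfolding dyadic_tail_def using r sets_M_plus_atLeastLessThan[OF \<mu>] half_power_le_1(2)
    by (auto intro!: finite_measure_mono simp del: power_Suc)
qed

lemma measure_tail_pos:
  assumes "0 \<le> r" "r < 1" shows "0 < measure \<nu> {r..<1}"
proof -
  have "r \<in> (\<Union>k. {1 - (1/2::real) ^ k..<1 - (1/2) ^ Suc k})" unfolding UN_dyadic_block using assms by simp
  then obtain k where "1 - (1/2) ^ k \<le> r" "r < 1 - (1/2) ^ Suc k" by auto
  from measure_tail_bounds(2)[OF M_plus this] W_pos[of "Suc k"] show ?thesis by linarith
qed

lemma tail_ratio_eq:
  assumes \<mu>: "\<mu> \<in> M_plus" and r: "0 \<le> r" "r < 1"
  shows "measure_tail \<mu> r / (measure_tail \<nu> r * ennreal ((1 - r) powr a)) = ennreal (tail_ratio a \<mu> r)"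
proof -
  have "measure_tail \<mu> r = ennreal (measure \<mu> {r..<1})"
    unfolding measure_tail_def using finite_measure.emeasure_eq_measure[OF finite_measure_M_plus[OF \<mu>]] .
  moreover have "measure_tail \<nu> r = ennreal (measure \<nu> {r..<1})"
    unfolding measure_tail_def using finite_measure.emeasure_eq_measure[OF finite_measure_M_plus[OF M_plus]] .
  moreover have "0 < measure \<nu> {r..<1} * (1 - r) powr a" using measure_tail_pos[OF r] r by simp
  ultimately show ?thesis
    unfolding tail_ratio_def by (simp add: ennreal_mult[symmetric] divide_ennreal)
qed

text \<open>Inside a block the tail of \<mu> is bounded above by its value at the left end, but
  below only by the value at the right end. As \<mu> need not be doubling, the lower bound therefore
  concerns index k + 1, while the change of the tails of \<nu> costs one factor D.\<close>

lemma tail_ratio_bounds: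
  assumes \<mu>: "\<mu> \<in> M_plus" and r: "1 - (1/2) ^ k \<le> r" "r < 1 - (1/2) ^ Suc k" and a: "0 \<le> a"
  shows "tail_ratio a \<mu> r \<le> D * 2 powr a * (ratio \<mu> k * 2 powr (real k * (a - 1)))"
    "ratio \<mu> (Suc k) * 2 powr (real (Suc k) * (a - 1)) \<le> D * 2 powr a * tail_ratio a \<mu> r"
proof -
  have r01: "0 \<le> r" "r < 1" using r half_power_le_1(2)[of k] zero_less_power[of "1/2::real" "Suc k"] by linarith+
  have D: "0 < D" using D_ge_1 by simp
  have split: "ratio \<mu> k * 2 powr (real k * (a - 1)) = dyadic_tail \<mu> k / W k * 2 powr (real k * a)" for k
  proof -
    have "2 ^ k * 2 powr (real k * (a - 1)) = 2 powr (real k * a)"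
      by (simp add: powr_realpow[symmetric] powr_add[symmetric] algebra_simps)
    then show ?thesis unfolding ratio_def by (metis (no_types, lifting) mult.assoc mult.commute times_divide_eq_left)
  qed
  have step: "2 powr (real (Suc k) * a) = 2 powr a * 2 powr (real k * a)" by (simp add: powr_add[symmetric] algebra_simps)
  have h: "((1/2::real) ^ k) powr a = 1 / 2 powr (real k * a)" for k
    unfolding half_power_powr powr_powr by (simp add: powr_minus divide_inverse)
  have "tail_ratio a \<mu> r \<le> dyadic_tail \<mu> k / (W (Suc k) * ((1/2) ^ Suc k) powr a)"
    unfolding tail_ratio_def
    using measure_tail_bounds[OF \<mu> r] measure_tail_bounds[OF M_plus r] W_pos[of "Suc k"] r a
    by (intro frac_le mult_mono powr_mono2 mult_pos_pos) (auto simp: dyadic_tail_nonneg)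
  also have "\<dots> = dyadic_tail \<mu> k / W (Suc k) * 2 powr (real (Suc k) * a)" unfolding h by simp
  also have "\<dots> \<le> dyadic_tail \<mu> k * D / W k * 2 powr (real (Suc k) * a)"
  proof -
    have "1 / W (Suc k) \<le> D / W k" using tail_doubling[of k] W_pos[of k] W_pos[of "Suc k"] by (simp add: field_simps)
    then have "dyadic_tail \<mu> k * (1 / W (Suc k)) \<le> dyadic_tail \<mu> k * (D / W k)"
      using dyadic_tail_nonneg by (rule mult_left_mono)
    then show ?thesis by (intro mult_right_mono) auto
  qed
  also have "\<dots> = D * 2 powr a * (ratio \<mu> k * 2 powr (real k * (a - 1)))"
    unfolding split step by simp
  finally show "tail_ratio a \<mu> r \<le> D * 2 powr a * (ratio \<mu> k * 2 powr (real k * (a - 1)))" .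
  have "dyadic_tail \<mu> (Suc k) / (W k * ((1/2) ^ k) powr a) \<le> tail_ratio a \<mu> r"
    unfolding tail_ratio_def
    using measure_tail_bounds[OF \<mu> r] measure_tail_bounds[OF M_plus r] measure_tail_pos[OF r01] r r01 a
    by (intro frac_le mult_mono powr_mono2 mult_pos_pos) (auto simp: dyadic_tail_nonneg)
  then have "D * 2 powr a * (dyadic_tail \<mu> (Suc k) / (W k * ((1/2) ^ k) powr a)) \<le> D * 2 powr a * tail_ratio a \<mu> r"
    using D by (intro mult_left_mono) auto
  moreover have "ratio \<mu> (Suc k) * 2 powr (real (Suc k) * (a - 1)) = dyadic_tail \<mu> (Suc k) / W (Suc k) * 2 powr (real (Suc k) * a)"
    by (rule split)
  moreover have "\<dots> \<le> dyadic_tail \<mu> (Suc k) * D / W k * 2 powr (real (Suc k) * a)"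
  proof -
    have "1 / W (Suc k) \<le> D / W k" using tail_doubling[of k] W_pos[of k] W_pos[of "Suc k"] by (simp add: field_simps)
    then have "dyadic_tail \<mu> (Suc k) * (1 / W (Suc k)) \<le> dyadic_tail \<mu> (Suc k) * (D / W k)"
      using dyadic_tail_nonneg by (rule mult_left_mono)
    then show ?thesis by (intro mult_right_mono) auto
  qed
  moreover have "\<dots> = D * 2 powr a * (dyadic_tail \<mu> (Suc k) / (W k * ((1/2) ^ k) powr a))"
    unfolding h step by simp
  ultimately show "ratio \<mu> (Suc k) * 2 powr (real (Suc k) * (a - 1)) \<le> D * 2 powr a * tail_ratio a \<mu> r"
    by linarith
qed

lemma tail_ratio_dyadic:
  "tail_ratio a \<mu> (1 - (1/2) ^ k) = ratio \<mu> k * 2 powr (real k * (a - 1))"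
proof -
  have "((1/2::real) ^ k) powr a = 1 / (2 ^ k * 2 powr (real k * (a - 1)))"
    unfolding half_power_powr powr_powr powr_realpow[symmetric, of 2 k, simplified]
    by (simp add: powr_minus divide_inverse algebra_simps flip: powr_add)
  then show ?thesis unfolding tail_ratio_def ratio_def dyadic_tail_def by simp
qed

text \<open>The second bound has constant 1 and loses no index, since the dyadic points are
  themselves among the r of the supremum.\<close>

lemma tail_sup_bounds:
  assumes \<mu>: "\<mu> \<in> M_plus" and \<delta>: "0 \<le> \<delta>"
  defines "N \<equiv> (SUP r\<in>{0..<1}. measure_tail \<mu> r / (measure_tail \<nu> r * ennreal ((1 - r) powr (1 + \<delta>))))"
  shows "N \<le> ennreal (D * 2 powr (1 + \<delta>)) * ratio_sup \<delta> \<mu>" "ratio_sup \<delta> \<mu> \<le> N"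
proof -
  have N: "N = (SUP r\<in>{0..<1}. ennreal (tail_ratio (1 + \<delta>) \<mu> r))"
    unfolding N_def by (intro SUP_cong refl tail_ratio_eq[OF \<mu>]) auto
  show "N \<le> ennreal (D * 2 powr (1 + \<delta>)) * ratio_sup \<delta> \<mu>"
    unfolding N ratio_sup_def
  proof (rule SUP_ennreal_le_cmult_SUP)
    fix Q r assume Q: "\<And>k. k \<in> UNIV \<Longrightarrow> ratio \<mu> k * 2 powr (real k * \<delta>) \<le> Q" and r: "r \<in> {0..<1::real}"
    then obtain k where k: "1 - (1/2) ^ k \<le> r" "r < 1 - (1/2) ^ Suc k" unfolding UN_dyadic_block[symmetric] by auto
    have "tail_ratio (1 + \<delta>) \<mu> r \<le> D * 2 powr (1 + \<delta>) * (ratio \<mu> k * 2 powr (real k * \<delta>))"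
      using tail_ratio_bounds(1)[OF \<mu> k, of "1 + \<delta>"] \<delta> by simp
    also have "\<dots> \<le> D * 2 powr (1 + \<delta>) * Q" using Q[of k] D_ge_1 by (intro mult_left_mono) auto
    finally show "tail_ratio (1 + \<delta>) \<mu> r \<le> D * 2 powr (1 + \<delta>) * Q" .
  qed (use D_ge_1 in auto)
  show "ratio_sup \<delta> \<mu> \<le> N" unfolding N ratio_sup_def
  proof (rule SUP_least)
    fix k
    have "ennreal (ratio \<mu> k * 2 powr (real k * \<delta>)) = ennreal (tail_ratio (1 + \<delta>) \<mu> (1 - (1/2) ^ k))"
      unfolding tail_ratio_dyadic by simp
    also have "\<dots> \<le> (SUP r\<in>{0..<1}. ennreal (tail_ratio (1 + \<delta>) \<mu> r))"
      by (rule SUP_upper) (auto simp: half_power_le_1)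
    finally show "ennreal (ratio \<mu> k * 2 powr (real k * \<delta>)) \<le> (SUP r\<in>{0..<1}. ennreal (tail_ratio (1 + \<delta>) \<mu> r))" .
  qed
qed

text \<open>The integral is split into dyadic blocks of length 2^(-k-1). From below, block k
  controls the term of index k + 1, so the integral misses the term of index 0; the additional power
  of the total mass supplies exactly this term, with a factor depending on
  \<open>W 0\<close>.\<close>

lemma tail_power_bounds:
  assumes s: "0 < s"
  obtains C where "0 < C" "\<And>\<mu>. \<mu> \<in> M_plus \<Longrightarrow>
    (\<integral>\<^sup>+r\<in>{0..<1}. ennpowr (measure_tail \<mu> r / (measure_tail \<nu> r * ennreal (1 - r))) s \<partial>lebesgue) + ennpowr (measure_tail \<mu> 0) s
      \<le> ennreal C * ratio_sum s \<mu>"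
    "\<And>\<mu>. \<mu> \<in> M_plus \<Longrightarrow> ratio_sum s \<mu> \<le> ennreal C *
    ((\<integral>\<^sup>+r\<in>{0..<1}. ennpowr (measure_tail \<mu> r / (measure_tail \<nu> r * ennreal (1 - r))) s \<partial>lebesgue) + ennpowr (measure_tail \<mu> 0) s)"
proof -
  define C1 where "C1 = (D * 2) powr s"
  define C where "C = max (C1 + W 0 powr s) (max C1 (1 / W 0 powr s))"
  have D: "0 < D" using D_ge_1 by simp
  have C1: "0 < C1" unfolding C1_def using D by simp
  define B where "B k = {1 - (1/2::real) ^ k..<1 - (1/2) ^ Suc k}" for k
  have [measurable]: "B k \<in> sets lebesgue" for k unfolding B_def by simp
  have indB: "(\<Sum>k. indicator (B k) r) = (indicator {0..<1} r :: ennreal)" for r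
    using suminf_indicator[OF disjoint_dyadic_block, of r] unfolding UN_dyadic_block B_def by simp
  have both: "(\<integral>\<^sup>+r\<in>{0..<1}. ennpowr (measure_tail \<mu> r / (measure_tail \<nu> r * ennreal (1 - r))) s \<partial>lebesgue) + ennpowr (measure_tail \<mu> 0) s
      \<le> ennreal C * ratio_sum s \<mu> \<and> ratio_sum s \<mu> \<le> ennreal C *
    ((\<integral>\<^sup>+r\<in>{0..<1}. ennpowr (measure_tail \<mu> r / (measure_tail \<nu> r * ennreal (1 - r))) s \<partial>lebesgue) + ennpowr (measure_tail \<mu> 0) s)"
    if \<mu>: "\<mu> \<in> M_plus" for \<mu>
  proof -
    define T where "T r = tail_ratio 1 \<mu> r" for r
    define I where "I = (\<integral>\<^sup>+r\<in>{0..<1}. ennreal (T r powr s) \<partial>lebesgue)"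
    have T0: "0 \<le> T r" for r unfolding T_def tail_ratio_def by simp
    have I_eq: "(\<integral>\<^sup>+r\<in>{0..<1}. ennpowr (measure_tail \<mu> r / (measure_tail \<nu> r * ennreal (1 - r))) s \<partial>lebesgue) = I"
      unfolding I_def
    proof (rule nn_integral_cong)
      fix r :: real
      show "ennpowr (measure_tail \<mu> r / (measure_tail \<nu> r * ennreal (1 - r))) s * indicator {0..<1} r = ennreal (T r powr s) * indicator {0..<1} r"
        using tail_ratio_eq[OF \<mu>, of r 1] ennpowr_ennreal[OF T0, of r s] unfolding T_def by (auto simp: indicator_def)
    qed
    define v where "v = dyadic_tail \<mu> 0"
    have v0: "0 \<le> v" unfolding v_def by (rule dyadic_tail_nonneg)
    have mt: "ennpowr (measure_tail \<mu> 0) s = ennreal (v powr s)"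
      unfolding measure_tail_def v_def dyadic_tail_def
      using finite_measure.emeasure_eq_measure[OF finite_measure_M_plus[OF \<mu>]] by (simp add: ennpowr_ennreal)
    have r0: "ratio \<mu> 0 = v / W 0" unfolding ratio_def v_def by simp
    have S0: "ennreal (ratio \<mu> 0 powr s) \<le> ratio_sum s \<mu>"
    proof -
      define F where "F k = ennreal ((1/2) ^ k * ratio \<mu> k powr s)" for k
      have "(\<Sum>k\<in>{0}. F k) \<le> (\<Sum>k. F k)" by (intro sum_le_suminf summableI) auto
      then have "F 0 \<le> (\<Sum>k. F k)" by simp
      then show ?thesis unfolding F_def ratio_sum_def by (simp only: power_0 mult_1)
    qed
    have up: "ennreal (T r powr s) \<le> ennreal (C1 * ratio \<mu> k powr s)" and low: "ratio \<mu> (Suc k) powr s / C1 \<le> T r powr s"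
      if "r \<in> B k" for r k
    proof -
      have k: "1 - (1/2) ^ k \<le> r" "r < 1 - (1/2) ^ Suc k" using that unfolding B_def by auto
      have "T r powr s \<le> (D * 2 * ratio \<mu> k) powr s"
        using tail_ratio_bounds(1)[OF \<mu> k, of 1] T0 s unfolding T_def by (intro powr_mono2) auto
      then show "ennreal (T r powr s) \<le> ennreal (C1 * ratio \<mu> k powr s)" unfolding C1_def powr_mult[of "D * 2"] by (rule ennreal_leI)
      have "ratio \<mu> (Suc k) powr s \<le> (D * 2 * T r) powr s"
        using tail_ratio_bounds(2)[OF \<mu> k, of 1] ratio_nonneg s unfolding T_def by (intro powr_mono2) auto
      then show "ratio \<mu> (Suc k) powr s / C1 \<le> T r powr s"
        unfolding powr_mult[of "D * 2"] C1_def[symmetric] using C1 by (simp add: divide_le_eq mult.commute)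
    qed
    have int: "(\<integral>\<^sup>+r. (\<Sum>k. ennreal (c k) * indicator (B k) r) \<partial>lebesgue) = (\<Sum>k. ennreal (c k) * ennreal ((1/2) ^ Suc k))" for c
    proof -
      have "(\<integral>\<^sup>+r. (\<Sum>k. ennreal (c k) * indicator (B k) r) \<partial>lebesgue) = (\<Sum>k. \<integral>\<^sup>+r. ennreal (c k) * indicator (B k) r \<partial>lebesgue)"
        by (rule nn_integral_suminf) simp
      also have "(\<lambda>k. \<integral>\<^sup>+r. ennreal (c k) * indicator (B k) r \<partial>lebesgue) = (\<lambda>k. ennreal (c k) * ennreal ((1/2) ^ Suc k))"
        by (subst nn_integral_cmult_indicator) (simp, simp only: B_def emeasure_dyadic_block)
      finally show ?thesis .
    qed
    have "I = (\<integral>\<^sup>+r. (\<Sum>k. ennreal (T r powr s) * indicator (B k) r) \<partial>lebesgue)"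
      unfolding I_def indB[symmetric] ennreal_suminf_cmult ..
    also have "\<dots> \<le> (\<integral>\<^sup>+r. (\<Sum>k. ennreal (C1 * ratio \<mu> k powr s) * indicator (B k) r) \<partial>lebesgue)"
      by (intro nn_integral_mono suminf_le summableI) (auto simp: indicator_def intro: up)
    also have "\<dots> = (\<Sum>k. ennreal (C1 * ratio \<mu> k powr s) * ennreal ((1/2) ^ Suc k))" by (rule int)
    also have "\<dots> \<le> (\<Sum>k. ennreal C1 * ennreal ((1/2) ^ k * ratio \<mu> k powr s))"
    proof (intro suminf_le summableI)
      fix k
      have "ennreal (C1 * ratio \<mu> k powr s) * ennreal ((1/2) ^ Suc k) = ennreal (C1 * ratio \<mu> k powr s * (1/2) ^ Suc k)"
        using C1 by (intro ennreal_mult[symmetric]) auto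
      also have "\<dots> \<le> ennreal (C1 * ((1/2) ^ k * ratio \<mu> k powr s))" using C1 by (intro ennreal_leI) simp
      also have "\<dots> = ennreal C1 * ennreal ((1/2) ^ k * ratio \<mu> k powr s)" using C1 by (intro ennreal_mult) auto
      finally show "ennreal (C1 * ratio \<mu> k powr s) * ennreal ((1/2) ^ Suc k) \<le> ennreal C1 * ennreal ((1/2) ^ k * ratio \<mu> k powr s)" .
    qed
    also have "\<dots> = ennreal C1 * ratio_sum s \<mu>" unfolding ratio_sum_def by simp
    finally have I1: "I \<le> ennreal C1 * ratio_sum s \<mu>" .
    have "ennreal (v powr s) = ennreal (W 0 powr s) * ennreal (ratio \<mu> 0 powr s)"
      unfolding r0 powr_divide using W_pos[of 0] by (subst ennreal_mult[symmetric]) auto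
    also have "\<dots> \<le> ennreal (W 0 powr s) * ratio_sum s \<mu>" by (intro mult_left_mono S0) simp
    finally have "I + ennreal (v powr s) \<le> (ennreal C1 + ennreal (W 0 powr s)) * ratio_sum s \<mu>"
      unfolding distrib_right by (rule add_mono[OF I1])
    also have "\<dots> \<le> ennreal C * ratio_sum s \<mu>"
      unfolding C_def using C1 by (intro mult_right_mono) (auto simp flip: ennreal_plus intro!: ennreal_leI)
    finally have first: "I + ennreal (v powr s) \<le> ennreal C * ratio_sum s \<mu>" .
    have split: "ratio_sum s \<mu> = (\<Sum>k. ennreal ((1/2) ^ Suc k * ratio \<mu> (Suc k) powr s)) + ennreal (ratio \<mu> 0 powr s)"
    proof -
      define F where "F k = ennreal ((1/2) ^ k * ratio \<mu> k powr s)" for k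
      have "(\<Sum>k. F k) = (\<Sum>k. F (k + 1)) + (\<Sum>k<1. F k)" by (rule suminf_offset[OF summableI])
      then have "(\<Sum>k. F k) = (\<Sum>k. F (Suc k)) + F 0" by simp
      then show ?thesis unfolding F_def ratio_sum_def by (simp only: power_0 mult_1)
    qed
    have "(\<Sum>k. ennreal ((1/2) ^ Suc k * ratio \<mu> (Suc k) powr s)) = (\<Sum>k. ennreal C1 * (ennreal (ratio \<mu> (Suc k) powr s / C1) * ennreal ((1/2) ^ Suc k)))"
      using C1 by (intro suminf_cong) (simp add: ennreal_mult[symmetric] mult_ac)
    also have "\<dots> = ennreal C1 * (\<integral>\<^sup>+r. (\<Sum>k. ennreal (ratio \<mu> (Suc k) powr s / C1) * indicator (B k) r) \<partial>lebesgue)"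
      unfolding int by (rule ennreal_suminf_cmult)
    also have "\<dots> \<le> ennreal C1 * (\<integral>\<^sup>+r. (\<Sum>k. ennreal (T r powr s) * indicator (B k) r) \<partial>lebesgue)"
      by (intro mult_left_mono nn_integral_mono suminf_le summableI) (auto simp: indicator_def intro!: ennreal_leI low)
    also have "\<dots> = ennreal C1 * I" unfolding I_def indB[symmetric] ennreal_suminf_cmult ..
    finally have "ratio_sum s \<mu> \<le> ennreal C1 * I + ennreal (ratio \<mu> 0 powr s)"
      unfolding split by (rule add_right_mono)
    also have "ennreal (ratio \<mu> 0 powr s) = ennreal (1 / W 0 powr s) * ennreal (v powr s)"
      unfolding r0 powr_divide by (subst ennreal_mult[symmetric]) auto
    also have "ennreal C1 * I + \<dots> \<le> ennreal C * I + ennreal C * ennreal (v powr s)"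
      unfolding C_def by (intro add_mono mult_right_mono ennreal_leI) auto
    finally have "ratio_sum s \<mu> \<le> ennreal C * (I + ennreal (v powr s))" by (simp add: distrib_left)
    then show ?thesis using first unfolding I_eq mt by simp
  qed
  moreover have "0 < C" unfolding C_def using C1 by simp
  ultimately show ?thesis using that by blast
qed

end

section \<open>Moment conditions\<close>

context doubling_measure
begin

definition moment_ratio :: "real measure \<Rightarrow> nat \<Rightarrow> real" where
  "moment_ratio \<mu> n = measure_moment \<mu> n * (real n + 1) / measure_moment \<nu> n"

lemma moment_ratio_nonneg: "\<mu> \<in> M_plus \<Longrightarrow> 0 \<le> moment_ratio \<mu> n"
  unfolding moment_ratio_def using measure_moment_nonneg[of \<mu> n] moment_pos[of n] by simp

text \<open>Rewriting the tail of \<mu> at level i by \<open>ratio \<mu> i\<close> costs 2^k / W k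
  against 2^i / W i, at most \<open>(2 * D) ^ (k - i)\<close>. The doubly exponential weights still
  win, which is exploited in two ways below.\<close>

lemma moment_ratio_upper:
  assumes \<mu>: "\<mu> \<in> M_plus" and k: "2 ^ k \<le> Suc n" "Suc n \<le> 2 ^ Suc k"
  shows "moment_ratio \<mu> n \<le> 6 * D * (\<Sum>i\<le>k. 2 * exp (- (2 ^ (k - i) / 2)) * (2 * D) ^ (k - i) * ratio \<mu> i)"
proof -
  have D: "0 < D" using D_ge_1 by simp
  have "Suc n \<le> 2 ^ (k + 1)" using k(2) by simp
  from W_le_moment[OF this] have w: "W k \<le> 3 * D * measure_moment \<nu> n" by simp
  have "real (Suc n) \<le> real (2 ^ Suc k)" using k(2) by (rule of_nat_mono)
  then have n: "real n + 1 \<le> 2 * 2 ^ k" by simp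
  have "moment_ratio \<mu> n = measure_moment \<mu> n * ((real n + 1) / measure_moment \<nu> n)" unfolding moment_ratio_def by simp
  also have "\<dots> \<le> (\<Sum>i\<le>k. 2 * exp (- (2 ^ (k - i) / 2)) * dyadic_tail \<mu> i) * ((2 * 2 ^ k) / (W k / (3 * D)))"
  proof (intro mult_mono measure_moment_upper[OF \<mu> k(1)] frac_le n)
    show "W k / (3 * D) \<le> measure_moment \<nu> n" using w D by (simp add: divide_le_eq mult_ac)
  qed (use W_pos[of k] D dyadic_tail_nonneg moment_pos[of n] in \<open>auto intro!: sum_nonneg mult_nonneg_nonneg divide_nonneg_nonneg simp: order.strict_implies_order\<close>)
  also have "\<dots> = 6 * D * (\<Sum>i\<le>k. 2 * exp (- (2 ^ (k - i) / 2)) * (dyadic_tail \<mu> i * 2 ^ k / W k))"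
    unfolding sum_distrib_left sum_distrib_right by (intro sum.cong) auto
  also have "\<dots> \<le> 6 * D * (\<Sum>i\<le>k. 2 * exp (- (2 ^ (k - i) / 2)) * ((2 * D) ^ (k - i) * ratio \<mu> i))"
  proof (intro mult_left_mono sum_mono)
    fix i assume i: "i \<in> {..k}"
    have "W i \<le> D ^ (k - i) * W k" using W_le_shift[of i "k - i"] i by simp
    then have "1 / W k \<le> D ^ (k - i) / W i" using W_pos[of i] W_pos[of k] by (simp add: divide_le_eq le_divide_eq mult_ac)
    then have "dyadic_tail \<mu> i * 2 ^ k * (1 / W k) \<le> dyadic_tail \<mu> i * 2 ^ k * (D ^ (k - i) / W i)"
      using dyadic_tail_nonneg by (intro mult_left_mono) auto
    also have "(2::real) ^ k = 2 ^ (k - i) * 2 ^ i" using i by (simp flip: power_add)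
    finally show "dyadic_tail \<mu> i * 2 ^ k / W k \<le> (2 * D) ^ (k - i) * ratio \<mu> i"
      unfolding ratio_def using i by (simp add: power_mult_distrib mult_ac flip: power_add)
  qed (use D in auto)
  finally show ?thesis by (simp only: mult.assoc)
qed

lemma moment_ratio_lower:
  obtains C where "0 < C" "\<And>\<mu> k n. \<mu> \<in> M_plus \<Longrightarrow> Suc n \<le> 2 ^ k \<Longrightarrow> 2 ^ k \<le> 2 * Suc n \<Longrightarrow> ratio \<mu> k \<le> C * moment_ratio \<mu> n"
proof -
  obtain A where A: "0 < A" "\<And>k n. 2 ^ k \<le> Suc n \<Longrightarrow> measure_moment \<nu> n \<le> A * W k"
    using moment_le_W by blast
  have "ratio \<mu> k \<le> (6 * (A * D)) * moment_ratio \<mu> n" if \<mu>: "\<mu> \<in> M_plus" and k: "Suc n \<le> 2 ^ k" "2 ^ k \<le> 2 * Suc n" for \<mu> k n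
  proof -
    have "measure_moment \<nu> n \<le> A * (D * W k)"
    proof (cases k)
      case 0
      have "measure_moment \<nu> n \<le> A * W 0" by (rule A) simp
      also have "\<dots> \<le> A * (D * W 0)" using A(1) D_ge_1 W_pos[of 0] by simp
      finally show ?thesis using 0 by simp
    next
      case (Suc i)
      have "measure_moment \<nu> n \<le> A * W i" using k(2) Suc by (intro A) simp
      also have "\<dots> \<le> A * (D * W (Suc i))" using A(1) tail_doubling[of i] by simp
      finally show ?thesis using Suc by simp
    qed
    then have w: "1 / W k \<le> A * D / measure_moment \<nu> n"
      using W_pos[of k] moment_pos[of n] by (simp add: divide_le_eq le_divide_eq mult_ac)
    have m: "2 ^ k * dyadic_tail \<mu> k \<le> (2 * (real n + 1)) * (3 * measure_moment \<mu> n)"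
    proof (intro mult_mono measure_moment_lower[OF \<mu> k(1)])
      have "real (2 ^ k) \<le> real (2 * Suc n)" using k(2) by (rule of_nat_mono)
      then show "(2::real) ^ k \<le> 2 * (real n + 1)" by simp
    qed (auto simp: dyadic_tail_nonneg)
    have "2 ^ k * dyadic_tail \<mu> k * (1 / W k) \<le> (2 * (real n + 1)) * (3 * measure_moment \<mu> n) * (A * D / measure_moment \<nu> n)"
      by (rule mult_mono[OF m w]) (use W_pos[of k] measure_moment_nonneg[OF \<mu>, of n] in auto)
    then show ?thesis unfolding ratio_def moment_ratio_def by (simp add: mult_ac)
  qed
  moreover have "0 < 6 * (A * D)" using A(1) D_ge_1 by simp
  ultimately show ?thesis using that by blast
qed

lemma moment_sup_bounds:
  assumes \<delta>: "0 \<le> \<delta>"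
  obtains C where "0 < C" "\<And>\<mu>. \<mu> \<in> M_plus \<Longrightarrow>
    (SUP n. ennreal (measure_moment \<mu> n * (real n + 1) powr (1 + \<delta>) / measure_moment \<nu> n)) \<le> ennreal C * ratio_sup \<delta> \<mu>"
    "\<And>\<mu>. \<mu> \<in> M_plus \<Longrightarrow> ratio_sup \<delta> \<mu> \<le> ennreal C *
      (SUP n. ennreal (measure_moment \<mu> n * (real n + 1) powr (1 + \<delta>) / measure_moment \<nu> n))"
proof -
  obtain C1 where C1: "0 < C1" "\<And>\<mu> k n. \<mu> \<in> M_plus \<Longrightarrow> Suc n \<le> 2 ^ k \<Longrightarrow> 2 ^ k \<le> 2 * Suc n \<Longrightarrow> ratio \<mu> k \<le> C1 * moment_ratio \<mu> n"
    using moment_ratio_lower by blast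
  have D: "0 < D" using D_ge_1 by simp
  \<comment> \<open>The additional \<open>2 powr \<delta>\<close> per level accounts for replacing
    \<open>2 powr (k * \<delta>)\<close> by \<open>2 powr (i * \<delta>)\<close>.\<close>
  define D' where "D' = 2 * D * 2 powr \<delta>"
  have D': "0 < D'" unfolding D'_def using D by simp
  note sm = summable_geometric_exp_two_power[OF D']
  define \<Sigma> where "\<Sigma> = (\<Sum>m. 2 * exp (- (2 ^ m / 2)) * D' ^ m)"
  define C2 where "C2 = 6 * D * 2 powr \<delta> * \<Sigma>"
  have \<Sigma>: "0 < \<Sigma>" unfolding \<Sigma>_def using D' by (intro suminf_pos sm) auto
  have C2: "0 < C2" unfolding C2_def using D \<Sigma> by simp
  have eq: "measure_moment \<mu> n * (real n + 1) powr (1 + \<delta>) / measure_moment \<nu> n = moment_ratio \<mu> n * (real n + 1) powr \<delta>" for \<mu> n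
    unfolding moment_ratio_def powr_add by simp
  have up: "(SUP n. ennreal (moment_ratio \<mu> n * (real n + 1) powr \<delta>)) \<le> ennreal C2 * ratio_sup \<delta> \<mu>" if \<mu>: "\<mu> \<in> M_plus" for \<mu>
    unfolding ratio_sup_def
  proof (rule SUP_ennreal_le_cmult_SUP)
    fix Q n assume Q0: "0 \<le> Q" and Q: "\<And>k. k \<in> UNIV \<Longrightarrow> ratio \<mu> k * 2 powr (real k * \<delta>) \<le> Q"
    obtain k where k: "2 ^ k \<le> Suc n" "Suc n < 2 ^ Suc k" using ex_dyadic_index by blast
    have "real (Suc n) \<le> real (2 ^ Suc k)" using k(2) by (intro of_nat_mono) simp
    then have "(real n + 1) powr \<delta> \<le> (2 ^ Suc k) powr \<delta>" using \<delta> by (intro powr_mono2) auto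
    also have "(2 ^ Suc k) powr \<delta> = 2 powr \<delta> * 2 powr (real k * \<delta>)"
      unfolding power_Suc powr_mult by (simp add: powr_powr flip: powr_realpow)
    finally have n: "(real n + 1) powr \<delta> \<le> 2 powr \<delta> * 2 powr (real k * \<delta>)" .
    have "moment_ratio \<mu> n * (real n + 1) powr \<delta>
        \<le> (6 * D * (\<Sum>i\<le>k. 2 * exp (- (2 ^ (k - i) / 2)) * (2 * D) ^ (k - i) * ratio \<mu> i)) * (2 powr \<delta> * 2 powr (real k * \<delta>))"
      using k D ratio_nonneg by (intro mult_mono moment_ratio_upper[OF \<mu>] n) (auto intro!: mult_nonneg_nonneg sum_nonneg)
    also have "\<dots> = 6 * D * 2 powr \<delta> * (\<Sum>i\<le>k. 2 * exp (- (2 ^ (k - i) / 2)) * (2 * D) ^ (k - i) * (ratio \<mu> i * 2 powr (real k * \<delta>)))"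
      unfolding sum_distrib_left sum_distrib_right by (intro sum.cong) auto
    also have "\<dots> \<le> 6 * D * 2 powr \<delta> * (\<Sum>i\<le>k. 2 * exp (- (2 ^ (k - i) / 2)) * D' ^ (k - i) * Q)"
    proof (intro mult_left_mono sum_mono)
      fix i assume i: "i \<in> {..k}"
      have "2 powr (real k * \<delta>) = (2 powr \<delta>) ^ (k - i) * 2 powr (real i * \<delta>)"
        using i by (simp add: powr_powr of_nat_diff algebra_simps flip: powr_realpow powr_add)
      then have "(2 * D) ^ (k - i) * (ratio \<mu> i * 2 powr (real k * \<delta>)) = D' ^ (k - i) * (ratio \<mu> i * 2 powr (real i * \<delta>))"
        unfolding D'_def by (simp add: power_mult_distrib)
      also have "\<dots> \<le> D' ^ (k - i) * Q" using D' Q by (intro mult_left_mono) auto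
      finally have "2 * exp (- (2 ^ (k - i) / 2)) * ((2 * D) ^ (k - i) * (ratio \<mu> i * 2 powr (real k * \<delta>))) \<le> 2 * exp (- (2 ^ (k - i) / 2)) * (D' ^ (k - i) * Q)"
        by (intro mult_left_mono) auto
      then show "2 * exp (- (2 ^ (k - i) / 2)) * (2 * D) ^ (k - i) * (ratio \<mu> i * 2 powr (real k * \<delta>)) \<le> 2 * exp (- (2 ^ (k - i) / 2)) * D' ^ (k - i) * Q"
        by (simp only: mult.assoc)
    qed (use D in auto)
    also have "(\<Sum>i\<le>k. 2 * exp (- (2 ^ (k - i) / 2)) * D' ^ (k - i) * Q) = (\<Sum>m\<le>k. 2 * exp (- (2 ^ m / 2)) * D' ^ m) * Q"
      unfolding sum_distrib_right[symmetric]
      by (subst sum.nat_diff_reindex[of "\<lambda>m. 2 * exp (- (2 ^ m / 2)) * D' ^ m" "Suc k", symmetric, unfolded lessThan_Suc_atMost]) simp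
    also have "6 * D * 2 powr \<delta> * ((\<Sum>m\<le>k. 2 * exp (- (2 ^ m / 2)) * D' ^ m) * Q) \<le> 6 * D * 2 powr \<delta> * (\<Sigma> * Q)"
      unfolding \<Sigma>_def using Q0 D D'
      by (intro mult_left_mono mult_right_mono sum_le_suminf sm) (auto intro: order.strict_implies_order)
    finally show "moment_ratio \<mu> n * (real n + 1) powr \<delta> \<le> C2 * Q" unfolding C2_def by (simp add: mult_ac)
  qed (use C2 in auto)
  have low: "ratio_sup \<delta> \<mu> \<le> ennreal C1 * (SUP n. ennreal (moment_ratio \<mu> n * (real n + 1) powr \<delta>))" if \<mu>: "\<mu> \<in> M_plus" for \<mu>
    unfolding ratio_sup_def
  proof (rule SUP_ennreal_le_cmult_SUP)
    fix Q k assume Q: "\<And>n. n \<in> UNIV \<Longrightarrow> moment_ratio \<mu> n * (real n + 1) powr \<delta> \<le> Q"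
    \<comment> \<open>The lower bound samples the moments at n = 2^k - 1, where n + 1 is exactly
      2^k.\<close>
    have n: "Suc (2 ^ k - 1) = 2 ^ k" "real (2 ^ k - 1) + 1 = 2 ^ k" by (auto simp: of_nat_diff)
    have "2 powr (real k * \<delta>) = (2 ^ k) powr \<delta>" by (simp add: powr_powr flip: powr_realpow)
    then have "ratio \<mu> k * 2 powr (real k * \<delta>) \<le> C1 * moment_ratio \<mu> (2 ^ k - 1) * (real (2 ^ k - 1) + 1) powr \<delta>"
      unfolding n(2) using n(1) by (intro mult_mono C1(2)[OF \<mu>]) (use C1(1) moment_ratio_nonneg[OF \<mu>] in auto)
    also have "\<dots> \<le> C1 * Q" using Q[of "2 ^ k - 1"] C1(1) by (simp add: mult.assoc)
    finally show "ratio \<mu> k * 2 powr (real k * \<delta>) \<le> C1 * Q" .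
  qed (use C1 in auto)
  show ?thesis
  proof (rule that[of "max C1 C2"])
    fix \<mu> assume \<mu>: "\<mu> \<in> M_plus"
    show "(SUP n. ennreal (measure_moment \<mu> n * (real n + 1) powr (1 + \<delta>) / measure_moment \<nu> n)) \<le> ennreal (max C1 C2) * ratio_sup \<delta> \<mu>"
      unfolding eq by (rule order_trans[OF up[OF \<mu>]]) (intro mult_right_mono ennreal_leI; simp)
    show "ratio_sup \<delta> \<mu> \<le> ennreal (max C1 C2) * (SUP n. ennreal (measure_moment \<mu> n * (real n + 1) powr (1 + \<delta>) / measure_moment \<nu> n))"
      unfolding eq by (rule order_trans[OF low[OF \<mu>]]) (intro mult_right_mono ennreal_leI; simp)
  qed (use C1 in auto)
qed

text \<open>For the upper bound the weights of \<open>moment_ratio_upper\<close> are replaced by a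
  constant; what remains are partial sums of ratios, and the discrete Hardy inequality applies. A
  block has 2^k indices of weight about 4^-k, hence total weight about 2^-k. For the lower bound,
  block k controls the ratio of index k + 1.\<close>

lemma moment_power_bounds:
  assumes s: "0 < s"
  obtains C where "0 < C" "\<And>\<mu>. \<mu> \<in> M_plus \<Longrightarrow>
    (\<Sum>n. ennreal (moment_ratio \<mu> n powr s * (1 / (real n + 1)\<^sup>2))) \<le> ennreal C * ratio_sum s \<mu>"
    "\<And>\<mu>. \<mu> \<in> M_plus \<Longrightarrow> ratio_sum s \<mu> \<le> ennreal C * (\<Sum>n. ennreal (moment_ratio \<mu> n powr s * (1 / (real n + 1)\<^sup>2)))"
proof -
  obtain C1 where C1: "0 < C1" "\<And>\<mu> k n. \<mu> \<in> M_plus \<Longrightarrow> Suc n \<le> 2 ^ k \<Longrightarrow> 2 ^ k \<le> 2 * Suc n \<Longrightarrow> ratio \<mu> k \<le> C1 * moment_ratio \<mu> n"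
    using moment_ratio_lower by blast
  obtain CH where CH: "CH > 0" "\<And>a N. (\<And>k. 0 \<le> a k) \<Longrightarrow>
      (\<Sum>j<N. (1/2) ^ j * (\<Sum>k\<le>j. a k) powr s) \<le> CH * (\<Sum>k<N. (1/2) ^ k * a k powr s)"
    using discrete_hardy_partial_sums[OF s] by blast
  have D: "0 < 2 * D" using D_ge_1 by simp
  note sm = summable_geometric_exp_two_power[OF D]
  define \<Sigma> where "\<Sigma> = (\<Sum>m. 2 * exp (- (2 ^ m / 2)) * (2 * D) ^ m)"
  have \<Sigma>: "0 < \<Sigma>" unfolding \<Sigma>_def using D by (intro suminf_pos sm) auto
  have term_le: "2 * exp (- (2 ^ m / 2)) * (2 * D) ^ m \<le> \<Sigma>" for m
  proof -
    define F where "F m = 2 * exp (- (2 ^ m / 2)) * (2 * D) ^ m" for m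
    have "(\<Sum>i\<in>{m}. F i) \<le> (\<Sum>i. F i)" unfolding F_def using D by (intro sum_le_suminf sm) auto
    then show ?thesis unfolding F_def \<Sigma>_def by simp
  qed
  define E where "E = 6 * D * \<Sigma>"
  have E: "0 < E" unfolding E_def using D \<Sigma> by simp
  define f where "f \<mu> n = moment_ratio \<mu> n powr s * (1 / (real n + 1)\<^sup>2)" for \<mu> n
  have f0: "0 \<le> f \<mu> n" for \<mu> n unfolding f_def by simp
  have card: "card {2 ^ k - 1..<2 ^ Suc k - 1 :: nat} = 2 ^ k" for k
    using one_le_power[of "2::nat" k] by simp
  have blk: "2 ^ k \<le> Suc n" "Suc n \<le> 2 ^ Suc k" if "n \<in> {2 ^ k - 1..<2 ^ Suc k - 1}" for n k using that by auto
  have up: "(\<Sum>n. ennreal (f \<mu> n)) \<le> ennreal (E powr s * CH) * ratio_sum s \<mu>" if \<mu>: "\<mu> \<in> M_plus" for \<mu>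
  proof (rule suminf_le_of_dyadic_blocks)
    fix K
    have "(\<Sum>k<K. \<Sum>n\<in>{2 ^ k - 1..<2 ^ Suc k - 1}. f \<mu> n) \<le> (\<Sum>k<K. E powr s * ((1/2) ^ k * (\<Sum>i\<le>k. ratio \<mu> i) powr s))"
    proof (rule sum_mono)
      fix k
      have "f \<mu> n \<le> E powr s * (\<Sum>i\<le>k. ratio \<mu> i) powr s * (1 / (2 ^ k)\<^sup>2)" if n: "n \<in> {2 ^ k - 1..<2 ^ Suc k - 1}" for n
        unfolding f_def
      proof (rule mult_mono)
        have "moment_ratio \<mu> n \<le> 6 * D * (\<Sum>i\<le>k. 2 * exp (- (2 ^ (k - i) / 2)) * (2 * D) ^ (k - i) * ratio \<mu> i)"
          by (rule moment_ratio_upper[OF \<mu> blk[OF n]])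
        also have "\<dots> \<le> 6 * D * (\<Sum>i\<le>k. \<Sigma> * ratio \<mu> i)"
          using D term_le ratio_nonneg by (intro mult_left_mono sum_mono mult_right_mono) auto
        also have "\<dots> = E * (\<Sum>i\<le>k. ratio \<mu> i)" unfolding E_def by (simp add: sum_distrib_left mult_ac)
        finally have "moment_ratio \<mu> n powr s \<le> (E * (\<Sum>i\<le>k. ratio \<mu> i)) powr s"
          using s moment_ratio_nonneg[OF \<mu>] by (intro powr_mono2) auto
        then show "moment_ratio \<mu> n powr s \<le> E powr s * (\<Sum>i\<le>k. ratio \<mu> i) powr s" by (simp only: powr_mult)
        have "real (2 ^ k) \<le> real (Suc n)" using blk(1)[OF n] by (rule of_nat_mono)
        then show "1 / (real n + 1)\<^sup>2 \<le> 1 / (2 ^ k)\<^sup>2" by (intro divide_left_mono power_mono mult_pos_pos) auto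
      qed auto
      then have "(\<Sum>n\<in>{2 ^ k - 1..<2 ^ Suc k - 1}. f \<mu> n) \<le> real (card {2 ^ k - 1..<2 ^ Suc k - 1 :: nat}) * (E powr s * (\<Sum>i\<le>k. ratio \<mu> i) powr s * (1 / (2 ^ k)\<^sup>2))"
        by (rule sum_bounded_above)
      also have "\<dots> = E powr s * ((1/2) ^ k * (\<Sum>i\<le>k. ratio \<mu> i) powr s)"
        unfolding card by (simp add: power2_eq_square power_divide)
      finally show "(\<Sum>n\<in>{2 ^ k - 1..<2 ^ Suc k - 1}. f \<mu> n) \<le> E powr s * ((1/2) ^ k * (\<Sum>i\<le>k. ratio \<mu> i) powr s)" .
    qed
    also have "\<dots> \<le> E powr s * (CH * (\<Sum>k<K. (1/2) ^ k * ratio \<mu> k powr s))"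
      unfolding sum_distrib_left[symmetric] by (intro mult_left_mono CH ratio_nonneg) simp
    finally have le: "(\<Sum>k<K. \<Sum>n\<in>{2 ^ k - 1..<2 ^ Suc k - 1}. f \<mu> n) \<le> E powr s * CH * (\<Sum>k<K. (1/2) ^ k * ratio \<mu> k powr s)"
      by (simp only: mult.assoc)
    have "(\<Sum>k<K. \<Sum>n\<in>{2 ^ k - 1..<2 ^ Suc k - 1}. ennreal (f \<mu> n)) = ennreal (\<Sum>k<K. \<Sum>n\<in>{2 ^ k - 1..<2 ^ Suc k - 1}. f \<mu> n)"
      using f0 by (simp add: sum_ennreal sum_nonneg)
    also have "\<dots> \<le> ennreal (E powr s * CH * (\<Sum>k<K. (1/2) ^ k * ratio \<mu> k powr s))" using le by (rule ennreal_leI)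
    also have "\<dots> = ennreal (E powr s * CH) * (\<Sum>k<K. ennreal ((1/2) ^ k * ratio \<mu> k powr s))"
      using CH(1) by (subst sum_ennreal) (auto simp: ennreal_mult sum_nonneg)
    also have "\<dots> \<le> ennreal (E powr s * CH) * ratio_sum s \<mu>"
      unfolding ratio_sum_def by (intro mult_left_mono sum_le_suminf) auto
    finally show "(\<Sum>k<K. \<Sum>n\<in>{2 ^ k - 1..<2 ^ Suc k - 1}. ennreal (f \<mu> n)) \<le> ennreal (E powr s * CH) * ratio_sum s \<mu>" .
  qed
  have low: "ratio_sum s \<mu> \<le> ennreal (3 * C1 powr s) * (\<Sum>n. ennreal (f \<mu> n))" if \<mu>: "\<mu> \<in> M_plus" for \<mu>
    unfolding ratio_sum_def
  proof (rule suminf_le_const[OF summableI])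
    fix K
    define g where "g k = (1/2) ^ k * ratio \<mu> k powr s" for k
    have g0: "0 \<le> g k" for k unfolding g_def by simp
    have ratio_le: "ratio \<mu> k powr s \<le> C1 powr s * moment_ratio \<mu> n powr s" if "Suc n \<le> 2 ^ k" "2 ^ k \<le> 2 * Suc n" for k n
      unfolding powr_mult[symmetric] using C1(2)[OF \<mu> that] ratio_nonneg s by (intro powr_mono2) auto
    have gS: "g (Suc k) \<le> 2 * C1 powr s * (\<Sum>n\<in>{2 ^ k - 1..<2 ^ Suc k - 1}. f \<mu> n)" for k
    proof -
      have "ratio \<mu> (Suc k) powr s / C1 powr s * (1 / (2 ^ Suc k)\<^sup>2) \<le> f \<mu> n" if n: "n \<in> {2 ^ k - 1..<2 ^ Suc k - 1}" for n
        unfolding f_def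
      proof (rule mult_mono)
        show "ratio \<mu> (Suc k) powr s / C1 powr s \<le> moment_ratio \<mu> n powr s"
          using ratio_le[of n "Suc k"] blk[OF n] C1(1) by (simp add: divide_le_eq mult.commute)
        have "real (Suc n) \<le> real (2 ^ Suc k)" using blk(2)[OF n] by (rule of_nat_mono)
        then show "1 / (2 ^ Suc k)\<^sup>2 \<le> 1 / (real n + 1)\<^sup>2" by (intro divide_left_mono power_mono mult_pos_pos) auto
      qed auto
      then have "real (card {2 ^ k - 1..<2 ^ Suc k - 1 :: nat}) * (ratio \<mu> (Suc k) powr s / C1 powr s * (1 / (2 ^ Suc k)\<^sup>2)) \<le> (\<Sum>n\<in>{2 ^ k - 1..<2 ^ Suc k - 1}. f \<mu> n)"
        by (rule sum_bounded_below)
      moreover have "real (card {2 ^ k - 1..<2 ^ Suc k - 1 :: nat}) * (ratio \<mu> (Suc k) powr s / C1 powr s * (1 / (2 ^ Suc k)\<^sup>2)) = g (Suc k) / (2 * C1 powr s)"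
        unfolding card g_def by (simp add: power2_eq_square power_divide)
      ultimately have "g (Suc k) / (2 * C1 powr s) \<le> (\<Sum>n\<in>{2 ^ k - 1..<2 ^ Suc k - 1}. f \<mu> n)" by (simp only:)
      moreover have "0 < 2 * C1 powr s" using C1(1) by simp
      ultimately show ?thesis by (simp only: pos_divide_le_eq mult.commute)
    qed
    have "(\<Sum>k<Suc K. g k) = g 0 + (\<Sum>k<K. g (Suc k))" by (rule sum.lessThan_Suc_shift)
    \<comment> \<open>The shift by one index leaves out the ratio of index 0, which the single
      moment with n = 0 controls.\<close>
    also have "g 0 \<le> C1 powr s * f \<mu> 0" unfolding g_def f_def using ratio_le[of 0 0] by simp
    also have "(\<Sum>k<K. g (Suc k)) \<le> (\<Sum>k<K. 2 * C1 powr s * (\<Sum>n\<in>{2 ^ k - 1..<2 ^ Suc k - 1}. f \<mu> n))"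
      by (intro sum_mono gS)
    also have "\<dots> = 2 * C1 powr s * (\<Sum>n<2 ^ K - 1. f \<mu> n)" unfolding sum_dyadic_blocks sum_distrib_left ..
    finally have "(\<Sum>k<Suc K. g k) \<le> C1 powr s * f \<mu> 0 + 2 * C1 powr s * (\<Sum>n<2 ^ K - 1. f \<mu> n)" by simp
    moreover have "(\<Sum>k<K. g k) \<le> (\<Sum>k<Suc K. g k)" using g0 by simp
    ultimately have "(\<Sum>k<K. g k) \<le> C1 powr s * (\<Sum>n<1. f \<mu> n) + 2 * C1 powr s * (\<Sum>n<2 ^ K - 1. f \<mu> n)" by simp
    then have "ennreal (\<Sum>k<K. g k) \<le> ennreal (C1 powr s * (\<Sum>n<1. f \<mu> n) + 2 * C1 powr s * (\<Sum>n<2 ^ K - 1. f \<mu> n))"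
      by (rule ennreal_leI)
    also have "\<dots> = ennreal (C1 powr s) * (\<Sum>n<1. ennreal (f \<mu> n)) + ennreal (2 * C1 powr s) * (\<Sum>n<2 ^ K - 1. ennreal (f \<mu> n))"
      using f0 by (subst (1 2) sum_ennreal) (auto simp: ennreal_mult ennreal_plus sum_nonneg)
    also have "\<dots> \<le> ennreal (C1 powr s) * (\<Sum>n. ennreal (f \<mu> n)) + ennreal (2 * C1 powr s) * (\<Sum>n. ennreal (f \<mu> n))"
      by (intro add_mono mult_left_mono sum_le_suminf) auto
    also have "\<dots> = ennreal (3 * C1 powr s) * (\<Sum>n. ennreal (f \<mu> n))"
      unfolding distrib_right[symmetric] by (subst ennreal_plus[symmetric]) auto
    finally show "(\<Sum>k<K. ennreal ((1/2) ^ k * ratio \<mu> k powr s)) \<le> ennreal (3 * C1 powr s) * (\<Sum>n. ennreal (f \<mu> n))"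
      using g0 unfolding g_def by (subst sum_ennreal) auto
  qed
  define C where "C = max (E powr s * CH) (3 * C1 powr s)"
  show ?thesis
  proof (rule that[of C])
    show "0 < C" unfolding C_def using C1(1) by (simp add: less_max_iff_disj)
    fix \<mu> assume \<mu>: "\<mu> \<in> M_plus"
    show "(\<Sum>n. ennreal (moment_ratio \<mu> n powr s * (1 / (real n + 1)\<^sup>2))) \<le> ennreal C * ratio_sum s \<mu>"
      unfolding f_def[symmetric] C_def by (rule order_trans[OF up[OF \<mu>]]) (intro mult_right_mono ennreal_leI; simp)
    show "ratio_sum s \<mu> \<le> ennreal C * (\<Sum>n. ennreal (moment_ratio \<mu> n powr s * (1 / (real n + 1)\<^sup>2)))"
      unfolding f_def[symmetric] C_def by (rule order_trans[OF low[OF \<mu>]]) (intro mult_right_mono ennreal_leI; simp)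
  qed
qed

end

subsection \<open>Fractional derivatives and the growth space\<close>

lemma powr_le_of_comparable:
  fixes u v y :: real
  assumes "0 < u" "0 < v" "u \<le> 2 * v" "v \<le> 2 * u"
  shows "u powr y \<le> 2 powr \<bar>y\<bar> * v powr y"
proof -
  have "ln u \<le> ln 2 + ln v" "ln v \<le> ln 2 + ln u"
    using assms by (simp_all flip: ln_mult_pos)
  then have "\<bar>ln u - ln v\<bar> \<le> ln 2" by linarith
  then have "\<bar>y\<bar> * \<bar>ln u - ln v\<bar> \<le> \<bar>y\<bar> * ln 2" by (intro mult_left_mono) auto
  then have "y * ln u - y * ln v \<le> \<bar>y\<bar> * ln 2"
    unfolding abs_mult[symmetric] right_diff_distrib by linarith
  then have "exp (y * ln u) \<le> exp (\<bar>y\<bar> * ln 2 + y * ln v)" by simp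
  then show ?thesis using assms by (simp add: powr_def exp_add)
qed

text \<open>Euler's product: the sequence G converges to Gamma x, which is nonzero, so G and its
  reciprocal are both bounded. The comparison of n with n + 1 inside the power costs only a
  constant.\<close>

lemma pochhammer_growth:
  fixes x :: real
  assumes x: "0 < x"
  obtains c where "0 < c" "\<And>n. pochhammer x n / fact n \<le> c * (real n + 1) powr (x - 1)"
    "\<And>n. (real n + 1) powr (x - 1) \<le> c * (pochhammer x n / fact n)"
proof -
  define G where "G n = Gamma_series' x (Suc n)" for n
  have ex: "exp (x * ln (real (Suc n))) = real (Suc n) powr x" for n by (simp add: powr_def)
  have G_eq: "G n = fact n * real (Suc n) powr x / pochhammer x (Suc n)" for n
    unfolding G_def Gamma_series'_def ex[symmetric] by simp
  have G0: "0 < G n" for n unfolding G_eq using x by (intro divide_pos_pos mult_pos_pos pochhammer_pos) auto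
  have lim: "G \<longlonglongrightarrow> Gamma x" unfolding G_def using x by (intro LIMSEQ_Suc Gamma_series'_LIMSEQ)
  have gx: "Gamma x \<noteq> 0" using Gamma_real_pos[OF x] by simp
  obtain K1 where K1: "0 < K1" "\<And>n. norm (G n) \<le> K1"
    using convergent_imp_Bseq[OF convergentI[OF lim]] unfolding Bseq_def by blast
  obtain K2 where K2: "0 < K2" "\<And>n. norm (inverse (G n)) \<le> K2"
    using convergent_imp_Bseq[OF convergentI[OF tendsto_inverse[OF lim gx]]] unfolding Bseq_def by blast
  define T where "T = 2 powr \<bar>x - 1\<bar>"
  have T: "1 \<le> T" unfolding T_def by (rule ge_one_powr_ge_zero) auto
  define c where "c = T * (K1 + K2) + 1"
  have c: "T * K1 \<le> c" "T * K2 \<le> c" "1 \<le> c" unfolding c_def using T K1(1) K2(1) by (simp_all add: distrib_left add_nonneg_nonneg)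
  have eq: "pochhammer x (Suc m) / fact (Suc m) * G m = real (Suc m) powr (x - 1)" for m
    unfolding G_eq using x pochhammer_pos[OF x, of "Suc m"] by (simp add: powr_diff field_simps del: pochhammer_Suc of_nat_Suc)
  have P0: "0 \<le> pochhammer x n / fact n" for n using pochhammer_pos[OF x, of n] by simp
  have "pochhammer x n / fact n \<le> c * (real n + 1) powr (x - 1) \<and> (real n + 1) powr (x - 1) \<le> c * (pochhammer x n / fact n)" for n
  proof (cases n)
    case 0
    then show ?thesis using c(3) by simp
  next
    case (Suc m)
    have "pochhammer x n / fact n = real n powr (x - 1) * inverse (G m)"
      unfolding Suc eq[of m, symmetric] using G0[of m] by (simp del: pochhammer_Suc fact_Suc)
    also have "\<dots> \<le> (T * (real n + 1) powr (x - 1)) * K2"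
      unfolding T_def using Suc G0[of m] K2(2)[of m] by (intro mult_mono powr_le_of_comparable) auto
    also have "\<dots> = T * K2 * (real n + 1) powr (x - 1)" by simp
    also have "\<dots> \<le> c * (real n + 1) powr (x - 1)" using c(2) by (intro mult_right_mono) auto
    finally have 1: "pochhammer x n / fact n \<le> c * (real n + 1) powr (x - 1)" .
    have "(real n + 1) powr (x - 1) \<le> T * real n powr (x - 1)"
      unfolding T_def using Suc by (intro powr_le_of_comparable) auto
    also have "\<dots> = T * (pochhammer x n / fact n * G m)" unfolding Suc eq ..
    also have "\<dots> \<le> T * (pochhammer x n / fact n * K1)"
      using K1(2)[of m] T P0 by (intro mult_left_mono) auto
    also have "\<dots> = T * K1 * (pochhammer x n / fact n)" by simp
    also have "\<dots> \<le> c * (pochhammer x n / fact n)" using c(1) P0 by (intro mult_right_mono) auto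
    finally show ?thesis using 1 by blast
  qed
  then show ?thesis using that[of c] c(3) by fastforce
qed

text \<open>A beta integral, evaluated by recursion. Integrating the derivative of
  \<open>r ^ k * (1 - r\<^sup>2) powr \<alpha>\<close> with k = 2n + 2 shows that (n + 1 + \<alpha>)
  times the integral for n + 1 is n + 1 times the one for n. The case k = 0 starts the recursion.
  For \<alpha> < 1 the integrand is unbounded at 1, where \<open>powr\<close> takes the value
  0.\<close>

lemma has_integral_std_weight_moment:
  fixes \<alpha> :: real
  assumes \<alpha>: "0 < \<alpha>"
  shows "((\<lambda>r. r ^ (2 * n + 1) * (\<alpha> * (1 - r\<^sup>2) powr (\<alpha> - 1))) has_integral (fact n / (2 * pochhammer (\<alpha> + 1) n))) {0..1}"
proof -
  have ftc: "((\<lambda>r. real k * r ^ (k - 1) * (1 - r\<^sup>2) powr \<alpha> - 2 * \<alpha> * r ^ (k + 1) * (1 - r\<^sup>2) powr (\<alpha> - 1))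
      has_integral (0 - 0 ^ k)) {0..1}" for k
  proof -
    have "((\<lambda>r. real k * r ^ (k - 1) * (1 - r\<^sup>2) powr \<alpha> - 2 * \<alpha> * r ^ (k + 1) * (1 - r\<^sup>2) powr (\<alpha> - 1))
      has_integral (1 ^ k * (1 - 1\<^sup>2) powr \<alpha> - 0 ^ k * (1 - 0\<^sup>2) powr \<alpha>)) {0..1::real}"
    proof (rule fundamental_theorem_of_calculus_interior)
      have "\<And>r::real. 0 \<le> r \<Longrightarrow> r \<le> 1 \<Longrightarrow> r\<^sup>2 \<le> 1" by (simp add: power_le_one)
      then show "continuous_on {0..1} (\<lambda>r. r ^ k * (1 - r\<^sup>2) powr \<alpha>)"
        using \<alpha> by (intro continuous_intros continuous_on_powr') auto
      fix r :: real assume r: "r \<in> {0<..<1}"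
      then have "r\<^sup>2 < 1" by (simp add: power_less_one_iff)
      then have "0 < 1 - r\<^sup>2" by simp
      then have "((\<lambda>r. r ^ k * (1 - r\<^sup>2) powr \<alpha>) has_real_derivative
          real k * r ^ (k - 1) * (1 - r\<^sup>2) powr \<alpha> - 2 * \<alpha> * r ^ (k + 1) * (1 - r\<^sup>2) powr (\<alpha> - 1)) (at r)"
        by (auto intro!: derivative_eq_intros simp: powr_diff field_simps)
      then show "((\<lambda>r. r ^ k * (1 - r\<^sup>2) powr \<alpha>) has_vector_derivative
          real k * r ^ (k - 1) * (1 - r\<^sup>2) powr \<alpha> - 2 * \<alpha> * r ^ (k + 1) * (1 - r\<^sup>2) powr (\<alpha> - 1)) (at r)"
        by (simp add: has_real_derivative_iff_has_vector_derivative)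
    qed simp
    then show ?thesis by simp
  qed
  have powr_split: "(1 - r\<^sup>2) powr \<alpha> = (1 - r\<^sup>2) * (1 - r\<^sup>2) powr (\<alpha> - 1)" if "r \<in> {0..1}" for r :: real
  proof (cases "r = 1")
    case False
    with that have "r\<^sup>2 < 1" by (simp add: power_less_one_iff)
    then show ?thesis by (simp add: powr_diff)
  qed simp
  show ?thesis
  proof (induction n)
    case 0
    have "((\<lambda>r. - (1/2) * (real 0 * r ^ (0 - 1) * (1 - r\<^sup>2) powr \<alpha> - 2 * \<alpha> * r ^ (0 + 1) * (1 - r\<^sup>2) powr (\<alpha> - 1)))
      has_integral (- (1/2) * (0 - 0 ^ 0))) {0..1}" by (intro has_integral_mult_right ftc)
    then show ?case by (simp add: mult_ac)
  next
    case (Suc n)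
    define J where "J = fact n / (2 * pochhammer (\<alpha> + 1) n)"
    define N where "N = real (Suc n)"
    have "0 < N" unfolding N_def by simp
    \<comment> \<open>The combination of the integrand for n and the derivative is divided by N +
      \<alpha>, and the final step checks that it is pointwise the integrand for n + 1.\<close>
    have "((\<lambda>r. (N * (r ^ (2 * n + 1) * (\<alpha> * (1 - r\<^sup>2) powr (\<alpha> - 1)))
          - \<alpha> / 2 * (real (2 * Suc n) * r ^ (2 * Suc n - 1) * (1 - r\<^sup>2) powr \<alpha> - 2 * \<alpha> * r ^ (2 * Suc n + 1) * (1 - r\<^sup>2) powr (\<alpha> - 1))) / (N + \<alpha>))
       has_integral ((N * J - \<alpha> / 2 * (0 - 0 ^ (2 * Suc n))) / (N + \<alpha>))) {0..1}"
      using Suc.IH unfolding J_def[symmetric] by (intro has_integral_divide has_integral_diff has_integral_mult_right ftc)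
    also have "(N * J - \<alpha> / 2 * (0 - 0 ^ (2 * Suc n))) / (N + \<alpha>) = fact (Suc n) / (2 * pochhammer (\<alpha> + 1) (Suc n))"
      unfolding J_def N_def by (simp add: pochhammer_Suc mult_ac add_ac)
    finally show ?case
    proof (rule has_integral_eq[rotated])
      fix r :: real assume r: "r \<in> {0..1}"
      define w where "w = (1 - r\<^sup>2) powr (\<alpha> - 1)"
      have e: "2 * Suc n - 1 = 2 * n + 1" "2 * Suc n + 1 = (2 * n + 1) + 2" "real (2 * Suc n) = 2 * N" unfolding N_def by auto
      have "(N + \<alpha>) * (r ^ (2 * Suc n + 1) * (\<alpha> * w)) = N * (r ^ (2 * n + 1) * (\<alpha> * w))
          - \<alpha> / 2 * (2 * N * r ^ (2 * n + 1) * ((1 - r\<^sup>2) * w) - 2 * \<alpha> * r ^ (2 * Suc n + 1) * w)"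
        unfolding e power_add by (simp add: algebra_simps)
      then show "(N * (r ^ (2 * n + 1) * (\<alpha> * (1 - r\<^sup>2) powr (\<alpha> - 1)))
          - \<alpha> / 2 * (real (2 * Suc n) * r ^ (2 * Suc n - 1) * (1 - r\<^sup>2) powr \<alpha> - 2 * \<alpha> * r ^ (2 * Suc n + 1) * (1 - r\<^sup>2) powr (\<alpha> - 1))) / (N + \<alpha>)
          = r ^ (2 * Suc n + 1) * (\<alpha> * (1 - r\<^sup>2) powr (\<alpha> - 1))"
        unfolding powr_split[OF r] w_def[symmetric] e(1) e(3) using \<open>0 < N\<close> \<alpha> by (simp add: divide_eq_eq mult.commute)
    qed
  qed
qed

lemma std_weight_moment:
  assumes \<alpha>: "0 < \<alpha>"
  shows "weight_moment (std_weight (\<alpha> - 1)) (2 * n + 1) = fact n / (2 * pochhammer (\<alpha> + 1) n)"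
proof -
  define f where "f r = r ^ (2 * n + 1) * (\<alpha> * (1 - r\<^sup>2) powr (\<alpha> - 1))" for r :: real
  have int: "(f has_integral (fact n / (2 * pochhammer (\<alpha> + 1) n))) {0..<1}"
  proof -
    have "((\<lambda>r. if r \<in> {0..<1} then f r else 0) has_integral (fact n / (2 * pochhammer (\<alpha> + 1) n))) {0..1}"
      by (rule has_integral_eq[OF _ has_integral_std_weight_moment[OF \<alpha>, of n]]) (auto simp: f_def)
    then show ?thesis by (subst (asm) has_integral_restrict) auto
  qed
  have "f absolutely_integrable_on {0..<1}"
  proof (rule nonnegative_absolutely_integrable_1)
    fix r :: real assume "r \<in> {0..<1}"
    then show "0 \<le> f r" unfolding f_def using \<alpha> by simp
  qed (use int in blast)
  from set_lebesgue_integral_eq_integral(2)[OF this] have "(LINT r:{0..<1}|lebesgue. f r) = fact n / (2 * pochhammer (\<alpha> + 1) n)"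
    using integral_unique[OF int] by simp
  then show ?thesis unfolding weight_moment_def std_weight_def f_def by simp
qed

text \<open>With nonnegative coefficients the triangle inequality is an equality at the positive
  point of the circle, so the maximum is attained there.\<close>

lemma mean_infty_nonneg_coeffs:
  assumes a: "\<And>n. 0 \<le> a n" and sm: "summable (\<lambda>n. a n * r ^ n)" and r: "0 \<le> r"
  shows "mean_infty r (\<lambda>z. \<Sum>n. of_real (a n) * z ^ n) = (\<Sum>n. a n * r ^ n)"
proof -
  have eq: "norm (of_real (a n) * z ^ n :: complex) = a n * r ^ n" if "z \<in> sphere 0 r" for z n
    using that a[of n] by (simp add: norm_mult norm_power)
  have le: "norm (\<Sum>n. of_real (a n) * z ^ n :: complex) \<le> (\<Sum>n. a n * r ^ n)" if z: "z \<in> sphere 0 r" for z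
    using summable_norm[of "\<lambda>n. of_real (a n) * z ^ n :: complex"] sm unfolding eq[OF z] by simp
  have real: "(\<Sum>n. of_real (a n) * of_real r ^ n :: complex) = of_real (\<Sum>n. a n * r ^ n)"
    using suminf_of_real[OF sm, where 'a=complex] by simp
  have pos: "0 \<le> (\<Sum>n. a n * r ^ n)" using a r by (intro suminf_nonneg sm) auto
  have mem: "of_real r \<in> sphere (0::complex) r" using r by simp
  show ?thesis unfolding mean_infty_def
  proof (rule antisym)
    show "(SUP z\<in>sphere 0 r. norm (\<Sum>n. of_real (a n) * z ^ n :: complex)) \<le> (\<Sum>n. a n * r ^ n)"
      using mem le by (intro cSUP_least) auto
    have "norm (\<Sum>n. of_real (a n) * of_real r ^ n :: complex) \<le> (SUP z\<in>sphere 0 r. norm (\<Sum>n. of_real (a n) * z ^ n :: complex))"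
      using le by (intro cSUP_upper mem bdd_aboveI2)
    then show "(\<Sum>n. a n * r ^ n) \<le> (SUP z\<in>sphere 0 r. norm (\<Sum>n. of_real (a n) * z ^ n :: complex))"
      unfolding real using pos by simp
  qed
qed

text \<open>The coefficients are compared with those of the binomial series of
  \<open>(1 - r) powr (- \<beta>)\<close>, which are Pochhammer quotients.\<close>

lemma sum_powr_geometric_le:
  assumes \<beta>: "0 < \<beta>"
  obtains c where "0 < c" "\<And>r. 0 \<le> r \<Longrightarrow> r < 1 \<Longrightarrow> summable (\<lambda>n. (real n + 1) powr (\<beta> - 1) * r ^ n)"
    "\<And>r. 0 \<le> r \<Longrightarrow> r < 1 \<Longrightarrow> (\<Sum>n. (real n + 1) powr (\<beta> - 1) * r ^ n) \<le> c * (1 - r) powr (- \<beta>)"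
proof -
  obtain c where c: "0 < c" "\<And>n. (real n + 1) powr (\<beta> - 1) \<le> c * (pochhammer \<beta> n / fact n)"
    using pochhammer_growth[OF \<beta>] by metis
  have *: "summable (\<lambda>n. (real n + 1) powr (\<beta> - 1) * r ^ n) \<and> (\<Sum>n. (real n + 1) powr (\<beta> - 1) * r ^ n) \<le> c * (1 - r) powr (- \<beta>)"
    if r: "0 \<le> r" "r < 1" for r
  proof -
    have "(\<lambda>n. ((- \<beta>) gchoose n) * (- r) ^ n) sums (1 + - r) powr (- \<beta>)"
      by (rule gen_binomial_real) (use r in auto)
    moreover have "((- \<beta>) gchoose n) * (- r) ^ n = pochhammer \<beta> n / fact n * r ^ n" for n
      unfolding gbinomial_pochhammer power_minus[of r] by simp
    ultimately have "(\<lambda>n. pochhammer \<beta> n / fact n * r ^ n) sums (1 + - r) powr (- \<beta>)" by (simp only:)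
    then have s: "(\<lambda>n. c * (pochhammer \<beta> n / fact n * r ^ n)) sums (c * (1 - r) powr (- \<beta>))"
      unfolding diff_conv_add_uminus by (rule sums_mult)
    have le: "(real n + 1) powr (\<beta> - 1) * r ^ n \<le> c * (pochhammer \<beta> n / fact n * r ^ n)" for n
      using mult_right_mono[OF c(2)[of n], of "r ^ n"] r by (simp only: mult.assoc zero_le_power)
    have sm: "summable (\<lambda>n. (real n + 1) powr (\<beta> - 1) * r ^ n)"
      by (rule summable_comparison_test'[OF sums_summable[OF s], of 0]) (use le r in auto)
    from suminf_le[OF le sm sums_summable[OF s]] sm show ?thesis unfolding sums_unique[OF s, symmetric] by simp
  qed
  then show ?thesis using that[OF c(1)] by blast
qed

context doubling_measure
begin

text \<open>The n-th Taylor coefficient of the fractional derivative of the fundamental function;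
  the last factor is the reciprocal moment of the standard weight.\<close>

definition frac_coeff :: "real \<Rightarrow> real measure \<Rightarrow> nat \<Rightarrow> real" where
  "frac_coeff \<alpha> \<mu> n = b n * measure_moment \<mu> n * (2 * (pochhammer (\<alpha> + 1) n / fact n))"

lemma frac_coeff_nonneg: "0 < \<alpha> \<Longrightarrow> \<mu> \<in> M_plus \<Longrightarrow> 0 \<le> frac_coeff \<alpha> \<mu> n"
  unfolding frac_coeff_def using b_pos[of n] measure_moment_nonneg[of \<mu> n] pochhammer_pos[of "\<alpha> + 1" n] by simp

lemma frac_deriv_cesaro_one:
  assumes "0 < \<alpha>" "\<mu> \<in> M_plus"
  shows "frac_deriv \<alpha> (cesaro \<mu> (\<lambda>_. 1)) = (\<lambda>z. \<Sum>n. of_real (frac_coeff \<alpha> \<mu> n) * z ^ n)"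
proof -
  have "b n * measure_moment \<mu> n / (fact n / (2 * pochhammer (\<alpha> + 1) n)) = frac_coeff \<alpha> \<mu> n" for n
    unfolding frac_coeff_def by simp
  then show ?thesis
    unfolding frac_deriv_def weight_deriv_def std_weight_moment[OF assms(1)] fps_expansion_cesaro_one[OF assms(2)]
      of_real_divide[symmetric] by (simp only:)
qed

lemma summable_frac_coeff:
  assumes \<alpha>: "0 < \<alpha>" and \<mu>: "\<mu> \<in> M_plus" and r: "0 \<le> r" "r < 1"
  shows "summable (\<lambda>n. frac_coeff \<alpha> \<mu> n * r ^ n)"
proof -
  obtain A \<eta> where A: "0 < A" "\<And>k n. 2 ^ k \<le> Suc n \<Longrightarrow> b n \<le> A * (real (Suc n) / 2 ^ k) ^ \<eta> / W k"
    using b_growth by blast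
  obtain c where c: "0 < c" "\<And>n. pochhammer (\<alpha> + 1) n / fact n \<le> c * (real n + 1) powr (\<alpha> + 1 - 1)"
    using pochhammer_growth[of "\<alpha> + 1"] \<alpha> by (metis add_pos_pos zero_less_one)
  define m where "m = nat \<lceil>\<alpha>\<rceil>"
  have m: "\<alpha> \<le> real m" unfolding m_def by linarith
  define E where "E = A / W 0 * measure_moment \<mu> 0 * (2 * c)"
  have le: "frac_coeff \<alpha> \<mu> n * r ^ n \<le> E * (real (Suc n) ^ (\<eta> + m) * r ^ n)" for n
  proof -
    have "(real n + 1) powr \<alpha> \<le> (real n + 1) powr real m" using m by (intro powr_mono) auto
    also have "\<dots> = real (Suc n) ^ m" by (subst powr_realpow) (auto simp: add.commute)
    finally have p: "(real n + 1) powr \<alpha> \<le> real (Suc n) ^ m" .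
    have "pochhammer (\<alpha> + 1) n / fact n \<le> c * real (Suc n) ^ m"
      using order_trans[OF c(2)[of n, unfolded add_diff_cancel_right'] mult_left_mono[OF p]] c(1) by simp
    moreover have "b n \<le> A * real (Suc n) ^ \<eta> / W 0" using A(2)[of 0 n] by simp
    ultimately have "frac_coeff \<alpha> \<mu> n \<le> (A * real (Suc n) ^ \<eta> / W 0) * measure_moment \<mu> 0 * (2 * (c * real (Suc n) ^ m))"
      unfolding frac_coeff_def
      using A(1) c(1) W_pos[of 0] \<alpha> pochhammer_pos[of "\<alpha> + 1" n] b_pos[of n] measure_moment_nonneg[OF \<mu>] measure_moment_antimono[OF \<mu>, of 0 n]
      by (intro mult_mono mult_nonneg_nonneg divide_nonneg_nonneg) (auto intro: order.strict_implies_order)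
    also have "\<dots> = E * real (Suc n) ^ (\<eta> + m)" unfolding E_def power_add by simp
    finally show ?thesis using r mult_right_mono[of _ _ "r ^ n"] by (simp only: mult.assoc[symmetric] zero_le_power)
  qed
  have sm: "summable (\<lambda>n. E * (real (Suc n) ^ (\<eta> + m) * r ^ n))"
    using r by (intro summable_mult summable_Suc_power_geometric) simp
  have nm: "norm (frac_coeff \<alpha> \<mu> n * r ^ n) = frac_coeff \<alpha> \<mu> n * r ^ n" for n
    using frac_coeff_nonneg[OF \<alpha> \<mu>, of n] r by simp
  show ?thesis by (rule summable_comparison_test'[OF sm, of 0]) (simp only: nm le)
qed

lemma frac_deriv_cesaro_one_holomorphic:
  assumes \<alpha>: "0 < \<alpha>" and \<mu>: "\<mu> \<in> M_plus"
  shows "frac_deriv \<alpha> (cesaro \<mu> (\<lambda>_. 1)) holomorphic_on ball 0 1"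
proof (rule power_series_holomorphic)
  fix w :: complex assume w: "w \<in> ball 0 1"
  have "summable (\<lambda>n. norm (of_real (frac_coeff \<alpha> \<mu> n) * w ^ n))"
    using summable_frac_coeff[OF \<alpha> \<mu>, of "norm w"] w frac_coeff_nonneg[OF \<alpha> \<mu>] by (simp add: norm_mult norm_power)
  from summable_sums[OF summable_norm_cancel[OF this]]
  show "(\<lambda>n. of_real (frac_coeff \<alpha> \<mu> n) * (w - 0) ^ n) sums frac_deriv \<alpha> (cesaro \<mu> (\<lambda>_. 1)) w"
    unfolding frac_deriv_cesaro_one[OF \<alpha> \<mu>] by simp
qed

lemma mean_infty_frac_deriv:
  assumes "0 < \<alpha>" "\<mu> \<in> M_plus" "0 \<le> r" "r < 1"
  shows "mean_infty r (frac_deriv \<alpha> (cesaro \<mu> (\<lambda>_. 1))) = (\<Sum>n. frac_coeff \<alpha> \<mu> n * r ^ n)"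
  unfolding frac_deriv_cesaro_one[OF assms(1,2)]
  using assms by (intro mean_infty_nonneg_coeffs frac_coeff_nonneg summable_frac_coeff)

text \<open>By doubling, the moments of order n and 2n + 1 are comparable, so \<open>b n\<close> is
  comparable to the reciprocal moment of order n; the Pochhammer quotient has the size
  \<open>(n + 1) powr \<alpha>\<close>.\<close>

lemma frac_coeff_bounds:
  assumes \<alpha>: "0 < \<alpha>"
  obtains C where "0 < C"
    "\<And>\<mu> n. \<mu> \<in> M_plus \<Longrightarrow> frac_coeff \<alpha> \<mu> n \<le> C * (moment_ratio \<mu> n * (real n + 1) powr (\<alpha> - 1))"
    "\<And>\<mu> n. \<mu> \<in> M_plus \<Longrightarrow> moment_ratio \<mu> n * (real n + 1) powr (\<alpha> - 1) \<le> C * frac_coeff \<alpha> \<mu> n"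
proof -
  have \<alpha>1: "0 < \<alpha> + 1" using \<alpha> by simp
  obtain c where c: "0 < c" "\<And>n. pochhammer (\<alpha> + 1) n / fact n \<le> c * (real n + 1) powr (\<alpha> + 1 - 1)"
    "\<And>n. (real n + 1) powr (\<alpha> + 1 - 1) \<le> c * (pochhammer (\<alpha> + 1) n / fact n)"
    using pochhammer_growth[OF \<alpha>1] by blast
  obtain A where A: "0 < A" "\<And>n m. Suc m \<le> 2 ^ 1 * Suc n \<Longrightarrow> measure_moment \<nu> n \<le> A * measure_moment \<nu> m"
    using moment_window by blast
  have b1: "b n \<le> A / (2 * measure_moment \<nu> n)" for n
    using A(2)[of "2 * n + 1" n] moment_pos[of n] moment_pos[of "2 * n + 1"] unfolding b_def by (simp add: field_simps)
  have b2: "1 / (2 * measure_moment \<nu> n) \<le> b n" for n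
    unfolding b_def using moment_pos measure_moment_antimono[OF M_plus, of n "2 * n + 1"] by (intro divide_left_mono) auto
  have eq: "moment_ratio \<mu> n * (real n + 1) powr (\<alpha> - 1) = 1 / (2 * measure_moment \<nu> n) * measure_moment \<mu> n * (2 * (real n + 1) powr \<alpha>)" for \<mu> n
  proof -
    have "(real n + 1) powr \<alpha> = (real n + 1) * (real n + 1) powr (\<alpha> - 1)" by (simp add: powr_diff)
    then show ?thesis unfolding moment_ratio_def by simp
  qed
  note nn = measure_moment_nonneg moment_pos b_pos pochhammer_pos[OF \<alpha>1]
  have up: "frac_coeff \<alpha> \<mu> n \<le> (A * c) * (moment_ratio \<mu> n * (real n + 1) powr (\<alpha> - 1))" if \<mu>: "\<mu> \<in> M_plus" for \<mu> n
  proof -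
    have "frac_coeff \<alpha> \<mu> n \<le> A / (2 * measure_moment \<nu> n) * measure_moment \<mu> n * (2 * (c * (real n + 1) powr \<alpha>))"
      unfolding frac_coeff_def using c(2)[of n] b1[of n] nn(1)[OF \<mu>, of n] nn(2)[of n] nn(3)[of n] nn(4)[of n] A(1) by (intro mult_mono) auto
    then show ?thesis unfolding eq by (simp add: mult_ac)
  qed
  have low: "moment_ratio \<mu> n * (real n + 1) powr (\<alpha> - 1) \<le> c * frac_coeff \<alpha> \<mu> n" if \<mu>: "\<mu> \<in> M_plus" for \<mu> n
  proof -
    have "moment_ratio \<mu> n * (real n + 1) powr (\<alpha> - 1) \<le> b n * measure_moment \<mu> n * (2 * (c * (pochhammer (\<alpha> + 1) n / fact n)))"
      unfolding eq using c(3)[of n] b2[of n] nn(1)[OF \<mu>, of n] nn(2)[of n] nn(3)[of n] by (intro mult_mono) auto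
    then show ?thesis unfolding frac_coeff_def by (simp add: mult_ac)
  qed
  show ?thesis
  proof (rule that[of "max (A * c) c"])
    fix \<mu> n assume \<mu>: "\<mu> \<in> M_plus"
    show "frac_coeff \<alpha> \<mu> n \<le> max (A * c) c * (moment_ratio \<mu> n * (real n + 1) powr (\<alpha> - 1))"
      by (rule order_trans[OF up[OF \<mu>] mult_right_mono]) (use moment_ratio_nonneg[OF \<mu>] in auto)
    show "moment_ratio \<mu> n * (real n + 1) powr (\<alpha> - 1) \<le> max (A * c) c * frac_coeff \<alpha> \<mu> n"
      by (rule order_trans[OF low[OF \<mu>] mult_right_mono]) (use frac_coeff_nonneg[OF \<alpha> \<mu>] in auto)
  qed (use c in auto)
qed

text \<open>The coefficients are nonnegative, so the maximum modulus at radius r is the value of the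
  series at r. The supremum over n bounds the coefficients by a multiple of
  \<open>(n + 1) powr (\<beta> - 1)\<close>, whose series grows like
  \<open>(1 - r) powr (- \<beta>)\<close>. Conversely, at r = 1 - 2^-k the terms with n + 1
  comparable to 2^k are already large enough.\<close>

lemma X_norm_bounds:
  assumes \<beta>: "0 < \<beta>" and \<delta>: "0 \<le> \<delta>"
  obtains C where "0 < C"
    "\<And>\<mu>. \<mu> \<in> M_plus \<Longrightarrow> X_norm \<beta> (frac_deriv (\<beta> + \<delta>) (cesaro \<mu> (\<lambda>_. 1))) \<le> ennreal C * ratio_sup \<delta> \<mu>"
    "\<And>\<mu>. \<mu> \<in> M_plus \<Longrightarrow> ratio_sup \<delta> \<mu> \<le> ennreal C * X_norm \<beta> (frac_deriv (\<beta> + \<delta>) (cesaro \<mu> (\<lambda>_. 1)))"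
proof -
  define \<alpha> where "\<alpha> = \<beta> + \<delta>"
  have \<alpha>: "0 < \<alpha>" unfolding \<alpha>_def using \<beta> \<delta> by simp
  obtain A where A: "0 < A"
    "\<And>\<mu> n. \<mu> \<in> M_plus \<Longrightarrow> frac_coeff \<alpha> \<mu> n \<le> A * (moment_ratio \<mu> n * (real n + 1) powr (\<alpha> - 1))"
    "\<And>\<mu> n. \<mu> \<in> M_plus \<Longrightarrow> moment_ratio \<mu> n * (real n + 1) powr (\<alpha> - 1) \<le> A * frac_coeff \<alpha> \<mu> n"
    using frac_coeff_bounds[OF \<alpha>] by blast
  obtain C1 where C1: "0 < C1" "\<And>\<mu>. \<mu> \<in> M_plus \<Longrightarrow>
    (SUP n. ennreal (measure_moment \<mu> n * (real n + 1) powr (1 + \<delta>) / measure_moment \<nu> n)) \<le> ennreal C1 * ratio_sup \<delta> \<mu>"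
    using moment_sup_bounds[OF \<delta>] by metis
  obtain C2 where C2: "0 < C2" "\<And>\<mu> k n. \<mu> \<in> M_plus \<Longrightarrow> Suc n \<le> 2 ^ k \<Longrightarrow> 2 ^ k \<le> 2 * Suc n \<Longrightarrow> ratio \<mu> k \<le> C2 * moment_ratio \<mu> n"
    using moment_ratio_lower by blast
  obtain C3 where C3: "0 < C3" "\<And>r. 0 \<le> r \<Longrightarrow> r < 1 \<Longrightarrow> summable (\<lambda>n. (real n + 1) powr (\<beta> - 1) * r ^ n)"
    "\<And>r. 0 \<le> r \<Longrightarrow> r < 1 \<Longrightarrow> (\<Sum>n. (real n + 1) powr (\<beta> - 1) * r ^ n) \<le> C3 * (1 - r) powr (- \<beta>)"
    using sum_powr_geometric_le[OF \<beta>] by blast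
  have X: "X_norm \<beta> (frac_deriv \<alpha> (cesaro \<mu> (\<lambda>_. 1))) = (SUP r\<in>{0..<1}. ennreal ((1 - r) powr \<beta> * (\<Sum>n. frac_coeff \<alpha> \<mu> n * r ^ n)))"
    if \<mu>: "\<mu> \<in> M_plus" for \<mu>
    unfolding X_norm_def by (intro SUP_cong refl) (simp add: mean_infty_frac_deriv[OF \<alpha> \<mu>])
  have up: "X_norm \<beta> (frac_deriv \<alpha> (cesaro \<mu> (\<lambda>_. 1))) \<le> ennreal (A * C3 * C1) * ratio_sup \<delta> \<mu>" if \<mu>: "\<mu> \<in> M_plus" for \<mu>
  proof -
    have "X_norm \<beta> (frac_deriv \<alpha> (cesaro \<mu> (\<lambda>_. 1)))
        \<le> ennreal (A * C3) * (SUP n. ennreal (measure_moment \<mu> n * (real n + 1) powr (1 + \<delta>) / measure_moment \<nu> n))"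
      unfolding X[OF \<mu>]
    proof (rule SUP_ennreal_le_cmult_SUP)
      fix Q r assume Q0: "0 \<le> Q" and r: "r \<in> {0..<1::real}"
        and Q: "\<And>n. n \<in> UNIV \<Longrightarrow> measure_moment \<mu> n * (real n + 1) powr (1 + \<delta>) / measure_moment \<nu> n \<le> Q"
      have le: "frac_coeff \<alpha> \<mu> n * r ^ n \<le> A * Q * ((real n + 1) powr (\<beta> - 1) * r ^ n)" for n
      proof -
        have "(real n + 1) * (real n + 1) powr (\<alpha> - 1) = (real n + 1) powr (1 + \<delta>) * (real n + 1) powr (\<beta> - 1)"
          unfolding \<alpha>_def by (simp add: powr_mult_base flip: powr_add) (simp add: add_ac)
        then have "moment_ratio \<mu> n * (real n + 1) powr (\<alpha> - 1)
            = measure_moment \<mu> n * (real n + 1) powr (1 + \<delta>) / measure_moment \<nu> n * (real n + 1) powr (\<beta> - 1)"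
          unfolding moment_ratio_def by (simp add: mult.assoc)
        also have "\<dots> \<le> Q * (real n + 1) powr (\<beta> - 1)" using Q by (intro mult_right_mono) auto
        finally have "A * (moment_ratio \<mu> n * (real n + 1) powr (\<alpha> - 1)) \<le> A * (Q * (real n + 1) powr (\<beta> - 1))"
          using A(1) by (intro mult_left_mono) auto
        with A(2)[OF \<mu>, of n] have "frac_coeff \<alpha> \<mu> n \<le> A * (Q * (real n + 1) powr (\<beta> - 1))" by (rule order_trans)
        then have "frac_coeff \<alpha> \<mu> n * r ^ n \<le> A * (Q * (real n + 1) powr (\<beta> - 1)) * r ^ n"
          using r by (intro mult_right_mono) auto
        then show ?thesis by (simp only: mult.assoc)
      qed
      have "(\<Sum>n. frac_coeff \<alpha> \<mu> n * r ^ n) \<le> (\<Sum>n. A * Q * ((real n + 1) powr (\<beta> - 1) * r ^ n))"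
        using r by (intro suminf_le le summable_mult C3 summable_frac_coeff[OF \<alpha> \<mu>]) auto
      also have "\<dots> = A * Q * (\<Sum>n. (real n + 1) powr (\<beta> - 1) * r ^ n)" using r by (intro suminf_mult C3) auto
      also have "\<dots> \<le> A * Q * (C3 * (1 - r) powr (- \<beta>))" using r A(1) Q0 by (intro mult_left_mono C3) auto
      finally have "(1 - r) powr \<beta> * (\<Sum>n. frac_coeff \<alpha> \<mu> n * r ^ n) \<le> (1 - r) powr \<beta> * (A * Q * (C3 * (1 - r) powr (- \<beta>)))"
        by (intro mult_left_mono) auto
      also have "\<dots> = A * C3 * Q" using r by (simp add: powr_minus field_simps)
      finally show "(1 - r) powr \<beta> * (\<Sum>n. frac_coeff \<alpha> \<mu> n * r ^ n) \<le> A * C3 * Q" .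
    qed (use A(1) C3(1) in auto)
    also have "\<dots> \<le> ennreal (A * C3) * (ennreal C1 * ratio_sup \<delta> \<mu>)" by (intro mult_left_mono C1(2)[OF \<mu>]) simp
    also have "\<dots> = ennreal (A * C3 * C1) * ratio_sup \<delta> \<mu>" using A(1) C3(1) C1(1) by (simp add: ennreal_mult mult.assoc)
    finally show ?thesis .
  qed
  define E where "E = 6 * 2 powr \<alpha> * C2 * A"
  have E: "0 < E" unfolding E_def using A(1) C2(1) by simp
  have low: "ratio_sup \<delta> \<mu> \<le> ennreal E * X_norm \<beta> (frac_deriv \<alpha> (cesaro \<mu> (\<lambda>_. 1)))" if \<mu>: "\<mu> \<in> M_plus" for \<mu>
    unfolding X[OF \<mu>] ratio_sup_def
  proof (rule SUP_ennreal_le_cmult_SUP)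
    fix Q k assume Q: "\<And>r. r \<in> {0..<1} \<Longrightarrow> (1 - r) powr \<beta> * (\<Sum>n. frac_coeff \<alpha> \<mu> n * r ^ n) \<le> Q"
    define r where "r = 1 - (1/2::real) ^ k"
    \<comment> \<open>At least 2^k / 2 indices, on which n + 1 lies between 2^k / 2 and 2^k and
      \<open>r ^ n\<close> is at least 1/3. For k = 0 it is the single index 0.\<close>
    define I where "I = {2 ^ k div 2..<(2::nat) ^ k}"
    have r: "0 \<le> r" "r < 1" unfolding r_def by (auto simp: half_power_le_1)
    define m where "m = ratio \<mu> k / C2 * ((2 ^ k) powr \<alpha> / 2 powr \<alpha> / 2 ^ k) / A * (1/3)"
    have "m \<le> frac_coeff \<alpha> \<mu> n * r ^ n" if n: "n \<in> I" for n
      unfolding m_def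
    proof (rule mult_mono)
      have n1: "Suc n \<le> 2 ^ k" "2 ^ k \<le> 2 * Suc n" using n unfolding I_def by auto
      have "real (2 ^ k) \<le> real (2 * Suc n)" "real (Suc n) \<le> real (2 ^ k)" using n1 by (auto intro: of_nat_mono simp only:)
      then have n2: "(2::real) ^ k / 2 \<le> real n + 1" "real n + 1 \<le> 2 ^ k" by auto
      have "ratio \<mu> k / C2 \<le> moment_ratio \<mu> n" using C2(2)[OF \<mu> n1] C2(1) by (simp add: divide_le_eq mult.commute)
      moreover have "(2 ^ k) powr \<alpha> / 2 powr \<alpha> / 2 ^ k \<le> (real n + 1) powr (\<alpha> - 1)"
      proof -
        have "(2 ^ k / 2) powr \<alpha> \<le> (real n + 1) powr \<alpha>" using n2 \<alpha> by (intro powr_mono2) auto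
        then have "(2 ^ k) powr \<alpha> / 2 powr \<alpha> / 2 ^ k \<le> (real n + 1) powr \<alpha> / (real n + 1)"
          unfolding powr_divide using n2 by (intro frac_le) auto
        then show ?thesis by (simp add: powr_diff)
      qed
      ultimately have "ratio \<mu> k / C2 * ((2 ^ k) powr \<alpha> / 2 powr \<alpha> / 2 ^ k) \<le> moment_ratio \<mu> n * (real n + 1) powr (\<alpha> - 1)"
        using moment_ratio_nonneg[OF \<mu>] by (intro mult_mono) auto
      also have "\<dots> \<le> A * frac_coeff \<alpha> \<mu> n" by (rule A(3)[OF \<mu>])
      finally show "ratio \<mu> k / C2 * ((2 ^ k) powr \<alpha> / 2 powr \<alpha> / 2 ^ k) / A \<le> frac_coeff \<alpha> \<mu> n"
        using A(1) by (simp only: pos_divide_le_eq mult.commute)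
      have "1/3 \<le> (1 - 1 / real (2 ^ k)) ^ (2 ^ k - 1)" by (rule one_minus_inverse_power_ge) simp
      also have "1 - 1 / real (2 ^ k) = r" unfolding r_def by (simp add: power_one_over)
      also have "r ^ (2 ^ k - 1) \<le> r ^ n" using r n1 by (intro power_decreasing) auto
      finally show "1/3 \<le> r ^ n" .
    qed (use frac_coeff_nonneg[OF \<alpha> \<mu>] in auto)
    then have "real (card I) * m \<le> (\<Sum>n\<in>I. frac_coeff \<alpha> \<mu> n * r ^ n)" by (rule sum_bounded_below)
    also have "\<dots> \<le> (\<Sum>n. frac_coeff \<alpha> \<mu> n * r ^ n)"
      unfolding I_def using frac_coeff_nonneg[OF \<alpha> \<mu>] r by (intro sum_le_suminf summable_frac_coeff[OF \<alpha> \<mu>]) auto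
    finally have 1: "real (card I) * m \<le> (\<Sum>n. frac_coeff \<alpha> \<mu> n * r ^ n)" .
    have m0: "0 \<le> m" unfolding m_def using ratio_nonneg A(1) C2(1) by simp
    have "2 ^ k \<le> 2 * card I" using div_times_less_eq_dividend[of "2 ^ k" 2] unfolding I_def card_atLeastLessThan by linarith
    then have "real (2 ^ k) \<le> real (2 * card I)" by (rule of_nat_mono)
    then have "2 ^ k / 2 \<le> real (card I)" by simp
    then have "2 ^ k / 2 * m \<le> real (card I) * m" using m0 by (rule mult_right_mono)
    with 1 have "2 ^ k / 2 * m \<le> (\<Sum>n. frac_coeff \<alpha> \<mu> n * r ^ n)" by linarith
    then have "(1 - r) powr \<beta> * (2 ^ k / 2 * m) \<le> (1 - r) powr \<beta> * (\<Sum>n. frac_coeff \<alpha> \<mu> n * r ^ n)"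
      by (intro mult_left_mono) auto
    also have "\<dots> \<le> Q" using Q r by simp
    finally have 2: "(1 - r) powr \<beta> * (2 ^ k / 2 * m) \<le> Q" .
    have "(1 - r) powr \<beta> * (2 ^ k) powr \<alpha> = 2 powr (real k * \<delta>)"
      unfolding r_def half_power_powr \<alpha>_def powr_realpow[symmetric, of 2 k, simplified] by (simp add: powr_powr algebra_simps flip: powr_add)
    then have "ratio \<mu> k * 2 powr (real k * \<delta>) = E * ((1 - r) powr \<beta> * (2 ^ k / 2 * m))"
      unfolding E_def m_def using A(1) C2(1) by (simp add: field_simps)
    also have "\<dots> \<le> E * Q" using 2 E by (intro mult_left_mono) auto
    finally show "ratio \<mu> k * 2 powr (real k * \<delta>) \<le> E * Q" .
  qed (use E in auto)
  show ?thesis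
  proof (rule that[of "max (A * C3 * C1) E"])
    fix \<mu> assume \<mu>: "\<mu> \<in> M_plus"
    show "X_norm \<beta> (frac_deriv (\<beta> + \<delta>) (cesaro \<mu> (\<lambda>_. 1))) \<le> ennreal (max (A * C3 * C1) E) * ratio_sup \<delta> \<mu>"
      unfolding \<alpha>_def[symmetric] by (rule order_trans[OF up[OF \<mu>]]) (intro mult_right_mono ennreal_leI; simp)
    show "ratio_sup \<delta> \<mu> \<le> ennreal (max (A * C3 * C1) E) * X_norm \<beta> (frac_deriv (\<beta> + \<delta>) (cesaro \<mu> (\<lambda>_. 1)))"
      unfolding \<alpha>_def[symmetric] by (rule order_trans[OF low[OF \<mu>]]) (intro mult_right_mono ennreal_leI; simp)
  qed (use E in auto)
qed

end

subsection \<open>Two-sided comparisons\<close>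

text \<open>Two upper bounds avoid reciprocals in [0, \<infinity>]. Each norm is compared with one
  reference quantity, and \<open>comparable\<close> follows between any two of them with constant c
  * c.\<close>

definition equiv_by :: "real \<Rightarrow> ennreal \<Rightarrow> ennreal \<Rightarrow> bool" where
  "equiv_by c A N \<longleftrightarrow> A \<le> ennreal c * N \<and> N \<le> ennreal c * A"

lemma less_infinity_ennrealE:
  assumes "x < (\<infinity>::ennreal)" obtains y where "0 \<le> y" "x = ennreal y"
  using that[of "enn2real x"] assms by simp

lemma equiv_by_mono:
  assumes "equiv_by c A N" "c \<le> d" shows "equiv_by d A N"
proof -
  have le: "ennreal c * X \<le> ennreal d * X" for X by (intro mult_right_mono ennreal_leI assms(2)) simp
  show ?thesis using assms(1) order_trans[OF _ le[of N]] order_trans[OF _ le[of A]] unfolding equiv_by_def by simp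
qed

lemma comparable_if_equiv_by:
  assumes c: "0 < c" and A: "equiv_by c A N" and B: "equiv_by c B N"
  shows "comparable (c * c) A B"
proof -
  have *: "X \<le> ennreal (c * c) * Y" if "X \<le> ennreal c * N" "N \<le> ennreal c * Y" for X Y
    using order_trans[OF that(1) mult_left_mono[OF that(2)]] c by (simp add: ennreal_mult mult.assoc)
  have "ennreal (1 / (c * c)) * B \<le> ennreal (1 / (c * c)) * (ennreal (c * c) * A)"
    using A B unfolding equiv_by_def by (intro mult_left_mono *) auto
  also have "\<dots> = A" using c unfolding mult.assoc[symmetric] by (subst ennreal_mult[symmetric]) auto
  finally show ?thesis
    using A B *[of A B] unfolding comparable_def equiv_by_def by simp
qed

lemma equiv_by_finite_iff: "equiv_by c A N \<Longrightarrow> A < \<infinity> \<longleftrightarrow> N < \<infinity>"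
  unfolding equiv_by_def by (auto intro: order_le_less_trans simp: ennreal_mult_less_top)

lemma ennpowr_le:
  assumes "A \<le> ennreal c * N" and c: "0 < c" and a: "0 < a"
  shows "ennpowr A a \<le> ennreal (c powr a) * ennpowr N a"
proof (cases N)
  case (real n)
  then have "A \<le> ennreal (c * n)" using assms(1) c by (simp add: ennreal_mult)
  then obtain x where x: "0 \<le> x" "A = ennreal x" by (cases A) (auto simp: top_unique)
  have "x \<le> c * n" using \<open>A \<le> ennreal (c * n)\<close> x real c by (simp add: ennreal_le_iff)
  then have "x powr a \<le> (c * n) powr a" using x a by (intro powr_mono2) auto
  then have "ennreal (x powr a) \<le> ennreal (c powr a * n powr a)" unfolding powr_mult by (rule ennreal_leI)
  then show ?thesis unfolding x real ennpowr_ennreal[OF x(1)] ennpowr_ennreal[OF real(1)]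
    by (subst ennreal_mult[symmetric]) auto
next
  case top
  then show ?thesis using c by (simp add: ennpowr_def ennreal_mult_top)
qed

lemma equiv_by_ennpowr:
  assumes "0 < c" "0 < a" "equiv_by c A N" shows "equiv_by (c powr a) (ennpowr A a) (ennpowr N a)"
  using assms unfolding equiv_by_def by (simp add: ennpowr_le)

lemma ennpowr_finite_iff: "ennpowr A a < \<infinity> \<longleftrightarrow> A < \<infinity>"
  unfolding ennpowr_def by (auto simp: less_top)

lemma ennpowr_inverse_eq:
  assumes "0 < s" "0 \<le> Q" shows "ennpowr (ennreal (Q powr s)) (1 / s) = ennreal Q"
  using assms by (simp add: ennpowr_ennreal powr_powr)

subsection \<open>Boundedness in terms of integral means\<close>

lemma hardy_norm_le: "(\<And>r. 0 \<le> r \<Longrightarrow> r < 1 \<Longrightarrow> mean_p p r f \<le> H) \<Longrightarrow> hardy_norm p f \<le> ennreal H"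
  unfolding hardy_norm_def by (intro SUP_least ennreal_leI) auto

lemma mean_p_le_hardy_norm:
  assumes "hardy_norm p f \<le> ennreal H" "0 \<le> H" "0 \<le> r" "r < 1" shows "mean_p p r f \<le> H"
proof -
  have "ennreal (mean_p p r f) \<le> hardy_norm p f" unfolding hardy_norm_def using assms by (intro SUP_upper) auto
  then have "ennreal (mean_p p r f) \<le> ennreal H" using assms(1) by (rule order_trans)
  then show ?thesis using assms(2) by (simp add: ennreal_le_iff)
qed

text \<open>The estimates are phrased with a real bound H for all means of f, which is the
  convenient form for constants that must not depend on f or \<mu>.\<close>

lemma hardy_bound_mean_p_le:
  assumes T: "hardy_bound T p q K" and f: "f holomorphic_on ball 0 1"
    and H: "\<And>r. 0 \<le> r \<Longrightarrow> r < 1 \<Longrightarrow> mean_p p r f \<le> H" and r: "0 \<le> r" "r < 1"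
  shows "mean_p q r (T f) \<le> K * H"
proof -
  have H0: "0 \<le> H" using H[of 0] mean_p_nonneg[of p 0 f] by linarith
  have K: "0 \<le> K" using T unfolding hardy_bound_def by simp
  have n: "hardy_norm p f \<le> ennreal H" by (rule hardy_norm_le[OF H])
  then have "f \<in> hardy_space p" unfolding hardy_space_def using f by (auto intro: order_le_less_trans simp: ennreal_less_top)
  then have "hardy_norm q (T f) \<le> ennreal K * hardy_norm p f" using T unfolding hardy_bound_def by blast
  also have "\<dots> \<le> ennreal K * ennreal H" using n by (rule mult_left_mono) simp
  also have "\<dots> = ennreal (K * H)" using K H0 by (simp add: ennreal_mult)
  finally show ?thesis using K H0 r by (intro mean_p_le_hardy_norm) auto
qed

lemma hardy_boundI:
  assumes K: "0 \<le> K" and T: "\<And>f. f holomorphic_on ball 0 1 \<Longrightarrow> T f holomorphic_on ball 0 1"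
    and le: "\<And>f H r. f holomorphic_on ball 0 1 \<Longrightarrow> (\<And>r. 0 \<le> r \<Longrightarrow> r < 1 \<Longrightarrow> mean_p p r f \<le> H) \<Longrightarrow> 0 \<le> r \<Longrightarrow> r < 1 \<Longrightarrow>
      mean_p q r (T f) \<le> K * H"
  shows "hardy_bound T p q K"
proof -
  have "T f \<in> hardy_space q \<and> hardy_norm q (T f) \<le> ennreal K * hardy_norm p f" if "f \<in> hardy_space p" for f
  proof -
    have f: "f holomorphic_on ball 0 1" "hardy_norm p f < \<infinity>" using that unfolding hardy_space_def by auto
    obtain H where H: "0 \<le> H" "hardy_norm p f = ennreal H" using f(2) by (rule less_infinity_ennrealE)
    have "hardy_norm q (T f) \<le> ennreal (K * H)"
      by (rule hardy_norm_le[OF le[OF f(1) mean_p_le_hardy_norm[OF eq_refl[OF H(2)] H(1)]]])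
    also have "\<dots> = ennreal K * hardy_norm p f" unfolding H using K H by (simp add: ennreal_mult)
    finally have n: "hardy_norm q (T f) \<le> ennreal K * hardy_norm p f" .
    moreover have "ennreal K * hardy_norm p f < \<infinity>" using f(2) by (simp add: ennreal_mult_less_top)
    ultimately show ?thesis unfolding hardy_space_def using T[OF f(1)] by (auto intro: order_le_less_trans)
  qed
  then show ?thesis unfolding hardy_bound_def using K by blast
qed

lemma hardy_bounded_iff: "hardy_bounded T p q \<longleftrightarrow> hardy_opnorm T p q < \<infinity>"
proof
  assume "hardy_bounded T p q"
  then obtain K where "hardy_bound T p q K" unfolding hardy_bounded_def by blast
  then have "hardy_opnorm T p q \<le> ennreal K" unfolding hardy_opnorm_def by (intro INF_lower) auto
  then show "hardy_opnorm T p q < \<infinity>" by (auto intro: order_le_less_trans simp: ennreal_less_top)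
next
  assume fin: "hardy_opnorm T p q < \<infinity>"
  show "hardy_bounded T p q"
  proof (rule ccontr)
    assume "\<not> hardy_bounded T p q"
    then have "hardy_opnorm T p q = \<infinity>" unfolding hardy_opnorm_def hardy_bounded_def by simp
    with fin show False by simp
  qed
qed

text \<open>Only a finite reference value has to produce a bound for the operator. If the value is
  infinite, the lower estimate, valid for every admissible K, shows that there is no K.\<close>

lemma hardy_opnorm_equiv_by:
  assumes C: "0 < C"
    and up: "\<And>Q. 0 \<le> Q \<Longrightarrow> N = ennreal Q \<Longrightarrow> hardy_bound T p q (C * Q)"
    and low: "\<And>K. hardy_bound T p q K \<Longrightarrow> N \<le> ennreal (C * K)"
  shows "equiv_by C (hardy_opnorm T p q) N"
  unfolding equiv_by_def
proof
  show "hardy_opnorm T p q \<le> ennreal C * N"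
  proof (cases N)
    case (real Q)
    then have "hardy_opnorm T p q \<le> ennreal (C * Q)" unfolding hardy_opnorm_def by (intro INF_lower) (auto intro: up)
    then show ?thesis unfolding real using real(1) C by (simp add: ennreal_mult)
  next
    case top
    then show ?thesis using C by (simp add: ennreal_mult_top)
  qed
  have "ennreal (1 / C) * N \<le> hardy_opnorm T p q"
    unfolding hardy_opnorm_def
  proof (rule INF_greatest)
    fix K assume "K \<in> {K. hardy_bound T p q K}"
    then have K: "hardy_bound T p q K" "0 \<le> K" unfolding hardy_bound_def by auto
    have "ennreal (1 / C) * N \<le> ennreal (1 / C) * ennreal (C * K)" by (intro mult_left_mono low K) simp
    also have "\<dots> = ennreal K" using C K(2) by (subst ennreal_mult[symmetric]) auto
    finally show "ennreal (1 / C) * N \<le> ennreal K" .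
  qed
  then have "ennreal C * (ennreal (1 / C) * N) \<le> ennreal C * hardy_opnorm T p q" by (rule mult_left_mono) simp
  also have "ennreal C * (ennreal (1 / C) * N) = N"
    using C unfolding mult.assoc[symmetric] by (subst ennreal_mult[symmetric]) auto
  finally show "N \<le> ennreal C * hardy_opnorm T p q" .
qed

context doubling_measure
begin

lemma ratio_sup_leI:
  assumes "\<And>j. ratio \<mu> j \<le> Q * 2 powr (- real j * \<delta>)"
  shows "ratio_sup \<delta> \<mu> \<le> ennreal Q"
  unfolding ratio_sup_def
proof (intro SUP_least ennreal_leI)
  fix j
  have "ratio \<mu> j * 2 powr (real j * \<delta>) \<le> Q * 2 powr (- real j * \<delta>) * 2 powr (real j * \<delta>)"
    by (intro mult_right_mono assms) simp
  also have "\<dots> = Q" by (simp add: powr_minus)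
  finally show "ratio \<mu> j * 2 powr (real j * \<delta>) \<le> Q" .
qed

lemma ratio_le_ratio_sup:
  assumes "ratio_sup \<delta> \<mu> = ennreal Q" "0 \<le> Q"
  shows "ratio \<mu> j \<le> Q * 2 powr (- real j * \<delta>)"
proof -
  have "ennreal (ratio \<mu> j * 2 powr (real j * \<delta>)) \<le> ennreal Q"
    unfolding assms(1)[symmetric] ratio_sup_def by (rule SUP_upper) simp
  then have "ratio \<mu> j * 2 powr (real j * \<delta>) \<le> Q" using assms(2) by (simp add: ennreal_le_iff)
  then show ?thesis by (simp add: powr_minus_divide pos_le_divide_eq)
qed

lemma ratio_sum_leI:
  assumes "\<And>n. (\<Sum>j<n. (1/2) ^ j * ratio \<mu> j powr s) \<le> Q"
  shows "ratio_sum s \<mu> \<le> ennreal Q"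
  unfolding ratio_sum_def
proof (rule suminf_le_const[OF summableI])
  fix n
  have "(\<Sum>j<n. ennreal ((1/2) ^ j * ratio \<mu> j powr s)) = ennreal (\<Sum>j<n. (1/2) ^ j * ratio \<mu> j powr s)"
    by (rule sum_ennreal) simp
  then show "(\<Sum>j<n. ennreal ((1/2) ^ j * ratio \<mu> j powr s)) \<le> ennreal Q" using assms[of n] by (simp add: ennreal_leI)
qed

lemma ratio_norm_leI:
  assumes s: "0 < s" and Q: "0 \<le> Q" and "\<And>n. (\<Sum>j<n. (1/2) ^ j * ratio \<mu> j powr s) \<le> Q powr s"
  shows "ennpowr (ratio_sum s \<mu>) (1 / s) \<le> ennreal Q"
  using ennpowr_le[of "ratio_sum s \<mu>" 1 "ennreal (Q powr s)" "1 / s"] ratio_sum_leI[OF assms(3)] s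
  unfolding ennpowr_inverse_eq[OF s Q] by simp

lemma ratio_norm_eq:
  assumes s: "0 < s" and "ennpowr (ratio_sum s \<mu>) (1 / s) = ennreal Q" and Q: "0 \<le> Q"
  shows "(\<Sum>j. ennreal ((1/2) ^ j * ratio \<mu> j powr s)) \<le> ennreal (Q powr s)"
proof -
  have "ratio_sum s \<mu> < \<infinity>" using assms(2) ennpowr_finite_iff[of "ratio_sum s \<mu>" "1 / s"] by (simp add: ennreal_less_top)
  then obtain R where R: "0 \<le> R" "ratio_sum s \<mu> = ennreal R" by (rule less_infinity_ennrealE)
  have "R powr (1 / s) = Q" using assms(2) Q unfolding R(2) ennpowr_ennreal[OF R(1)] by simp
  then have "Q powr s = R" using s R(1) by (auto simp: powr_powr)
  then show ?thesis using R(2) unfolding ratio_sum_def by simp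
qed

lemma opnorm_equiv_ratio_sup:
  assumes p: "0 < p" and pq: "p \<le> q"
  obtains C where "0 < C" "\<And>\<mu>. \<mu> \<in> M_plus \<Longrightarrow> equiv_by C (hardy_opnorm (cesaro \<mu>) p q) (ratio_sup (1/p - 1/q) \<mu>)"
proof -
  have q: "0 < q" using p pq by simp
  obtain C1 where C1: "0 < C1" "\<And>\<mu> f H Q r. \<mu> \<in> M_plus \<Longrightarrow> f holomorphic_on ball 0 1 \<Longrightarrow>
    (\<And>r. 0 \<le> r \<Longrightarrow> r < 1 \<Longrightarrow> mean_p p r f \<le> H) \<Longrightarrow> (\<And>j. ratio \<mu> j \<le> Q * 2 powr (- real j * (1/p - 1/q))) \<Longrightarrow>
    0 \<le> r \<Longrightarrow> r < 1 \<Longrightarrow> mean_p q r (cesaro \<mu> f) \<le> C1 * Q * H"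
  proof (cases "p = q")
    case True
    show ?thesis using cesaro_mean_le_of_eq[OF p] that unfolding True by (simp, blast)
  next
    case False
    then have "p < q" using pq by simp
    then show ?thesis using cesaro_mean_le_of_greater[OF p] that by blast
  qed
  obtain C2 where C2: "0 < C2" "\<And>\<mu> K j. \<mu> \<in> M_plus \<Longrightarrow> 0 \<le> K \<Longrightarrow>
    (\<And>f H r. f holomorphic_on ball 0 1 \<Longrightarrow> (\<And>r. 0 \<le> r \<Longrightarrow> r < 1 \<Longrightarrow> mean_p p r f \<le> H) \<Longrightarrow> 0 \<le> r \<Longrightarrow> r < 1 \<Longrightarrow>
      mean_p q r (cesaro \<mu> f) \<le> K * H) \<Longrightarrow> ratio \<mu> j \<le> C2 * K * 2 powr (- real j * (1/p - 1/q))"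
    using cesaro_bounded_imp_ratio_le[OF p q] by blast
  define C where "C = max C1 C2"
  have C: "0 < C" "C1 \<le> C" "C2 \<le> C" unfolding C_def using C1(1) by auto
  show ?thesis
  proof (rule that[OF C(1)])
    fix \<mu> assume \<mu>: "\<mu> \<in> M_plus"
    show "equiv_by C (hardy_opnorm (cesaro \<mu>) p q) (ratio_sup (1/p - 1/q) \<mu>)"
    proof (rule hardy_opnorm_equiv_by[OF C(1)])
      fix Q assume Q: "0 \<le> Q" "ratio_sup (1/p - 1/q) \<mu> = ennreal Q"
      show "hardy_bound (cesaro \<mu>) p q (C * Q)"
      proof (rule hardy_boundI)
        fix f H r assume f: "f holomorphic_on ball 0 1" and H: "\<And>r. 0 \<le> r \<Longrightarrow> r < 1 \<Longrightarrow> mean_p p r f \<le> H"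
          and r: "0 \<le> r" "r < (1::real)"
        have H0: "0 \<le> H" using H[of 0] mean_p_nonneg[of p 0 f] by linarith
        have "mean_p q r (cesaro \<mu> f) \<le> C1 * Q * H"
          by (rule C1(2)[OF \<mu> f H ratio_le_ratio_sup[OF Q(2,1)] r])
        also have "\<dots> \<le> C * Q * H" using C H0 Q(1) by (intro mult_right_mono) auto
        finally show "mean_p q r (cesaro \<mu> f) \<le> C * Q * H" .
      qed (use C Q(1) cesaro_holomorphic[OF \<mu>] in auto)
    next
      fix K assume K: "hardy_bound (cesaro \<mu>) p q K"
      have K0: "0 \<le> K" using K unfolding hardy_bound_def by simp
      have "ratio_sup (1/p - 1/q) \<mu> \<le> ennreal (C2 * K)"
        by (rule ratio_sup_leI[OF C2(2)[OF \<mu> K0 hardy_bound_mean_p_le[OF K]]])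
      also have "\<dots> \<le> ennreal (C * K)" using C K0 by (intro ennreal_leI mult_right_mono) auto
      finally show "ratio_sup (1/p - 1/q) \<mu> \<le> ennreal (C * K)" .
    qed
  qed
qed

lemma opnorm_equiv_ratio_norm:
  assumes q: "0 < q" "q < p" and s: "s = q * p / (p - q)"
  obtains C where "0 < C" "\<And>\<mu>. \<mu> \<in> M_plus \<Longrightarrow> equiv_by C (hardy_opnorm (cesaro \<mu>) p q) (ennpowr (ratio_sum s \<mu>) (1 / s))"
proof -
  have s0: "0 < s" unfolding s using q by simp
  obtain C1 where C1: "0 < C1" "\<And>\<mu> f H Q r. \<mu> \<in> M_plus \<Longrightarrow> f holomorphic_on ball 0 1 \<Longrightarrow>
    (\<And>r. 0 \<le> r \<Longrightarrow> r < 1 \<Longrightarrow> mean_p p r f \<le> H) \<Longrightarrow> 0 \<le> Q \<Longrightarrow>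
    (\<Sum>j. ennreal ((1/2) ^ j * ratio \<mu> j powr s)) \<le> ennreal (Q powr s) \<Longrightarrow>
    0 \<le> r \<Longrightarrow> r < 1 \<Longrightarrow> mean_p q r (cesaro \<mu> f) \<le> C1 * Q * H"
    using cesaro_mean_le_of_less[OF q s] by blast
  obtain C2 where C2: "0 < C2" "\<And>\<mu> K n. \<mu> \<in> M_plus \<Longrightarrow> 0 \<le> K \<Longrightarrow>
    (\<And>f H r. f holomorphic_on ball 0 1 \<Longrightarrow> (\<And>r. 0 \<le> r \<Longrightarrow> r < 1 \<Longrightarrow> mean_p p r f \<le> H) \<Longrightarrow> 0 \<le> r \<Longrightarrow> r < 1 \<Longrightarrow>
      mean_p q r (cesaro \<mu> f) \<le> K * H) \<Longrightarrow> (\<Sum>j<n. (1/2) ^ j * ratio \<mu> j powr s) \<le> (C2 * K) powr s"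
    using cesaro_bounded_imp_ratio_power_sum_le[OF q s] by blast
  define C where "C = max C1 C2"
  have C: "0 < C" "C1 \<le> C" "C2 \<le> C" unfolding C_def using C1(1) by auto
  show ?thesis
  proof (rule that[OF C(1)])
    fix \<mu> assume \<mu>: "\<mu> \<in> M_plus"
    show "equiv_by C (hardy_opnorm (cesaro \<mu>) p q) (ennpowr (ratio_sum s \<mu>) (1 / s))"
    proof (rule hardy_opnorm_equiv_by[OF C(1)])
      fix Q assume Q: "0 \<le> Q" "ennpowr (ratio_sum s \<mu>) (1 / s) = ennreal Q"
      show "hardy_bound (cesaro \<mu>) p q (C * Q)"
      proof (rule hardy_boundI)
        fix f H r assume f: "f holomorphic_on ball 0 1" and H: "\<And>r. 0 \<le> r \<Longrightarrow> r < 1 \<Longrightarrow> mean_p p r f \<le> H"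
          and r: "0 \<le> r" "r < (1::real)"
        have H0: "0 \<le> H" using H[of 0] mean_p_nonneg[of p 0 f] by linarith
        have "mean_p q r (cesaro \<mu> f) \<le> C1 * Q * H"
          by (rule C1(2)[OF \<mu> f H Q(1) ratio_norm_eq[OF s0 Q(2,1)] r])
        also have "\<dots> \<le> C * Q * H" using C H0 Q(1) by (intro mult_right_mono) auto
        finally show "mean_p q r (cesaro \<mu> f) \<le> C * Q * H" .
      qed (use C Q(1) cesaro_holomorphic[OF \<mu>] in auto)
    next
      fix K assume K: "hardy_bound (cesaro \<mu>) p q K"
      have K0: "0 \<le> K" using K unfolding hardy_bound_def by simp
      have "ennpowr (ratio_sum s \<mu>) (1 / s) \<le> ennreal (C2 * K)"
        using C2(1) K0 by (intro ratio_norm_leI[OF s0 _ C2(2)[OF \<mu> K0 hardy_bound_mean_p_le[OF K]]]) auto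
      also have "\<dots> \<le> ennreal (C * K)" using C K0 by (intro ennreal_leI mult_right_mono) auto
      finally show "ennpowr (ratio_sum s \<mu>) (1 / s) \<le> ennreal (C * K)" .
    qed
  qed
qed

lemma hardy_norm_cesaro_one_equiv:
  assumes s: "0 < s"
  obtains C where "0 < C" "\<And>\<mu>. \<mu> \<in> M_plus \<Longrightarrow> equiv_by C (hardy_norm s (cesaro \<mu> (\<lambda>_. 1))) (ennpowr (ratio_sum s \<mu>) (1 / s))"
proof -
  obtain C1 where C1: "0 < C1" "\<And>\<mu> Q r. \<mu> \<in> M_plus \<Longrightarrow> 0 \<le> Q \<Longrightarrow>
    (\<Sum>j. ennreal ((1/2) ^ j * ratio \<mu> j powr s)) \<le> ennreal (Q powr s) \<Longrightarrow>
    0 \<le> r \<Longrightarrow> r < 1 \<Longrightarrow> mean_p s r (cesaro \<mu> (\<lambda>_. 1)) \<le> C1 * Q"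
    using cesaro_one_mean_le[OF s] by blast
  obtain C2 where C2: "0 < C2" "\<And>\<mu> H n. \<mu> \<in> M_plus \<Longrightarrow>
    (\<And>r. 0 \<le> r \<Longrightarrow> r < 1 \<Longrightarrow> mean_p s r (cesaro \<mu> (\<lambda>_. 1)) \<le> H) \<Longrightarrow> (\<Sum>j<n. (1/2) ^ j * ratio \<mu> j powr s) \<le> (C2 * H) powr s"
    using cesaro_one_imp_ratio_power_sum_le[OF s] by blast
  have "equiv_by (max C1 C2) (hardy_norm s (cesaro \<mu> (\<lambda>_. 1))) (ennpowr (ratio_sum s \<mu>) (1 / s))" if \<mu>: "\<mu> \<in> M_plus" for \<mu>
    unfolding equiv_by_def
  proof
    let ?N = "ennpowr (ratio_sum s \<mu>) (1 / s)" and ?h = "hardy_norm s (cesaro \<mu> (\<lambda>_. 1))"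
    show "?h \<le> ennreal (max C1 C2) * ?N"
    proof (cases ?N)
      case (real Q)
      have "?h \<le> ennreal (C1 * Q)" by (rule hardy_norm_le[OF C1(2)[OF \<mu> real(1) ratio_norm_eq[OF s real(2,1)]]])
      also have "\<dots> = ennreal C1 * ?N" unfolding real using C1(1) real(1) by (simp add: ennreal_mult)
      also have "\<dots> \<le> ennreal (max C1 C2) * ?N" by (intro mult_right_mono ennreal_leI) auto
      finally show ?thesis .
    next
      case top
      then show ?thesis using C1(1) by (simp add: ennreal_mult_top)
    qed
    show "?N \<le> ennreal (max C1 C2) * ?h"
    proof (cases ?h)
      case (real H)
      have "?N \<le> ennreal (C2 * H)"
        using C2(1) real by (intro ratio_norm_leI[OF s _ C2(2)[OF \<mu> mean_p_le_hardy_norm]]) auto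
      also have "\<dots> = ennreal C2 * ?h" unfolding real using C2(1) real(1) by (simp add: ennreal_mult)
      also have "\<dots> \<le> ennreal (max C1 C2) * ?h" by (intro mult_right_mono ennreal_leI) auto
      finally show ?thesis .
    next
      case top
      then show ?thesis using C1(1) by (simp add: ennreal_mult_top)
    qed
  qed
  then show ?thesis using that[of "max C1 C2"] C1(1) by simp
qed

end

lemma C_op_eq_cesaro:
  assumes "radial_weight \<omega>" "doubling_measure (radial_measure \<omega>) D"
  shows "C_op \<mu> \<omega> = doubling_measure.cesaro (radial_measure \<omega>) \<mu>"
proof -
  interpret doubling_measure "radial_measure \<omega>" D by (rule assms(2))
  have "B_kernel \<omega> t z = kern (of_real t * z)" for t z
    unfolding B_kernel_def kern_def b_def measure_moment_radial_measure[OF assms(1)] by (intro suminf_cong) simp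
  then show ?thesis unfolding C_op_def cesaro_def fun_eq_iff by simp
qed

theorem theorem1:
  fixes p q :: real and \<omega> :: "complex \<Rightarrow> real"
  assumes "0 < p" and "0 < q" and "\<omega> \<in> D_hat"
  shows
    "(p \<le> q \<longrightarrow>
       (\<forall>\<mu>\<in>M_plus.
          (hardy_bounded (C_op \<mu> \<omega>) p q \<longleftrightarrow> muL_sup p q \<omega> \<mu> < \<infinity>) \<and>
          (muL_sup p q \<omega> \<mu> < \<infinity> \<longleftrightarrow> muell_sup p q \<omega> \<mu> < \<infinity>) \<and>
          (muell_sup p q \<omega> \<mu> < \<infinity> \<longleftrightarrow>
             (\<forall>\<beta>>0. frac_deriv (\<beta> + 1/p - 1/q) (fundamental_fun \<mu> \<omega>) \<in> X_space \<beta>))) \<and>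
       (\<forall>\<beta>>0. \<exists>c>0. \<forall>\<mu>\<in>M_plus.
          comparable c (hardy_opnorm (C_op \<mu> \<omega>) p q) (muL_sup p q \<omega> \<mu>) \<and>
          comparable c (muL_sup p q \<omega> \<mu>) (muell_sup p q \<omega> \<mu>) \<and>
          comparable c (muell_sup p q \<omega> \<mu>)
            (X_norm \<beta> (frac_deriv (\<beta> + 1/p - 1/q) (fundamental_fun \<mu> \<omega>))))) \<and>
     (q < p \<longrightarrow>
       (\<forall>\<mu>\<in>M_plus.
          (hardy_bounded (C_op \<mu> \<omega>) p q \<longleftrightarrow> muL_pow (q * p / (p - q)) \<omega> \<mu> < \<infinity>) \<and>
          (muL_pow (q * p / (p - q)) \<omega> \<mu> < \<infinity> \<longleftrightarrow> muell_pow (q * p / (p - q)) \<omega> \<mu> < \<infinity>) \<and>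
          (muell_pow (q * p / (p - q)) \<omega> \<mu> < \<infinity> \<longleftrightarrow>
             fundamental_fun \<mu> \<omega> \<in> hardy_space (q * p / (p - q)))) \<and>
       (\<exists>c>0. \<forall>\<mu>\<in>M_plus.
          comparable c (hardy_opnorm (C_op \<mu> \<omega>) p q) (muell_norm (q * p / (p - q)) \<omega> \<mu>) \<and>
          comparable c (muell_norm (q * p / (p - q)) \<omega> \<mu>) (muL_norm (q * p / (p - q)) \<omega> \<mu>) \<and>
          comparable c (muL_norm (q * p / (p - q)) \<omega> \<mu>)
            (hardy_norm (q * p / (p - q)) (fundamental_fun \<mu> \<omega>))))"
proof -
  have p: "0 < p" and q: "0 < q" by fact+
  have \<omega>: "radial_weight \<omega>" using assms(3) unfolding D_hat_def by simp
  obtain D where dm: "doubling_measure (radial_measure \<omega>) D" using D_hat_doubling_measure[OF assms(3)] by blast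
  interpret doubling_measure "radial_measure \<omega>" D by (rule dm)
  have Cop: "C_op \<mu> \<omega> = cesaro \<mu>" for \<mu> by (rule C_op_eq_cesaro[OF \<omega> dm])
  have F: "fundamental_fun \<mu> \<omega> = cesaro \<mu> (\<lambda>_. 1)" for \<mu> unfolding fundamental_fun_def Cop ..
  have tail: "measure_tail (radial_measure \<omega>) r = weight_tail \<omega> r" if "0 \<le> r" for r
    by (rule measure_tail_radial_measure[OF \<omega> that])
  have moment: "measure_moment (radial_measure \<omega>) n = weight_moment \<omega> n" for n
    by (rule measure_moment_radial_measure[OF \<omega>])
  show ?thesis
  proof (intro conjI impI)
    assume pq: "p \<le> q"
    define \<delta> where "\<delta> = 1/p - 1/q"
    have \<delta>: "0 \<le> \<delta>" unfolding \<delta>_def using p pq by (simp add: frac_le)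
    have e1: "1 + 1/p - 1/q = 1 + \<delta>" and e\<beta>: "\<beta> + 1/p - 1/q = \<beta> + \<delta>" for \<beta> unfolding \<delta>_def by auto
    obtain C1 where C1: "0 < C1" "\<And>\<mu>. \<mu> \<in> M_plus \<Longrightarrow> equiv_by C1 (hardy_opnorm (C_op \<mu> \<omega>) p q) (ratio_sup \<delta> \<mu>)"
      using opnorm_equiv_ratio_sup[OF p pq] unfolding \<delta>_def Cop by blast
    obtain C2 where C2: "0 < C2" "\<And>\<mu>. \<mu> \<in> M_plus \<Longrightarrow> equiv_by C2 (muL_sup p q \<omega> \<mu>) (ratio_sup \<delta> \<mu>)"
    proof
      define c where "c = max 1 (D * 2 powr (1 + \<delta>))"
      show "0 < c" unfolding c_def by simp
      fix \<mu> assume \<mu>: "\<mu> \<in> M_plus"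
      have eq: "muL_sup p q \<omega> \<mu> = (SUP r\<in>{0..<1}. measure_tail \<mu> r / (measure_tail (radial_measure \<omega>) r * ennreal ((1 - r) powr (1 + \<delta>))))"
        unfolding muL_sup_def e1 by (intro SUP_cong refl) (simp add: tail)
      have "equiv_by c (muL_sup p q \<omega> \<mu>) (ratio_sup \<delta> \<mu>)"
        unfolding equiv_by_def eq
      proof
        show "(SUP r\<in>{0..<1}. measure_tail \<mu> r / (measure_tail (radial_measure \<omega>) r * ennreal ((1 - r) powr (1 + \<delta>)))) \<le> ennreal c * ratio_sup \<delta> \<mu>"
          by (rule order_trans[OF tail_sup_bounds(1)[OF \<mu> \<delta>] mult_right_mono[OF ennreal_leI]]) (auto simp: c_def)
        have "1 \<le> ennreal c" unfolding c_def by simp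
        from mult_right_mono[OF this, of "SUP r\<in>{0..<1}. measure_tail \<mu> r / (measure_tail (radial_measure \<omega>) r * ennreal ((1 - r) powr (1 + \<delta>)))"]
        show "ratio_sup \<delta> \<mu> \<le> ennreal c * (SUP r\<in>{0..<1}. measure_tail \<mu> r / (measure_tail (radial_measure \<omega>) r * ennreal ((1 - r) powr (1 + \<delta>))))"
          using tail_sup_bounds(2)[OF \<mu> \<delta>] by simp
      qed
      then show "equiv_by c (muL_sup p q \<omega> \<mu>) (ratio_sup \<delta> \<mu>)" .
    qed
    obtain C3 where C3: "0 < C3" "\<And>\<mu>. \<mu> \<in> M_plus \<Longrightarrow> equiv_by C3 (muell_sup p q \<omega> \<mu>) (ratio_sup \<delta> \<mu>)"
      by (rule moment_sup_bounds[OF \<delta>], erule that) (simp add: muell_sup_def equiv_by_def e1 moment)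
    have X: "\<exists>C>0. \<forall>\<mu>\<in>M_plus. equiv_by C (X_norm \<beta> (frac_deriv (\<beta> + 1/p - 1/q) (fundamental_fun \<mu> \<omega>))) (ratio_sup \<delta> \<mu>)"
      if "0 < \<beta>" for \<beta>
      by (rule X_norm_bounds[OF that \<delta>]) (auto simp: e\<beta> F equiv_by_def)
    have X_space: "frac_deriv (\<beta> + 1/p - 1/q) (fundamental_fun \<mu> \<omega>) \<in> X_space \<beta> \<longleftrightarrow> ratio_sup \<delta> \<mu> < \<infinity>"
      if \<beta>: "0 < \<beta>" and \<mu>: "\<mu> \<in> M_plus" for \<beta> \<mu>
    proof -
      have "frac_deriv (\<beta> + 1/p - 1/q) (fundamental_fun \<mu> \<omega>) holomorphic_on ball 0 1"
        unfolding e\<beta> F using \<beta> \<delta> by (intro frac_deriv_cesaro_one_holomorphic \<mu>) simp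
      then show ?thesis unfolding X_space_def using X[OF \<beta>] \<mu> equiv_by_finite_iff by blast
    qed
    show "\<forall>\<mu>\<in>M_plus. (hardy_bounded (C_op \<mu> \<omega>) p q \<longleftrightarrow> muL_sup p q \<omega> \<mu> < \<infinity>) \<and>
          (muL_sup p q \<omega> \<mu> < \<infinity> \<longleftrightarrow> muell_sup p q \<omega> \<mu> < \<infinity>) \<and>
          (muell_sup p q \<omega> \<mu> < \<infinity> \<longleftrightarrow>
             (\<forall>\<beta>>0. frac_deriv (\<beta> + 1/p - 1/q) (fundamental_fun \<mu> \<omega>) \<in> X_space \<beta>))"
    proof
      fix \<mu> assume \<mu>: "\<mu> \<in> M_plus"
      show "(hardy_bounded (C_op \<mu> \<omega>) p q \<longleftrightarrow> muL_sup p q \<omega> \<mu> < \<infinity>) \<and>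
          (muL_sup p q \<omega> \<mu> < \<infinity> \<longleftrightarrow> muell_sup p q \<omega> \<mu> < \<infinity>) \<and>
          (muell_sup p q \<omega> \<mu> < \<infinity> \<longleftrightarrow>
             (\<forall>\<beta>>0. frac_deriv (\<beta> + 1/p - 1/q) (fundamental_fun \<mu> \<omega>) \<in> X_space \<beta>))"
        unfolding hardy_bounded_iff equiv_by_finite_iff[OF C1(2)[OF \<mu>]] equiv_by_finite_iff[OF C2(2)[OF \<mu>]]
          equiv_by_finite_iff[OF C3(2)[OF \<mu>]]
        \<comment> \<open>Membership for each \<beta> is equivalent to one and the same condition.
          The converse direction applies the assumption on all \<beta> to \<beta> = 1.\<close>
        using X_space[OF _ \<mu>] zero_less_one by blast
    qed
    show "\<forall>\<beta>>0. \<exists>c>0. \<forall>\<mu>\<in>M_plus.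
          comparable c (hardy_opnorm (C_op \<mu> \<omega>) p q) (muL_sup p q \<omega> \<mu>) \<and>
          comparable c (muL_sup p q \<omega> \<mu>) (muell_sup p q \<omega> \<mu>) \<and>
          comparable c (muell_sup p q \<omega> \<mu>)
            (X_norm \<beta> (frac_deriv (\<beta> + 1/p - 1/q) (fundamental_fun \<mu> \<omega>)))"
    proof (intro allI impI)
      fix \<beta> :: real assume "0 < \<beta>"
      then obtain C4 where C4: "0 < C4"
        "\<And>\<mu>. \<mu> \<in> M_plus \<Longrightarrow> equiv_by C4 (X_norm \<beta> (frac_deriv (\<beta> + 1/p - 1/q) (fundamental_fun \<mu> \<omega>))) (ratio_sup \<delta> \<mu>)"
        using X by blast
      define c where "c = max (max C1 C2) (max C3 C4)"
      have c: "0 < c" "C1 \<le> c" "C2 \<le> c" "C3 \<le> c" "C4 \<le> c" unfolding c_def using C1(1) by auto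
      note eq = equiv_by_mono[OF C1(2) c(2)] equiv_by_mono[OF C2(2) c(3)] equiv_by_mono[OF C3(2) c(4)] equiv_by_mono[OF C4(2) c(5)]
      note cmp = comparable_if_equiv_by[OF c(1) eq(1) eq(2)] comparable_if_equiv_by[OF c(1) eq(2) eq(3)]
        comparable_if_equiv_by[OF c(1) eq(3) eq(4)]
      show "\<exists>c>0. \<forall>\<mu>\<in>M_plus.
          comparable c (hardy_opnorm (C_op \<mu> \<omega>) p q) (muL_sup p q \<omega> \<mu>) \<and>
          comparable c (muL_sup p q \<omega> \<mu>) (muell_sup p q \<omega> \<mu>) \<and>
          comparable c (muell_sup p q \<omega> \<mu>)
            (X_norm \<beta> (frac_deriv (\<beta> + 1/p - 1/q) (fundamental_fun \<mu> \<omega>)))"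
        using c(1) by (intro exI[of _ "c * c"] conjI ballI cmp mult_pos_pos)
    qed
  next
    assume qp: "q < p"
    define s where "s = q * p / (p - q)"
    have s: "0 < s" and s': "0 < 1 / s" unfolding s_def using q qp by auto
    obtain C1 where C1: "0 < C1" "\<And>\<mu>. \<mu> \<in> M_plus \<Longrightarrow> equiv_by C1 (hardy_opnorm (C_op \<mu> \<omega>) p q) (ennpowr (ratio_sum s \<mu>) (1 / s))"
      using opnorm_equiv_ratio_norm[OF q qp s_def] unfolding Cop by blast
    obtain C2 where C2: "0 < C2" "\<And>\<mu>. \<mu> \<in> M_plus \<Longrightarrow> equiv_by C2 (muL_pow s \<omega> \<mu>) (ratio_sum s \<mu>)"
    proof -
      have "muL_pow s \<omega> \<mu> = (\<integral>\<^sup>+r\<in>{0..<1}. ennpowr (measure_tail \<mu> r / (measure_tail (radial_measure \<omega>) r * ennreal (1 - r))) s \<partial>lebesgue)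
         + ennpowr (measure_tail \<mu> 0) s" for \<mu>
        unfolding muL_pow_def by (intro arg_cong2[where f="(+)"] refl nn_integral_cong) (auto simp: indicator_def tail)
      note eq = this
      show ?thesis by (rule tail_power_bounds[OF s], erule that) (simp add: eq equiv_by_def)
    qed
    obtain C3 where C3: "0 < C3" "\<And>\<mu>. \<mu> \<in> M_plus \<Longrightarrow> equiv_by C3 (muell_pow s \<omega> \<mu>) (ratio_sum s \<mu>)"
      by (rule moment_power_bounds[OF s], erule that) (simp add: muell_pow_def moment_ratio_def equiv_by_def moment)
    obtain C4 where C4: "0 < C4" "\<And>\<mu>. \<mu> \<in> M_plus \<Longrightarrow> equiv_by C4 (hardy_norm s (fundamental_fun \<mu> \<omega>)) (ennpowr (ratio_sum s \<mu>) (1 / s))"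
      using hardy_norm_cesaro_one_equiv[OF s] unfolding F by blast
    \<comment> \<open>Tail and moment conditions were compared as s-th powers; taking roots turns
      the constants into their s-th roots.\<close>
    have C2': "equiv_by (C2 powr (1 / s)) (muL_norm s \<omega> \<mu>) (ennpowr (ratio_sum s \<mu>) (1 / s))"
      and C3': "equiv_by (C3 powr (1 / s)) (muell_norm s \<omega> \<mu>) (ennpowr (ratio_sum s \<mu>) (1 / s))" if "\<mu> \<in> M_plus" for \<mu>
      unfolding muL_norm_def muell_norm_def
      using that by (auto intro!: equiv_by_ennpowr C2 C3 s')
    show "\<forall>\<mu>\<in>M_plus. (hardy_bounded (C_op \<mu> \<omega>) p q \<longleftrightarrow> muL_pow (q * p / (p - q)) \<omega> \<mu> < \<infinity>) \<and>
          (muL_pow (q * p / (p - q)) \<omega> \<mu> < \<infinity> \<longleftrightarrow> muell_pow (q * p / (p - q)) \<omega> \<mu> < \<infinity>) \<and>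
          (muell_pow (q * p / (p - q)) \<omega> \<mu> < \<infinity> \<longleftrightarrow>
             fundamental_fun \<mu> \<omega> \<in> hardy_space (q * p / (p - q)))"
      unfolding s_def[symmetric]
    proof
      fix \<mu> assume \<mu>: "\<mu> \<in> M_plus"
      have "fundamental_fun \<mu> \<omega> holomorphic_on ball 0 1" unfolding F by (intro cesaro_holomorphic[OF \<mu>] holomorphic_intros)
      then show "(hardy_bounded (C_op \<mu> \<omega>) p q \<longleftrightarrow> muL_pow s \<omega> \<mu> < \<infinity>) \<and> (muL_pow s \<omega> \<mu> < \<infinity> \<longleftrightarrow> muell_pow s \<omega> \<mu> < \<infinity>) \<and>
          (muell_pow s \<omega> \<mu> < \<infinity> \<longleftrightarrow> fundamental_fun \<mu> \<omega> \<in> hardy_space s)"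
        using equiv_by_finite_iff[OF C1(2)[OF \<mu>]] equiv_by_finite_iff[OF C2(2)[OF \<mu>]] equiv_by_finite_iff[OF C3(2)[OF \<mu>]]
          equiv_by_finite_iff[OF C4(2)[OF \<mu>]]
        unfolding hardy_bounded_iff ennpowr_finite_iff hardy_space_def by simp
    qed
    define c where "c = max (max C1 (C2 powr (1 / s))) (max (C3 powr (1 / s)) C4)"
    have c: "0 < c" "C1 \<le> c" "C2 powr (1 / s) \<le> c" "C3 powr (1 / s) \<le> c" "C4 \<le> c" unfolding c_def using C1(1) by auto
    note eq = equiv_by_mono[OF C1(2) c(2)] equiv_by_mono[OF C2' c(3)] equiv_by_mono[OF C3' c(4)] equiv_by_mono[OF C4(2) c(5)]
    note cmp = comparable_if_equiv_by[OF c(1) eq(1) eq(3)] comparable_if_equiv_by[OF c(1) eq(3) eq(2)]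
      comparable_if_equiv_by[OF c(1) eq(2) eq(4)]
    show "\<exists>c>0. \<forall>\<mu>\<in>M_plus.
          comparable c (hardy_opnorm (C_op \<mu> \<omega>) p q) (muell_norm (q * p / (p - q)) \<omega> \<mu>) \<and>
          comparable c (muell_norm (q * p / (p - q)) \<omega> \<mu>) (muL_norm (q * p / (p - q)) \<omega> \<mu>) \<and>
          comparable c (muL_norm (q * p / (p - q)) \<omega> \<mu>)
            (hardy_norm (q * p / (p - q)) (fundamental_fun \<mu> \<omega>))"
      unfolding s_def[symmetric]
      using c(1) by (intro exI[of _ "c * c"] conjI ballI cmp mult_pos_pos)
  qed
qed

end
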